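(* Let $\mathbb{F}$ be a finite field, let $d>0$, and let $f:F_1\rightarrow F_2$ be a morphism in $\mathcal{F}$ between finite functors of polynomial degree exactly $d$. If $\mathrm{image}(f)$ has polynomial degree exactly $d$, then, for all $G,H$ in $\mathcal{F}$, precomposition with $F_1$ together with $f$ induce a (naturally split) monomorphism $$\mathrm{Ext}^*_{\mathcal{F}}(G,H)\hookrightarrow \mathrm{Ext}^*_{\mathcal{F}}(G\circ F_1,H\circ F_2).$$
   Context: $\mathcal{F}$ is the abelian category of functors from finite-dimensional $\mathbb{F}$-vector spaces to $\mathbb{F}$-vector spaces. A functor is finite if it has a finite composition series (such functors take finite-dimensional values, so can be precomposed with). The difference functor $\Delta:\mathcal{F}\to\mathcal{F}$ is $\Delta F(V)=F(V\oplus\mathbb{F})/F(V)$; $F$ is polynomial of degree $d$ if $\Delta^{d+1}F=0$, and has polynomial degree exactly $d$ if it is polynomial of degree $d$ but not of degree $d-1$. The map in question is the composite of $\mathrm{Ext}^*_{\mathcal{F}}(G,H)\to\mathrm{Ext}^*_{\mathcal{F}}(G\circ F_1,H\circ F_1)$, induced by the exact functor of precomposition with $F_1$, with the map induced by $H(f):H\circ F_1\to H\circ F_2$ (equivalently, precomposition with $F_2$ followed by pullback along $G(f)$). *)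

theory Defs
  imports "HOL-Algebra.Module" "HOL-Algebra.AbelCoset" "HOL-Library.Infinite_Typeclass"
begin

section \<open>Vector spaces\<close>

text \<open>
  A vector space over a field \<open>R\<close> is an \<open>R\<close>-module whose carrier is a set of elements of a type
  \<open>'u\<close>, which plays the role of the universe. (The fields \<open>mult\<close> and \<open>one\<close>, which the record type
  inherits from rings, carry no information.) The type \<open>'u\<close> is infinite in all applications; as the
  field is finite, all finite-dimensional spaces then have isomorphic copies in \<open>'u\<close>, and the
  functors with values in \<open>'u\<close> are closed under all the constructions used below, including
  the formation of projective resolutions. So their \<open>Ext\<close> groups are the same in every universe.

  Morphisms are extensional functions, so that equality of morphisms is equality in HOL.
\<close>

definition linear_maps ::
  "('f, 'm) ring_scheme \<Rightarrow> ('f, 'a) module \<Rightarrow> ('f, 'b) module \<Rightarrow> ('a \<Rightarrow> 'b) set" where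
  "linear_maps R M N = {f \<in> carrier M \<rightarrow>\<^sub>E carrier N.
     (\<forall>x\<in>carrier M. \<forall>y\<in>carrier M. f (x \<oplus>\<^bsub>M\<^esub> y) = f x \<oplus>\<^bsub>N\<^esub> f y) \<and>
     (\<forall>a\<in>carrier R. \<forall>x\<in>carrier M. f (a \<odot>\<^bsub>M\<^esub> x) = a \<odot>\<^bsub>N\<^esub> f x)}"

definition fd_spaces :: "('f, 'm) ring_scheme \<Rightarrow> ('f, 'u) module set" where
  "fd_spaces R = {V. Module.module R V \<and>
     (\<exists>B. finite B \<and> B \<subseteq> carrier V \<and>
        (\<forall>x\<in>carrier V. \<exists>c \<in> B \<rightarrow> carrier R. x = (\<Oplus>\<^bsub>V\<^esub>b\<in>B. c b \<odot>\<^bsub>V\<^esub> b)))}"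

text \<open>
  The quotient of \<open>M\<close> by a submodule \<open>N\<close>, realised on a system of representatives of the cosets
  so that it stays in the universe of \<open>M\<close>; \<open>quot_rep M N\<close> is the projection.
\<close>

definition quot_rep :: "('f, 'u) module \<Rightarrow> 'u set \<Rightarrow> 'u \<Rightarrow> 'u" where
  "quot_rep M N x = (SOME y. y \<in> N +>\<^bsub>M\<^esub> x)"

definition quot_module :: "('f, 'u) module \<Rightarrow> 'u set \<Rightarrow> ('f, 'u) module" where
  "quot_module M N = M\<lparr>carrier := quot_rep M N ` carrier M,
     zero := quot_rep M N \<zero>\<^bsub>M\<^esub>,
     add := (\<lambda>x y. quot_rep M N (x \<oplus>\<^bsub>M\<^esub> y)),
     smult := (\<lambda>a x. quot_rep M N (a \<odot>\<^bsub>M\<^esub> x))\<rparr>"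


section \<open>The functor category\<close>

text \<open>
  An action on morphisms takes source and target as arguments, since these are not
  determined by the underlying function. Only the values at finite-dimensional spaces, and at
  linear maps between them, are relevant.
\<close>

record ('f, 'u) vfunctor =
  obj :: "('f, 'u) module \<Rightarrow> ('f, 'u) module"
  mor :: "('f, 'u) module \<Rightarrow> ('f, 'u) module \<Rightarrow> ('u \<Rightarrow> 'u) \<Rightarrow> ('u \<Rightarrow> 'u)"

type_synonym ('f, 'u) transf = "('f, 'u) module \<Rightarrow> 'u \<Rightarrow> 'u"

definition is_functor :: "('f, 'm) ring_scheme \<Rightarrow> ('f, 'u) vfunctor \<Rightarrow> bool" where
  "is_functor R F \<longleftrightarrow>
     (\<forall>V\<in>fd_spaces R. Module.module R (obj F V)) \<and>
     (\<forall>V\<in>fd_spaces R. \<forall>W\<in>fd_spaces R. \<forall>f\<in>linear_maps R V W.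
        mor F V W f \<in> linear_maps R (obj F V) (obj F W)) \<and>
     (\<forall>V\<in>fd_spaces R. mor F V V (\<lambda>x\<in>carrier V. x) = (\<lambda>x\<in>carrier (obj F V). x)) \<and>
     (\<forall>U\<in>fd_spaces R. \<forall>V\<in>fd_spaces R. \<forall>W\<in>fd_spaces R.
        \<forall>f\<in>linear_maps R U V. \<forall>g\<in>linear_maps R V W.
        mor F U W (compose (carrier U) g f) =
          compose (carrier (obj F U)) (mor F V W g) (mor F U V f))"

definition nat_trans ::
  "('f, 'm) ring_scheme \<Rightarrow> ('f, 'u) vfunctor \<Rightarrow> ('f, 'u) vfunctor \<Rightarrow> ('f, 'u) transf set" where
  "nat_trans R F G = {t \<in> (\<Pi>\<^sub>E V\<in>fd_spaces R. linear_maps R (obj F V) (obj G V)).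
     \<forall>V\<in>fd_spaces R. \<forall>W\<in>fd_spaces R. \<forall>f\<in>linear_maps R V W.
       compose (carrier (obj F V)) (t W) (mor F V W f) =
       compose (carrier (obj F V)) (mor G V W f) (t V)}"

definition id_trans :: "('f, 'm) ring_scheme \<Rightarrow> ('f, 'u) vfunctor \<Rightarrow> ('f, 'u) transf" where
  "id_trans R F = (\<lambda>V\<in>fd_spaces R. \<lambda>x\<in>carrier (obj F V). x)"

text \<open>Composite of \<open>s : F \<rightarrow> G\<close> and \<open>t : G \<rightarrow> H\<close>.\<close>

definition trans_comp ::
  "('f, 'm) ring_scheme \<Rightarrow> ('f, 'u) vfunctor \<Rightarrow> ('f, 'u) transf \<Rightarrow> ('f, 'u) transf
     \<Rightarrow> ('f, 'u) transf" where
  "trans_comp R F t s = (\<lambda>V\<in>fd_spaces R. compose (carrier (obj F V)) (t V) (s V))"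

text \<open>\<open>hom_module R F G\<close> is \<open>Hom(F, G)\<close> with its pointwise vector space structure.\<close>

definition hom_module ::
  "('f, 'm) ring_scheme \<Rightarrow> ('f, 'u) vfunctor \<Rightarrow> ('f, 'u) vfunctor
     \<Rightarrow> ('f, ('f, 'u) transf) module" where
  "hom_module R F G = \<lparr>carrier = nat_trans R F G, mult = undefined, one = undefined,
     zero = (\<lambda>V\<in>fd_spaces R. \<lambda>x\<in>carrier (obj F V). \<zero>\<^bsub>obj G V\<^esub>),
     add = (\<lambda>s t. \<lambda>V\<in>fd_spaces R. \<lambda>x\<in>carrier (obj F V). s V x \<oplus>\<^bsub>obj G V\<^esub> t V x),
     smult = (\<lambda>a t. \<lambda>V\<in>fd_spaces R. \<lambda>x\<in>carrier (obj F V). a \<odot>\<^bsub>obj G V\<^esub> t V x)\<rparr>"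

definition is_zero_functor :: "('f, 'm) ring_scheme \<Rightarrow> ('f, 'u) vfunctor \<Rightarrow> bool" where
  "is_zero_functor R F \<longleftrightarrow> (\<forall>V\<in>fd_spaces R. carrier (obj F V) = {\<zero>\<^bsub>obj F V\<^esub>})"

text \<open>Subobjects of \<open>F\<close> are given by the carriers of their values.\<close>

definition is_subfunctor ::
  "('f, 'm) ring_scheme \<Rightarrow> ('f, 'u) vfunctor \<Rightarrow> (('f, 'u) module \<Rightarrow> 'u set) \<Rightarrow> bool" where
  "is_subfunctor R F D \<longleftrightarrow>
     (\<forall>V\<in>fd_spaces R. submodule (D V) R (obj F V)) \<and>
     (\<forall>V\<in>fd_spaces R. \<forall>W\<in>fd_spaces R. \<forall>f\<in>linear_maps R V W. mor F V W f ` D V \<subseteq> D W)"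

definition sub_functor ::
  "('f, 'u) vfunctor \<Rightarrow> (('f, 'u) module \<Rightarrow> 'u set) \<Rightarrow> ('f, 'u) vfunctor" where
  "sub_functor F D = \<lparr>obj = (\<lambda>V. (obj F V)\<lparr>carrier := D V\<rparr>),
     mor = (\<lambda>V W f. restrict (mor F V W f) (D V))\<rparr>"

definition quot_functor ::
  "('f, 'u) vfunctor \<Rightarrow> (('f, 'u) module \<Rightarrow> 'u set) \<Rightarrow> ('f, 'u) vfunctor" where
  "quot_functor F D = \<lparr>obj = (\<lambda>V. quot_module (obj F V) (D V)),
     mor = (\<lambda>V W f. \<lambda>x\<in>carrier (quot_module (obj F V) (D V)).
       quot_rep (obj F W) (D W) (mor F V W f x))\<rparr>"

definition image_functor ::
  "('f, 'u) vfunctor \<Rightarrow> ('f, 'u) vfunctor \<Rightarrow> ('f, 'u) transf \<Rightarrow> ('f, 'u) vfunctor" where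
  "image_functor F G t = sub_functor G (\<lambda>V. t V ` carrier (obj F V))"

definition is_simple_functor :: "('f, 'm) ring_scheme \<Rightarrow> ('f, 'u) vfunctor \<Rightarrow> bool" where
  "is_simple_functor R F \<longleftrightarrow> is_functor R F \<and> \<not> is_zero_functor R F \<and>
     (\<forall>D. is_subfunctor R F D \<longrightarrow>
        (\<forall>V\<in>fd_spaces R. D V = {\<zero>\<^bsub>obj F V\<^esub>}) \<or> (\<forall>V\<in>fd_spaces R. D V = carrier (obj F V)))"

definition is_finite_functor :: "('f, 'm) ring_scheme \<Rightarrow> ('f, 'u) vfunctor \<Rightarrow> bool" where
  "is_finite_functor R F \<longleftrightarrow> is_functor R F \<and>
     (\<exists>(n :: nat) D. (\<forall>i\<le>n. is_subfunctor R F (D i)) \<and>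
        (\<forall>V\<in>fd_spaces R. D 0 V = {\<zero>\<^bsub>obj F V\<^esub>} \<and> D n V = carrier (obj F V)) \<and>
        (\<forall>i<n. (\<forall>V\<in>fd_spaces R. D i V \<subseteq> D (Suc i) V) \<and>
           is_simple_functor R (quot_functor (sub_functor F (D (Suc i))) (D i))))"


section \<open>Precomposition\<close>

definition precomp :: "('f, 'u) vfunctor \<Rightarrow> ('f, 'u) vfunctor \<Rightarrow> ('f, 'u) vfunctor"
    (infixl \<open>\<circ>\<^sub>F\<close> 55) where
  "G \<circ>\<^sub>F F = \<lparr>obj = (\<lambda>V. obj G (obj F V)),
     mor = (\<lambda>V W f. mor G (obj F V) (obj F W) (mor F V W f))\<rparr>"

text \<open>
  For \<open>t : G \<rightarrow> H\<close>, \<open>precomp_trans R F t\<close> is the induced \<open>G \<circ> F \<rightarrow> H \<circ> F\<close>;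
  for \<open>t : F1 \<rightarrow> F2\<close>, \<open>postcomp_trans R H F1 F2 t\<close> is \<open>H(t) : H \<circ> F1 \<rightarrow> H \<circ> F2\<close>.
\<close>

definition precomp_trans ::
  "('f, 'm) ring_scheme \<Rightarrow> ('f, 'u) vfunctor \<Rightarrow> ('f, 'u) transf \<Rightarrow> ('f, 'u) transf" where
  "precomp_trans R F t = (\<lambda>V\<in>fd_spaces R. t (obj F V))"

definition postcomp_trans ::
  "('f, 'm) ring_scheme \<Rightarrow> ('f, 'u) vfunctor \<Rightarrow> ('f, 'u) vfunctor \<Rightarrow> ('f, 'u) vfunctor
     \<Rightarrow> ('f, 'u) transf \<Rightarrow> ('f, 'u) transf" where
  "postcomp_trans R H F1 F2 t = (\<lambda>V\<in>fd_spaces R. mor H (obj F1 V) (obj F2 V) (t V))"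


section \<open>Difference functor and polynomial degree\<close>

text \<open>
  The carrier of \<open>V \<oplus> R\<close> is moved back into the universe by a fixed injective coding of pairs,
  which exists because \<open>'u\<close> is infinite and \<open>R\<close> is finite.
\<close>

definition pair_code :: "('f, 'm) ring_scheme \<Rightarrow> 'u \<times> 'f \<Rightarrow> 'u" where
  "pair_code R = (SOME e. inj_on e (UNIV \<times> carrier R))"

definition pair_decode :: "('f, 'm) ring_scheme \<Rightarrow> 'u \<Rightarrow> 'u \<times> 'f" where
  "pair_decode R = inv_into (UNIV \<times> carrier R) (pair_code R)"

definition plus_line_space ::
  "('f, 'm) ring_scheme \<Rightarrow> ('f, 'u) module \<Rightarrow> ('f, 'u) module" where
  "plus_line_space R V = V\<lparr>carrier := pair_code R ` (carrier V \<times> carrier R),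
     zero := pair_code R (\<zero>\<^bsub>V\<^esub>, \<zero>\<^bsub>R\<^esub>),
     add := (\<lambda>z w. pair_code R (fst (pair_decode R z) \<oplus>\<^bsub>V\<^esub> fst (pair_decode R w),
                               snd (pair_decode R z) \<oplus>\<^bsub>R\<^esub> snd (pair_decode R w))),
     smult := (\<lambda>a z. pair_code R (a \<odot>\<^bsub>V\<^esub> fst (pair_decode R z),
                                 a \<otimes>\<^bsub>R\<^esub> snd (pair_decode R z)))\<rparr>"

text \<open>The functor \<open>V \<mapsto> V \<oplus> R\<close> and the inclusion \<open>V \<rightarrow> V \<oplus> R\<close>.\<close>

definition plus_line :: "('f, 'm) ring_scheme \<Rightarrow> ('f, 'u) vfunctor" where
  "plus_line R = \<lparr>obj = plus_line_space R,
     mor = (\<lambda>V W f. \<lambda>z\<in>carrier (plus_line_space R V).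
       pair_code R (f (fst (pair_decode R z)), snd (pair_decode R z)))\<rparr>"

definition plus_line_incl ::
  "('f, 'm) ring_scheme \<Rightarrow> ('f, 'u) module \<Rightarrow> 'u \<Rightarrow> 'u" where
  "plus_line_incl R V = (\<lambda>x\<in>carrier V. pair_code R (x, \<zero>\<^bsub>R\<^esub>))"

definition difference ::
  "('f, 'm) ring_scheme \<Rightarrow> ('f, 'u) vfunctor \<Rightarrow> ('f, 'u) vfunctor" where
  "difference R F = quot_functor (F \<circ>\<^sub>F plus_line R)
     (\<lambda>V. mor F V (plus_line_space R V) (plus_line_incl R V) ` carrier (obj F V))"

definition is_polynomial ::
  "('f, 'm) ring_scheme \<Rightarrow> nat \<Rightarrow> ('f, 'u) vfunctor \<Rightarrow> bool" where
  "is_polynomial R d F \<longleftrightarrow> is_zero_functor R ((difference R ^^ (d + 1)) F)"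

text \<open>
  The second conjunct says that \<open>F\<close> is not polynomial of degree \<open>d - 1\<close>; in this form it is
  also correct for \<open>d = 0\<close>.
\<close>

definition has_polynomial_degree ::
  "('f, 'm) ring_scheme \<Rightarrow> nat \<Rightarrow> ('f, 'u) vfunctor \<Rightarrow> bool" where
  "has_polynomial_degree R d F \<longleftrightarrow>
     is_polynomial R d F \<and> \<not> is_zero_functor R ((difference R ^^ d) F)"


section \<open>Projective resolutions\<close>

text \<open>Exactness in a functor category is exactness of the values.\<close>

definition is_epi ::
  "('f, 'm) ring_scheme \<Rightarrow> ('f, 'u) vfunctor \<Rightarrow> ('f, 'u) vfunctor \<Rightarrow> ('f, 'u) transf \<Rightarrow> bool" where
  "is_epi R A B t \<longleftrightarrow> (\<forall>V\<in>fd_spaces R. t V ` carrier (obj A V) = carrier (obj B V))"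

definition is_exact ::
  "('f, 'm) ring_scheme \<Rightarrow> ('f, 'u) vfunctor \<Rightarrow> ('f, 'u) vfunctor \<Rightarrow> ('f, 'u) vfunctor
     \<Rightarrow> ('f, 'u) transf \<Rightarrow> ('f, 'u) transf \<Rightarrow> bool" where
  "is_exact R A B C s t \<longleftrightarrow>
     (\<forall>V\<in>fd_spaces R. s V ` carrier (obj A V) = {x \<in> carrier (obj B V). t V x = \<zero>\<^bsub>obj C V\<^esub>})"

definition is_projective :: "('f, 'm) ring_scheme \<Rightarrow> ('f, 'u) vfunctor \<Rightarrow> bool" where
  "is_projective R P \<longleftrightarrow> is_functor R P \<and>
     (\<forall>A B e t. is_functor R A \<and> is_functor R B \<and> e \<in> nat_trans R A B \<and> is_epi R A B e \<and>
        t \<in> nat_trans R P B \<longrightarrow> (\<exists>s\<in>nat_trans R P A. trans_comp R P e s = t))"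

text \<open>
  An augmented complex \<open>\<dots> \<rightarrow> term 1 \<rightarrow> term 0 \<rightarrow> G\<close> with
  \<open>diff n : term (n + 1) \<rightarrow> term n\<close> and augmentation \<open>aug : term 0 \<rightarrow> G\<close>.
\<close>

record ('f, 'u) aug_complex =
  "term" :: "nat \<Rightarrow> ('f, 'u) vfunctor"
  diff :: "nat \<Rightarrow> ('f, 'u) transf"
  aug :: "('f, 'u) transf"

definition is_projective_resolution ::
  "('f, 'm) ring_scheme \<Rightarrow> ('f, 'u) vfunctor \<Rightarrow> ('f, 'u) aug_complex \<Rightarrow> bool" where
  "is_projective_resolution R G X \<longleftrightarrow>
     (\<forall>n. is_projective R (term X n)) \<and>
     (\<forall>n. diff X n \<in> nat_trans R (term X (Suc n)) (term X n)) \<and>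
     aug X \<in> nat_trans R (term X 0) G \<and>
     is_epi R (term X 0) G (aug X) \<and>
     is_exact R (term X 1) (term X 0) G (diff X 0) (aug X) \<and>
     (\<forall>n. is_exact R (term X (n + 2)) (term X (n + 1)) (term X n) (diff X (n + 1)) (diff X n))"

definition projective_resolution ::
  "('f, 'm) ring_scheme \<Rightarrow> ('f, 'u) vfunctor \<Rightarrow> ('f, 'u) aug_complex" where
  "projective_resolution R G = (SOME X. is_projective_resolution R G X)"

definition precomp_complex ::
  "('f, 'm) ring_scheme \<Rightarrow> ('f, 'u) vfunctor \<Rightarrow> ('f, 'u) aug_complex \<Rightarrow> ('f, 'u) aug_complex" where
  "precomp_complex R F X = \<lparr>term = (\<lambda>n. term X n \<circ>\<^sub>F F),
     diff = (\<lambda>n. precomp_trans R F (diff X n)), aug = precomp_trans R F (aug X)\<rparr>"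

definition is_chain_map ::
  "('f, 'm) ring_scheme \<Rightarrow> ('f, 'u) aug_complex \<Rightarrow> ('f, 'u) aug_complex \<Rightarrow> ('f, 'u) transf
     \<Rightarrow> (nat \<Rightarrow> ('f, 'u) transf) \<Rightarrow> bool" where
  "is_chain_map R X Y g \<phi> \<longleftrightarrow>
     (\<forall>n. \<phi> n \<in> nat_trans R (term X n) (term Y n)) \<and>
     trans_comp R (term X 0) (aug Y) (\<phi> 0) = trans_comp R (term X 0) g (aug X) \<and>
     (\<forall>n. trans_comp R (term X (Suc n)) (diff Y n) (\<phi> (Suc n)) =
          trans_comp R (term X (Suc n)) (\<phi> n) (diff X n))"

text \<open>
  A lift of a morphism \<open>g\<close> of the augmented objects; for \<open>X\<close> a projective resolution and \<open>Y\<close>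
  exact it exists and is unique up to chain homotopy.
\<close>

definition chain_lift ::
  "('f, 'm) ring_scheme \<Rightarrow> ('f, 'u) aug_complex \<Rightarrow> ('f, 'u) aug_complex \<Rightarrow> ('f, 'u) transf
     \<Rightarrow> nat \<Rightarrow> ('f, 'u) transf" where
  "chain_lift R X Y g = (SOME \<phi>. is_chain_map R X Y g \<phi>)"


section \<open>Ext\<close>

text \<open>
  \<open>ext R n G H\<close> is the \<open>n\<close>-th cohomology of \<open>Hom(P, H)\<close> for the chosen projective resolution
  \<open>P\<close> of \<open>G\<close>. Since \<open>quot_module\<close> works with representatives, its elements are cocycles, one
  from each cohomology class; \<open>ext_class\<close> sends a cocycle to the representative of its class.
\<close>

definition cocycles ::
  "('f, 'm) ring_scheme \<Rightarrow> nat \<Rightarrow> ('f, 'u) vfunctor \<Rightarrow> ('f, 'u) vfunctor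
     \<Rightarrow> ('f, 'u) transf set" where
  "cocycles R n G H = (let P = projective_resolution R G in
     {c \<in> nat_trans R (term P n) H.
        trans_comp R (term P (Suc n)) c (diff P n) = \<zero>\<^bsub>hom_module R (term P (Suc n)) H\<^esub>})"

definition coboundaries ::
  "('f, 'm) ring_scheme \<Rightarrow> nat \<Rightarrow> ('f, 'u) vfunctor \<Rightarrow> ('f, 'u) vfunctor
     \<Rightarrow> ('f, 'u) transf set" where
  "coboundaries R n G H = (let P = projective_resolution R G in
     case n of
       0 \<Rightarrow> {\<zero>\<^bsub>hom_module R (term P 0) H\<^esub>}
     | Suc m \<Rightarrow> (\<lambda>b. trans_comp R (term P (Suc m)) b (diff P m)) ` nat_trans R (term P m) H)"

definition cocycle_module ::
  "('f, 'm) ring_scheme \<Rightarrow> nat \<Rightarrow> ('f, 'u) vfunctor \<Rightarrow> ('f, 'u) vfunctor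
     \<Rightarrow> ('f, ('f, 'u) transf) module" where
  "cocycle_module R n G H =
     (hom_module R (term (projective_resolution R G) n) H)\<lparr>carrier := cocycles R n G H\<rparr>"

definition ext ::
  "('f, 'm) ring_scheme \<Rightarrow> nat \<Rightarrow> ('f, 'u) vfunctor \<Rightarrow> ('f, 'u) vfunctor
     \<Rightarrow> ('f, ('f, 'u) transf) module" where
  "ext R n G H = quot_module (cocycle_module R n G H) (coboundaries R n G H)"

definition ext_class ::
  "('f, 'm) ring_scheme \<Rightarrow> nat \<Rightarrow> ('f, 'u) vfunctor \<Rightarrow> ('f, 'u) vfunctor
     \<Rightarrow> ('f, 'u) transf \<Rightarrow> ('f, 'u) transf" where
  "ext_class R n G H = quot_rep (cocycle_module R n G H) (coboundaries R n G H)"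

text \<open>The map \<open>Ext(G, H) \<rightarrow> Ext(G, H')\<close> induced by \<open>h : H \<rightarrow> H'\<close>.\<close>

definition ext_push ::
  "('f, 'm) ring_scheme \<Rightarrow> nat \<Rightarrow> ('f, 'u) vfunctor \<Rightarrow> ('f, 'u) vfunctor \<Rightarrow> ('f, 'u) vfunctor
     \<Rightarrow> ('f, 'u) transf \<Rightarrow> ('f, 'u) transf \<Rightarrow> ('f, 'u) transf" where
  "ext_push R n G H H' h = (\<lambda>c\<in>carrier (ext R n G H).
     ext_class R n G H' (trans_comp R (term (projective_resolution R G) n) h c))"

text \<open>The map \<open>Ext(G, H) \<rightarrow> Ext(G', H)\<close> induced by \<open>g : G' \<rightarrow> G\<close>.\<close>

definition ext_pull ::
  "('f, 'm) ring_scheme \<Rightarrow> nat \<Rightarrow> ('f, 'u) vfunctor \<Rightarrow> ('f, 'u) vfunctor \<Rightarrow> ('f, 'u) vfunctor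
     \<Rightarrow> ('f, 'u) transf \<Rightarrow> ('f, 'u) transf \<Rightarrow> ('f, 'u) transf" where
  "ext_pull R n G' G H g = (let P' = projective_resolution R G'; P = projective_resolution R G in
     (\<lambda>c\<in>carrier (ext R n G H).
       ext_class R n G' H (trans_comp R (term P' n) c (chain_lift R P' P g n))))"

text \<open>
  The map \<open>Ext(G, H) \<rightarrow> Ext(G \<circ> F, H \<circ> F)\<close> induced by precomposition with \<open>F\<close>: if \<open>P\<close> is
  the resolution of \<open>G\<close> and \<open>Q\<close> the one of \<open>G \<circ> F\<close>, then \<open>P \<circ> F\<close> is an exact (in general not
  projective) resolution of \<open>G \<circ> F\<close>, and a cocycle \<open>c\<close> is sent to the composite of \<open>c \<circ> F\<close> with
  a lift \<open>Q \<rightarrow> P \<circ> F\<close> of the identity.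
\<close>

definition ext_precomp ::
  "('f, 'm) ring_scheme \<Rightarrow> nat \<Rightarrow> ('f, 'u) vfunctor \<Rightarrow> ('f, 'u) vfunctor \<Rightarrow> ('f, 'u) vfunctor
     \<Rightarrow> ('f, 'u) transf \<Rightarrow> ('f, 'u) transf" where
  "ext_precomp R n F G H =
     (let P = projective_resolution R G; Q = projective_resolution R (G \<circ>\<^sub>F F) in
      (\<lambda>c\<in>carrier (ext R n G H).
        ext_class R n (G \<circ>\<^sub>F F) (H \<circ>\<^sub>F F)
          (trans_comp R (term Q n) (precomp_trans R F c)
             (chain_lift R Q (precomp_complex R F P) (id_trans R (G \<circ>\<^sub>F F)) n))))"

text \<open>
  For \<open>f : F1 \<rightarrow> F2\<close>, the composite
  \<open>Ext(G, H) \<rightarrow> Ext(G \<circ> F1, H \<circ> F1) \<rightarrow> Ext(G \<circ> F1, H \<circ> F2)\<close> of precomposition with \<open>F1\<close> and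
  the map induced by \<open>H(f)\<close>.
\<close>

definition ext_induced ::
  "('f, 'm) ring_scheme \<Rightarrow> ('f, 'u) vfunctor \<Rightarrow> ('f, 'u) vfunctor \<Rightarrow> ('f, 'u) transf \<Rightarrow> nat
     \<Rightarrow> ('f, 'u) vfunctor \<Rightarrow> ('f, 'u) vfunctor \<Rightarrow> ('f, 'u) transf \<Rightarrow> ('f, 'u) transf" where
  "ext_induced R F1 F2 f n G H =
     compose (carrier (ext R n G H))
       (ext_push R n (G \<circ>\<^sub>F F1) (H \<circ>\<^sub>F F1) (H \<circ>\<^sub>F F2) (postcomp_trans R H F1 F2 f))
       (ext_precomp R n F1 G H)"

end

theory Submission
  imports Defs
begin

text \<open>
  The map of the theorem is split by a map of the same kind. Suppose that \<open>T\<close> is a functor from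
  finite-dimensional spaces to finite-dimensional spaces and that there are natural transformations
  \<open>\<alpha> : Id \<rightarrow> F1 \<circ> T\<close> and \<open>\<beta> : F2 \<circ> T \<rightarrow> Id\<close> such that \<open>\<beta> \<circ> f T \<circ> \<alpha>\<close> is the identity
  (\<open>identity_retract\<close>). Then precomposition with \<open>T\<close>, followed by pullback along \<open>G(\<alpha>)\<close> and by
  the map induced by \<open>H(\<beta>)\<close>, is a retraction. Indeed, let \<open>P\<close> be a projective resolution of
  \<open>G\<close> and \<open>c : P n \<rightarrow> H\<close> a cocycle. The round trip sends the class of \<open>c\<close> to the class of
  \<open>H(\<beta> \<circ> f T) \<circ> c F1 T \<circ> \<phi> n\<close>, where \<open>\<phi> : P \<rightarrow> P \<circ> F1 \<circ> T\<close> is any lift of \<open>G(\<alpha>)\<close>.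
  One such lift is \<open>P(\<alpha>)\<close>, and for it the cocycle is \<open>H(\<beta> \<circ> f T \<circ> \<alpha>) \<circ> c = c\<close>, by naturality
  of \<open>c\<close>. All maps in the statement are operations given by a functor \<open>T\<close> and two natural
  transformations, and such operations compose in the evident way (\<open>operation_comp\<close>). So every
  identity between them reduces to an identity between natural transformations
  (\<open>ext_induced_split\<close>).

  It remains to find \<open>T\<close>, \<open>\<alpha>\<close> and \<open>\<beta>\<close>, by induction on the degree. The difference functor
  \<open>\<Delta>F\<close> is a natural direct summand of \<open>V \<mapsto> F(V \<oplus> R)\<close>, so a retraction for \<open>\<Delta>F1 \<rightarrow> \<Delta>F2\<close> and \<open>T\<close>
  gives one for \<open>F1 \<rightarrow> F2\<close> and \<open>V \<mapsto> T V \<oplus> R\<close> (\<open>identity_retract_difference\<close>). The image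
  enters as a functor \<open>I\<close> with a factorisation \<open>F1 \<rightarrow> I \<rightarrow> F2\<close> of \<open>f\<close> into an epimorphism and a
  monomorphism; \<open>\<Delta>\<close> preserves such factorisations.

  This leads to the case of degree one. There a space \<open>W\<close> with \<open>(\<Delta>I)(W) \<noteq> 0\<close> is fixed, and the
  part of \<open>F1(W \<oplus> V)\<close> and \<open>F2(W \<oplus> V)\<close> that vanishes for \<open>V = 0\<close> is additive in \<open>V\<close>
  (\<open>cross_effect\<close>). An additive functor over a finite field is a direct sum of twists of the identity
  by field automorphisms, and it suffices to isolate one of them. The nonzero
  scalars act on the line in \<open>F1(W \<oplus> R)\<close>, and this space contains an eigenvector \<open>v\<close> that is not
  killed by \<open>f\<close>. Additivity forces the character of \<open>v\<close>, extended by \<open>0\<close>, to be a field automorphism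
  \<open>\<sigma>\<close> (\<open>linear_part_eigenvector\<close>). Let \<open>T V\<close> be \<open>W \<oplus> V\<close> with scalars acting on \<open>V\<close> through
  \<open>\<sigma>\<close>. The images of \<open>v\<close> under the maps \<open>W \<oplus> R \<rightarrow> T V\<close> given by the elements of \<open>V\<close> define
  \<open>\<alpha>\<close>, and an eigenfunctional on \<open>F2(W \<oplus> R)\<close> defines \<open>\<beta>\<close> (\<open>identity_retract_linear_part\<close>).

  Two facts are needed besides. Projective resolutions exist in the given universe, because one
  functor, a sum of representable functors, is projective and maps onto every other
  (\<open>generator_cover\<close>). And finite functors have finite-dimensional values, because a
  simple functor is generated by a single element (\<open>finite_functor_fd\<close>).
\<close>


section \<open>Codes in an infinite universe\<close>

text \<open>
  The elements of \<open>A\<close> can be named by elements of the universe \<open>'u\<close>.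
  Modules are built below on other types and then moved into \<open>'u\<close> along such a
  naming.
\<close>

definition codable :: "'u itself \<Rightarrow> 'a set \<Rightarrow> bool" where
  "codable U A \<longleftrightarrow> (\<exists>g :: 'a \<Rightarrow> 'u. inj_on g A)"

lemma codable_iff_card: "codable TYPE('u) A \<longleftrightarrow> (card_of A, card_of (UNIV :: 'u set)) \<in> ordLeq"
  unfolding codable_def card_of_ordLeq[symmetric] by auto

lemma codable_UNIV: "codable TYPE('u) (A :: 'u set)"
  unfolding codable_def by (intro exI[of _ id]) simp

lemma codable_inj: "codable TYPE('u) B \<Longrightarrow> inj_on g A \<Longrightarrow> g ` A \<subseteq> B \<Longrightarrow> codable TYPE('u) A"
  unfolding codable_def by (metis comp_inj_on inj_on_subset)

lemma codable_nat: "codable TYPE('u :: infinite) (A :: nat set)"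
proof -
  obtain f :: "nat \<Rightarrow> 'u" where "inj f" using infinite_countable_subset[OF infinite_UNIV] by blast
  then show ?thesis unfolding codable_def using inj_on_subset by blast
qed

lemma codable_finite: "finite A \<Longrightarrow> codable TYPE('u :: infinite) A"
  unfolding codable_def by (rule arb_inj_on_finite_infinite)

lemma codable_Times:
  assumes "codable TYPE('u :: infinite) A" "codable TYPE('u) B"
  shows "codable TYPE('u) (A \<times> B)"
  unfolding codable_iff_card
proof (rule card_of_Times_ordLeq_infinite_Field)
  show "infinite (Field (card_of (UNIV :: 'u set)))" by (simp add: Field_card_of infinite_UNIV)
qed (use assms card_of_Card_order in \<open>auto simp: codable_iff_card\<close>)

text \<open>
  Finite sets are sets of entries of lists, and the lists of each length are named by induction on
  the length.
\<close>

lemma codable_Fpow: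
  assumes A: "codable TYPE('u :: infinite) A"
  shows "codable TYPE('u) (Fpow A)"
proof -
  define Ls where "Ls n = {xs. set xs \<subseteq> A \<and> length xs = n}" for n
  have Ls: "codable TYPE('u) (Ls n)" for n
  proof (induction n)
    case 0
    have "Ls 0 \<subseteq> {[]}" by (auto simp: Ls_def)
    then show ?case using codable_finite finite_subset by blast
  next
    case (Suc n)
    have "codable TYPE('u) (A \<times> Ls n)" using codable_Times A Suc .
    then show ?case
    proof (rule codable_inj)
      show "inj_on (\<lambda>xs. (hd xs, tl xs)) (Ls (Suc n))"
      proof (rule inj_onI)
        fix xs ys assume "xs \<in> Ls (Suc n)" "ys \<in> Ls (Suc n)" and eq: "(hd xs, tl xs) = (hd ys, tl ys)"
        then have "xs \<noteq> []" "ys \<noteq> []" by (auto simp: Ls_def)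
        then show "xs = ys" using eq by (simp add: list.expand)
      qed
      show "(\<lambda>xs. (hd xs, tl xs)) ` Ls (Suc n) \<subseteq> A \<times> Ls n"
      proof
        fix p assume "p \<in> (\<lambda>xs. (hd xs, tl xs)) ` Ls (Suc n)"
        then obtain xs where "set xs \<subseteq> A" "length xs = Suc n" "p = (hd xs, tl xs)" by (auto simp: Ls_def)
        then show "p \<in> A \<times> Ls n" by (cases xs) (auto simp: Ls_def)
      qed
    qed
  qed
  have "codable TYPE('u) (\<Union>n. Ls n)"
    unfolding codable_iff_card
    by (rule card_of_UNION_ordLeq_infinite[OF infinite_UNIV])
      (use Ls codable_nat[where 'u='u, of UNIV] in \<open>auto simp: codable_iff_card\<close>)
  then show ?thesis
  proof (rule codable_inj)
    let ?l = "\<lambda>X. SOME xs. set xs = X"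
    have l: "set (?l X) = X" if "X \<in> Fpow A" for X
    proof -
      from that have "finite X" by (simp add: Fpow_def)
      then show ?thesis by (rule someI_ex[OF finite_list])
    qed
    show "inj_on ?l (Fpow A)" by (rule inj_onI) (metis l)
    show "?l ` Fpow A \<subseteq> (\<Union>n. Ls n)" using l by (fastforce simp: Ls_def Fpow_def)
  qed
qed

locale finite_field = field R for R :: "('f, 'm) ring_scheme" (structure) +
  assumes finite_scalars: "finite (carrier R)"
begin

section \<open>Linear maps\<close>

lemma linear_mapsI:
  assumes "\<And>x. x \<in> carrier M \<Longrightarrow> f x \<in> carrier N"
    and "\<And>x y. x \<in> carrier M \<Longrightarrow> y \<in> carrier M \<Longrightarrow> f (x \<oplus>\<^bsub>M\<^esub> y) = f x \<oplus>\<^bsub>N\<^esub> f y"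
    and "\<And>a x. a \<in> carrier R \<Longrightarrow> x \<in> carrier M \<Longrightarrow> f (a \<odot>\<^bsub>M\<^esub> x) = a \<odot>\<^bsub>N\<^esub> f x"
    and "f \<in> extensional (carrier M)"
  shows "f \<in> linear_maps R M N"
  using assms by (auto simp: linear_maps_def PiE_def)

lemma lin_closed: "f \<in> linear_maps R M N \<Longrightarrow> x \<in> carrier M \<Longrightarrow> f x \<in> carrier N"
  by (auto simp: linear_maps_def)

lemma lin_add: "f \<in> linear_maps R M N \<Longrightarrow> x \<in> carrier M \<Longrightarrow> y \<in> carrier M \<Longrightarrow>
    f (x \<oplus>\<^bsub>M\<^esub> y) = f x \<oplus>\<^bsub>N\<^esub> f y"
  by (auto simp: linear_maps_def)

lemma lin_smult: "f \<in> linear_maps R M N \<Longrightarrow> a \<in> carrier R \<Longrightarrow> x \<in> carrier M \<Longrightarrow>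
    f (a \<odot>\<^bsub>M\<^esub> x) = a \<odot>\<^bsub>N\<^esub> f x"
  by (auto simp: linear_maps_def)

lemma lin_ext: "f \<in> linear_maps R M N \<Longrightarrow> f \<in> extensional (carrier M)"
  by (auto simp: linear_maps_def PiE_def)

lemma lin_eqI:
  "f \<in> linear_maps R M N \<Longrightarrow> g \<in> linear_maps R M N' \<Longrightarrow> (\<And>x. x \<in> carrier M \<Longrightarrow> f x = g x) \<Longrightarrow> f = g"
  by (rule extensionalityI[OF lin_ext lin_ext])

lemma lin_id: "(\<lambda>x\<in>carrier M. x) \<in> linear_maps R M M" if "Module.module R M"
proof -
  interpret Module.module R M by fact
  show ?thesis by (rule linear_mapsI) auto
qed

lemma lin_comp:
  assumes f: "f \<in> linear_maps R L M" and g: "g \<in> linear_maps R M N" and L: "Module.module R L"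
  shows "compose (carrier L) g f \<in> linear_maps R L N"
proof -
  interpret Module.module R L by fact
  show ?thesis
    by (rule linear_mapsI) (auto simp: compose_def lin_closed[OF f] lin_closed[OF g] lin_add[OF f]
        lin_add[OF g] lin_smult[OF f] lin_smult[OF g])
qed

lemma lin_zero:
  assumes "f \<in> linear_maps R M N" "Module.module R M" "Module.module R N"
  shows "f \<zero>\<^bsub>M\<^esub> = \<zero>\<^bsub>N\<^esub>"
proof -
  interpret M: Module.module R M by fact
  interpret N: Module.module R N by fact
  have "f (\<zero> \<odot>\<^bsub>M\<^esub> \<zero>\<^bsub>M\<^esub>) = \<zero> \<odot>\<^bsub>N\<^esub> f \<zero>\<^bsub>M\<^esub>" by (rule lin_smult[OF assms(1)]) auto
  then show ?thesis using lin_closed[OF assms(1)] by simp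
qed

lemma lin_minus:
  assumes "f \<in> linear_maps R M N" "Module.module R M" "Module.module R N" "x \<in> carrier M" "y \<in> carrier M"
  shows "f (x \<ominus>\<^bsub>M\<^esub> y) = f x \<ominus>\<^bsub>N\<^esub> f y"
proof -
  interpret M: Module.module R M by fact
  interpret N: Module.module R N by fact
  have "f (\<ominus>\<^bsub>M\<^esub> y) = f ((\<ominus> \<one>) \<odot>\<^bsub>M\<^esub> y)" using assms by (simp add: M.smult_l_minus)
  also have "\<dots> = \<ominus>\<^bsub>N\<^esub> f y" using assms
    by (simp add: lin_smult[OF assms(1)] N.smult_l_minus lin_closed[OF assms(1)])
  finally show ?thesis using assms by (simp add: a_minus_def lin_add[OF assms(1)])
qed

lemma lin_finsum:
  assumes f: "f \<in> linear_maps R M N" and M: "Module.module R M" and N: "Module.module R N"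
    and A: "finite A" and g: "g \<in> A \<rightarrow> carrier M"
  shows "f (\<Oplus>\<^bsub>M\<^esub>i\<in>A. g i) = (\<Oplus>\<^bsub>N\<^esub>i\<in>A. f (g i))"
proof -
  interpret M: Module.module R M by fact
  interpret N: Module.module R N by fact
  from A g show ?thesis
  proof (induction A)
    case empty
    then show ?case using lin_zero[OF f M N] by simp
  next
    case (insert a A)
    then have "g \<in> A \<rightarrow> carrier M" "g a \<in> carrier M" "(\<lambda>i. f (g i)) \<in> A \<rightarrow> carrier N" "f (g a) \<in> carrier N"
      by (auto simp: lin_closed[OF f] Pi_def)
    then show ?case using insert by (simp add: lin_add[OF f])
  qed
qed

lemma lin_restrict_minus:
  assumes f: "f \<in> linear_maps R M N" and g: "g \<in> linear_maps R M N" and M: "Module.module R M" and N: "Module.module R N"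
  shows "(\<lambda>x\<in>carrier M. f x \<ominus>\<^bsub>N\<^esub> g x) \<in> linear_maps R M N"
proof -
  interpret M: Module.module R M by fact
  interpret N: Module.module R N by fact
  note [simp] = lin_closed[OF f] lin_closed[OF g] lin_add[OF f] lin_add[OF g] lin_smult[OF f] lin_smult[OF g]
  show ?thesis
    by (rule linear_mapsI)
      (auto simp: a_minus_def N.smult_r_distr N.smult_r_minus N.minus_add N.a_ac)
qed

text \<open>
  A way to compute differences without computing negatives: in modules of natural transformations,
  the negative is only given by its defining property.
\<close>

lemma minus_eqI:
  assumes "Module.module R M" "y \<in> carrier M" "z \<in> carrier M" "x = z \<oplus>\<^bsub>M\<^esub> y"
  shows "x \<ominus>\<^bsub>M\<^esub> y = z"
proof -
  interpret Module.module R M by fact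
  show ?thesis using assms by (simp add: a_minus_def M.a_assoc M.r_neg)
qed

lemma minus_add_cancel:
  assumes "Module.module R M" "x \<in> carrier M" "y \<in> carrier M"
  shows "(x \<ominus>\<^bsub>M\<^esub> y) \<oplus>\<^bsub>M\<^esub> y = x"
proof -
  interpret Module.module R M by fact
  show ?thesis using assms by (simp add: a_minus_def M.a_assoc M.l_neg)
qed

lemma minus_eq_zero_iff:
  assumes "Module.module R M" "x \<in> carrier M" "y \<in> carrier M"
  shows "x \<ominus>\<^bsub>M\<^esub> y = \<zero>\<^bsub>M\<^esub> \<longleftrightarrow> x = y"
proof -
  interpret Module.module R M by fact
  show ?thesis using assms
    by (metis M.minus_closed M.l_zero M.r_neg a_minus_def M.minus_equality M.minus_minus M.a_inv_closed)
qed

section \<open>Finite-dimensional spaces\<close>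

text \<open>
  Since the field is finite, there are only finitely many linear combinations of finitely many
  vectors.
\<close>

lemma fd_iff_finite: "V \<in> fd_spaces R \<longleftrightarrow> Module.module R V \<and> finite (carrier V)"
proof
  assume V: "V \<in> fd_spaces R"
  then have "Module.module R V" by (simp add: fd_spaces_def)
  then interpret V: Module.module R V .
  from V obtain B where B: "finite B" "B \<subseteq> carrier V"
    "\<And>x. x \<in> carrier V \<Longrightarrow> \<exists>c \<in> B \<rightarrow> carrier R. x = (\<Oplus>\<^bsub>V\<^esub>b\<in>B. c b \<odot>\<^bsub>V\<^esub> b)"
    by (auto simp: fd_spaces_def)
  have "carrier V \<subseteq> (\<lambda>c. \<Oplus>\<^bsub>V\<^esub>b\<in>B. c b \<odot>\<^bsub>V\<^esub> b) ` (B \<rightarrow>\<^sub>E carrier R)"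
  proof
    fix x assume "x \<in> carrier V"
    then obtain c where c: "c \<in> B \<rightarrow> carrier R" "x = (\<Oplus>\<^bsub>V\<^esub>b\<in>B. c b \<odot>\<^bsub>V\<^esub> b)" using B(3) by blast
    have "x = (\<Oplus>\<^bsub>V\<^esub>b\<in>B. restrict c B b \<odot>\<^bsub>V\<^esub> b)"
      unfolding c by (rule V.finsum_cong') (use B c in \<open>auto simp: Pi_def\<close>)
    moreover have "restrict c B \<in> B \<rightarrow>\<^sub>E carrier R" using c by auto
    ultimately show "x \<in> (\<lambda>c. \<Oplus>\<^bsub>V\<^esub>b\<in>B. c b \<odot>\<^bsub>V\<^esub> b) ` (B \<rightarrow>\<^sub>E carrier R)" by blast
  qed
  moreover have "finite (B \<rightarrow>\<^sub>E carrier R)" by (intro finite_PiE) (auto simp: B finite_scalars)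
  ultimately show "Module.module R V \<and> finite (carrier V)"
    using \<open>Module.module R V\<close> finite_surj by blast
next
  assume V: "Module.module R V \<and> finite (carrier V)"
  then interpret V: Module.module R V by simp
  have "\<exists>c \<in> carrier V \<rightarrow> carrier R. x = (\<Oplus>\<^bsub>V\<^esub>b\<in>carrier V. c b \<odot>\<^bsub>V\<^esub> b)" if x: "x \<in> carrier V" for x
  proof
    show "(\<lambda>b. if b = x then \<one> else \<zero>) \<in> carrier V \<rightarrow> carrier R" by auto
    have "(\<Oplus>\<^bsub>V\<^esub>b\<in>carrier V. (if b = x then \<one> else \<zero>) \<odot>\<^bsub>V\<^esub> b) = (\<Oplus>\<^bsub>V\<^esub>b\<in>carrier V. if x = b then b else \<zero>\<^bsub>V\<^esub>)"
      by (rule V.finsum_cong') auto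
    also have "\<dots> = x" using V x by (subst V.finsum_singleton) auto
    finally show "x = (\<Oplus>\<^bsub>V\<^esub>b\<in>carrier V. (if b = x then \<one> else \<zero>) \<odot>\<^bsub>V\<^esub> b)" by simp
  qed
  then show "V \<in> fd_spaces R" unfolding fd_spaces_def using V by blast
qed

lemma fd_module: "V \<in> fd_spaces R \<Longrightarrow> Module.module R V"
  by (simp add: fd_iff_finite)

lemma finite_linear_maps:
  assumes "finite (carrier M)" "finite (carrier N)"
  shows "finite (linear_maps R M N)"
  by (rule finite_subset[OF _ finite_PiE[of "carrier M" "\<lambda>_. carrier N"]])
    (use assms in \<open>auto simp: linear_maps_def\<close>)

section \<open>Submodules and quotients\<close>

lemma submodule_simps:
  assumes "Module.module R M" "submodule N R M"
  shows "N \<subseteq> carrier M" "\<zero>\<^bsub>M\<^esub> \<in> N" "x \<in> N \<Longrightarrow> y \<in> N \<Longrightarrow> x \<oplus>\<^bsub>M\<^esub> y \<in> N"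
    "a \<in> carrier R \<Longrightarrow> x \<in> N \<Longrightarrow> a \<odot>\<^bsub>M\<^esub> x \<in> N" "x \<in> N \<Longrightarrow> \<ominus>\<^bsub>M\<^esub> x \<in> N"
    "x \<in> N \<Longrightarrow> y \<in> N \<Longrightarrow> x \<ominus>\<^bsub>M\<^esub> y \<in> N"
proof -
  interpret M: Module.module R M by fact
  note E = M.submoduleE[OF assms(2)]
  show *: "N \<subseteq> carrier M" "x \<in> N \<Longrightarrow> y \<in> N \<Longrightarrow> x \<oplus>\<^bsub>M\<^esub> y \<in> N"
    "a \<in> carrier R \<Longrightarrow> x \<in> N \<Longrightarrow> a \<odot>\<^bsub>M\<^esub> x \<in> N" "x \<in> N \<Longrightarrow> \<ominus>\<^bsub>M\<^esub> x \<in> N"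
    using E by auto
  show "x \<in> N \<Longrightarrow> y \<in> N \<Longrightarrow> x \<ominus>\<^bsub>M\<^esub> y \<in> N" using E by (auto simp: a_minus_def)
  obtain x where "x \<in> N" using E(2) by blast
  then have "\<zero> \<odot>\<^bsub>M\<^esub> x \<in> N" using E(4) by blast
  then show "\<zero>\<^bsub>M\<^esub> \<in> N" using \<open>x \<in> N\<close> E(1) by (metis M.smult_l_null subsetD)
qed

lemma submoduleI':
  assumes "Module.module R M" "N \<subseteq> carrier M" "\<zero>\<^bsub>M\<^esub> \<in> N"
    "\<And>x y. x \<in> N \<Longrightarrow> y \<in> N \<Longrightarrow> x \<oplus>\<^bsub>M\<^esub> y \<in> N"
    "\<And>a x. a \<in> carrier R \<Longrightarrow> x \<in> N \<Longrightarrow> a \<odot>\<^bsub>M\<^esub> x \<in> N"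
  shows "submodule N R M"
proof -
  interpret M: Module.module R M by fact
  show ?thesis
  proof (rule M.submoduleI)
    fix x assume x: "x \<in> N"
    have "(\<ominus> \<one>) \<odot>\<^bsub>M\<^esub> x \<in> N" using assms(5) x by auto
    then show "\<ominus>\<^bsub>M\<^esub> x \<in> N" using x assms(2) by (simp add: M.smult_l_minus subset_iff)
  qed (use assms in auto)
qed

lemma submodule_image:
  assumes f: "f \<in> linear_maps R M N" and M: "Module.module R M" and N: "Module.module R N"
  shows "submodule (f ` carrier M) R N"
proof -
  interpret M: Module.module R M by fact
  show ?thesis
  proof (rule submoduleI'[OF N])
    show "f ` carrier M \<subseteq> carrier N" using lin_closed[OF f] by auto
    show "\<zero>\<^bsub>N\<^esub> \<in> f ` carrier M" using lin_zero[OF f M N] by (metis M.zero_closed image_eqI)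
  qed (use lin_add[OF f] lin_smult[OF f] in \<open>metis (no_types, lifting) imageE imageI M.a_closed M.smult_closed\<close>)+
qed

lemma submodule_kernel:
  assumes f: "f \<in> linear_maps R M N" and M: "Module.module R M" and N: "Module.module R N"
  shows "submodule {x \<in> carrier M. f x = \<zero>\<^bsub>N\<^esub>} R M"
proof -
  interpret M: Module.module R M by fact
  interpret N: Module.module R N by fact
  show ?thesis
    by (rule submoduleI'[OF M]) (auto simp: lin_zero[OF f M N] lin_add[OF f] lin_smult[OF f])
qed

context
  fixes M :: "('f, 'u) module" and N
  assumes M: "Module.module R M" and N: "submodule N R M"
begin

interpretation M: Module.module R M by (rule M)

lemma quot_rep_ex: 
  assumes "x \<in> carrier M"
  obtains n where "n \<in> N" "n \<in> carrier M" "quot_rep M N x = n \<oplus>\<^bsub>M\<^esub> x"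
proof -
  have "\<zero>\<^bsub>M\<^esub> \<oplus>\<^bsub>M\<^esub> x \<in> N +>\<^bsub>M\<^esub> x"
    using submodule_simps[OF M N] by (auto simp: a_r_coset_def' )
  then have "quot_rep M N x \<in> N +>\<^bsub>M\<^esub> x"
    unfolding quot_rep_def by (rule someI)
  then show ?thesis using that submodule_simps(1)[OF M N] by (auto simp: a_r_coset_def')
qed

lemma quot_rep_closed: "x \<in> carrier M \<Longrightarrow> quot_rep M N x \<in> carrier M"
  by (rule quot_rep_ex) auto

lemma quot_rep_minus: "x \<in> carrier M \<Longrightarrow> quot_rep M N x \<ominus>\<^bsub>M\<^esub> x \<in> N"
  by (rule quot_rep_ex) (auto simp: minus_eqI[OF M])

lemma quot_rep_eq_iff:
  assumes x: "x \<in> carrier M" and y: "y \<in> carrier M"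
  shows "quot_rep M N x = quot_rep M N y \<longleftrightarrow> x \<ominus>\<^bsub>M\<^esub> y \<in> N"
proof
  obtain m n where m: "m \<in> N" "quot_rep M N x = m \<oplus>\<^bsub>M\<^esub> x" and n: "n \<in> N" "quot_rep M N y = n \<oplus>\<^bsub>M\<^esub> y"
    using quot_rep_ex x y by metis
  have mn: "m \<in> carrier M" "n \<in> carrier M" using m n submodule_simps[OF M N] by auto
  assume "quot_rep M N x = quot_rep M N y"
  then have *: "m \<oplus>\<^bsub>M\<^esub> x = n \<oplus>\<^bsub>M\<^esub> y" using m n by simp
  have "x = (n \<ominus>\<^bsub>M\<^esub> m) \<oplus>\<^bsub>M\<^esub> y"
  proof -
    have "x = \<ominus>\<^bsub>M\<^esub> m \<oplus>\<^bsub>M\<^esub> (m \<oplus>\<^bsub>M\<^esub> x)" using mn x by (simp add: M.a_assoc[symmetric] M.l_neg)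
    also have "\<dots> = \<ominus>\<^bsub>M\<^esub> m \<oplus>\<^bsub>M\<^esub> (n \<oplus>\<^bsub>M\<^esub> y)" using * by simp
    finally show ?thesis using mn x y by (simp add: a_minus_def M.a_ac)
  qed
  then have "x \<ominus>\<^bsub>M\<^esub> y = n \<ominus>\<^bsub>M\<^esub> m"
    using minus_eqI[OF M y] mn by simp
  then show "x \<ominus>\<^bsub>M\<^esub> y \<in> N" using m n submodule_simps[OF M N] by simp
next
  assume d: "x \<ominus>\<^bsub>M\<^esub> y \<in> N"
  define k where "k = x \<ominus>\<^bsub>M\<^esub> y"
  have k: "k \<in> N" "k \<in> carrier M" using d submodule_simps(1)[OF M N] by (auto simp: k_def)
  have xk: "x = k \<oplus>\<^bsub>M\<^esub> y" using x y by (simp add: k_def a_minus_def M.a_assoc M.l_neg)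
  have "N +>\<^bsub>M\<^esub> x = N +>\<^bsub>M\<^esub> y"
  proof (auto simp: a_r_coset_def' xk)
    fix h assume h: "h \<in> N"
    have hM: "h \<in> carrier M" using h submodule_simps(1)[OF M N] by auto
    show "\<exists>n\<in>N. h \<oplus>\<^bsub>M\<^esub> (k \<oplus>\<^bsub>M\<^esub> y) = n \<oplus>\<^bsub>M\<^esub> y"
      using hM k y submodule_simps(3)[OF M N h k(1)] by (intro bexI[of _ "h \<oplus>\<^bsub>M\<^esub> k"]) (auto simp: M.a_assoc)
    show "\<exists>n\<in>N. h \<oplus>\<^bsub>M\<^esub> y = n \<oplus>\<^bsub>M\<^esub> (k \<oplus>\<^bsub>M\<^esub> y)"
      using hM k y submodule_simps(6)[OF M N h k(1)]
      by (intro bexI[of _ "h \<ominus>\<^bsub>M\<^esub> k"]) (auto simp: a_minus_def M.a_assoc M.a_assoc[symmetric, of "\<ominus>\<^bsub>M\<^esub> k"] M.l_neg)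
  qed
  then show "quot_rep M N x = quot_rep M N y" by (simp add: quot_rep_def)
qed

lemma quot_rep_idem: "x \<in> carrier M \<Longrightarrow> quot_rep M N (quot_rep M N x) = quot_rep M N x"
  by (simp add: quot_rep_eq_iff quot_rep_closed quot_rep_minus)

lemma quot_carrier: "carrier (quot_module M N) = quot_rep M N ` carrier M"
  by (simp add: quot_module_def)

lemma quot_carrier_subset: "x \<in> carrier (quot_module M N) \<Longrightarrow> x \<in> carrier M"
  by (auto simp: quot_carrier quot_rep_closed)

lemma quot_rep_carrier: "x \<in> carrier (quot_module M N) \<Longrightarrow> quot_rep M N x = x"
  by (auto simp: quot_carrier quot_rep_idem)

lemma quot_rep_add: "x \<in> carrier M \<Longrightarrow> y \<in> carrier M \<Longrightarrow>
    quot_rep M N (quot_rep M N x \<oplus>\<^bsub>M\<^esub> quot_rep M N y) = quot_rep M N (x \<oplus>\<^bsub>M\<^esub> y)"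
proof -
  assume x: "x \<in> carrier M" and y: "y \<in> carrier M"
  obtain m where m: "m \<in> N" "quot_rep M N x = m \<oplus>\<^bsub>M\<^esub> x" using quot_rep_ex x by metis
  obtain n where n: "n \<in> N" "quot_rep M N y = n \<oplus>\<^bsub>M\<^esub> y" using quot_rep_ex y by metis
  have c: "m \<in> carrier M" "n \<in> carrier M" using m n submodule_simps[OF M N] by auto
  have "(m \<oplus>\<^bsub>M\<^esub> x \<oplus>\<^bsub>M\<^esub> (n \<oplus>\<^bsub>M\<^esub> y)) \<ominus>\<^bsub>M\<^esub> (x \<oplus>\<^bsub>M\<^esub> y) = m \<oplus>\<^bsub>M\<^esub> n"
    using c x y by (intro minus_eqI[OF M]) (auto simp: M.a_ac)
  then show ?thesis
    unfolding m(2) n(2) using c x y m(1) n(1) submodule_simps[OF M N]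
    by (subst quot_rep_eq_iff) auto
qed

lemma quot_rep_smult: "a \<in> carrier R \<Longrightarrow> x \<in> carrier M \<Longrightarrow>
    quot_rep M N (a \<odot>\<^bsub>M\<^esub> quot_rep M N x) = quot_rep M N (a \<odot>\<^bsub>M\<^esub> x)"
proof -
  assume a: "a \<in> carrier R" and x: "x \<in> carrier M"
  obtain m where m: "m \<in> N" "quot_rep M N x = m \<oplus>\<^bsub>M\<^esub> x" using quot_rep_ex x by metis
  have c: "m \<in> carrier M" using m submodule_simps[OF M N] by auto
  have "(a \<odot>\<^bsub>M\<^esub> (m \<oplus>\<^bsub>M\<^esub> x)) \<ominus>\<^bsub>M\<^esub> (a \<odot>\<^bsub>M\<^esub> x) = a \<odot>\<^bsub>M\<^esub> m"
    using c x a by (intro minus_eqI[OF M]) (auto simp: M.smult_r_distr)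
  then show ?thesis
    unfolding m(2) using c x a m(1) submodule_simps[OF M N]
    by (subst quot_rep_eq_iff) auto
qed

lemma quot_add: "x \<in> carrier M \<Longrightarrow> y \<in> carrier M \<Longrightarrow>
    quot_rep M N x \<oplus>\<^bsub>quot_module M N\<^esub> quot_rep M N y = quot_rep M N (x \<oplus>\<^bsub>M\<^esub> y)"
  by (simp add: quot_module_def quot_rep_add)

lemma quot_smult: "a \<in> carrier R \<Longrightarrow> x \<in> carrier M \<Longrightarrow>
    a \<odot>\<^bsub>quot_module M N\<^esub> quot_rep M N x = quot_rep M N (a \<odot>\<^bsub>M\<^esub> x)"
  by (simp add: quot_module_def quot_rep_smult)

lemma quot_zero: "\<zero>\<^bsub>quot_module M N\<^esub> = quot_rep M N \<zero>\<^bsub>M\<^esub>"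
  by (simp add: quot_module_def)

lemma quot_rep_eq_zero_iff: "x \<in> carrier M \<Longrightarrow> quot_rep M N x = \<zero>\<^bsub>quot_module M N\<^esub> \<longleftrightarrow> x \<in> N"
  using minus_eqI[OF M M.zero_closed, of x] by (simp add: quot_zero quot_rep_eq_iff)

lemma quot_module_is_module: "Module.module R (quot_module M N)"
proof (rule moduleI)
  show "cring R" by (rule is_cring)
  show "abelian_group (quot_module M N)"
  proof (rule abelian_groupI)
    fix x assume "x \<in> carrier (quot_module M N)"
    then obtain y where y: "y \<in> carrier M" "x = quot_rep M N y" by (auto simp: quot_carrier)
    then have "quot_rep M N (\<ominus>\<^bsub>M\<^esub> y) \<oplus>\<^bsub>quot_module M N\<^esub> x = \<zero>\<^bsub>quot_module M N\<^esub>"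
      by (simp add: quot_add quot_zero M.l_neg)
    then show "\<exists>y\<in>carrier (quot_module M N). y \<oplus>\<^bsub>quot_module M N\<^esub> x = \<zero>\<^bsub>quot_module M N\<^esub>"
      using y by (auto simp: quot_carrier)
  qed (auto simp: quot_carrier quot_add quot_zero M.a_ac)
qed (auto simp: quot_carrier quot_add quot_smult M.smult_r_distr M.smult_l_distr M.smult_assoc1)

lemma quot_rep_linear: "restrict (quot_rep M N) (carrier M) \<in> linear_maps R M (quot_module M N)"
  by (rule linear_mapsI) (auto simp: quot_carrier quot_add quot_smult)

text \<open>
  The quotient consists of representatives, so the factorisation of \<open>t\<close> is its
  restriction to them.
\<close>

lemma quot_lift_linear:
  assumes t: "t \<in> linear_maps R M P" and P: "Module.module R P" and 0: "\<forall>x\<in>N. t x = \<zero>\<^bsub>P\<^esub>"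
  shows "restrict t (carrier (quot_module M N)) \<in> linear_maps R (quot_module M N) P"
    and "x \<in> carrier M \<Longrightarrow> t (quot_rep M N x) = t x"
proof -
  interpret P: Module.module R P by (rule P)
  show *: "t (quot_rep M N x) = t x" if x: "x \<in> carrier M" for x
  proof -
    obtain n where n: "n \<in> N" "quot_rep M N x = n \<oplus>\<^bsub>M\<^esub> x" using quot_rep_ex x by metis
    then have "n \<in> carrier M" using submodule_simps[OF M N] by auto
    then show ?thesis using n x 0 by (simp add: lin_add[OF t] lin_closed[OF t])
  qed
  interpret Q: Module.module R "quot_module M N" by (rule quot_module_is_module)
  show "restrict t (carrier (quot_module M N)) \<in> linear_maps R (quot_module M N) P"
  proof (rule linear_mapsI)
    fix x y assume "x \<in> carrier (quot_module M N)" "y \<in> carrier (quot_module M N)"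
    then obtain x' y' where "x' \<in> carrier M" "y' \<in> carrier M" "x = quot_rep M N x'" "y = quot_rep M N y'"
      by (auto simp: quot_carrier)
    then show "restrict t (carrier (quot_module M N)) (x \<oplus>\<^bsub>quot_module M N\<^esub> y) =
        restrict t (carrier (quot_module M N)) x \<oplus>\<^bsub>P\<^esub> restrict t (carrier (quot_module M N)) y"
      by (simp add: quot_add) (simp add: quot_carrier * lin_add[OF t])
  next
    fix a x assume "a \<in> carrier R" "x \<in> carrier (quot_module M N)"
    then obtain x' where "x' \<in> carrier M" "x = quot_rep M N x'" "a \<in> carrier R"
      by (auto simp: quot_carrier)
    then show "restrict t (carrier (quot_module M N)) (a \<odot>\<^bsub>quot_module M N\<^esub> x) =
        a \<odot>\<^bsub>P\<^esub> restrict t (carrier (quot_module M N)) x"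
      by (simp add: quot_smult) (simp add: quot_carrier * lin_smult[OF t])
  qed (auto simp: quot_carrier_subset lin_closed[OF t])
qed

end

section \<open>Functors and natural transformations\<close>

abbreviation fd :: "('f, 'u) module set" where "fd \<equiv> fd_spaces R"

lemma fun_module: "is_functor R F \<Longrightarrow> V \<in> fd \<Longrightarrow> Module.module R (obj F V)"
  by (simp add: is_functor_def)

lemma fun_lin: "is_functor R F \<Longrightarrow> V \<in> fd \<Longrightarrow> W \<in> fd \<Longrightarrow> f \<in> linear_maps R V W \<Longrightarrow>
    mor F V W f \<in> linear_maps R (obj F V) (obj F W)"
  by (simp add: is_functor_def)

lemma fun_closed: "is_functor R F \<Longrightarrow> V \<in> fd \<Longrightarrow> W \<in> fd \<Longrightarrow> f \<in> linear_maps R V W \<Longrightarrow>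
    x \<in> carrier (obj F V) \<Longrightarrow> mor F V W f x \<in> carrier (obj F W)"
  by (blast intro: lin_closed fun_lin)

lemma fun_id: "is_functor R F \<Longrightarrow> V \<in> fd \<Longrightarrow> x \<in> carrier (obj F V) \<Longrightarrow>
    mor F V V (\<lambda>x\<in>carrier V. x) x = x"
  by (simp add: is_functor_def)

lemma fun_comp: "is_functor R F \<Longrightarrow> U \<in> fd \<Longrightarrow> V \<in> fd \<Longrightarrow> W \<in> fd \<Longrightarrow>
    f \<in> linear_maps R U V \<Longrightarrow> g \<in> linear_maps R V W \<Longrightarrow> x \<in> carrier (obj F U) \<Longrightarrow>
    mor F V W g (mor F U V f x) = mor F U W (compose (carrier U) g f) x"
  by (simp add: is_functor_def compose_eq)

lemma is_functorI:
  assumes "\<And>V. V \<in> fd \<Longrightarrow> Module.module R (obj F V)"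
    and "\<And>V W f. V \<in> fd \<Longrightarrow> W \<in> fd \<Longrightarrow> f \<in> linear_maps R V W \<Longrightarrow>
        mor F V W f \<in> linear_maps R (obj F V) (obj F W)"
    and "\<And>V x. V \<in> fd \<Longrightarrow> x \<in> carrier (obj F V) \<Longrightarrow> mor F V V (\<lambda>x\<in>carrier V. x) x = x"
    and "\<And>U V W f g x. U \<in> fd \<Longrightarrow> V \<in> fd \<Longrightarrow> W \<in> fd \<Longrightarrow>
        f \<in> linear_maps R U V \<Longrightarrow> g \<in> linear_maps R V W \<Longrightarrow> x \<in> carrier (obj F U) \<Longrightarrow>
        mor F U W (compose (carrier U) g f) x = mor F V W g (mor F U V f x)"
  shows "is_functor R F"
  unfolding is_functor_def
proof (intro conjI ballI)
  fix V :: "('f, 'a) module" assume V: "V \<in> fd"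
  show "Module.module R (obj F V)" by (rule assms(1)[OF V])
  show "mor F V V (\<lambda>x\<in>carrier V. x) = (\<lambda>x\<in>carrier (obj F V). x)"
    by (rule lin_eqI[OF assms(2)[OF V V lin_id] lin_id])
      (use assms(1,3) V fd_module[OF V] in auto)
next
  fix V W :: "('f, 'a) module" and f assume "V \<in> fd" "W \<in> fd" "f \<in> linear_maps R V W"
  then show "mor F V W f \<in> linear_maps R (obj F V) (obj F W)" by (rule assms(2))
next
  fix U V W :: "('f, 'a) module" and f g
  assume UVW: "U \<in> fd" "V \<in> fd" "W \<in> fd" and f: "f \<in> linear_maps R U V" and g: "g \<in> linear_maps R V W"
  show "mor F U W (compose (carrier U) g f) =
      compose (carrier (obj F U)) (mor F V W g) (mor F U V f)"
    by (rule lin_eqI[OF assms(2)[OF _ _ lin_comp[OF f g]] lin_comp[OF assms(2)[OF _ _ f] assms(2)[OF _ _ g]]])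
      (auto simp: UVW assms(4)[OF _ _ _ f g] fd_module f g assms(1) compose_eq)
qed

lemma nt_lin: "t \<in> nat_trans R F G \<Longrightarrow> V \<in> fd \<Longrightarrow> t V \<in> linear_maps R (obj F V) (obj G V)"
  by (auto simp: nat_trans_def)

lemma nt_closed: "t \<in> nat_trans R F G \<Longrightarrow> V \<in> fd \<Longrightarrow> x \<in> carrier (obj F V) \<Longrightarrow> t V x \<in> carrier (obj G V)"
  by (blast intro: lin_closed nt_lin)

lemma nt_nat:
  assumes "t \<in> nat_trans R F G" "V \<in> fd" "W \<in> fd" "f \<in> linear_maps R V W" "x \<in> carrier (obj F V)"
  shows "t W (mor F V W f x) = mor G V W f (t V x)"
proof -
  have "compose (carrier (obj F V)) (t W) (mor F V W f) x = compose (carrier (obj F V)) (mor G V W f) (t V) x"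
    using assms(1-4) by (simp add: nat_trans_def)
  then show ?thesis using assms(5) by (simp add: compose_eq)
qed

lemma ntI:
  assumes "\<And>V. V \<in> fd \<Longrightarrow> t V \<in> linear_maps R (obj F V) (obj G V)"
    and "\<And>V W f x. V \<in> fd \<Longrightarrow> W \<in> fd \<Longrightarrow> f \<in> linear_maps R V W \<Longrightarrow> x \<in> carrier (obj F V) \<Longrightarrow>
        t W (mor F V W f x) = mor G V W f (t V x)"
    and "t \<in> extensional fd"
  shows "t \<in> nat_trans R F G"
  using assms by (auto simp: nat_trans_def PiE_def compose_def intro!: restrict_ext)

lemma nt_ext: "t \<in> nat_trans R F G \<Longrightarrow> t \<in> extensional fd"
  by (auto simp: nat_trans_def PiE_def)

lemma nt_eqI:
  assumes "s \<in> nat_trans R F G" "t \<in> nat_trans R F G'"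
    and "\<And>V x. V \<in> fd \<Longrightarrow> x \<in> carrier (obj F V) \<Longrightarrow> s V x = t V x"
  shows "s = t"
  by (rule extensionalityI[OF nt_ext[OF assms(1)] nt_ext[OF assms(2)]])
    (rule lin_eqI[OF nt_lin[OF assms(1)] nt_lin[OF assms(2)] assms(3)])

lemma trans_comp_apply [simp]: "V \<in> fd \<Longrightarrow> x \<in> carrier (obj F V) \<Longrightarrow> trans_comp R F t s V x = t V (s V x)"
  by (simp add: trans_comp_def compose_eq)

lemma trans_comp_nt:
  assumes s: "s \<in> nat_trans R F G" and t: "t \<in> nat_trans R G H" and F: "is_functor R F"
  shows "trans_comp R F t s \<in> nat_trans R F H"
proof (rule ntI)
  fix V :: "('f, 'a) module" assume V: "V \<in> fd"
  then show "trans_comp R F t s V \<in> linear_maps R (obj F V) (obj H V)"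
    by (simp add: trans_comp_def) (rule lin_comp[OF nt_lin[OF s] nt_lin[OF t] fun_module[OF F]])
next
  fix V W :: "('f, 'a) module" and f x
  assume "V \<in> fd" "W \<in> fd" "f \<in> linear_maps R V W" "x \<in> carrier (obj F V)"
  then show "trans_comp R F t s W (mor F V W f x) = mor H V W f (trans_comp R F t s V x)"
    by (simp add: fun_closed[OF F] nt_nat[OF s] nt_nat[OF t] nt_closed[OF s])
qed (simp add: trans_comp_def)

lemma id_trans_apply [simp]: "V \<in> fd \<Longrightarrow> x \<in> carrier (obj F V) \<Longrightarrow> id_trans R F V x = x"
  by (simp add: id_trans_def)

lemma id_trans_nt: "is_functor R F \<Longrightarrow> id_trans R F \<in> nat_trans R F F"
  by (rule ntI) (auto simp: id_trans_def lin_id fun_module fun_closed)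

lemma trans_comp_id_left: "t \<in> nat_trans R F G \<Longrightarrow> trans_comp R F (id_trans R G) t = t"
  unfolding trans_comp_def id_trans_def
  by (rule extensionalityI[OF _ nt_ext], simp, assumption, simp,
    rule extensionalityI[OF _ lin_ext[OF nt_lin]]) (auto simp: compose_eq nt_closed)

lemma trans_comp_id_right: "t \<in> nat_trans R F G \<Longrightarrow> trans_comp R F t (id_trans R F) = t"
  unfolding trans_comp_def id_trans_def
  by (rule extensionalityI[OF _ nt_ext], simp, assumption, simp,
    rule extensionalityI[OF _ lin_ext[OF nt_lin]]) (auto simp: compose_eq nt_closed)

subsection \<open>Precomposition\<close>

text \<open>
  The functors with which others can be precomposed.
\<close>

definition fd_functor :: "('f, 'u) vfunctor \<Rightarrow> bool" where
  "fd_functor T \<longleftrightarrow> is_functor R T \<and> (\<forall>V\<in>fd. obj T V \<in> fd)"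

definition id_functor :: "('f, 'u) vfunctor" where
  "id_functor = \<lparr>obj = (\<lambda>V. V), mor = (\<lambda>V W f. f)\<rparr>"

lemma obj_precomp [simp]: "obj (G \<circ>\<^sub>F F) V = obj G (obj F V)"
  and mor_precomp [simp]: "mor (G \<circ>\<^sub>F F) V W f = mor G (obj F V) (obj F W) (mor F V W f)"
  by (simp_all add: precomp_def)

lemma precomp_assoc: "G \<circ>\<^sub>F (F \<circ>\<^sub>F E) = G \<circ>\<^sub>F F \<circ>\<^sub>F E"
  by (simp add: precomp_def)

lemma precomp_id [simp]: "G \<circ>\<^sub>F id_functor = G" "id_functor \<circ>\<^sub>F G = G"
  by (simp_all add: precomp_def id_functor_def)

lemma obj_id_functor [simp]: "obj id_functor V = V" "mor id_functor V W f = f"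
  by (simp_all add: id_functor_def)

lemma fd_functor_functor: "fd_functor T \<Longrightarrow> is_functor R T"
  and fd_functor_obj: "fd_functor T \<Longrightarrow> V \<in> fd \<Longrightarrow> obj T V \<in> fd"
  by (auto simp: fd_functor_def)

lemma fd_functor_mor: "fd_functor T \<Longrightarrow> V \<in> fd \<Longrightarrow> W \<in> fd \<Longrightarrow> f \<in> linear_maps R V W \<Longrightarrow>
   mor T V W f \<in> linear_maps R (obj T V) (obj T W)"
  by (auto simp: fd_functor_def fun_lin)

lemma fd_functor_id: "fd_functor id_functor"
  by (auto simp: fd_functor_def compose_eq fd_module intro!: is_functorI)

lemma precomp_functor:
  assumes G: "is_functor R G" and T: "fd_functor T"
  shows "is_functor R (G \<circ>\<^sub>F T)"
proof (rule is_functorI)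
  have T': "is_functor R T" using T by (rule fd_functor_functor)
  fix V :: "('f, 'a) module" assume V: "V \<in> fd"
  show "Module.module R (obj (G \<circ>\<^sub>F T) V)" using V by (simp add: fun_module[OF G] fd_functor_obj[OF T])
  have "mor T V V (\<lambda>x\<in>carrier V. x) = (\<lambda>x\<in>carrier (obj T V). x)"
    using T' V by (simp add: is_functor_def)
  then show "mor (G \<circ>\<^sub>F T) V V (\<lambda>x\<in>carrier V. x) x = x" if "x \<in> carrier (obj (G \<circ>\<^sub>F T) V)" for x
    using that V by (simp add: fun_id[OF G] fd_functor_obj[OF T])
next
  fix V W :: "('f, 'a) module" and f assume "V \<in> fd" "W \<in> fd" "f \<in> linear_maps R V W"
  then show "mor (G \<circ>\<^sub>F T) V W f \<in> linear_maps R (obj (G \<circ>\<^sub>F T) V) (obj (G \<circ>\<^sub>F T) W)"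
    by (simp add: fun_lin[OF G] fd_functor_mor[OF T] fd_functor_obj[OF T])
next
  fix U V W :: "('f, 'a) module" and f g x
  assume UVW: "U \<in> fd" "V \<in> fd" "W \<in> fd" and f: "f \<in> linear_maps R U V" and g: "g \<in> linear_maps R V W"
    and x: "x \<in> carrier (obj (G \<circ>\<^sub>F T) U)"
  have "mor T U W (compose (carrier U) g f) = compose (carrier (obj T U)) (mor T V W g) (mor T U V f)"
    using fd_functor_functor[OF T] UVW f g by (simp add: is_functor_def)
  then show "mor (G \<circ>\<^sub>F T) U W (compose (carrier U) g f) x = mor (G \<circ>\<^sub>F T) V W g (mor (G \<circ>\<^sub>F T) U V f x)"
    using UVW f g x by (simp add: fun_comp[OF G] fd_functor_mor[OF T] fd_functor_obj[OF T])
qed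

lemma fd_functor_precomp: "fd_functor G \<Longrightarrow> fd_functor T \<Longrightarrow> fd_functor (G \<circ>\<^sub>F T)"
  using precomp_functor by (auto simp: fd_functor_def)

lemma precomp_trans_apply [simp]: "V \<in> fd \<Longrightarrow> precomp_trans R T t V = t (obj T V)"
  by (simp add: precomp_trans_def)

lemma precomp_trans_nt:
  assumes T: "fd_functor T" and t: "t \<in> nat_trans R F G"
  shows "precomp_trans R T t \<in> nat_trans R (F \<circ>\<^sub>F T) (G \<circ>\<^sub>F T)"
  by (rule ntI) (auto simp: nt_lin[OF t] nt_nat[OF t] fd_functor_obj[OF T] fd_functor_mor[OF T],
    simp add: precomp_trans_def)

lemma precomp_trans_id_functor: "t \<in> nat_trans R F G \<Longrightarrow> precomp_trans R id_functor t = t"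
  by (rule extensionalityI[OF _ nt_ext]) (auto simp: precomp_trans_def)

lemma precomp_trans_id_trans:
  assumes "fd_functor T"
  shows "precomp_trans R T (id_trans R F) = id_trans R (F \<circ>\<^sub>F T)"
  using assms by (auto simp: precomp_trans_def id_trans_def fd_functor_obj restrict_def)

lemma postcomp_trans_apply [simp]:
  "V \<in> fd \<Longrightarrow> postcomp_trans R H S T t V = mor H (obj S V) (obj T V) (t V)"
  by (simp add: postcomp_trans_def)

lemma postcomp_trans_nt:
  assumes H: "is_functor R H" and S: "fd_functor S" and T: "fd_functor T" and t: "t \<in> nat_trans R S T"
  shows "postcomp_trans R H S T t \<in> nat_trans R (H \<circ>\<^sub>F S) (H \<circ>\<^sub>F T)"
proof (rule ntI)
  fix V :: "('f, 'a) module" assume "V \<in> fd"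
  then show "postcomp_trans R H S T t V \<in> linear_maps R (obj (H \<circ>\<^sub>F S) V) (obj (H \<circ>\<^sub>F T) V)"
    by (simp add: fun_lin[OF H] fd_functor_obj S T nt_lin[OF t])
next
  fix V W :: "('f, 'a) module" and f x
  assume VW: "V \<in> fd" "W \<in> fd" "f \<in> linear_maps R V W" and x: "x \<in> carrier (obj (H \<circ>\<^sub>F S) V)"
  have "compose (carrier (obj S V)) (t W) (mor S V W f) = compose (carrier (obj S V)) (mor T V W f) (t V)"
    using t VW by (simp add: nat_trans_def)
  then show "postcomp_trans R H S T t W (mor (H \<circ>\<^sub>F S) V W f x) =
      mor (H \<circ>\<^sub>F T) V W f (postcomp_trans R H S T t V x)"
    using VW x by (simp add: fun_comp[OF H] fd_functor_obj[OF S] fd_functor_obj[OF T]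
        fd_functor_mor[OF S] fd_functor_mor[OF T] nt_lin[OF t])
qed (simp add: postcomp_trans_def)

subsection \<open>Spaces of natural transformations\<close>

lemma hom_module_simps [simp]:
  "carrier (hom_module R F G) = nat_trans R F G"
  "V \<in> fd \<Longrightarrow> x \<in> carrier (obj F V) \<Longrightarrow> \<zero>\<^bsub>hom_module R F G\<^esub> V x = \<zero>\<^bsub>obj G V\<^esub>"
  "V \<in> fd \<Longrightarrow> x \<in> carrier (obj F V) \<Longrightarrow> (s \<oplus>\<^bsub>hom_module R F G\<^esub> t) V x = s V x \<oplus>\<^bsub>obj G V\<^esub> t V x"
  "V \<in> fd \<Longrightarrow> x \<in> carrier (obj F V) \<Longrightarrow> (a \<odot>\<^bsub>hom_module R F G\<^esub> t) V x = a \<odot>\<^bsub>obj G V\<^esub> t V x"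
  by (simp_all add: hom_module_def)

context
  fixes F G :: "('f, 'u) vfunctor"
  assumes F: "is_functor R F" and G: "is_functor R G"
begin

lemma hom_zero_nt: "\<zero>\<^bsub>hom_module R F G\<^esub> \<in> nat_trans R F G"
proof (rule ntI)
  fix V :: "('f, 'u) module" assume V: "V \<in> fd"
  interpret F: Module.module R "obj F V" using V F by (simp add: fun_module)
  interpret G: Module.module R "obj G V" using V G by (simp add: fun_module)
  show "\<zero>\<^bsub>hom_module R F G\<^esub> V \<in> linear_maps R (obj F V) (obj G V)"
    by (rule linear_mapsI) (use V in \<open>auto simp: hom_module_def\<close>)
next
  fix V W :: "('f, 'u) module" and f x
  assume "V \<in> fd" "W \<in> fd" "f \<in> linear_maps R V W" "x \<in> carrier (obj F V)"
  then show "\<zero>\<^bsub>hom_module R F G\<^esub> W (mor F V W f x) = mor G V W f (\<zero>\<^bsub>hom_module R F G\<^esub> V x)"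
    by (simp add: fun_closed[OF F] lin_zero[OF fun_lin[OF G]] fun_module[OF G])
qed (simp add: hom_module_def)

lemma hom_add_nt:
  assumes s: "s \<in> nat_trans R F G" and t: "t \<in> nat_trans R F G"
  shows "s \<oplus>\<^bsub>hom_module R F G\<^esub> t \<in> nat_trans R F G"
proof (rule ntI)
  fix V :: "('f, 'u) module" assume V: "V \<in> fd"
  interpret F: Module.module R "obj F V" using V F by (simp add: fun_module)
  interpret G: Module.module R "obj G V" using V G by (simp add: fun_module)
  note [simp] = lin_add[OF nt_lin[OF s V]] lin_add[OF nt_lin[OF t V]] lin_smult[OF nt_lin[OF s V]]
     lin_smult[OF nt_lin[OF t V]] nt_closed[OF s V] nt_closed[OF t V] V
  show "(s \<oplus>\<^bsub>hom_module R F G\<^esub> t) V \<in> linear_maps R (obj F V) (obj G V)"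
    by (rule linear_mapsI) (auto simp: G.M.a_ac G.smult_r_distr, simp add: hom_module_def)
next
  fix V W :: "('f, 'u) module" and f x
  assume "V \<in> fd" "W \<in> fd" "f \<in> linear_maps R V W" "x \<in> carrier (obj F V)"
  then show "(s \<oplus>\<^bsub>hom_module R F G\<^esub> t) W (mor F V W f x) = mor G V W f ((s \<oplus>\<^bsub>hom_module R F G\<^esub> t) V x)"
    by (simp add: fun_closed[OF F] lin_add[OF fun_lin[OF G]] nt_nat[OF s] nt_nat[OF t]
        nt_closed[OF s] nt_closed[OF t])
qed (simp add: hom_module_def)

lemma hom_smult_nt:
  assumes a: "a \<in> carrier R" and t: "t \<in> nat_trans R F G"
  shows "a \<odot>\<^bsub>hom_module R F G\<^esub> t \<in> nat_trans R F G"
proof (rule ntI)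
  fix V :: "('f, 'u) module" assume V: "V \<in> fd"
  interpret F: Module.module R "obj F V" using V F by (simp add: fun_module)
  interpret G: Module.module R "obj G V" using V G by (simp add: fun_module)
  note [simp] = lin_add[OF nt_lin[OF t V]]
     lin_smult[OF nt_lin[OF t V]] nt_closed[OF t V] V a
  have *: "a \<odot>\<^bsub>obj G V\<^esub> (b \<odot>\<^bsub>obj G V\<^esub> x) = b \<odot>\<^bsub>obj G V\<^esub> (a \<odot>\<^bsub>obj G V\<^esub> x)"
    if "b \<in> carrier R" "x \<in> carrier (obj G V)" for b x
    using that by (simp add: G.smult_assoc1[symmetric] m_comm)
  show "(a \<odot>\<^bsub>hom_module R F G\<^esub> t) V \<in> linear_maps R (obj F V) (obj G V)"
    by (rule linear_mapsI) (auto simp: G.smult_r_distr *, simp add: hom_module_def)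
next
  fix V W :: "('f, 'u) module" and f x
  assume "V \<in> fd" "W \<in> fd" "f \<in> linear_maps R V W" "x \<in> carrier (obj F V)"
  then show "(a \<odot>\<^bsub>hom_module R F G\<^esub> t) W (mor F V W f x) = mor G V W f ((a \<odot>\<^bsub>hom_module R F G\<^esub> t) V x)"
    by (simp add: fun_closed[OF F] lin_smult[OF fun_lin[OF G]] nt_nat[OF t] nt_closed[OF t] a)
qed (simp add: hom_module_def)

lemma hom_module_is_module: "Module.module R (hom_module R F G)"
proof -
  let ?H = "hom_module R F G"
  have eqI: "s = t" if "s \<in> carrier ?H" "t \<in> carrier ?H"
    "\<And>V x. V \<in> fd \<Longrightarrow> x \<in> carrier (obj F V) \<Longrightarrow> s V x = t V x" for s t
    using nt_eqI that by (metis hom_module_simps(1))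
  have ag: "abelian_group (obj G V)" "abelian_monoid (obj G V)" if "V \<in> fd" for V
    using fun_module[OF G that] by (auto simp: Module.module_def abelian_group_def)
  show ?thesis
  proof (rule moduleI)
    show "cring R" by (rule is_cring)
    show "abelian_group ?H"
    proof (rule abelian_groupI)
      fix s assume s: "s \<in> carrier ?H"
      show "\<exists>t\<in>carrier ?H. t \<oplus>\<^bsub>?H\<^esub> s = \<zero>\<^bsub>?H\<^esub>"
      proof
        show t: "(\<ominus> \<one>) \<odot>\<^bsub>?H\<^esub> s \<in> carrier ?H" using hom_smult_nt s by simp
        show "(\<ominus> \<one>) \<odot>\<^bsub>?H\<^esub> s \<oplus>\<^bsub>?H\<^esub> s = \<zero>\<^bsub>?H\<^esub>"
        proof (rule eqI)
          fix V x assume V: "V \<in> fd" "x \<in> carrier (obj F V)"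
          interpret G: Module.module R "obj G V" using V G by (simp add: fun_module)
          show "((\<ominus> \<one>) \<odot>\<^bsub>?H\<^esub> s \<oplus>\<^bsub>?H\<^esub> s) V x = \<zero>\<^bsub>?H\<^esub> V x"
            using V s nt_closed[of s F G V x] by (simp add: G.smult_l_minus G.M.l_neg)
        qed (use hom_add_nt hom_zero_nt s t in auto)
      qed
    qed (auto intro!: eqI hom_add_nt hom_zero_nt simp: nt_closed
         abelian_monoid.a_assoc[OF ag(2)] abelian_monoid.a_comm[OF ag(2)] abelian_monoid.l_zero[OF ag(2)])
  qed (auto intro!: eqI hom_add_nt hom_smult_nt nt_closed
        simp: Module.module.smult_l_distr[OF fun_module[OF G]]
        Module.module.smult_r_distr[OF fun_module[OF G]] Module.module.smult_assoc1[OF fun_module[OF G]]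
        Module.module.smult_one[OF fun_module[OF G]] nt_closed)
qed

lemma hom_minus_nt: "s \<in> nat_trans R F G \<Longrightarrow> t \<in> nat_trans R F G \<Longrightarrow> s \<ominus>\<^bsub>hom_module R F G\<^esub> t \<in> nat_trans R F G"
proof -
  assume st: "s \<in> nat_trans R F G" "t \<in> nat_trans R F G"
  interpret H: Module.module R "hom_module R F G" by (rule hom_module_is_module)
  show ?thesis using H.M.minus_closed[of s t] st by simp
qed

lemma hom_minus_apply:
  assumes st: "s \<in> nat_trans R F G" "t \<in> nat_trans R F G" and V: "V \<in> fd" "x \<in> carrier (obj F V)"
  shows "(s \<ominus>\<^bsub>hom_module R F G\<^esub> t) V x = s V x \<ominus>\<^bsub>obj G V\<^esub> t V x"
proof -
  interpret H: Module.module R "hom_module R F G" by (rule hom_module_is_module)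
  have "s = (s \<ominus>\<^bsub>hom_module R F G\<^esub> t) \<oplus>\<^bsub>hom_module R F G\<^esub> t"
    using minus_add_cancel[OF hom_module_is_module, of s t] st by simp
  then have "s V x = (s \<ominus>\<^bsub>hom_module R F G\<^esub> t) V x \<oplus>\<^bsub>obj G V\<^esub> t V x"
    using V by (metis hom_module_simps(3))
  then show ?thesis
    using minus_eqI[OF fun_module[OF G V(1)]] nt_closed[OF _ V] st hom_minus_nt by metis
qed

end

subsection \<open>Subfunctors and quotient functors\<close>

lemma sub_functor_simps [simp]:
  "carrier (obj (sub_functor F D) V) = D V"
  "\<zero>\<^bsub>obj (sub_functor F D) V\<^esub> = \<zero>\<^bsub>obj F V\<^esub>"
  "x \<oplus>\<^bsub>obj (sub_functor F D) V\<^esub> y = x \<oplus>\<^bsub>obj F V\<^esub> y"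
  "a \<odot>\<^bsub>obj (sub_functor F D) V\<^esub> y = a \<odot>\<^bsub>obj F V\<^esub> y"
  "x \<in> D V \<Longrightarrow> mor (sub_functor F D) V W f x = mor F V W f x"
  by (simp_all add: sub_functor_def)

lemma subfunctor_subset: "is_functor R F \<Longrightarrow> is_subfunctor R F D \<Longrightarrow> V \<in> fd \<Longrightarrow> D V \<subseteq> carrier (obj F V)"
  using submodule_simps(1)[OF fun_module] by (auto simp: is_subfunctor_def)

lemma subfunctor_mor: "is_subfunctor R F D \<Longrightarrow> V \<in> fd \<Longrightarrow> W \<in> fd \<Longrightarrow> f \<in> linear_maps R V W \<Longrightarrow>
    x \<in> D V \<Longrightarrow> mor F V W f x \<in> D W"
  unfolding is_subfunctor_def image_subset_iff by blast

lemma sub_functor_functor: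
  assumes F: "is_functor R F" and D: "is_subfunctor R F D"
  shows "is_functor R (sub_functor F D)"
proof (rule is_functorI)
  fix V :: "('f, 'a) module" assume V: "V \<in> fd"
  have DV: "submodule (D V) R (obj F V)" using V D by (simp add: is_subfunctor_def)
  show "Module.module R (obj (sub_functor F D) V)"
    using submodule.submodule_is_module[OF DV fun_module[OF F V]] by (simp add: sub_functor_def)
  show "mor (sub_functor F D) V V (\<lambda>x\<in>carrier V. x) x = x" if "x \<in> carrier (obj (sub_functor F D) V)" for x
    using that V subfunctor_subset[OF F D V] by (auto simp: fun_id[OF F])
next
  fix V W :: "('f, 'a) module" and f assume VW: "V \<in> fd" "W \<in> fd" "f \<in> linear_maps R V W"
  note S = submodule_simps[OF fun_module[OF F VW(1)], of "D V"]
  have DV: "submodule (D V) R (obj F V)" using VW D by (simp add: is_subfunctor_def)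
  have im: "mor F V W f x \<in> D W" if "x \<in> D V" for x using subfunctor_mor[OF D VW that] .
  show "mor (sub_functor F D) V W f \<in> linear_maps R (obj (sub_functor F D) V) (obj (sub_functor F D) W)"
    by (rule linear_mapsI) (use S[OF DV] im in \<open>auto simp: lin_add[OF fun_lin[OF F VW]] lin_smult[OF fun_lin[OF F VW]] subset_iff,
       simp add: sub_functor_def\<close>)
next
  fix U V W :: "('f, 'a) module" and f g x
  assume *: "U \<in> fd" "V \<in> fd" "W \<in> fd" "f \<in> linear_maps R U V" "g \<in> linear_maps R V W"
    "x \<in> carrier (obj (sub_functor F D) U)"
  then have "mor F U V f x \<in> D V" by (simp add: subfunctor_mor[OF D])
  then show "mor (sub_functor F D) U W (compose (carrier U) g f) x =
      mor (sub_functor F D) V W g (mor (sub_functor F D) U V f x)"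
    using * subfunctor_subset[OF F D \<open>U \<in> fd\<close>] by (auto simp: fun_comp[OF F])
qed

lemma kernel_subfunctor:
  assumes F: "is_functor R F" and G: "is_functor R G" and t: "t \<in> nat_trans R F G"
  shows "is_subfunctor R F (\<lambda>V. {x \<in> carrier (obj F V). t V x = \<zero>\<^bsub>obj G V\<^esub>})"
  unfolding is_subfunctor_def
  by (auto simp: submodule_kernel nt_lin[OF t] fun_module F G fun_closed[OF F] nt_nat[OF t] lin_zero[OF fun_lin[OF G]])

lemma image_subfunctor:
  assumes F: "is_functor R F" and G: "is_functor R G" and t: "t \<in> nat_trans R F G"
  shows "is_subfunctor R G (\<lambda>V. t V ` carrier (obj F V))"
  unfolding is_subfunctor_def
  by (auto simp: submodule_image nt_lin[OF t] fun_module F G nt_nat[OF t, symmetric] fun_closed[OF F])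

text \<open>
  Transformations do not record their target, so the corestriction of \<open>t\<close> is
  \<open>t\<close> itself.
\<close>

lemma nt_into_sub:
  assumes t: "t \<in> nat_trans R F G" and D: "\<And>V x. V \<in> fd \<Longrightarrow> x \<in> carrier (obj F V) \<Longrightarrow> t V x \<in> D V"
  shows "t \<in> nat_trans R F (sub_functor G D)"
proof (rule ntI)
  fix V :: "('f, 'a) module" assume V: "V \<in> fd"
  show "t V \<in> linear_maps R (obj F V) (obj (sub_functor G D) V)"
    by (rule linear_mapsI) (auto simp: D V lin_add[OF nt_lin[OF t V]] lin_smult[OF nt_lin[OF t V]]
      intro: lin_ext[OF nt_lin[OF t V]])
qed (auto simp: nt_nat[OF t] D nt_ext[OF t])

lemma nt_from_sub:
  assumes t: "t \<in> nat_trans R F (sub_functor G D)" and G: "is_functor R G" and D: "is_subfunctor R G D"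
  shows "t \<in> nat_trans R F G"
proof (rule ntI)
  fix V :: "('f, 'a) module" assume V: "V \<in> fd"
  show "t V \<in> linear_maps R (obj F V) (obj G V)"
    using nt_closed[OF t V] subfunctor_subset[OF G D V]
    by (intro linear_mapsI) (auto simp: V lin_add[OF nt_lin[OF t V]] lin_smult[OF nt_lin[OF t V]]
      intro: lin_ext[OF nt_lin[OF t V]])
qed (use nt_closed[OF t] in \<open>auto simp: nt_nat[OF t] nt_ext[OF t]\<close>)

definition quot_trans :: "('f, 'u) vfunctor \<Rightarrow> (('f, 'u) module \<Rightarrow> 'u set) \<Rightarrow> ('f, 'u) transf" where
  "quot_trans F D = (\<lambda>V\<in>fd. restrict (quot_rep (obj F V) (D V)) (carrier (obj F V)))"

lemma quot_trans_apply [simp]: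
  "V \<in> fd \<Longrightarrow> x \<in> carrier (obj F V) \<Longrightarrow> quot_trans F D V x = quot_rep (obj F V) (D V) x"
  by (simp add: quot_trans_def)

context
  fixes F :: "('f, 'u) vfunctor" and D
  assumes F: "is_functor R F" and D: "is_subfunctor R F D"
begin

lemma quot_functor_sub: "V \<in> fd \<Longrightarrow> submodule (D V) R (obj F V)"
  using D by (simp add: is_subfunctor_def)

lemma obj_quot_functor [simp]: "obj (quot_functor F D) V = quot_module (obj F V) (D V)"
  by (simp add: quot_functor_def)

lemma mor_quot_functor:
  assumes "V \<in> fd" "W \<in> fd" "f \<in> linear_maps R V W"
  shows "mor (quot_functor F D) V W f \<in> linear_maps R (quot_module (obj F V) (D V)) (quot_module (obj F W) (D W))"
    and "x \<in> carrier (obj F V) \<Longrightarrow> mor (quot_functor F D) V W f (quot_rep (obj F V) (D V) x) =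
      quot_rep (obj F W) (D W) (mor F V W f x)"
proof -
  note V = fun_module[OF F assms(1)] quot_functor_sub[OF assms(1)]
  note W = fun_module[OF F assms(2)] quot_functor_sub[OF assms(2)]
  let ?Q = "quot_module (obj F W) (D W)"
  let ?t = "compose (carrier (obj F V)) (restrict (quot_rep (obj F W) (D W)) (carrier (obj F W))) (mor F V W f)"
  have t: "?t \<in> linear_maps R (obj F V) ?Q"
    by (rule lin_comp[OF fun_lin[OF F assms] quot_rep_linear[OF W] V(1)])
  have 0: "\<forall>x\<in>D V. ?t x = \<zero>\<^bsub>?Q\<^esub>"
  proof
    fix x assume x: "x \<in> D V"
    have "x \<in> carrier (obj F V)" "mor F V W f x \<in> D W"
      using submodule_simps(1)[OF V] x subfunctor_mor[OF D assms x] by auto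
    then show "?t x = \<zero>\<^bsub>?Q\<^esub>"
      using submodule_simps(1)[OF W] by (auto simp: compose_eq quot_rep_eq_zero_iff[OF W])
  qed
  note L = quot_lift_linear[OF V t quot_module_is_module[OF W] 0]
  have eq: "mor (quot_functor F D) V W f = restrict ?t (carrier (quot_module (obj F V) (D V)))"
    by (auto simp: quot_functor_def restrict_def fun_eq_iff compose_def quot_carrier_subset[OF V]
        fun_closed[OF F assms])
  show "mor (quot_functor F D) V W f \<in> linear_maps R (quot_module (obj F V) (D V)) ?Q"
    unfolding eq by (rule L(1))
  show "mor (quot_functor F D) V W f (quot_rep (obj F V) (D V) x) =
      quot_rep (obj F W) (D W) (mor F V W f x)" if "x \<in> carrier (obj F V)"
    unfolding eq using L(2)[OF that] that by (simp add: quot_carrier[OF V] compose_eq fun_closed[OF F assms])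
qed

lemma quot_functor_functor: "is_functor R (quot_functor F D)"
proof (rule is_functorI)
  fix V :: "('f, 'u) module" assume V: "V \<in> fd"
  show "Module.module R (obj (quot_functor F D) V)"
    using quot_module_is_module[OF fun_module[OF F V] quot_functor_sub[OF V]] by simp
  fix x assume "x \<in> carrier (obj (quot_functor F D) V)"
  then obtain y where "y \<in> carrier (obj F V)" "x = quot_rep (obj F V) (D V) y"
    by (auto simp: quot_carrier[OF fun_module[OF F V] quot_functor_sub[OF V]])
  then show "mor (quot_functor F D) V V (\<lambda>x\<in>carrier V. x) x = x"
    by (simp add: mor_quot_functor(2)[OF V V lin_id[OF fd_module[OF V]]] fun_id[OF F V])
next
  fix V W :: "('f, 'u) module" and f assume "V \<in> fd" "W \<in> fd" "f \<in> linear_maps R V W"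
  then show "mor (quot_functor F D) V W f \<in> linear_maps R (obj (quot_functor F D) V) (obj (quot_functor F D) W)"
    using mor_quot_functor(1) by simp
next
  fix U V W :: "('f, 'u) module" and f g x
  assume UVW: "U \<in> fd" "V \<in> fd" "W \<in> fd" and f: "f \<in> linear_maps R U V" and g: "g \<in> linear_maps R V W"
    and x: "x \<in> carrier (obj (quot_functor F D) U)"
  then obtain y where "y \<in> carrier (obj F U)" "x = quot_rep (obj F U) (D U) y"
    by (auto simp: quot_carrier[OF fun_module[OF F \<open>U \<in> fd\<close>] quot_functor_sub[OF \<open>U \<in> fd\<close>]])
  then show "mor (quot_functor F D) U W (compose (carrier U) g f) x =
      mor (quot_functor F D) V W g (mor (quot_functor F D) U V f x)"
    using UVW f g by (simp add: mor_quot_functor(2) lin_comp[OF f g] fd_module fun_closed[OF F] fun_comp[OF F])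
qed

lemma quot_trans_nt: "quot_trans F D \<in> nat_trans R F (quot_functor F D)"
  by (rule ntI)
    (auto simp: mor_quot_functor(2) fun_closed[OF F], auto simp: quot_trans_def quot_rep_linear fun_module[OF F] quot_functor_sub)

lemma quot_functor_elem:
  assumes "V \<in> fd" "x \<in> carrier (obj (quot_functor F D) V)"
  obtains y where "y \<in> carrier (obj F V)" "x = quot_trans F D V y"
  using assms by (auto simp: quot_carrier[OF fun_module[OF F] quot_functor_sub])

lemma quot_trans_zero_iff: "V \<in> fd \<Longrightarrow> x \<in> carrier (obj F V) \<Longrightarrow>
    quot_trans F D V x = \<zero>\<^bsub>obj (quot_functor F D) V\<^esub> \<longleftrightarrow> x \<in> D V"
  by (simp add: quot_rep_eq_zero_iff[OF fun_module[OF F] quot_functor_sub])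

text \<open>
  The universal property of the quotient functor.
\<close>

lemma quot_lift_nt:
  assumes G: "is_functor R G" and t: "t \<in> nat_trans R F G"
    and 0: "\<And>V. V \<in> fd \<Longrightarrow> \<forall>x\<in>D V. t V x = \<zero>\<^bsub>obj G V\<^esub>"
  obtains s where "s \<in> nat_trans R (quot_functor F D) G"
    "\<And>V x. V \<in> fd \<Longrightarrow> x \<in> carrier (obj F V) \<Longrightarrow> s V (quot_trans F D V x) = t V x"
proof
  let ?s = "\<lambda>V\<in>fd. restrict (t V) (carrier (obj (quot_functor F D) V))"
  note L = quot_lift_linear[OF fun_module[OF F] quot_functor_sub nt_lin[OF t] fun_module[OF G] 0]
  show *: "?s V (quot_trans F D V x) = t V x" if "V \<in> fd" "x \<in> carrier (obj F V)" for V x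
    using that nt_closed[OF quot_trans_nt that]
    by (simp add: L(2))
  show "?s \<in> nat_trans R (quot_functor F D) G"
  proof (rule ntI)
    fix V :: "('f, 'u) module" assume V: "V \<in> fd"
    show "?s V \<in> linear_maps R (obj (quot_functor F D) V) (obj G V)" using L(1) V by simp
  next
    fix V W :: "('f, 'u) module" and f x
    assume VW: "V \<in> fd" "W \<in> fd" "f \<in> linear_maps R V W" and x: "x \<in> carrier (obj (quot_functor F D) V)"
    obtain y where y: "y \<in> carrier (obj F V)" "x = quot_trans F D V y" using quot_functor_elem VW x by metis
    have "?s W (mor (quot_functor F D) V W f x) = ?s W (quot_trans F D W (mor F V W f y))"
      unfolding y(2) nt_nat[OF quot_trans_nt VW y(1)] by (rule refl)
    also have "\<dots> = t W (mor F V W f y)" by (rule *) (use VW y in \<open>auto simp: fun_closed[OF F]\<close>)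
    also have "\<dots> = mor G V W f (t V y)" by (rule nt_nat[OF t VW y(1)])
    also have "t V y = ?s V x" unfolding y(2) by (rule *[symmetric]) (use VW y in auto)
    finally show "?s W (mor (quot_functor F D) V W f x) = mor G V W f (?s V x)" .
  qed auto
qed

end

section \<open>Linear algebra\<close>

subsection \<open>Functionals and coordinates\<close>

definition scalars :: "('f, 'f) module" where
  "scalars = \<lparr>carrier = carrier R, mult = (\<otimes>), one = \<one>, zero = \<zero>, add = (\<oplus>), smult = (\<otimes>)\<rparr>"

lemma scalars_simps [simp]:
  "carrier scalars = carrier R" "\<zero>\<^bsub>scalars\<^esub> = \<zero>" "x \<oplus>\<^bsub>scalars\<^esub> y = x \<oplus> y" "a \<odot>\<^bsub>scalars\<^esub> x = a \<otimes> x"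
  by (simp_all add: scalars_def)

lemma scalars_module: "Module.module R scalars"
proof (rule moduleI)
  show "abelian_group scalars"
    by (rule abelian_groupI) (auto simp: a_ac intro: bexI[of _ "\<ominus> x" for x] l_neg)
qed (auto simp: is_cring l_distr r_distr m_assoc)

lemma smult_linear:
  assumes M: "Module.module R M" and x: "x \<in> carrier M" and \<eta>: "\<eta> \<in> linear_maps R N scalars" and N: "Module.module R N"
  shows "(\<lambda>y\<in>carrier N. \<eta> y \<odot>\<^bsub>M\<^esub> x) \<in> linear_maps R N M"
proof -
  interpret M: Module.module R M by fact
  interpret N: Module.module R N by fact
  note [simp] = lin_closed[OF \<eta>, simplified] lin_add[OF \<eta>] lin_smult[OF \<eta>]
  show ?thesis by (rule linear_mapsI) (use x in \<open>auto simp: M.smult_l_distr M.smult_assoc1\<close>)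
qed

lemma lin_sum:
  assumes f: "f \<in> linear_maps R M N" and g: "g \<in> linear_maps R M N" and M: "Module.module R M" and N: "Module.module R N"
  shows "(\<lambda>x\<in>carrier M. f x \<oplus>\<^bsub>N\<^esub> g x) \<in> linear_maps R M N"
proof -
  interpret M: Module.module R M by fact
  interpret N: Module.module R N by fact
  note [simp] = lin_closed[OF f] lin_closed[OF g] lin_add[OF f] lin_add[OF g] lin_smult[OF f] lin_smult[OF g]
  show ?thesis
    by (rule linear_mapsI) (auto simp: N.smult_r_distr N.M.a_ac)
qed

lemma submodule_add_line:
  assumes M: "Module.module R M" and K: "submodule K R M" and x: "x \<in> carrier M"
  shows "submodule {k \<oplus>\<^bsub>M\<^esub> a \<odot>\<^bsub>M\<^esub> x | k a. k \<in> K \<and> a \<in> carrier R} R M"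
proof -
  interpret M: Module.module R M by fact
  note KM = submodule_simps[OF M K]
  have c: "k \<in> carrier M" if "k \<in> K" for k using KM(1) that by auto
  show ?thesis
  proof (rule submoduleI'[OF M])
    show "{k \<oplus>\<^bsub>M\<^esub> a \<odot>\<^bsub>M\<^esub> x | k a. k \<in> K \<and> a \<in> carrier R} \<subseteq> carrier M" using c x by auto
    have "\<zero>\<^bsub>M\<^esub> = \<zero>\<^bsub>M\<^esub> \<oplus>\<^bsub>M\<^esub> \<zero> \<odot>\<^bsub>M\<^esub> x" using x by simp
    then show "\<zero>\<^bsub>M\<^esub> \<in> {k \<oplus>\<^bsub>M\<^esub> a \<odot>\<^bsub>M\<^esub> x | k a. k \<in> K \<and> a \<in> carrier R}" using KM(2) by blast
  next
    fix y z assume "y \<in> {k \<oplus>\<^bsub>M\<^esub> a \<odot>\<^bsub>M\<^esub> x | k a. k \<in> K \<and> a \<in> carrier R}"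
      "z \<in> {k \<oplus>\<^bsub>M\<^esub> a \<odot>\<^bsub>M\<^esub> x | k a. k \<in> K \<and> a \<in> carrier R}"
    then obtain k a l b where *: "k \<in> K" "l \<in> K" "a \<in> carrier R" "b \<in> carrier R"
      "y = k \<oplus>\<^bsub>M\<^esub> a \<odot>\<^bsub>M\<^esub> x" "z = l \<oplus>\<^bsub>M\<^esub> b \<odot>\<^bsub>M\<^esub> x" by blast
    then have "y \<oplus>\<^bsub>M\<^esub> z = (k \<oplus>\<^bsub>M\<^esub> l) \<oplus>\<^bsub>M\<^esub> (a \<oplus> b) \<odot>\<^bsub>M\<^esub> x"
      using x c by (simp add: M.smult_l_distr M.M.a_ac)
    then show "y \<oplus>\<^bsub>M\<^esub> z \<in> {k \<oplus>\<^bsub>M\<^esub> a \<odot>\<^bsub>M\<^esub> x | k a. k \<in> K \<and> a \<in> carrier R}" using * KM(3) by blast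
  next
    fix r y assume r: "r \<in> carrier R" and "y \<in> {k \<oplus>\<^bsub>M\<^esub> a \<odot>\<^bsub>M\<^esub> x | k a. k \<in> K \<and> a \<in> carrier R}"
    then obtain k a where *: "k \<in> K" "a \<in> carrier R" "y = k \<oplus>\<^bsub>M\<^esub> a \<odot>\<^bsub>M\<^esub> x" by blast
    then have "r \<odot>\<^bsub>M\<^esub> y = r \<odot>\<^bsub>M\<^esub> k \<oplus>\<^bsub>M\<^esub> (r \<otimes> a) \<odot>\<^bsub>M\<^esub> x"
      using x c r by (simp add: M.smult_r_distr M.smult_assoc1)
    then show "r \<odot>\<^bsub>M\<^esub> y \<in> {k \<oplus>\<^bsub>M\<^esub> a \<odot>\<^bsub>M\<^esub> x | k a. k \<in> K \<and> a \<in> carrier R}" using * KM(4) r by blast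
  qed
qed

text \<open>
  By Zorn's lemma there is a maximal submodule \<open>K\<close> that avoids \<open>u\<close>.
  Maximality makes it a complement of the line through \<open>u\<close>, and the functional reads
  off the coefficient of \<open>u\<close>.
\<close>

lemma functional_exists:
  assumes M: "Module.module R M" and u: "u \<in> carrier M" "u \<noteq> \<zero>\<^bsub>M\<^esub>"
  obtains \<xi> where "\<xi> \<in> linear_maps R M scalars" "\<xi> u = \<one>"
proof -
  interpret M: Module.module R M by fact
  define A where "A = {K. submodule K R M \<and> u \<notin> K}"
  have "submodule {\<zero>\<^bsub>M\<^esub>} R M" by (rule submoduleI'[OF M]) auto
  then have "{\<zero>\<^bsub>M\<^esub>} \<in> A" using u by (simp add: A_def)
  then have "A \<noteq> {}" by blast
  moreover have "\<Union>C \<in> A" if C: "C \<noteq> {}" "subset.chain A C" for C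
  proof -
    have CA: "\<And>K. K \<in> C \<Longrightarrow> submodule K R M \<and> u \<notin> K" and lin: "\<And>K L. K \<in> C \<Longrightarrow> L \<in> C \<Longrightarrow> K \<subseteq> L \<or> L \<subseteq> K"
      using C(2) unfolding subset_chain_def A_def by auto
    have "submodule (\<Union>C) R M"
    proof (rule submoduleI'[OF M])
      show "\<Union>C \<subseteq> carrier M" using CA submodule_simps(1)[OF M] by blast
      show "\<zero>\<^bsub>M\<^esub> \<in> \<Union>C" using CA submodule_simps(2)[OF M] C(1) by blast
      show "x \<oplus>\<^bsub>M\<^esub> y \<in> \<Union>C" if xy: "x \<in> \<Union>C" "y \<in> \<Union>C" for x y
      proof -
        obtain K L where KL: "K \<in> C" "L \<in> C" "x \<in> K" "y \<in> L" using xy by blast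
        with lin obtain N where "N \<in> C" "x \<in> N" "y \<in> N" by blast
        then show ?thesis using CA submodule_simps(3)[OF M] by blast
      qed
      show "a \<odot>\<^bsub>M\<^esub> x \<in> \<Union>C" if "a \<in> carrier R" "x \<in> \<Union>C" for a x
        using that CA submodule_simps(4)[OF M] by blast
    qed
    then show ?thesis using CA by (auto simp: A_def)
  qed
  ultimately obtain K where K: "K \<in> A" and max: "\<And>L. L \<in> A \<Longrightarrow> K \<subseteq> L \<Longrightarrow> L = K"
    using subset_Zorn_nonempty[of A] by blast
  have KM: "submodule K R M" and uK: "u \<notin> K" using K by (auto simp: A_def)
  note KS = submodule_simps[OF M KM]
  have Kc: "k \<in> carrier M" if "k \<in> K" for k using KS(1) that by auto
  have ex: "\<exists>a\<in>carrier R. \<exists>k\<in>K. x = k \<oplus>\<^bsub>M\<^esub> a \<odot>\<^bsub>M\<^esub> u" if x: "x \<in> carrier M" for x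
  proof (cases "x \<in> K")
    case True
    then show ?thesis using u x by (intro bexI[of _ \<zero>] bexI[of _ x]) auto
  next
    case False
    let ?L = "{k \<oplus>\<^bsub>M\<^esub> a \<odot>\<^bsub>M\<^esub> x | k a. k \<in> K \<and> a \<in> carrier R}"
    have "k = k \<oplus>\<^bsub>M\<^esub> \<zero> \<odot>\<^bsub>M\<^esub> x" if "k \<in> K" for k using Kc[OF that] x by simp
    then have "K \<subseteq> ?L" by blast
    moreover have "x = \<zero>\<^bsub>M\<^esub> \<oplus>\<^bsub>M\<^esub> \<one> \<odot>\<^bsub>M\<^esub> x" using x by simp
    then have "x \<in> ?L" using KS(2) by blast
    ultimately have "?L \<notin> A" using max False by blast
    then have "u \<in> ?L" using submodule_add_line[OF M KM x] unfolding A_def by blast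
    then obtain k a where ka: "k \<in> K" "a \<in> carrier R" "u = k \<oplus>\<^bsub>M\<^esub> a \<odot>\<^bsub>M\<^esub> x" by blast
    have "a \<noteq> \<zero>" using ka uK x Kc[OF ka(1)] by auto
    then have a: "inv a \<in> carrier R" "inv a \<otimes> a = \<one>" using ka(2) field_Units by auto
    have "inv a \<odot>\<^bsub>M\<^esub> u = inv a \<odot>\<^bsub>M\<^esub> k \<oplus>\<^bsub>M\<^esub> x"
      unfolding ka(3) using a ka x Kc[OF ka(1)]
      by (simp add: M.smult_r_distr M.smult_assoc1[symmetric])
    then have "x = (\<ominus>\<^bsub>M\<^esub> (inv a \<odot>\<^bsub>M\<^esub> k)) \<oplus>\<^bsub>M\<^esub> inv a \<odot>\<^bsub>M\<^esub> u"
      using a x Kc[OF ka(1)] by (simp add: M.M.a_assoc[symmetric] M.M.l_neg)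
    moreover have "\<ominus>\<^bsub>M\<^esub> (inv a \<odot>\<^bsub>M\<^esub> k) \<in> K" by (intro KS a ka)
    ultimately show ?thesis using a by blast
  qed
  have uniq: "a = b" if ab: "a \<in> carrier R" "b \<in> carrier R" "k \<in> K" "l \<in> K"
      and eq: "k \<oplus>\<^bsub>M\<^esub> a \<odot>\<^bsub>M\<^esub> u = l \<oplus>\<^bsub>M\<^esub> b \<odot>\<^bsub>M\<^esub> u" for a b k l
  proof (rule ccontr)
    assume ne: "a \<noteq> b"
    define c where "c = a \<ominus> b"
    have ac: "a = c \<oplus> b" using ab by (simp add: c_def a_minus_def a_assoc l_neg)
    then have "c \<noteq> \<zero>" using ne ab by auto
    then have c: "c \<in> carrier R" "inv c \<in> carrier R" "inv c \<otimes> c = \<one>" using ab field_Units by (auto simp: c_def)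
    have "(k \<oplus>\<^bsub>M\<^esub> c \<odot>\<^bsub>M\<^esub> u) \<oplus>\<^bsub>M\<^esub> b \<odot>\<^bsub>M\<^esub> u = l \<oplus>\<^bsub>M\<^esub> b \<odot>\<^bsub>M\<^esub> u"
      using eq ab c u Kc by (simp add: ac M.smult_l_distr M.M.a_assoc)
    then have "k \<oplus>\<^bsub>M\<^esub> c \<odot>\<^bsub>M\<^esub> u = l"
      using ab c u Kc by simp
    then have "c \<odot>\<^bsub>M\<^esub> u = \<ominus>\<^bsub>M\<^esub> k \<oplus>\<^bsub>M\<^esub> l"
      using ab c u Kc[OF ab(3)] by (auto simp: M.M.a_assoc[symmetric] M.M.l_neg)
    then have "c \<odot>\<^bsub>M\<^esub> u \<in> K" using KS(3)[OF KS(5)[OF ab(3)] ab(4)] by simp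
    then have "inv c \<odot>\<^bsub>M\<^esub> (c \<odot>\<^bsub>M\<^esub> u) \<in> K" using c KS(4) by blast
    then show False using c u uK by (simp add: M.smult_assoc1[symmetric])
  qed
  define \<xi> where "\<xi> = (\<lambda>x\<in>carrier M. THE a. a \<in> carrier R \<and> (\<exists>k\<in>K. x = k \<oplus>\<^bsub>M\<^esub> a \<odot>\<^bsub>M\<^esub> u))"
  have \<xi>: "\<xi> x = a" if "a \<in> carrier R" "k \<in> K" "x = k \<oplus>\<^bsub>M\<^esub> a \<odot>\<^bsub>M\<^esub> u" for x a k
  proof -
    have "x \<in> carrier M" using that Kc u by auto
    then show ?thesis unfolding \<xi>_def using that uniq by (auto intro!: the_equality)
  qed
  show ?thesis
  proof
    show "\<xi> \<in> linear_maps R M scalars"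
    proof (rule linear_mapsI)
      fix x assume "x \<in> carrier M"
      then show "\<xi> x \<in> carrier scalars" using ex \<xi> by fastforce
    next
      fix x y assume "x \<in> carrier M" "y \<in> carrier M"
      then obtain a k b l where *: "a \<in> carrier R" "k \<in> K" "x = k \<oplus>\<^bsub>M\<^esub> a \<odot>\<^bsub>M\<^esub> u"
        "b \<in> carrier R" "l \<in> K" "y = l \<oplus>\<^bsub>M\<^esub> b \<odot>\<^bsub>M\<^esub> u" using ex by metis
      then have "x \<oplus>\<^bsub>M\<^esub> y = (k \<oplus>\<^bsub>M\<^esub> l) \<oplus>\<^bsub>M\<^esub> (a \<oplus> b) \<odot>\<^bsub>M\<^esub> u"
        using u Kc by (simp add: M.smult_l_distr M.M.a_ac)
      then have "\<xi> (x \<oplus>\<^bsub>M\<^esub> y) = a \<oplus> b" using * by (intro \<xi>[OF _ KS(3)]) auto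
      then show "\<xi> (x \<oplus>\<^bsub>M\<^esub> y) = \<xi> x \<oplus>\<^bsub>scalars\<^esub> \<xi> y"
        using \<xi>[OF *(1-3)] \<xi>[OF *(4-6)] by simp
    next
      fix r x assume r: "r \<in> carrier R" and "x \<in> carrier M"
      then obtain a k where *: "a \<in> carrier R" "k \<in> K" "x = k \<oplus>\<^bsub>M\<^esub> a \<odot>\<^bsub>M\<^esub> u" using ex by metis
      then have "r \<odot>\<^bsub>M\<^esub> x = (r \<odot>\<^bsub>M\<^esub> k) \<oplus>\<^bsub>M\<^esub> (r \<otimes> a) \<odot>\<^bsub>M\<^esub> u"
        using u Kc r by (simp add: M.smult_r_distr M.smult_assoc1)
      then have "\<xi> (r \<odot>\<^bsub>M\<^esub> x) = r \<otimes> a" using * r by (intro \<xi>[OF _ KS(4)]) auto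
      then show "\<xi> (r \<odot>\<^bsub>M\<^esub> x) = r \<odot>\<^bsub>scalars\<^esub> \<xi> x" using \<xi>[OF *] by simp
    qed (simp add: \<xi>_def)
    show "\<xi> u = \<one>" by (rule \<xi>[OF _ KS(2)]) (use u in auto)
  qed
qed

text \<open>
  Coordinates are found by splitting off lines: if \<open>\<xi> u = 1\<close>, then \<open>x -
  \<xi>(x) u\<close> lies in the smaller submodule on which \<open>\<xi>\<close> vanishes, and
  \<open>\<xi>\<close> and \<open>u\<close> become the last coordinate.
\<close>

lemma coordinates_submodule:
  fixes V :: "('f, 'u) module"
  assumes V: "V \<in> fd"
  shows "submodule N R V \<Longrightarrow> \<exists>n b \<eta>. (\<forall>j<n. b j \<in> carrier V \<and> \<eta> j \<in> linear_maps R V scalars) \<and>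
    (\<forall>x\<in>N. x = (\<Oplus>\<^bsub>V\<^esub>j\<in>{..<n::nat}. \<eta> j x \<odot>\<^bsub>V\<^esub> b j))"
proof (induction "card N" arbitrary: N rule: less_induct)
  case less
  have VM: "Module.module R V" by (rule fd_module[OF V])
  interpret V: Module.module R V by (rule VM)
  note NS = submodule_simps[OF VM less.prems]
  have finN: "finite N" using V NS(1) by (auto simp: fd_iff_finite intro: finite_subset)
  show ?case
  proof (cases "N = {\<zero>\<^bsub>V\<^esub>}")
    case True
    then show ?thesis by (intro exI[of _ 0]) auto
  next
    case False
    then obtain u where u: "u \<in> N" "u \<noteq> \<zero>\<^bsub>V\<^esub>" using NS(2) by blast
    then have uV: "u \<in> carrier V" using NS(1) by auto
    obtain \<xi> where \<xi>: "\<xi> \<in> linear_maps R V scalars" "\<xi> u = \<one>" using functional_exists[OF VM uV u(2)] .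
    note [simp] = lin_closed[OF \<xi>(1), simplified]
    define N' where "N' = {x \<in> N. \<xi> x = \<zero>}"
    have "submodule N' R V"
      by (rule submoduleI'[OF VM])
        (use NS in \<open>auto simp: N'_def lin_zero[OF \<xi>(1) VM scalars_module] lin_add[OF \<xi>(1)] lin_smult[OF \<xi>(1)] subset_iff\<close>)
    moreover have "u \<notin> N'" using \<xi> by (simp add: N'_def)
    then have "N' \<subset> N" using u by (auto simp: N'_def)
    then have "card N' < card N" using finN by (simp add: psubset_card_mono)
    ultimately obtain n b \<eta> where IH: "\<And>j. j < n \<Longrightarrow> b j \<in> carrier V \<and> \<eta> j \<in> linear_maps R V scalars"
      "\<And>x. x \<in> N' \<Longrightarrow> x = (\<Oplus>\<^bsub>V\<^esub>j\<in>{..<n::nat}. \<eta> j x \<odot>\<^bsub>V\<^esub> b j)"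
      using less.hyps[of N'] by blast
    define q where "q = (\<lambda>x\<in>carrier V. (\<lambda>x\<in>carrier V. x) x \<ominus>\<^bsub>V\<^esub> (\<lambda>x\<in>carrier V. \<xi> x \<odot>\<^bsub>V\<^esub> u) x)"
    have q: "q \<in> linear_maps R V V"
      unfolding q_def by (rule lin_restrict_minus[OF lin_id smult_linear]) (auto simp: VM uV \<xi>)
    have q_eq: "q x = x \<ominus>\<^bsub>V\<^esub> \<xi> x \<odot>\<^bsub>V\<^esub> u" if "x \<in> carrier V" for x using that by (simp add: q_def)
    have qN: "q x \<in> N'" if "x \<in> N" for x
    proof -
      have x: "x \<in> carrier V" using that NS(1) by auto
      have "\<xi> (q x) = \<xi> x \<ominus>\<^bsub>scalars\<^esub> \<xi> (\<xi> x \<odot>\<^bsub>V\<^esub> u)"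
        unfolding q_eq[OF x] by (rule lin_minus[OF \<xi>(1) VM scalars_module]) (use x uV in auto)
      also have "\<dots> = \<zero>" using x uV \<xi> minus_eq_zero_iff[OF scalars_module]
        by (simp add: lin_smult[OF \<xi>(1)])
      finally show ?thesis using that x u NS by (simp add: N'_def q_eq)
    qed
    define b' where "b' j = (if j = n then u else b j)" for j
    define \<eta>' where "\<eta>' j = (if j = n then \<xi> else compose (carrier V) (\<eta> j) q)" for j
    have "\<eta>' j \<in> linear_maps R V scalars" if "j < Suc n" for j
      using that IH(1)[of j] lin_comp[OF q _ VM] \<xi>(1) by (auto simp: \<eta>'_def less_Suc_eq)
    moreover have "b' j \<in> carrier V" if "j < Suc n" for j
      using that IH(1)[of j] uV by (auto simp: b'_def less_Suc_eq)
    moreover have "x = (\<Oplus>\<^bsub>V\<^esub>j\<in>{..<Suc n}. \<eta>' j x \<odot>\<^bsub>V\<^esub> b' j)" if xN: "x \<in> N" for x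
    proof -
      have x: "x \<in> carrier V" using xN NS(1) by auto
      have qx: "q x \<in> carrier V" using lin_closed[OF q x] .
      have cl: "\<eta> j (q x) \<odot>\<^bsub>V\<^esub> b j \<in> carrier V" if "j < n" for j
        using IH(1)[OF that] lin_closed[of "\<eta> j" V scalars "q x"] qx by auto
      have "(\<Oplus>\<^bsub>V\<^esub>j\<in>{..<n}. \<eta>' j x \<odot>\<^bsub>V\<^esub> b' j) = (\<Oplus>\<^bsub>V\<^esub>j\<in>{..<n}. \<eta> j (q x) \<odot>\<^bsub>V\<^esub> b j)"
        by (rule V.M.finsum_cong') (use cl x in \<open>auto simp: \<eta>'_def b'_def compose_eq\<close>)
      also have "\<dots> = q x" using IH(2)[OF qN[OF xN]] by simp
      finally have *: "(\<Oplus>\<^bsub>V\<^esub>j\<in>{..<n}. \<eta>' j x \<odot>\<^bsub>V\<^esub> b' j) = q x" .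
      have "(\<Oplus>\<^bsub>V\<^esub>j\<in>{..<Suc n}. \<eta>' j x \<odot>\<^bsub>V\<^esub> b' j) = (\<eta>' n x \<odot>\<^bsub>V\<^esub> b' n) \<oplus>\<^bsub>V\<^esub> (\<Oplus>\<^bsub>V\<^esub>j\<in>{..<n}. \<eta>' j x \<odot>\<^bsub>V\<^esub> b' j)"
        unfolding lessThan_Suc
        by (rule V.M.finsum_insert) (use cl x uV in \<open>auto simp: \<eta>'_def b'_def compose_eq\<close>)
      also have "\<dots> = \<xi> x \<odot>\<^bsub>V\<^esub> u \<oplus>\<^bsub>V\<^esub> q x" unfolding * by (simp add: \<eta>'_def b'_def)
      also have "\<dots> = x" using minus_add_cancel[OF VM x, of "\<xi> x \<odot>\<^bsub>V\<^esub> u"] x uV qx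
        by (simp add: q_eq V.M.a_comm)
      finally show ?thesis by simp
    qed
    ultimately show ?thesis by (intro exI[of _ "Suc n"] exI[of _ b'] exI[of _ \<eta>']) auto
  qed
qed

lemma coordinates_exist:
  fixes V :: "('f, 'u) module"
  assumes V: "V \<in> fd"
  obtains n :: nat and b \<eta> where "\<And>j. j < n \<Longrightarrow> b j \<in> carrier V" "\<And>j. j < n \<Longrightarrow> \<eta> j \<in> linear_maps R V scalars"
    "\<And>x. x \<in> carrier V \<Longrightarrow> x = (\<Oplus>\<^bsub>V\<^esub>j\<in>{..<n}. \<eta> j x \<odot>\<^bsub>V\<^esub> b j)"
  using coordinates_submodule[OF V Module.module.carrier_is_submodule[OF fd_module[OF V]]] by metis

subsection \<open>Direct sums\<close>

text \<open>
  Moves a module along a coding into the universe.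
\<close>

lemma transport_module:
  assumes M: "Module.module R M"
    and N: "carrier N = k ` carrier M" "\<zero>\<^bsub>N\<^esub> = k \<zero>\<^bsub>M\<^esub>"
    and add: "\<And>x y. x \<in> carrier M \<Longrightarrow> y \<in> carrier M \<Longrightarrow> k x \<oplus>\<^bsub>N\<^esub> k y = k (x \<oplus>\<^bsub>M\<^esub> y)"
    and smult: "\<And>a x. a \<in> carrier R \<Longrightarrow> x \<in> carrier M \<Longrightarrow> a \<odot>\<^bsub>N\<^esub> k x = k (a \<odot>\<^bsub>M\<^esub> x)"
  shows "Module.module R N"
proof -
  interpret M: Module.module R M by fact
  show ?thesis
  proof (rule moduleI)
    show "abelian_group N"
    proof (rule abelian_groupI)
      fix x assume "x \<in> carrier N"
      then obtain y where y: "y \<in> carrier M" "x = k y" using N by auto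
      then show "\<exists>y\<in>carrier N. y \<oplus>\<^bsub>N\<^esub> x = \<zero>\<^bsub>N\<^esub>"
        using N add by (intro bexI[of _ "k (\<ominus>\<^bsub>M\<^esub> y)"]) (auto simp: M.M.l_neg)
    qed (auto simp: N add M.M.a_ac)
  qed (auto simp: N add smult is_cring M.smult_l_distr M.smult_r_distr M.smult_assoc1)
qed

definition prod_module :: "('f, 'a) module \<Rightarrow> ('f, 'b) module \<Rightarrow> ('f, 'a \<times> 'b) module" where
  "prod_module M N = \<lparr>carrier = carrier M \<times> carrier N, mult = undefined, one = undefined,
     zero = (\<zero>\<^bsub>M\<^esub>, \<zero>\<^bsub>N\<^esub>), add = (\<lambda>p q. (fst p \<oplus>\<^bsub>M\<^esub> fst q, snd p \<oplus>\<^bsub>N\<^esub> snd q)),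
     smult = (\<lambda>a p. (a \<odot>\<^bsub>M\<^esub> fst p, a \<odot>\<^bsub>N\<^esub> snd p))\<rparr>"

lemma prod_module_simps [simp]:
  "carrier (prod_module M N) = carrier M \<times> carrier N"
  "\<zero>\<^bsub>prod_module M N\<^esub> = (\<zero>\<^bsub>M\<^esub>, \<zero>\<^bsub>N\<^esub>)"
  "(x, y) \<oplus>\<^bsub>prod_module M N\<^esub> (x', y') = (x \<oplus>\<^bsub>M\<^esub> x', y \<oplus>\<^bsub>N\<^esub> y')"
  "a \<odot>\<^bsub>prod_module M N\<^esub> (x, y) = (a \<odot>\<^bsub>M\<^esub> x, a \<odot>\<^bsub>N\<^esub> y)"
  by (simp_all add: prod_module_def)

lemma prod_module_is_module:
  assumes M: "Module.module R M" and N: "Module.module R N"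
  shows "Module.module R (prod_module M N)"
proof -
  interpret M: Module.module R M by fact
  interpret N: Module.module R N by fact
  show ?thesis
  proof (rule moduleI)
    show "abelian_group (prod_module M N)"
    proof (rule abelian_groupI)
      fix p assume "p \<in> carrier (prod_module M N)"
      then show "\<exists>q\<in>carrier (prod_module M N). q \<oplus>\<^bsub>prod_module M N\<^esub> p = \<zero>\<^bsub>prod_module M N\<^esub>"
        by (intro bexI[of _ "(\<ominus>\<^bsub>M\<^esub> fst p, \<ominus>\<^bsub>N\<^esub> snd p)"]) (auto simp: M.M.l_neg N.M.l_neg)
    qed (auto simp: M.M.a_ac N.M.a_ac)
  qed (auto simp: is_cring M.smult_l_distr M.smult_r_distr M.smult_assoc1 N.smult_l_distr N.smult_r_distr N.smult_assoc1)
qed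

subsection \<open>Adding a line\<close>

lemma pair_code_inj: "inj_on (pair_code R :: 'u :: infinite \<times> 'f \<Rightarrow> 'u) (UNIV \<times> carrier R)"
proof -
  have "codable TYPE('u) ((UNIV :: 'u set) \<times> carrier R)"
    by (intro codable_Times codable_UNIV codable_finite finite_scalars)
  then have "\<exists>e :: 'u \<times> 'f \<Rightarrow> 'u. inj_on e (UNIV \<times> carrier R)" by (simp add: codable_def)
  then show ?thesis unfolding pair_code_def by (rule someI_ex)
qed

lemma pair_decode_code [simp]: "r \<in> carrier R \<Longrightarrow> pair_decode R (pair_code R (x :: 'u :: infinite, r)) = (x, r)"
  unfolding pair_decode_def by (rule inv_into_f_f[OF pair_code_inj]) simp

lemma plus_line_carrier: "carrier (plus_line_space R V) = pair_code R ` (carrier V \<times> carrier R)"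
  by (simp add: plus_line_space_def)

lemma plus_line_simps [simp]:
  fixes V :: "('f, 'u :: infinite) module"
  shows "\<zero>\<^bsub>plus_line_space R V\<^esub> = pair_code R (\<zero>\<^bsub>V\<^esub>, \<zero>)"
    "r \<in> carrier R \<Longrightarrow> s \<in> carrier R \<Longrightarrow>
      pair_code R (x, r) \<oplus>\<^bsub>plus_line_space R V\<^esub> pair_code R (y, s) = pair_code R (x \<oplus>\<^bsub>V\<^esub> y, r \<oplus> s)"
    "r \<in> carrier R \<Longrightarrow> a \<odot>\<^bsub>plus_line_space R V\<^esub> pair_code R (x, r) = pair_code R (a \<odot>\<^bsub>V\<^esub> x, a \<otimes> r)"
  by (simp_all add: plus_line_space_def)

lemma plus_line_elem [simp]:
  fixes V :: "('f, 'u :: infinite) module"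
  shows "r \<in> carrier R \<Longrightarrow> pair_code R (x, r) \<in> carrier (plus_line_space R V) \<longleftrightarrow> x \<in> carrier V"
  unfolding plus_line_carrier using pair_code_inj by (fastforce simp: inj_on_def)

lemma plus_line_cases:
  fixes V :: "('f, 'u :: infinite) module"
  assumes "z \<in> carrier (plus_line_space R V)"
  obtains x r where "x \<in> carrier V" "r \<in> carrier R" "z = pair_code R (x, r)"
  using assms unfolding plus_line_carrier by blast

lemma plus_line_fd:
  fixes V :: "('f, 'u :: infinite) module"
  assumes V: "V \<in> fd"
  shows "plus_line_space R V \<in> fd"
proof -
  have "Module.module R (plus_line_space R V)"
    by (rule transport_module[OF prod_module_is_module[OF fd_module[OF V] scalars_module], where k="pair_code R"])
      (auto simp: plus_line_carrier)
  then show ?thesis using V finite_scalars by (simp add: fd_iff_finite plus_line_carrier)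
qed

text \<open>
  Elements of \<open>V \<oplus> R\<close> are codes of pairs; this reduces linearity of a map on
  codes to linearity of its formula in terms of pairs.
\<close>

lemma line_linearI:
  fixes V :: "('f, 'u :: infinite) module"
  assumes V: "V \<in> fd"
    and closed: "\<And>x r. x \<in> carrier V \<Longrightarrow> r \<in> carrier R \<Longrightarrow> F x r \<in> carrier M"
    and add: "\<And>x r y s. x \<in> carrier V \<Longrightarrow> r \<in> carrier R \<Longrightarrow> y \<in> carrier V \<Longrightarrow> s \<in> carrier R \<Longrightarrow>
      F (x \<oplus>\<^bsub>V\<^esub> y) (r \<oplus> s) = F x r \<oplus>\<^bsub>M\<^esub> F y s"
    and smult: "\<And>a x r. a \<in> carrier R \<Longrightarrow> x \<in> carrier V \<Longrightarrow> r \<in> carrier R \<Longrightarrow>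
      F (a \<odot>\<^bsub>V\<^esub> x) (a \<otimes> r) = a \<odot>\<^bsub>M\<^esub> F x r"
  shows "(\<lambda>z\<in>carrier (plus_line_space R V). F (fst (pair_decode R z)) (snd (pair_decode R z)))
     \<in> linear_maps R (plus_line_space R V) M" (is "?f \<in> _")
proof -
  interpret V: Module.module R V by (rule fd_module[OF V])
  have f: "?f (pair_code R (x, r)) = F x r" if "x \<in> carrier V" "r \<in> carrier R" for x r
    using that by simp
  show ?thesis
  proof (rule linear_mapsI)
    fix z assume "z \<in> carrier (plus_line_space R V)"
    then obtain x r where "x \<in> carrier V" "r \<in> carrier R" "z = pair_code R (x, r)" by (rule plus_line_cases)
    then show "?f z \<in> carrier M" by (simp add: closed)
  next
    fix z w assume "z \<in> carrier (plus_line_space R V)" "w \<in> carrier (plus_line_space R V)"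
    then obtain x r y s where "x \<in> carrier V" "r \<in> carrier R" "z = pair_code R (x, r)"
      "y \<in> carrier V" "s \<in> carrier R" "w = pair_code R (y, s)" by (metis plus_line_cases)
    then show "?f (z \<oplus>\<^bsub>plus_line_space R V\<^esub> w) = ?f z \<oplus>\<^bsub>M\<^esub> ?f w" by (simp add: add)
  next
    fix a z assume "a \<in> carrier R" "z \<in> carrier (plus_line_space R V)"
    then obtain x r where "a \<in> carrier R" "x \<in> carrier V" "r \<in> carrier R" "z = pair_code R (x, r)"
      by (metis plus_line_cases)
    then show "?f (a \<odot>\<^bsub>plus_line_space R V\<^esub> z) = a \<odot>\<^bsub>M\<^esub> ?f z" by (simp add: smult)
  qed simp
qed

lemma line_map_linear:
  fixes V :: "('f, 'u :: infinite) module"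
  assumes V: "V \<in> fd" and M: "Module.module R M" and g: "g \<in> linear_maps R V M" and b: "b \<in> carrier M"
  shows "(\<lambda>z\<in>carrier (plus_line_space R V). g (fst (pair_decode R z)) \<oplus>\<^bsub>M\<^esub> snd (pair_decode R z) \<odot>\<^bsub>M\<^esub> b)
     \<in> linear_maps R (plus_line_space R V) M"
proof -
  interpret V: Module.module R V by (rule fd_module[OF V])
  interpret M: Module.module R M by fact
  note [simp] = lin_closed[OF g] lin_add[OF g] lin_smult[OF g] b
  show ?thesis
    by (rule line_linearI) (auto simp: M.smult_l_distr M.smult_r_distr M.smult_assoc1 M.M.a_ac V)
qed

lemma into_line_linear:
  fixes V :: "('f, 'u :: infinite) module"
  assumes M: "Module.module R M" and g: "g \<in> linear_maps R M V" and \<eta>: "\<eta> \<in> linear_maps R M scalars"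
  shows "(\<lambda>x\<in>carrier M. pair_code R (g x, \<eta> x)) \<in> linear_maps R M (plus_line_space R V)"
proof -
  interpret M: Module.module R M by fact
  note [simp] = lin_closed[OF g] lin_add[OF g] lin_smult[OF g]
    lin_closed[OF \<eta>, simplified] lin_add[OF \<eta>] lin_smult[OF \<eta>]
  show ?thesis by (rule linear_mapsI) auto
qed

subsection \<open>Standard spaces\<close>

text \<open>
  The space \<open>R\<^sup>n\<close>, obtained from a zero space by adding lines.
  Finite-dimensional spaces in the universe do not form a small enough family to sum over, but
  each of them is a retract of one of these countably many spaces.
\<close>

definition std :: "nat \<Rightarrow> ('f, 'u) module" where
  "std n = (plus_line_space R ^^ n) \<lparr>carrier = {undefined}, mult = undefined, one = undefined,
     zero = undefined, add = (\<lambda>_ _. undefined), smult = (\<lambda>_ _. undefined)\<rparr>"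

lemma std_fd: "std n \<in> (fd :: ('f, 'u :: infinite) module set)"
proof (induction n)
  case 0
  have "Module.module R (std 0 :: ('f, 'u) module)"
    by (rule moduleI) (auto simp: std_def is_cring intro!: abelian_groupI)
  then show ?case by (simp add: fd_iff_finite) (simp add: std_def)
next
  case (Suc n)
  then show ?case using plus_line_fd by (simp add: std_def)
qed

lemma std_Suc: "std (Suc n) = plus_line_space R (std n)"
  by (simp add: std_def)

text \<open>
  The two maps take \<open>x\<close> to its coordinates, and coordinates to the linear combination
  of the vectors \<open>b j\<close>; both are built up one coordinate at a time.
\<close>

lemma std_retract:
  fixes V :: "('f, 'u :: infinite) module"
  assumes V: "V \<in> fd"
  obtains n s p where "s \<in> linear_maps R V (std n :: ('f, 'u) module)" "p \<in> linear_maps R (std n) V"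
    "compose (carrier V) p s = (\<lambda>x\<in>carrier V. x)"
proof -
  have VM: "Module.module R V" by (rule fd_module[OF V])
  interpret V: Module.module R V by (rule VM)
  obtain n :: nat and b \<eta> where b: "\<And>j. j < n \<Longrightarrow> b j \<in> carrier V" and \<eta>: "\<And>j. j < n \<Longrightarrow> \<eta> j \<in> linear_maps R V scalars"
    and x: "\<And>x. x \<in> carrier V \<Longrightarrow> x = (\<Oplus>\<^bsub>V\<^esub>j\<in>{..<n}. \<eta> j x \<odot>\<^bsub>V\<^esub> b j)"
    by (rule coordinates_exist[OF V]) (rule that)
  have "\<exists>s\<in>linear_maps R V (std m :: ('f, 'u) module). \<exists>p\<in>linear_maps R (std m) V.
      \<forall>x\<in>carrier V. p (s x) = (\<Oplus>\<^bsub>V\<^esub>j\<in>{..<m}. \<eta> j x \<odot>\<^bsub>V\<^esub> b j)" if "m \<le> n" for m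
    using that
  proof (induction m)
    case 0
    show ?case
    proof (intro bexI ballI)
      show "(\<lambda>x\<in>carrier V. \<zero>\<^bsub>std 0\<^esub>) \<in> linear_maps R V (std 0 :: ('f, 'u) module)"
        by (rule linear_mapsI) (auto simp: std_def)
      show "(\<lambda>x\<in>carrier (std 0). \<zero>\<^bsub>V\<^esub>) \<in> linear_maps R (std 0) V"
        by (rule linear_mapsI) (auto simp: std_def)
    qed (auto simp: std_def)
  next
    case (Suc m)
    then obtain s p where s: "s \<in> linear_maps R V (std m :: ('f, 'u) module)" and p: "p \<in> linear_maps R (std m) V"
      and ps: "\<And>x. x \<in> carrier V \<Longrightarrow> p (s x) = (\<Oplus>\<^bsub>V\<^esub>j\<in>{..<m}. \<eta> j x \<odot>\<^bsub>V\<^esub> b j)" by auto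
    have m: "m < n" using Suc by simp
    note lm = line_map_linear[OF std_fd VM p b[OF m]] and il = into_line_linear[OF VM s \<eta>[OF m]]
    have cl: "\<eta> j x \<odot>\<^bsub>V\<^esub> b j \<in> carrier V" if "j < n" "x \<in> carrier V" for j x
      using lin_closed[OF \<eta>[OF that(1)] that(2)] b[OF that(1)] by simp
    show ?case
      unfolding std_Suc
    proof (intro bexI[OF _ il] bexI[OF _ lm] ballI)
      fix x assume xV: "x \<in> carrier V"
      have "(\<Oplus>\<^bsub>V\<^esub>j\<in>{..<Suc m}. \<eta> j x \<odot>\<^bsub>V\<^esub> b j) = \<eta> m x \<odot>\<^bsub>V\<^esub> b m \<oplus>\<^bsub>V\<^esub> (\<Oplus>\<^bsub>V\<^esub>j\<in>{..<m}. \<eta> j x \<odot>\<^bsub>V\<^esub> b j)"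
        unfolding lessThan_Suc by (rule V.M.finsum_insert) (use cl xV m in auto)
      also have "\<dots> = p (s x) \<oplus>\<^bsub>V\<^esub> \<eta> m x \<odot>\<^bsub>V\<^esub> b m"
        using ps[OF xV] cl[OF m xV] lin_closed[OF p lin_closed[OF s xV]] by (simp add: V.M.a_comm)
      finally show "(\<lambda>z\<in>carrier (plus_line_space R (std m)). p (fst (pair_decode R z)) \<oplus>\<^bsub>V\<^esub>
           snd (pair_decode R z) \<odot>\<^bsub>V\<^esub> b m) ((\<lambda>x\<in>carrier V. pair_code R (s x, \<eta> m x)) x) =
         (\<Oplus>\<^bsub>V\<^esub>j\<in>{..<Suc m}. \<eta> j x \<odot>\<^bsub>V\<^esub> b j)"
        using xV lin_closed[OF s xV] lin_closed[OF \<eta>[OF m] xV] by simp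
    qed
  qed
  then obtain s p where sp: "s \<in> linear_maps R V (std n :: ('f, 'u) module)" "p \<in> linear_maps R (std n) V"
    "\<forall>x\<in>carrier V. p (s x) = (\<Oplus>\<^bsub>V\<^esub>j\<in>{..<n}. \<eta> j x \<odot>\<^bsub>V\<^esub> b j)" by blast
  have "compose (carrier V) p s = (\<lambda>x\<in>carrier V. x)"
    using sp(3) x[symmetric] by (auto simp: compose_def)
  then show ?thesis using that sp by blast
qed

section \<open>A projective generator\<close>

subsection \<open>Free modules\<close>

definition free_module :: "'i set \<Rightarrow> ('f, 'i \<Rightarrow> 'f) module" where
  "free_module I = \<lparr>carrier = {c. (\<forall>i. c i \<in> carrier R) \<and> finite {i. c i \<noteq> \<zero>} \<and> {i. c i \<noteq> \<zero>} \<subseteq> I},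
     mult = undefined, one = undefined, zero = (\<lambda>i. \<zero>), add = (\<lambda>c d i. c i \<oplus> d i), smult = (\<lambda>a c i. a \<otimes> c i)\<rparr>"

lemma free_module_simps [simp]:
  "c \<in> carrier (free_module I) \<longleftrightarrow> (\<forall>i. c i \<in> carrier R) \<and> finite {i. c i \<noteq> \<zero>} \<and> {i. c i \<noteq> \<zero>} \<subseteq> I"
  "\<zero>\<^bsub>free_module I\<^esub> = (\<lambda>i. \<zero>)"
  "c \<oplus>\<^bsub>free_module I\<^esub> d = (\<lambda>i. c i \<oplus> d i)"
  "a \<odot>\<^bsub>free_module I\<^esub> c = (\<lambda>i. a \<otimes> c i)"
  by (simp_all add: free_module_def)

lemma free_module_is_module: "Module.module R (free_module I)"
proof (rule moduleI)
  have sub: "{i. c i \<oplus> d i \<noteq> \<zero>} \<subseteq> {i. c i \<noteq> \<zero>} \<union> {i. d i \<noteq> \<zero>}" for c d :: "'a \<Rightarrow> 'f"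
    by auto
  have sub2: "{i. a \<otimes> c i \<noteq> \<zero>} \<subseteq> {i. c i \<noteq> \<zero>}" if "a \<in> carrier R" for a and c :: "'a \<Rightarrow> 'f"
    using that by auto
  show "cring R" by (rule is_cring)
  show "abelian_group (free_module I)"
  proof (rule abelian_groupI)
    fix c d assume "c \<in> carrier (free_module I)" "d \<in> carrier (free_module I)"
    then show "c \<oplus>\<^bsub>free_module I\<^esub> d \<in> carrier (free_module I)"
      using finite_subset[OF sub[of c d]] sub[of c d] by auto
  next
    fix c assume c: "c \<in> carrier (free_module I)"
    have "\<ominus> c i = \<zero> \<longleftrightarrow> c i = \<zero>" for i
      using c by (metis (no_types) free_module_simps(1) minus_minus minus_zero)
    then show "\<exists>d\<in>carrier (free_module I). d \<oplus>\<^bsub>free_module I\<^esub> c = \<zero>\<^bsub>free_module I\<^esub>"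
      using c by (intro bexI[of _ "\<lambda>i. \<ominus> c i"]) (auto simp: l_neg)
  qed (auto simp: fun_eq_iff a_ac)
  fix a and c :: "'a \<Rightarrow> 'f" assume "a \<in> carrier R" "c \<in> carrier (free_module I)"
  then show "a \<odot>\<^bsub>free_module I\<^esub> c \<in> carrier (free_module I)"
    using finite_subset[OF sub2[of a c]] sub2[of a c] by auto
qed (auto simp: fun_eq_iff l_distr r_distr m_assoc)

definition free_gen :: "'i \<Rightarrow> 'i \<Rightarrow> 'f" where
  "free_gen i = (\<lambda>j. if j = i then \<one> else \<zero>)"

lemma free_gen_closed [simp]: "i \<in> I \<Longrightarrow> free_gen i \<in> carrier (free_module I)"
proof -
  assume "i \<in> I"
  moreover have "{j. free_gen i j \<noteq> \<zero>} \<subseteq> {i}" by (auto simp: free_gen_def)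
  ultimately show ?thesis using finite_subset[of "{j. free_gen i j \<noteq> \<zero>}" "{i}"] by (auto simp: free_gen_def)
qed

text \<open>
  Induction on the size of the support.
\<close>

lemma free_linear_eqI:
  assumes f: "f \<in> linear_maps R (free_module I) M" and g: "g \<in> linear_maps R (free_module I) M"
    and M: "Module.module R M" and eq: "\<And>i. i \<in> I \<Longrightarrow> f (free_gen i) = g (free_gen i)"
  shows "f = g"
proof (rule lin_eqI[OF f g])
  fix c assume "c \<in> carrier (free_module I)"
  then show "f c = g c"
  proof (induction "card {i. c i \<noteq> \<zero>}" arbitrary: c rule: less_induct)
    case less
    show ?case
    proof (cases "{i. c i \<noteq> \<zero>} = {}")
      case True
      then have "c = \<zero>\<^bsub>free_module I\<^esub>" by auto
      then show ?thesis using lin_zero[OF f free_module_is_module M] lin_zero[OF g free_module_is_module M] by simp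
    next
      case False
      then obtain i where i: "c i \<noteq> \<zero>" by blast
      define d where "d = c(i := \<zero>)"
      have supp: "{j. d j \<noteq> \<zero>} = {j. c j \<noteq> \<zero>} - {i}" by (auto simp: d_def)
      then have d: "d \<in> carrier (free_module I)" using less.prems by (auto simp: d_def)
      have iI: "i \<in> I" and ci: "c i \<in> carrier R" using less.prems i by auto
      have "card {j. d j \<noteq> \<zero>} < card {j. c j \<noteq> \<zero>}"
        unfolding supp using less.prems i by (intro card_Diff1_less) auto
      then have IH: "f d = g d" using less.hyps d by blast
      have c: "c = d \<oplus>\<^bsub>free_module I\<^esub> (c i \<odot>\<^bsub>free_module I\<^esub> free_gen i)"
        using less.prems by (auto simp: d_def free_gen_def fun_eq_iff)
      have sc: "c i \<odot>\<^bsub>free_module I\<^esub> free_gen i \<in> carrier (free_module I)"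
        by (rule Module.module.smult_closed[OF free_module_is_module ci free_gen_closed[OF iI]])
      show ?thesis
        by (subst c, subst (2) c)
          (simp only: lin_add[OF f d sc] lin_add[OF g d sc] lin_smult[OF f ci free_gen_closed[OF iI]]
             lin_smult[OF g ci free_gen_closed[OF iI]] IH eq[OF iI])
    qed
  qed
qed

lemma free_linear_exists:
  assumes M: "Module.module R M" and a: "\<And>i. i \<in> I \<Longrightarrow> a i \<in> carrier M"
  obtains f where "f \<in> linear_maps R (free_module I) M" "\<And>i. i \<in> I \<Longrightarrow> f (free_gen i) = a i"
proof -
  interpret M: Module.module R M by fact
  define f where "f = (\<lambda>c\<in>carrier (free_module I). \<Oplus>\<^bsub>M\<^esub>i\<in>{i. c i \<noteq> \<zero>}. c i \<odot>\<^bsub>M\<^esub> a i)"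
  have f: "f c = (\<Oplus>\<^bsub>M\<^esub>i\<in>S. c i \<odot>\<^bsub>M\<^esub> a i)"
    if c: "c \<in> carrier (free_module I)" and S: "finite S" "{i. c i \<noteq> \<zero>} \<subseteq> S" "S \<subseteq> I" for c S
  proof -
    have "(\<Oplus>\<^bsub>M\<^esub>i\<in>{i. c i \<noteq> \<zero>}. c i \<odot>\<^bsub>M\<^esub> a i) = (\<Oplus>\<^bsub>M\<^esub>i\<in>S. c i \<odot>\<^bsub>M\<^esub> a i)"
      by (rule M.add.finprod_mono_neutral_cong_left) (use c S a in \<open>auto simp: subset_iff\<close>)
    then show ?thesis using c by (simp add: f_def)
  qed
  have sub: "{i. c i \<oplus> d i \<noteq> \<zero>} \<subseteq> {i. c i \<noteq> \<zero>} \<union> {i. d i \<noteq> \<zero>}" for c d :: "'b \<Rightarrow> 'f"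
    by auto
  show ?thesis
  proof
    show "f \<in> linear_maps R (free_module I) M"
    proof (rule linear_mapsI)
      fix c assume "c \<in> carrier (free_module I)"
      then show "f c \<in> carrier M" using a by (auto simp: f_def intro!: M.M.finsum_closed)
    next
      fix c d assume c: "c \<in> carrier (free_module I)" and d: "d \<in> carrier (free_module I)"
      let ?S = "{i. c i \<noteq> \<zero>} \<union> {i. d i \<noteq> \<zero>}"
      have S: "finite ?S" "?S \<subseteq> I" using c d by auto
      have cd: "c \<oplus>\<^bsub>free_module I\<^esub> d \<in> carrier (free_module I)"
        using Module.module.axioms(2)[OF free_module_is_module, of I] c d
        by (intro abelian_monoid.a_closed abelian_group.axioms(1)) 
      have cl: "(\<lambda>i. c i \<odot>\<^bsub>M\<^esub> a i) \<in> ?S \<rightarrow> carrier M" "(\<lambda>i. d i \<odot>\<^bsub>M\<^esub> a i) \<in> ?S \<rightarrow> carrier M"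
        using c d a S(2) by auto
      have "f (c \<oplus>\<^bsub>free_module I\<^esub> d) = (\<Oplus>\<^bsub>M\<^esub>i\<in>?S. (c \<oplus>\<^bsub>free_module I\<^esub> d) i \<odot>\<^bsub>M\<^esub> a i)"
        by (rule f[OF cd S(1) _ S(2)]) (use sub[of c d] in simp)
      also have "\<dots> = (\<Oplus>\<^bsub>M\<^esub>i\<in>?S. c i \<odot>\<^bsub>M\<^esub> a i \<oplus>\<^bsub>M\<^esub> d i \<odot>\<^bsub>M\<^esub> a i)"
        by (rule M.M.finsum_cong') (use c d a S(2) in \<open>auto simp: M.smult_l_distr subset_iff\<close>)
      also have "\<dots> = (\<Oplus>\<^bsub>M\<^esub>i\<in>?S. c i \<odot>\<^bsub>M\<^esub> a i) \<oplus>\<^bsub>M\<^esub> (\<Oplus>\<^bsub>M\<^esub>i\<in>?S. d i \<odot>\<^bsub>M\<^esub> a i)"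
        by (rule M.M.finsum_addf[OF cl])
      also have "\<dots> = f c \<oplus>\<^bsub>M\<^esub> f d" using f[OF c S(1) _ S(2)] f[OF d S(1) _ S(2)] by simp
      finally show "f (c \<oplus>\<^bsub>free_module I\<^esub> d) = f c \<oplus>\<^bsub>M\<^esub> f d" .
    next
      fix r c assume r: "r \<in> carrier R" and c: "c \<in> carrier (free_module I)"
      let ?S = "{i. c i \<noteq> \<zero>}"
      have S: "finite ?S" "?S \<subseteq> I" using c by auto
      have rc: "r \<odot>\<^bsub>free_module I\<^esub> c \<in> carrier (free_module I)"
        by (rule Module.module.smult_closed[OF free_module_is_module r c])
      have "f (r \<odot>\<^bsub>free_module I\<^esub> c) = (\<Oplus>\<^bsub>M\<^esub>i\<in>?S. (r \<odot>\<^bsub>free_module I\<^esub> c) i \<odot>\<^bsub>M\<^esub> a i)"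
        by (rule f[OF rc S(1) _ S(2)]) (use r in auto)
      also have "\<dots> = (\<Oplus>\<^bsub>M\<^esub>i\<in>?S. r \<odot>\<^bsub>M\<^esub> (c i \<odot>\<^bsub>M\<^esub> a i))"
        by (rule M.M.finsum_cong') (use c r a S(2) in \<open>auto simp: M.smult_assoc1 subset_iff\<close>)
      also have "\<dots> = r \<odot>\<^bsub>M\<^esub> (\<Oplus>\<^bsub>M\<^esub>i\<in>?S. c i \<odot>\<^bsub>M\<^esub> a i)"
        by (rule M.finsum_smult_ldistr[symmetric]) (use S c r a in auto)
      finally show "f (r \<odot>\<^bsub>free_module I\<^esub> c) = r \<odot>\<^bsub>M\<^esub> f c" using f[OF c S(1) _ S(2)] by simp
    qed (simp add: f_def)
    show "f (free_gen i) = a i" if i: "i \<in> I" for i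
    proof -
      have "f (free_gen i) = (\<Oplus>\<^bsub>M\<^esub>j\<in>{i}. free_gen i j \<odot>\<^bsub>M\<^esub> a j)"
        by (rule f) (use i free_gen_closed[OF i] in \<open>auto simp: free_gen_def\<close>)
      also have "\<dots> = a i" using a[OF i] by (simp add: free_gen_def)
      finally show ?thesis .
    qed
  qed
qed

subsection \<open>The generator\<close>

abbreviation std_maps :: "nat \<Rightarrow> ('f, 'u) module \<Rightarrow> ('u \<Rightarrow> 'u) set" where
  "std_maps n W \<equiv> linear_maps R (std n) W"

text \<open>
  The basis of the value at \<open>W\<close> of the direct sum of representable functors
  \<open>R[Hom(R\<^sup>n, -)]\<close>, with one summand for each \<open>n\<close> and each element
  \<open>x\<close> of the universe. Since \<open>x\<close> is unrestricted, this one functor maps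
  onto every \<open>G\<close>: the summand of \<open>(n, x)\<close> goes to \<open>G\<close> by
  the element \<open>x\<close> of \<open>G(R\<^sup>n)\<close>, if it is one.
\<close>

definition gens :: "('f, 'u) module \<Rightarrow> (nat \<times> 'u \<times> ('u \<Rightarrow> 'u)) set" where
  "gens W = {(n, x, \<phi>). \<phi> \<in> std_maps n W}"

text \<open>
  Contains the finitely supported functions on \<open>gens W\<close> for all \<open>W\<close> at
  once, so that one coding serves for all values of the functor.
\<close>

definition all_coeffs :: "(nat \<times> 'u \<times> ('u \<Rightarrow> 'u) \<Rightarrow> 'f) set" where
  "all_coeffs = carrier (free_module {(n, x, \<phi>). \<phi> \<in> extensional (carrier (std n))})"

definition free_code :: "(nat \<times> 'u \<times> ('u \<Rightarrow> 'u) \<Rightarrow> 'f) \<Rightarrow> 'u" where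
  "free_code = (SOME e. inj_on e all_coeffs)"

definition free_decode :: "'u \<Rightarrow> nat \<times> 'u \<times> ('u \<Rightarrow> 'u) \<Rightarrow> 'f" where
  "free_decode = inv_into all_coeffs free_code"

text \<open>
  A linear map on \<open>R\<^sup>n\<close> is determined by its graph over the finite set
  \<open>R\<^sup>n\<close>.
\<close>

lemma codable_gens:
  "codable TYPE('u :: infinite) {(n :: nat, x :: 'u, \<phi> :: 'u \<Rightarrow> 'u). \<phi> \<in> extensional (carrier (std n))}"
proof -
  let ?g = "\<lambda>(n :: nat, x :: 'u, \<phi> :: 'u \<Rightarrow> 'u). (n, x, (\<lambda>y. (y, \<phi> y)) ` carrier (std n))"
  have "codable TYPE('u) ((UNIV :: nat set) \<times> (UNIV :: 'u set) \<times> Fpow ((UNIV :: 'u set) \<times> (UNIV :: 'u set)))"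
    by (intro codable_Times codable_nat codable_UNIV codable_Fpow)
  then show ?thesis
  proof (rule codable_inj)
    have "\<phi> = \<psi>" if "\<phi> \<in> extensional C" "\<psi> \<in> extensional C" "(\<lambda>y. (y, \<phi> y)) ` C = (\<lambda>y. (y, \<psi> y)) ` C"
      for \<phi> \<psi> :: "'u \<Rightarrow> 'u" and C
      by (rule extensionalityI[OF that(1,2)]) (use that(3) in auto)
    then show "inj_on ?g {(n, x, \<phi>). \<phi> \<in> extensional (carrier (std n))}"
      by (auto simp: inj_on_def)
    have "finite (carrier (std n :: ('f, 'u) module))" for n
      by (rule conjunct2[OF fd_iff_finite[THEN iffD1, OF std_fd]])
    then show "?g ` {(n, x, \<phi>). \<phi> \<in> extensional (carrier (std n))} \<subseteq>
      UNIV \<times> UNIV \<times> Fpow (UNIV \<times> UNIV)"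
      by (auto simp: Fpow_def)
  qed
qed

lemma free_code_inj: "inj_on (free_code :: _ \<Rightarrow> 'u :: infinite) all_coeffs"
proof -
  let ?I = "{(n :: nat, x :: 'u, \<phi> :: 'u \<Rightarrow> 'u). \<phi> \<in> extensional (carrier (std n))}"
  have "codable TYPE('u) (Fpow (?I \<times> carrier R))"
    by (intro codable_Fpow codable_Times codable_gens codable_finite finite_scalars)
  then have "codable TYPE('u) (all_coeffs :: (nat \<times> 'u \<times> ('u \<Rightarrow> 'u) \<Rightarrow> 'f) set)"
  proof (rule codable_inj)
    let ?g = "\<lambda>c :: nat \<times> 'u \<times> ('u \<Rightarrow> 'u) \<Rightarrow> 'f. (\<lambda>i. (i, c i)) ` {i. c i \<noteq> \<zero>}"
    show "inj_on ?g all_coeffs"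
    proof (rule inj_onI, rule ext)
      fix c d :: "nat \<times> 'u \<times> ('u \<Rightarrow> 'u) \<Rightarrow> 'f" and i
      assume eq: "?g c = ?g d"
      show "c i = d i"
      proof (cases "c i = \<zero>")
        case True
        have "d i = \<zero>"
        proof (rule ccontr)
          assume "d i \<noteq> \<zero>"
          then have "(i, d i) \<in> ?g c" unfolding eq by auto
          then show False using True \<open>d i \<noteq> \<zero>\<close> by auto
        qed
        then show ?thesis using True by simp
      next
        case False
        then have "(i, c i) \<in> ?g d" unfolding eq[symmetric] by auto
        then show ?thesis by auto
      qed
    qed
    show "?g ` all_coeffs \<subseteq> Fpow (?I \<times> carrier R)"
      unfolding all_coeffs_def Fpow_def by auto
  qed
  then have "\<exists>e :: (nat \<times> 'u \<times> ('u \<Rightarrow> 'u) \<Rightarrow> 'f) \<Rightarrow> 'u. inj_on e all_coeffs" by (simp add: codable_def)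
  then show ?thesis unfolding free_code_def by (rule someI_ex)
qed

lemma gens_coeffs: "c \<in> carrier (free_module (gens W)) \<Longrightarrow> c \<in> all_coeffs"
proof -
  have "gens W \<subseteq> {(n, x, \<phi>). \<phi> \<in> extensional (carrier (std n))}"
    by (auto simp: gens_def dest: lin_ext)
  then show "c \<in> carrier (free_module (gens W)) \<Longrightarrow> c \<in> all_coeffs"
    unfolding all_coeffs_def free_module_simps by blast
qed

lemma free_decode_code:
  "c \<in> carrier (free_module (gens W)) \<Longrightarrow> free_decode (free_code c :: 'u :: infinite) = c"
  unfolding free_decode_def by (rule inv_into_f_f[OF free_code_inj gens_coeffs])

definition gen_module :: "('f, 'u) module \<Rightarrow> ('f, 'u) module" where
  "gen_module W = \<lparr>carrier = free_code ` carrier (free_module (gens W)), mult = undefined, one = undefined,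
     zero = free_code \<zero>\<^bsub>free_module (gens W)\<^esub>,
     add = (\<lambda>x y. free_code (free_decode x \<oplus>\<^bsub>free_module (gens W)\<^esub> free_decode y)),
     smult = (\<lambda>a x. free_code (a \<odot>\<^bsub>free_module (gens W)\<^esub> free_decode x))\<rparr>"

lemma gen_module_carrier: "carrier (gen_module W) = free_code ` carrier (free_module (gens W))"
  by (simp add: gen_module_def)

lemma gen_module_ops:
  fixes W :: "('f, 'u :: infinite) module"
  shows "c \<in> carrier (free_module (gens W)) \<Longrightarrow> d \<in> carrier (free_module (gens W)) \<Longrightarrow>
     free_code c \<oplus>\<^bsub>gen_module W\<^esub> free_code d = free_code (c \<oplus>\<^bsub>free_module (gens W)\<^esub> d)"
   "c \<in> carrier (free_module (gens W)) \<Longrightarrow>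
     a \<odot>\<^bsub>gen_module W\<^esub> free_code c = free_code (a \<odot>\<^bsub>free_module (gens W)\<^esub> c)"
  unfolding gen_module_def by (simp_all only: module.simps ring.simps monoid.simps partial_object.simps free_decode_code)

lemma gen_module_is_module: "Module.module R (gen_module W)"
  for W :: "('f, 'u :: infinite) module"
proof (rule transport_module[where M="free_module (gens W)" and k=free_code])
  show "\<zero>\<^bsub>gen_module W\<^esub> = free_code \<zero>\<^bsub>free_module (gens W)\<^esub>" by (simp add: gen_module_def)
qed (rule free_module_is_module gen_module_carrier gen_module_ops; assumption)+

lemma free_code_linear:
  fixes W :: "('f, 'u :: infinite) module"
  shows "restrict free_code (carrier (free_module (gens W))) \<in> linear_maps R (free_module (gens W)) (gen_module W)"
proof -
  interpret F: Module.module R "free_module (gens W)" by (rule free_module_is_module)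
  show ?thesis
    by (rule linear_mapsI)
      (simp_all only: restrict_apply' F.M.a_closed F.smult_closed gen_module_ops gen_module_carrier imageI restrict_extensional)
qed

lemma free_decode_linear:
  fixes W :: "('f, 'u :: infinite) module"
  shows "restrict free_decode (carrier (gen_module W)) \<in> linear_maps R (gen_module W) (free_module (gens W))"
proof -
  interpret F: Module.module R "free_module (gens W)" by (rule free_module_is_module)
  interpret G: Module.module R "gen_module W" by (rule gen_module_is_module)
  show ?thesis
  proof (rule linear_mapsI)
    fix x assume "x \<in> carrier (gen_module W)"
    then show "restrict free_decode (carrier (gen_module W)) x \<in> carrier (free_module (gens W))"
      unfolding gen_module_carrier by (auto simp only: restrict_apply' free_decode_code)
  next
    fix x y assume xy: "x \<in> carrier (gen_module W)" "y \<in> carrier (gen_module W)"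
    then obtain c d where cd: "c \<in> carrier (free_module (gens W))" "d \<in> carrier (free_module (gens W))"
      "x = free_code c" "y = free_code d" unfolding gen_module_carrier by blast
    show "restrict free_decode (carrier (gen_module W)) (x \<oplus>\<^bsub>gen_module W\<^esub> y) =
      restrict free_decode (carrier (gen_module W)) x \<oplus>\<^bsub>free_module (gens W)\<^esub> restrict free_decode (carrier (gen_module W)) y"
      using xy G.M.a_closed[OF xy] unfolding cd(3,4)
      by (simp only: restrict_apply' gen_module_ops cd(1,2) free_decode_code[OF cd(1)] free_decode_code[OF cd(2)]
        free_decode_code[OF F.M.a_closed[OF cd(1,2)]])
  next
    fix a x assume a: "a \<in> carrier R" and x: "x \<in> carrier (gen_module W)"
    then obtain c where c: "c \<in> carrier (free_module (gens W))" "x = free_code c"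
      unfolding gen_module_carrier by blast
    show "restrict free_decode (carrier (gen_module W)) (a \<odot>\<^bsub>gen_module W\<^esub> x) =
      a \<odot>\<^bsub>free_module (gens W)\<^esub> restrict free_decode (carrier (gen_module W)) x"
      using a x G.smult_closed[OF a x] unfolding c(2)
      by (simp only: restrict_apply' gen_module_ops c(1) free_decode_code[OF c(1)]
        free_decode_code[OF F.smult_closed[OF a c(1)]])
  qed simp
qed

text \<open>
  The basis element with index \<open>(n, x, \<phi>)\<close>, as an element of the universe.
\<close>

definition gen_elt :: "nat \<Rightarrow> 'u \<Rightarrow> ('u \<Rightarrow> 'u) \<Rightarrow> 'u" where
  "gen_elt n x \<phi> = free_code (free_gen (n, x, \<phi>))"

lemma gen_elt_closed: "\<phi> \<in> std_maps n W \<Longrightarrow> gen_elt n x \<phi> \<in> carrier (gen_module W)"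
  unfolding gen_elt_def gen_module_carrier by (intro imageI free_gen_closed) (simp add: gens_def)

lemma gen_linear_eqI:
  fixes W :: "('f, 'u :: infinite) module"
  assumes f: "f \<in> linear_maps R (gen_module W) M" and g: "g \<in> linear_maps R (gen_module W) M"
    and M: "Module.module R M"
    and eq: "\<And>n x \<phi>. \<phi> \<in> std_maps n W \<Longrightarrow> f (gen_elt n x \<phi>) = g (gen_elt n x \<phi>)"
  shows "f = g"
proof (rule lin_eqI[OF f g])
  let ?F = "free_module (gens W)"
  let ?c = "restrict free_code (carrier ?F)"
  have "compose (carrier ?F) f ?c = compose (carrier ?F) g ?c"
  proof (rule free_linear_eqI[OF lin_comp[OF free_code_linear f free_module_is_module]
        lin_comp[OF free_code_linear g free_module_is_module] M])
    fix i assume i: "i \<in> gens W"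
    obtain n x \<phi> where [simp]: "i = (n, x, \<phi>)" by (cases i)
    have "\<phi> \<in> std_maps n W" using i by (simp add: gens_def)
    then have "f (free_code (free_gen i)) = g (free_code (free_gen i))"
      using eq by (simp add: gen_elt_def)
    then show "compose (carrier ?F) f ?c (free_gen i) = compose (carrier ?F) g ?c (free_gen i)"
      using free_gen_closed[OF i] by (simp only: compose_eq restrict_apply')
  qed
  note eq_free = fun_cong[OF this]
  fix z assume "z \<in> carrier (gen_module W)"
  then obtain c where c: "c \<in> carrier ?F" "z = free_code c" unfolding gen_module_carrier by blast
  show "f z = g z"
    using eq_free[of c] c(1) unfolding c(2) by (simp only: compose_eq restrict_apply')
qed

lemma gen_linear_exists:
  fixes W :: "('f, 'u :: infinite) module"
  assumes M: "Module.module R M"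
    and a: "\<And>n x \<phi>. \<phi> \<in> std_maps n W \<Longrightarrow> a n x \<phi> \<in> carrier M"
  obtains f where "f \<in> linear_maps R (gen_module W) M"
    "\<And>n x \<phi>. \<phi> \<in> std_maps n W \<Longrightarrow> f (gen_elt n x \<phi>) = a n x \<phi>"
proof -
  let ?F = "free_module (gens W)"
  obtain f where f: "f \<in> linear_maps R ?F M" "\<And>i. i \<in> gens W \<Longrightarrow> f (free_gen i) = (case i of (n, x, \<phi>) \<Rightarrow> a n x \<phi>)"
    by (rule free_linear_exists[OF M, of "gens W" "\<lambda>(n, x, \<phi>). a n x \<phi>"]) (use a in \<open>auto simp: gens_def\<close>)
  let ?d = "restrict free_decode (carrier (gen_module W))"
  show ?thesis
  proof
    show "compose (carrier (gen_module W)) f ?d \<in> linear_maps R (gen_module W) M"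
      by (rule lin_comp[OF free_decode_linear f(1) gen_module_is_module])
    fix n x \<phi> assume \<phi>: "\<phi> \<in> std_maps n W"
    then have i: "(n, x, \<phi>) \<in> gens W" by (simp add: gens_def)
    have "compose (carrier (gen_module W)) f ?d (gen_elt n x \<phi>) = f (free_decode (gen_elt n x \<phi>))"
      using gen_elt_closed[OF \<phi>] by (simp only: compose_eq restrict_apply')
    also have "\<dots> = f (free_gen (n, x, \<phi>))"
      unfolding gen_elt_def by (simp only: free_decode_code[OF free_gen_closed[OF i]])
    finally show "compose (carrier (gen_module W)) f ?d (gen_elt n x \<phi>) = a n x \<phi>"
      using f(2)[OF i] by simp
  qed
qed

text \<open>
  A linear map is applied to basis elements by composition. It is determined by this, since the
  basis elements generate (\<open>gen_linear_eqI\<close>).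
\<close>

definition generator :: "('f, 'u) vfunctor" where
  "generator = \<lparr>obj = gen_module, mor = (\<lambda>V W h. SOME f. f \<in> linear_maps R (gen_module V) (gen_module W) \<and>
     (\<forall>n x \<phi>. \<phi> \<in> std_maps n V \<longrightarrow> f (gen_elt n x \<phi>) = gen_elt n x (compose (carrier (std n)) h \<phi>)))\<rparr>"

lemma generator_obj [simp]: "obj generator W = gen_module W"
  by (simp add: generator_def)

lemma generator_mor:
  fixes W :: "('f, 'u :: infinite) module"
  assumes h: "h \<in> linear_maps R V W"
  shows "mor generator V W h \<in> linear_maps R (gen_module V) (gen_module W)"
    "\<phi> \<in> std_maps n V \<Longrightarrow>
      mor generator V W h (gen_elt n x \<phi>) = gen_elt n x (compose (carrier (std n)) h \<phi>)"
proof -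
  have cl: "compose (carrier (std n)) h \<phi> \<in> std_maps n W" if "\<phi> \<in> std_maps n V" for n \<phi>
    by (rule lin_comp[OF that h fd_module[OF std_fd]])
  obtain f where "f \<in> linear_maps R (gen_module V) (gen_module W)"
     "\<And>n x \<phi>. \<phi> \<in> std_maps n V \<Longrightarrow> f (gen_elt n x \<phi>) = gen_elt n x (compose (carrier (std n)) h \<phi>)"
    by (rule gen_linear_exists[OF gen_module_is_module, of V "\<lambda>n x \<phi>. gen_elt n x (compose (carrier (std n)) h \<phi>)"])
      (auto intro: gen_elt_closed cl)
  then have "\<exists>f. f \<in> linear_maps R (gen_module V) (gen_module W) \<and>
     (\<forall>n x \<phi>. \<phi> \<in> std_maps n V \<longrightarrow> f (gen_elt n x \<phi>) = gen_elt n x (compose (carrier (std n)) h \<phi>))"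
    by blast
  from someI_ex[OF this] show "mor generator V W h \<in> linear_maps R (gen_module V) (gen_module W)"
    "\<phi> \<in> std_maps n V \<Longrightarrow>
      mor generator V W h (gen_elt n x \<phi>) = gen_elt n x (compose (carrier (std n)) h \<phi>)"
    unfolding generator_def by auto
qed

lemma generator_functor: "is_functor R (generator :: ('f, 'u :: infinite) vfunctor)"
proof (rule is_functorI)
  fix V :: "('f, 'u) module" assume V: "V \<in> fd"
  show "Module.module R (obj generator V)" by (simp add: gen_module_is_module)
  note id = lin_id[OF fd_module[OF V]]
  have "mor generator V V (\<lambda>x\<in>carrier V. x) = (\<lambda>x\<in>carrier (gen_module V). x)"
  proof (rule gen_linear_eqI[OF generator_mor(1)[OF id] lin_id[OF gen_module_is_module] gen_module_is_module])
    fix n x \<phi> assume \<phi>: "\<phi> \<in> std_maps n V"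
    have "compose (carrier (std n)) (\<lambda>x\<in>carrier V. x) \<phi> = \<phi>"
      by (rule lin_eqI[OF lin_comp[OF \<phi> id fd_module[OF std_fd]] \<phi>]) (simp add: compose_eq lin_closed[OF \<phi>])
    then show "mor generator V V (\<lambda>x\<in>carrier V. x) (gen_elt n x \<phi>) = (\<lambda>x\<in>carrier (gen_module V). x) (gen_elt n x \<phi>)"
      by (simp add: generator_mor(2)[OF id \<phi>] gen_elt_closed[OF \<phi>])
  qed
  then show "mor generator V V (\<lambda>x\<in>carrier V. x) x = x" if "x \<in> carrier (obj generator V)" for x
    using that by simp
next
  fix V W :: "('f, 'u) module" and f assume "f \<in> linear_maps R V W"
  then show "mor generator V W f \<in> linear_maps R (obj generator V) (obj generator W)"
    using generator_mor(1) by simp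
next
  fix U V W :: "('f, 'u) module" and f g x
  assume U: "U \<in> fd" and f: "f \<in> linear_maps R U V" and g: "g \<in> linear_maps R V W"
    and x: "x \<in> carrier (obj generator U)"
  note gf = lin_comp[OF f g fd_module[OF U]]
  have "mor generator U W (compose (carrier U) g f) =
      compose (carrier (gen_module U)) (mor generator V W g) (mor generator U V f)"
  proof (rule gen_linear_eqI[OF generator_mor(1)[OF gf]
        lin_comp[OF generator_mor(1)[OF f] generator_mor(1)[OF g] gen_module_is_module] gen_module_is_module])
    fix n x \<phi> assume \<phi>: "\<phi> \<in> std_maps n U"
    have "compose (carrier (std n)) (compose (carrier U) g f) \<phi> =
        compose (carrier (std n)) g (compose (carrier (std n)) f \<phi>)"
      using lin_closed[OF \<phi>] by (auto simp: compose_def restrict_def fun_eq_iff)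
    then show "mor generator U W (compose (carrier U) g f) (gen_elt n x \<phi>) =
        compose (carrier (gen_module U)) (mor generator V W g) (mor generator U V f) (gen_elt n x \<phi>)"
      by (simp add: compose_eq gen_elt_closed[OF \<phi>] generator_mor(2)[OF gf \<phi>] generator_mor(2)[OF f \<phi>]
          generator_mor(2)[OF g lin_comp[OF \<phi> f fd_module[OF std_fd]]])
  qed
  then show "mor generator U W (compose (carrier U) g f) x = mor generator V W g (mor generator U V f x)"
    using x by (simp add: compose_eq)
qed

text \<open>
  The universal element of the summand with index \<open>(n, x)\<close>.
\<close>

definition gen_id :: "nat \<Rightarrow> 'u \<Rightarrow> 'u" where
  "gen_id n x = gen_elt n x (\<lambda>y\<in>carrier (std n). y)"

lemma gen_id_closed: "gen_id n x \<in> carrier (gen_module (std n :: ('f, 'u :: infinite) module))"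
  unfolding gen_id_def by (rule gen_elt_closed[OF lin_id[OF fd_module[OF std_fd]]])

lemma gen_elt_mor:
  fixes W :: "('f, 'u :: infinite) module"
  assumes \<phi>: "\<phi> \<in> std_maps n W"
  shows "mor generator (std n) W \<phi> (gen_id n x) = gen_elt n x \<phi>"
proof -
  have "compose (carrier (std n)) \<phi> (\<lambda>y\<in>carrier (std n). y) = \<phi>"
    using lin_ext[OF \<phi>] by (auto simp: compose_def extensional_def fun_eq_iff)
  then show ?thesis
    unfolding gen_id_def by (simp add: generator_mor(2)[OF \<phi> lin_id[OF fd_module[OF std_fd]]])
qed

text \<open>
  One half of the Yoneda lemma: a transformation can be prescribed on the universal elements. The
  other half is \<open>generator_trans_eqI\<close>.
\<close>

lemma generator_trans_exists:
  fixes A :: "('f, 'u :: infinite) vfunctor"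
  assumes A: "is_functor R A" and a: "\<And>n x. a n x \<in> carrier (obj A (std n))"
  obtains t where "t \<in> nat_trans R generator A"
    "\<And>n x W \<phi>. W \<in> fd \<Longrightarrow> \<phi> \<in> std_maps n W \<Longrightarrow> t W (gen_elt n x \<phi>) = mor A (std n) W \<phi> (a n x)"
proof -
  have "\<exists>f. f \<in> linear_maps R (gen_module W) (obj A W) \<and>
    (\<forall>n x \<phi>. \<phi> \<in> std_maps n W \<longrightarrow> f (gen_elt n x \<phi>) = mor A (std n) W \<phi> (a n x))"
    if W: "W \<in> fd" for W
    using gen_linear_exists[OF fun_module[OF A W], of W "\<lambda>n x \<phi>. mor A (std n) W \<phi> (a n x)"]
      fun_closed[OF A std_fd W _ a] by metis
  then obtain f where f: "\<And>W. W \<in> fd \<Longrightarrow> f W \<in> linear_maps R (gen_module W) (obj A W)"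
    "\<And>W n x \<phi>. W \<in> fd \<Longrightarrow> \<phi> \<in> std_maps n W \<Longrightarrow> f W (gen_elt n x \<phi>) = mor A (std n) W \<phi> (a n x)"
    by metis
  show ?thesis
  proof
    show "restrict f fd \<in> nat_trans R generator A"
    proof (rule ntI)
      fix V W :: "('f, 'u) module" and h z
      assume VW: "V \<in> fd" "W \<in> fd" and h: "h \<in> linear_maps R V W" and z: "z \<in> carrier (obj generator V)"
      have "compose (carrier (gen_module V)) (f W) (mor generator V W h) =
          compose (carrier (gen_module V)) (mor A V W h) (f V)"
      proof (rule gen_linear_eqI[OF lin_comp[OF generator_mor(1)[OF h] f(1)[OF VW(2)] gen_module_is_module]
            lin_comp[OF f(1)[OF VW(1)] fun_lin[OF A VW h] gen_module_is_module] fun_module[OF A VW(2)]])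
        fix n x \<phi> assume \<phi>: "\<phi> \<in> std_maps n V"
        show "compose (carrier (gen_module V)) (f W) (mor generator V W h) (gen_elt n x \<phi>) =
            compose (carrier (gen_module V)) (mor A V W h) (f V) (gen_elt n x \<phi>)"
          using fun_comp[OF A std_fd VW \<phi> h a] lin_comp[OF \<phi> h fd_module[OF std_fd]]
          by (simp add: compose_eq gen_elt_closed[OF \<phi>] generator_mor(2)[OF h \<phi>] f(2) VW \<phi>)
      qed
      then have "f W (mor generator V W h z) = mor A V W h (f V z)"
        using z by (metis compose_eq generator_obj)
      then show "restrict f fd W (mor generator V W h z) = mor A V W h (restrict f fd V z)"
        using VW by simp
    qed (use f(1) in auto)
  qed (use f(2) in auto)
qed

lemma generator_trans_eqI:
  fixes A :: "('f, 'u :: infinite) vfunctor"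
  assumes A: "is_functor R A" and s: "s \<in> nat_trans R generator A" and t: "t \<in> nat_trans R generator A"
    and eq: "\<And>n x. s (std n) (gen_id n x) = t (std n) (gen_id n x)"
  shows "s = t"
proof (rule extensionalityI[OF nt_ext[OF s] nt_ext[OF t]])
  fix W :: "('f, 'u) module" assume W: "W \<in> fd"
  show "s W = t W"
  proof (rule gen_linear_eqI[OF _ _ fun_module[OF A W]])
    fix n x \<phi> assume \<phi>: "\<phi> \<in> std_maps n W"
    show "s W (gen_elt n x \<phi>) = t W (gen_elt n x \<phi>)"
      unfolding gen_elt_mor[OF \<phi>, symmetric]
      using nt_nat[OF s std_fd W \<phi>] nt_nat[OF t std_fd W \<phi>] gen_id_closed[of n x] eq by simp
  qed (use nt_lin[OF s W] nt_lin[OF t W] in simp_all)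
qed

text \<open>
  By the Yoneda lemma, it suffices to choose preimages of the images of the universal elements.
\<close>

lemma generator_projective: "is_projective R (generator :: ('f, 'u :: infinite) vfunctor)"
  unfolding is_projective_def
proof (intro conjI allI impI generator_functor)
  fix A B :: "('f, 'u) vfunctor" and e t
  assume "is_functor R A \<and> is_functor R B \<and> e \<in> nat_trans R A B \<and> is_epi R A B e \<and> t \<in> nat_trans R generator B"
  then have A: "is_functor R A" and B: "is_functor R B" and e: "e \<in> nat_trans R A B"
    and epi: "is_epi R A B e" and t: "t \<in> nat_trans R generator B" by auto
  have "\<exists>y\<in>carrier (obj A (std n)). e (std n) y = t (std n) (gen_id n x)" for n x
  proof -
    have "t (std n) (gen_id n x) \<in> carrier (obj B (std n))"
      using nt_closed[OF t std_fd, of "gen_id n x" n] gen_id_closed[of n x] by simp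
    then show ?thesis using epi[unfolded is_epi_def, rule_format, OF std_fd[of n]] by (metis imageE)
  qed
  then obtain a where a: "\<And>n x. a n x \<in> carrier (obj A (std n))" "\<And>n x. e (std n) (a n x) = t (std n) (gen_id n x)"
    by metis
  obtain s where s: "s \<in> nat_trans R generator A"
    "\<And>n x W \<phi>. W \<in> fd \<Longrightarrow> \<phi> \<in> std_maps n W \<Longrightarrow> s W (gen_elt n x \<phi>) = mor A (std n) W \<phi> (a n x)"
    by (rule generator_trans_exists[OF A, of a]) (use a in auto)
  have "trans_comp R generator e s = t"
  proof (rule generator_trans_eqI[OF B trans_comp_nt[OF s(1) e generator_functor] t])
    fix n x
    have "s (std n) (gen_id n x) = a n x"
      unfolding gen_id_def by (simp add: s(2) std_fd lin_id fd_module fun_id[OF A] a)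
    then show "trans_comp R generator e s (std n) (gen_id n x) = t (std n) (gen_id n x)"
      using a(2) gen_id_closed[of n x] trans_comp_apply[OF std_fd, of "gen_id n x" generator n] by simp
  qed
  then show "\<exists>s\<in>nat_trans R generator A. trans_comp R generator e s = t" using s(1) by blast
qed

text \<open>
  An element \<open>y\<close> of \<open>G(V)\<close> is reached because \<open>V\<close> is a
  retract of some \<open>R\<^sup>n\<close>, say by \<open>s\<close> and \<open>p\<close>: it is
  the image under \<open>G(p)\<close> of the element \<open>G(s)(y)\<close> of
  \<open>G(R\<^sup>n)\<close>.
\<close>

lemma generator_cover:
  fixes G :: "('f, 'u :: infinite) vfunctor"
  assumes G: "is_functor R G"
  obtains t where "t \<in> nat_trans R generator G" "is_epi R generator G t"
proof -
  (* Indices x outside G(R^n) are sent to zero. *)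
  define a where "a n x = (if x \<in> carrier (obj G (std n)) then x else \<zero>\<^bsub>obj G (std n)\<^esub>)" for n x
  have a: "a n x \<in> carrier (obj G (std n))" for n x
  proof -
    interpret Module.module R "obj G (std n)" by (rule fun_module[OF G std_fd])
    show ?thesis by (simp add: a_def)
  qed
  obtain t where t: "t \<in> nat_trans R generator G"
    "\<And>n x W \<phi>. W \<in> fd \<Longrightarrow> \<phi> \<in> std_maps n W \<Longrightarrow> t W (gen_elt n x \<phi>) = mor G (std n) W \<phi> (a n x)"
    by (rule generator_trans_exists[OF G, of a]) (use a in auto)
  have "is_epi R generator G t"
    unfolding is_epi_def
  proof (intro ballI equalityI subsetI)
    fix V y assume "V \<in> (fd :: ('f, 'u) module set)" "y \<in> t V ` carrier (obj generator V)"
    then show "y \<in> carrier (obj G V)" using nt_closed[OF t(1)] by auto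
  next
    fix V :: "('f, 'u) module" and y assume V: "V \<in> fd" and y: "y \<in> carrier (obj G V)"
    obtain n s p where s: "s \<in> linear_maps R V (std n :: ('f, 'u) module)" and p: "p \<in> std_maps n V"
      and ps: "compose (carrier V) p s = (\<lambda>x\<in>carrier V. x)" using std_retract[OF V] .
    let ?x = "mor G V (std n) s y"
    have x: "?x \<in> carrier (obj G (std n))" by (rule fun_closed[OF G V std_fd s y])
    have "t V (gen_elt n ?x p) = mor G (std n) V p ?x" by (simp add: t(2)[OF V p] a_def x)
    also have "\<dots> = y" by (simp only: fun_comp[OF G V std_fd V s p y] ps fun_id[OF G V y])
    finally show "y \<in> t V ` carrier (obj generator V)"
      using gen_elt_closed[OF p] by (metis generator_obj imageI)
  qed
  then show ?thesis using that t(1) by blast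
qed

subsection \<open>Resolutions\<close>

lemma generator_cover_kernel:
  fixes A B :: "('f, 'u :: infinite) vfunctor"
  assumes A: "is_functor R A" and B: "is_functor R B" and t: "t \<in> nat_trans R A B"
  obtains s where "s \<in> nat_trans R generator A" "is_exact R generator A B s t"
proof -
  let ?D = "\<lambda>V. {x \<in> carrier (obj A V). t V x = \<zero>\<^bsub>obj B V\<^esub>}"
  have D: "is_subfunctor R A ?D" by (rule kernel_subfunctor[OF A B t])
  obtain s where s: "s \<in> nat_trans R generator (sub_functor A ?D)" "is_epi R generator (sub_functor A ?D) s"
    using generator_cover[OF sub_functor_functor[OF A D]] .
  then show ?thesis using that[of s] nt_from_sub[OF s(1) A D] by (simp add: is_exact_def is_epi_def)
qed

text \<open>
  The generator is taken in every degree: it covers \<open>G\<close>, and then the kernel of each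
  map constructed before.
\<close>

lemma projective_resolution_resolves:
  fixes G :: "('f, 'u :: infinite) vfunctor"
  assumes G: "is_functor R G"
  shows "is_projective_resolution R G (projective_resolution R G)"
proof -
  obtain t where t: "t \<in> nat_trans R generator G" "is_epi R generator G t" using generator_cover[OF G] .
  define P where "P n d \<longleftrightarrow> d \<in> nat_trans R generator (generator :: ('f, 'u) vfunctor) \<and>
      (n = (0::nat) \<longrightarrow> is_exact R generator generator G d t)" for n d
  have "\<exists>d. \<forall>n. P n (d n) \<and> is_exact R generator generator generator (d (Suc n)) (d n)"
  proof (rule dependent_nat_choice)
    show "\<exists>d. P 0 d"
      using generator_cover_kernel[OF generator_functor G t(1)] by (auto simp: P_def)
    fix d n assume "P n d"
    then have d: "d \<in> nat_trans R generator generator" by (simp add: P_def)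
    show "\<exists>d'. P (Suc n) d' \<and> is_exact R generator generator generator d' d"
      using generator_cover_kernel[OF generator_functor generator_functor d] by (auto simp: P_def)
  qed
  then obtain d where d: "\<And>n. P n (d n)" "\<And>n. is_exact R generator generator generator (d (Suc n)) (d n)" by blast
  have "is_projective_resolution R G \<lparr>term = (\<lambda>_. generator), diff = d, aug = t\<rparr>"
    using d d(1)[of 0] t by (auto simp: is_projective_resolution_def generator_projective P_def)
  then show ?thesis unfolding projective_resolution_def by (rule someI)
qed

section \<open>Chain maps out of projective resolutions\<close>

text \<open>
  The augmentation is treated as the differential in degree 0, with target the augmented object.
\<close>

definition bdry :: "('f, 'u) aug_complex \<Rightarrow> nat \<Rightarrow> ('f, 'u) transf" where
  "bdry X n = (case n of 0 \<Rightarrow> aug X | Suc m \<Rightarrow> diff X m)"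

definition bdry_target :: "('f, 'u) aug_complex \<Rightarrow> ('f, 'u) vfunctor \<Rightarrow> nat \<Rightarrow> ('f, 'u) vfunctor" where
  "bdry_target X G n = (case n of 0 \<Rightarrow> G | Suc m \<Rightarrow> term X m)"

lemma bdry_simps [simp]: "bdry X 0 = aug X" "bdry X (Suc n) = diff X n"
  "bdry_target X G 0 = G" "bdry_target X G (Suc n) = term X n"
  by (simp_all add: bdry_def bdry_target_def)

definition exact_complex :: "('f, 'u) vfunctor \<Rightarrow> ('f, 'u) aug_complex \<Rightarrow> bool" where
  "exact_complex G X \<longleftrightarrow> is_functor R G \<and> (\<forall>n. is_functor R (term X n)) \<and>
     (\<forall>n. bdry X n \<in> nat_trans R (term X n) (bdry_target X G n)) \<and>
     is_epi R (term X 0) G (aug X) \<and>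
     (\<forall>n. is_exact R (term X (Suc n)) (term X n) (bdry_target X G n) (diff X n) (bdry X n))"

lemma exact_complex_simps:
  assumes "exact_complex G X"
  shows "is_functor R G" "is_functor R (term X n)" "is_functor R (bdry_target X G n)"
    "bdry X n \<in> nat_trans R (term X n) (bdry_target X G n)"
    "diff X n \<in> nat_trans R (term X (Suc n)) (term X n)" "aug X \<in> nat_trans R (term X 0) G"
    "is_epi R (term X 0) G (aug X)"
    "is_exact R (term X (Suc n)) (term X n) (bdry_target X G n) (diff X n) (bdry X n)"
proof -
  have *: "\<And>n. bdry X n \<in> nat_trans R (term X n) (bdry_target X G n)"
    using assms by (simp add: exact_complex_def)
  show "diff X n \<in> nat_trans R (term X (Suc n)) (term X n)" "aug X \<in> nat_trans R (term X 0) G"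
    using *[of "Suc n"] *[of 0] by simp_all
  show "is_functor R (bdry_target X G n)" using assms by (cases n) (auto simp: exact_complex_def)
qed (use assms in \<open>auto simp: exact_complex_def\<close>)

lemma resolution_exact:
  assumes G: "is_functor R G" and X: "is_projective_resolution R G X"
  shows "exact_complex G X"
proof -
  note X' = X[unfolded is_projective_resolution_def]
  have "bdry X n \<in> nat_trans R (term X n) (bdry_target X G n)" for n
    using X' by (cases n) auto
  moreover have "is_exact R (term X (Suc n)) (term X n) (bdry_target X G n) (diff X n) (bdry X n)" for n
    using X' by (cases n) auto
  ultimately show ?thesis using X' G by (auto simp: exact_complex_def is_projective_def)
qed

lemma resolution_projective: "is_projective_resolution R G X \<Longrightarrow> is_projective R (term X n)"
  by (simp add: is_projective_resolution_def)

lemma precomp_complex_simps [simp]: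
  "term (precomp_complex R T X) n = term X n \<circ>\<^sub>F T"
  "diff (precomp_complex R T X) n = precomp_trans R T (diff X n)"
  "aug (precomp_complex R T X) = precomp_trans R T (aug X)"
  "bdry (precomp_complex R T X) n = precomp_trans R T (bdry X n)"
  "bdry_target (precomp_complex R T X) (G \<circ>\<^sub>F T) n = bdry_target X G n \<circ>\<^sub>F T"
  by (cases n; simp add: precomp_complex_def)+

lemma precomp_exact:
  assumes X: "exact_complex G X" and T: "fd_functor T"
  shows "exact_complex (G \<circ>\<^sub>F T) (precomp_complex R T X)"
proof -
  note E = exact_complex_simps[OF X]
  show ?thesis
    unfolding exact_complex_def
    using E(7,8)
    by (auto simp: precomp_functor[OF _ T] E(1,2) precomp_trans_nt[OF T] E(4) is_epi_def is_exact_def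
        fd_functor_obj[OF T])
qed

lemma projective_lift_epi:
  assumes "is_projective R P" "is_functor R A" "is_functor R B" "e \<in> nat_trans R A B"
    "is_epi R A B e" "t \<in> nat_trans R P B"
  obtains s where "s \<in> nat_trans R P A" "trans_comp R P e s = t"
  using assms unfolding is_projective_def by blast

text \<open>
  By exactness, \<open>s\<close> is an epimorphism onto the kernel of \<open>t\<close>, and
  \<open>g\<close> takes values in this kernel.
\<close>

lemma projective_lift_exact:
  assumes P: "is_projective R P" and A: "is_functor R A" and B: "is_functor R B" and C: "is_functor R C"
    and s: "s \<in> nat_trans R A B" and t: "t \<in> nat_trans R B C" and ex: "is_exact R A B C s t"
    and g: "g \<in> nat_trans R P B" and 0: "\<And>V x. V \<in> fd \<Longrightarrow> x \<in> carrier (obj P V) \<Longrightarrow> t V (g V x) = \<zero>\<^bsub>obj C V\<^esub>"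
  obtains h where "h \<in> nat_trans R P A" "\<And>V x. V \<in> fd \<Longrightarrow> x \<in> carrier (obj P V) \<Longrightarrow> s V (h V x) = g V x"
proof -
  define D where "D V = {x \<in> carrier (obj B V). t V x = \<zero>\<^bsub>obj C V\<^esub>}" for V
  have D: "is_subfunctor R B D" unfolding D_def by (rule kernel_subfunctor[OF B C t])
  have s': "s \<in> nat_trans R A (sub_functor B D)"
    by (rule nt_into_sub[OF s]) (use ex in \<open>auto simp: is_exact_def D_def\<close>)
  have g': "g \<in> nat_trans R P (sub_functor B D)"
    by (rule nt_into_sub[OF g]) (auto simp: D_def 0 nt_closed[OF g])
  have "is_epi R A (sub_functor B D) s" using ex by (simp add: is_epi_def is_exact_def D_def)
  then obtain h where "h \<in> nat_trans R P A" "trans_comp R P s h = g"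
    using projective_lift_epi[OF P A sub_functor_functor[OF B D] s' _ g'] by blast
  then show ?thesis using that by (metis trans_comp_apply)
qed

lemma is_exact_zero:
  "is_exact R A B C s t \<Longrightarrow> V \<in> fd \<Longrightarrow> x \<in> carrier (obj A V) \<Longrightarrow> t V (s V x) = \<zero>\<^bsub>obj C V\<^esub>"
  by (auto simp: is_exact_def)

lemma chain_map_iff:
  assumes X: "exact_complex G X" and Y: "exact_complex K Y" and g: "g \<in> nat_trans R G K"
  shows "is_chain_map R X Y g \<phi> \<longleftrightarrow>
    (\<forall>n. \<phi> n \<in> nat_trans R (term X n) (term Y n)) \<and>
    (\<forall>V\<in>fd. \<forall>x\<in>carrier (obj (term X 0) V). aug Y V (\<phi> 0 V x) = g V (aug X V x)) \<and>
    (\<forall>n. \<forall>V\<in>fd. \<forall>x\<in>carrier (obj (term X (Suc n)) V). diff Y n V (\<phi> (Suc n) V x) = \<phi> n V (diff X n V x))"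
proof -
  note EX = exact_complex_simps[OF X] and EY = exact_complex_simps[OF Y]
  have 1: "trans_comp R (term X 0) (aug Y) (\<phi> 0) = trans_comp R (term X 0) g (aug X) \<longleftrightarrow>
    (\<forall>V\<in>fd. \<forall>x\<in>carrier (obj (term X 0) V). aug Y V (\<phi> 0 V x) = g V (aug X V x))"
    if "\<phi> 0 \<in> nat_trans R (term X 0) (term Y 0)"
  proof
    assume "trans_comp R (term X 0) (aug Y) (\<phi> 0) = trans_comp R (term X 0) g (aug X)"
    then show "\<forall>V\<in>fd. \<forall>x\<in>carrier (obj (term X 0) V). aug Y V (\<phi> 0 V x) = g V (aug X V x)"
      by (metis trans_comp_apply)
  next
    assume "\<forall>V\<in>fd. \<forall>x\<in>carrier (obj (term X 0) V). aug Y V (\<phi> 0 V x) = g V (aug X V x)"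
    then show "trans_comp R (term X 0) (aug Y) (\<phi> 0) = trans_comp R (term X 0) g (aug X)"
      by (intro nt_eqI[OF trans_comp_nt[OF that EY(6) EX(2)] trans_comp_nt[OF EX(6) g EX(2)]]) simp
  qed
  have 2: "trans_comp R (term X (Suc n)) (diff Y n) (\<phi> (Suc n)) = trans_comp R (term X (Suc n)) (\<phi> n) (diff X n) \<longleftrightarrow>
    (\<forall>V\<in>fd. \<forall>x\<in>carrier (obj (term X (Suc n)) V). diff Y n V (\<phi> (Suc n) V x) = \<phi> n V (diff X n V x))"
    if "\<And>n. \<phi> n \<in> nat_trans R (term X n) (term Y n)" for n
  proof
    assume "trans_comp R (term X (Suc n)) (diff Y n) (\<phi> (Suc n)) = trans_comp R (term X (Suc n)) (\<phi> n) (diff X n)"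
    then show "\<forall>V\<in>fd. \<forall>x\<in>carrier (obj (term X (Suc n)) V). diff Y n V (\<phi> (Suc n) V x) = \<phi> n V (diff X n V x)"
      by (metis trans_comp_apply)
  next
    assume "\<forall>V\<in>fd. \<forall>x\<in>carrier (obj (term X (Suc n)) V). diff Y n V (\<phi> (Suc n) V x) = \<phi> n V (diff X n V x)"
    then show "trans_comp R (term X (Suc n)) (diff Y n) (\<phi> (Suc n)) = trans_comp R (term X (Suc n)) (\<phi> n) (diff X n)"
      by (intro nt_eqI[OF trans_comp_nt[OF that EY(5) EX(2)] trans_comp_nt[OF EX(5) that EX(2)]]) simp
  qed
  show ?thesis unfolding is_chain_map_def using 1 2 by blast
qed

text \<open>
  The lift is constructed degree by degree. A component \<open>\<phi>\<close> can be continued if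
  its composite with the differentials of \<open>X\<close> and of \<open>Y\<close> on both sides
  vanishes, and the next component then has this property again.
\<close>

lemma chain_map_exists:
  assumes X: "is_projective_resolution R G X" and G: "is_functor R G" and Y: "exact_complex K Y"
    and g: "g \<in> nat_trans R G K"
  shows "is_chain_map R X Y g (chain_lift R X Y g)"
proof -
  have X': "exact_complex G X" by (rule resolution_exact[OF G X])
  note EX = exact_complex_simps[OF X'] and EY = exact_complex_simps[OF Y]
  note pr = resolution_projective[OF X]
  (* P: the lift can be continued beyond degree n; in degree 0 it also covers g. *)
  define P where "P n \<phi> \<longleftrightarrow> \<phi> \<in> nat_trans R (term X n) (term Y n) \<and>
    (n = 0 \<longrightarrow> (\<forall>V\<in>fd. \<forall>x\<in>carrier (obj (term X 0) V). aug Y V (\<phi> V x) = g V (aug X V x))) \<and>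
    (\<forall>V\<in>fd. \<forall>x\<in>carrier (obj (term X (Suc n)) V). bdry Y n V (\<phi> V (diff X n V x)) = \<zero>\<^bsub>obj (bdry_target Y K n) V\<^esub>)"
    for n and \<phi> :: "('f, 'a) transf"
  define Q where "Q n \<phi> \<psi> \<longleftrightarrow>
    (\<forall>V\<in>fd. \<forall>x\<in>carrier (obj (term X (Suc n)) V). diff Y n V (\<psi> V x) = \<phi> V (diff X n V x))"
    for n and \<phi> \<psi> :: "('f, 'a) transf"
  have "\<exists>\<phi>. \<forall>n. P n (\<phi> n) \<and> Q n (\<phi> n) (\<phi> (Suc n))"
  proof (rule dependent_nat_choice)
    obtain \<phi> where \<phi>: "\<phi> \<in> nat_trans R (term X 0) (term Y 0)"
        "trans_comp R (term X 0) (aug Y) \<phi> = trans_comp R (term X 0) g (aug X)"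
      using projective_lift_epi[OF pr EY(2) EY(1) EY(6) EY(7) trans_comp_nt[OF EX(6) g EX(2)]] by blast
    have eq: "aug Y V (\<phi> V x) = g V (aug X V x)" if "V \<in> fd" "x \<in> carrier (obj (term X 0) V)" for V x
      using \<phi>(2) that by (metis trans_comp_apply)
    have "aug Y V (\<phi> V (diff X 0 V x)) = \<zero>\<^bsub>obj K V\<^esub>" if "V \<in> fd" "x \<in> carrier (obj (term X (Suc 0)) V)" for V x
      using that is_exact_zero[OF EX(8), of V x 0] nt_closed[OF EX(5), of V x 0]
      by (simp add: eq lin_zero[OF nt_lin[OF g]] fun_module EX EY)
    then have "P 0 \<phi>" using \<phi>(1) eq by (simp add: P_def)
    then show "\<exists>\<phi>. P 0 \<phi>" by blast
  next
    fix \<phi> n assume P: "P n \<phi>"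
    have \<phi>: "\<phi> \<in> nat_trans R (term X n) (term Y n)" using P by (simp add: P_def)
    have 0: "bdry Y n V (trans_comp R (term X (Suc n)) \<phi> (diff X n) V x) = \<zero>\<^bsub>obj (bdry_target Y K n) V\<^esub>"
      if "V \<in> fd" "x \<in> carrier (obj (term X (Suc n)) V)" for V x
      using P that by (simp add: P_def)
    obtain \<psi> where \<psi>: "\<psi> \<in> nat_trans R (term X (Suc n)) (term Y (Suc n))"
      "\<And>V x. V \<in> fd \<Longrightarrow> x \<in> carrier (obj (term X (Suc n)) V) \<Longrightarrow>
         diff Y n V (\<psi> V x) = trans_comp R (term X (Suc n)) \<phi> (diff X n) V x"
      using projective_lift_exact[OF pr EY(2) EY(2) EY(3) EY(5) EY(4) EY(8) trans_comp_nt[OF EX(5) \<phi> EX(2)]] 0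
      by metis
    have "diff Y n V (\<psi> V (diff X (Suc n) V x)) = \<zero>\<^bsub>obj (term Y n) V\<^esub>"
      if V: "V \<in> fd" "x \<in> carrier (obj (term X (Suc (Suc n))) V)" for V x
      using V is_exact_zero[OF EX(8) V] nt_closed[OF EX(5) V]
      by (simp add: \<psi>(2) lin_zero[OF nt_lin[OF \<phi>]] fun_module EX EY)
    then have "P (Suc n) \<psi>" using \<psi>(1) by (simp add: P_def)
    moreover have "Q n \<phi> \<psi>" using \<psi>(2) by (simp add: Q_def)
    ultimately show "\<exists>\<psi>. P (Suc n) \<psi> \<and> Q n \<phi> \<psi>" by blast
  qed
  then obtain \<phi> where "\<And>n. P n (\<phi> n)" "\<And>n. Q n (\<phi> n) (\<phi> (Suc n))" by blast
  then have "is_chain_map R X Y g \<phi>"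
    by (auto simp: chain_map_iff[OF X' Y g] P_def Q_def)
  then show ?thesis unfolding chain_lift_def by (rule someI[of "is_chain_map R X Y g"])
qed

text \<open>
  The components of the homotopy are again obtained by lifting. A component \<open>h\<close> in
  degree \<open>n\<close> can be continued if the difference of the chain maps, minus the
  differential of \<open>h\<close>, vanishes on the boundaries of \<open>X\<close>.
\<close>

lemma chain_map_homotopy:
  assumes X: "is_projective_resolution R G X" and G: "is_functor R G" and Y: "exact_complex K Y"
    and g: "g \<in> nat_trans R G K"
    and \<phi>: "is_chain_map R X Y g \<phi>" and \<psi>: "is_chain_map R X Y g \<psi>"
  obtains h where "\<And>n. h n \<in> nat_trans R (term X n) (term Y (Suc n))"
    "\<And>V x. V \<in> fd \<Longrightarrow> x \<in> carrier (obj (term X 0) V) \<Longrightarrow>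
       \<phi> 0 V x \<ominus>\<^bsub>obj (term Y 0) V\<^esub> \<psi> 0 V x = diff Y 0 V (h 0 V x)"
    "\<And>n V x. V \<in> fd \<Longrightarrow> x \<in> carrier (obj (term X (Suc n)) V) \<Longrightarrow>
       \<phi> (Suc n) V x \<ominus>\<^bsub>obj (term Y (Suc n)) V\<^esub> \<psi> (Suc n) V x =
       diff Y (Suc n) V (h (Suc n) V x) \<oplus>\<^bsub>obj (term Y (Suc n)) V\<^esub> h n V (diff X n V x)"
proof -
  have X': "exact_complex G X" by (rule resolution_exact[OF G X])
  note EX = exact_complex_simps[OF X'] and EY = exact_complex_simps[OF Y]
  note pr = resolution_projective[OF X]
  note \<phi>' = \<phi>[unfolded chain_map_iff[OF X' Y g]] and \<psi>' = \<psi>[unfolded chain_map_iff[OF X' Y g]]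
  have \<phi>n: "\<phi> n \<in> nat_trans R (term X n) (term Y n)" and \<psi>n: "\<psi> n \<in> nat_trans R (term X n) (term Y n)" for n
    using \<phi>' \<psi>' by simp_all
  define \<theta> where "\<theta> n = \<phi> n \<ominus>\<^bsub>hom_module R (term X n) (term Y n)\<^esub> \<psi> n" for n
  have \<theta>_nt: "\<theta> n \<in> nat_trans R (term X n) (term Y n)" for n
    unfolding \<theta>_def by (rule hom_minus_nt[OF EX(2) EY(2) \<phi>n \<psi>n])
  have \<theta>: "\<theta> n V x = \<phi> n V x \<ominus>\<^bsub>obj (term Y n) V\<^esub> \<psi> n V x"
    if "V \<in> fd" "x \<in> carrier (obj (term X n) V)" for n V x
    unfolding \<theta>_def by (rule hom_minus_apply[OF EX(2) EY(2) \<phi>n \<psi>n that])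
  have \<theta>_aug: "aug Y V (\<theta> 0 V x) = \<zero>\<^bsub>obj K V\<^esub>" if "V \<in> fd" "x \<in> carrier (obj (term X 0) V)" for V x
  proof -
    have "aug Y V (\<theta> 0 V x) = aug Y V (\<phi> 0 V x) \<ominus>\<^bsub>obj K V\<^esub> aug Y V (\<psi> 0 V x)"
      unfolding \<theta>[OF that]
      by (rule lin_minus[OF nt_lin[OF EY(6) that(1)] fun_module[OF EY(2) that(1)] fun_module[OF EY(1) that(1)]
            nt_closed[OF \<phi>n that] nt_closed[OF \<psi>n that]])
    also have "\<dots> = g V (aug X V x) \<ominus>\<^bsub>obj K V\<^esub> g V (aug X V x)" using \<phi>' \<psi>' that by simp
    finally show ?thesis
      using minus_eq_zero_iff[OF fun_module[OF EY(1)]] nt_closed[OF g] nt_closed[OF EX(6)] that by simp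
  qed
  have \<theta>_diff: "diff Y n V (\<theta> (Suc n) V x) = \<theta> n V (diff X n V x)"
    if "V \<in> fd" "x \<in> carrier (obj (term X (Suc n)) V)" for n V x
  proof -
    have "diff Y n V (\<theta> (Suc n) V x) = diff Y n V (\<phi> (Suc n) V x) \<ominus>\<^bsub>obj (term Y n) V\<^esub> diff Y n V (\<psi> (Suc n) V x)"
      unfolding \<theta>[OF that]
      by (rule lin_minus[OF nt_lin[OF EY(5) that(1)] fun_module[OF EY(2) that(1)] fun_module[OF EY(2) that(1)]
            nt_closed[OF \<phi>n that] nt_closed[OF \<psi>n that]])
    also have "\<dots> = \<theta> n V (diff X n V x)" using \<phi>' \<psi>' that by (simp add: \<theta> nt_closed[OF EX(5)])
    finally show ?thesis .
  qed
  (* P: the homotopy can be continued beyond degree n; in degree 0 there is no earlier component. *)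
  define P where "P n h \<longleftrightarrow> h \<in> nat_trans R (term X n) (term Y (Suc n)) \<and>
    (n = 0 \<longrightarrow> (\<forall>V\<in>fd. \<forall>x\<in>carrier (obj (term X 0) V). diff Y 0 V (h V x) = \<theta> 0 V x)) \<and>
    (\<forall>V\<in>fd. \<forall>x\<in>carrier (obj (term X (Suc n)) V). diff Y n V (h V (diff X n V x)) = \<theta> n V (diff X n V x))"
    for n and h :: "('f, 'a) transf"
  define Q where "Q n h k \<longleftrightarrow>
    (\<forall>V\<in>fd. \<forall>x\<in>carrier (obj (term X (Suc n)) V). diff Y (Suc n) V (k V x) =
        \<theta> (Suc n) V x \<ominus>\<^bsub>obj (term Y (Suc n)) V\<^esub> h V (diff X n V x))"
    for n and h k :: "('f, 'a) transf"
  have "\<exists>h. \<forall>n. P n (h n) \<and> Q n (h n) (h (Suc n))"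
  proof (rule dependent_nat_choice)
    obtain h where h: "h \<in> nat_trans R (term X 0) (term Y (Suc 0))"
      "\<And>V x. V \<in> fd \<Longrightarrow> x \<in> carrier (obj (term X 0) V) \<Longrightarrow> diff Y 0 V (h V x) = \<theta> 0 V x"
      using projective_lift_exact[OF pr EY(2) EY(2) EY(3) EY(5) EY(4) EY(8) \<theta>_nt[of 0]] \<theta>_aug
      by (metis bdry_simps(1,3))
    then have "P 0 h" by (simp add: P_def nt_closed[OF EX(5)])
    then show "\<exists>h. P 0 h" by blast
  next
    fix h n assume P: "P n h"
    have h: "h \<in> nat_trans R (term X n) (term Y (Suc n))" using P by (simp add: P_def)
    define k where "k = \<theta> (Suc n) \<ominus>\<^bsub>hom_module R (term X (Suc n)) (term Y (Suc n))\<^esub>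
      trans_comp R (term X (Suc n)) h (diff X n)"
    have hd: "trans_comp R (term X (Suc n)) h (diff X n) \<in> nat_trans R (term X (Suc n)) (term Y (Suc n))"
      by (rule trans_comp_nt[OF EX(5) h EX(2)])
    have k: "k V x = \<theta> (Suc n) V x \<ominus>\<^bsub>obj (term Y (Suc n)) V\<^esub> h V (diff X n V x)"
      if "V \<in> fd" "x \<in> carrier (obj (term X (Suc n)) V)" for V x
      unfolding k_def using hom_minus_apply[OF EX(2) EY(2) \<theta>_nt hd that] that by simp
    have k_nt: "k \<in> nat_trans R (term X (Suc n)) (term Y (Suc n))"
      unfolding k_def by (rule hom_minus_nt[OF EX(2) EY(2) \<theta>_nt hd])
    have "diff Y n V (k V x) = \<zero>\<^bsub>obj (term Y n) V\<^esub>" if V: "V \<in> fd" "x \<in> carrier (obj (term X (Suc n)) V)" for V x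
    proof -
      have "diff Y n V (k V x) = diff Y n V (\<theta> (Suc n) V x) \<ominus>\<^bsub>obj (term Y n) V\<^esub> diff Y n V (h V (diff X n V x))"
        unfolding k[OF V] by (intro lin_minus[OF nt_lin[OF EY(5)]] fun_module EY V nt_closed[OF \<theta>_nt]
            nt_closed[OF h] nt_closed[OF EX(5)])
      also have "\<dots> = \<theta> n V (diff X n V x) \<ominus>\<^bsub>obj (term Y n) V\<^esub> \<theta> n V (diff X n V x)"
        using P V by (simp add: P_def \<theta>_diff)
      finally show ?thesis
        using minus_eq_zero_iff[OF fun_module[OF EY(2)]] nt_closed[OF \<theta>_nt] nt_closed[OF EX(5)] V by simp
    qed
    then obtain h' where h': "h' \<in> nat_trans R (term X (Suc n)) (term Y (Suc (Suc n)))"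
      "\<And>V x. V \<in> fd \<Longrightarrow> x \<in> carrier (obj (term X (Suc n)) V) \<Longrightarrow> diff Y (Suc n) V (h' V x) = k V x"
      using projective_lift_exact[OF pr EY(2) EY(2) EY(3) EY(5) EY(4) EY(8) k_nt]
      by (metis bdry_simps(2,4))
    have "diff Y (Suc n) V (h' V (diff X (Suc n) V x)) = \<theta> (Suc n) V (diff X (Suc n) V x)"
      if V: "V \<in> fd" "x \<in> carrier (obj (term X (Suc (Suc n))) V)" for V x
    proof -
      have "diff X n V (diff X (Suc n) V x) = \<zero>\<^bsub>obj (term X n) V\<^esub>"
        using is_exact_zero[OF EX(8) V] by simp
      then have "h V (diff X n V (diff X (Suc n) V x)) = \<zero>\<^bsub>obj (term Y (Suc n)) V\<^esub>"
        using V by (simp add: lin_zero[OF nt_lin[OF h]] fun_module EX EY)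
      moreover interpret Module.module R "obj (term Y (Suc n)) V" using V by (simp add: fun_module EY)
      have "\<theta> (Suc n) V (diff X (Suc n) V x) \<ominus>\<^bsub>obj (term Y (Suc n)) V\<^esub> \<zero>\<^bsub>obj (term Y (Suc n)) V\<^esub> =
          \<theta> (Suc n) V (diff X (Suc n) V x)"
        using nt_closed[OF \<theta>_nt V(1) nt_closed[OF EX(5) V]] by (intro minus_eqI) (auto intro: fun_module EY V)
      ultimately show ?thesis using V by (simp add: h'(2) k nt_closed[OF EX(5)])
    qed
    then have "P (Suc n) h'" using h'(1) by (simp add: P_def)
    moreover have "Q n h h'" using h'(2) k by (simp add: Q_def)
    ultimately show "\<exists>h'. P (Suc n) h' \<and> Q n h h'" by blast
  qed
  then obtain h where P: "\<And>n. P n (h n)" and Q: "\<And>n. Q n (h n) (h (Suc n))" by blast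
  have h: "h n \<in> nat_trans R (term X n) (term Y (Suc n))" for n using P by (simp add: P_def)
  show ?thesis
  proof
    show "\<phi> 0 V x \<ominus>\<^bsub>obj (term Y 0) V\<^esub> \<psi> 0 V x = diff Y 0 V (h 0 V x)"
      if "V \<in> fd" "x \<in> carrier (obj (term X 0) V)" for V x
      using P[of 0] that by (simp add: P_def \<theta>)
    show "\<phi> (Suc n) V x \<ominus>\<^bsub>obj (term Y (Suc n)) V\<^esub> \<psi> (Suc n) V x =
       diff Y (Suc n) V (h (Suc n) V x) \<oplus>\<^bsub>obj (term Y (Suc n)) V\<^esub> h n V (diff X n V x)"
      if V: "V \<in> fd" "x \<in> carrier (obj (term X (Suc n)) V)" for n V x
      using Q[of n] V minus_add_cancel[OF fun_module[OF EY(2) V(1)] nt_closed[OF \<theta>_nt V]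
          nt_closed[OF h V(1) nt_closed[OF EX(5) V]]]
      by (simp add: Q_def \<theta>)
  qed (rule h)
qed

section \<open>Operations on Ext\<close>

subsection \<open>Cocycles and coboundaries\<close>

lemma cocycles_iff:
  fixes G :: "('f, 'u :: infinite) vfunctor"
  assumes G: "is_functor R G" and H: "is_functor R H"
  defines "P \<equiv> projective_resolution R G"
  shows "c \<in> cocycles R n G H \<longleftrightarrow> c \<in> nat_trans R (term P n) H \<and>
    (\<forall>V\<in>fd. \<forall>x\<in>carrier (obj (term P (Suc n)) V). c V (diff P n V x) = \<zero>\<^bsub>obj H V\<^esub>)"
proof -
  note E = exact_complex_simps[OF resolution_exact[OF G projective_resolution_resolves[OF G]], folded P_def]
  have "trans_comp R (term P (Suc n)) c (diff P n) = \<zero>\<^bsub>hom_module R (term P (Suc n)) H\<^esub> \<longleftrightarrow>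
      (\<forall>V\<in>fd. \<forall>x\<in>carrier (obj (term P (Suc n)) V). c V (diff P n V x) = \<zero>\<^bsub>obj H V\<^esub>)"
    (is "?L = ?R") if c: "c \<in> nat_trans R (term P n) H"
  proof
    assume ?L then show ?R by (metis trans_comp_apply hom_module_simps(2))
  next
    assume ?R then show ?L
      by (intro nt_eqI[OF trans_comp_nt[OF E(5) c E(2)] hom_zero_nt[OF E(2) H]]) simp
  qed
  then show ?thesis unfolding cocycles_def Let_def P_def by blast
qed

context
  fixes G H :: "('f, 'u :: infinite) vfunctor"
  assumes G: "is_functor R G" and H: "is_functor R H"
begin

lemmas resolution = exact_complex_simps[OF resolution_exact[OF G projective_resolution_resolves[OF G]]]

lemma cocycle_nt: "c \<in> cocycles R n G H \<Longrightarrow> c \<in> nat_trans R (term (projective_resolution R G) n) H"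
  by (simp add: cocycles_iff[OF G H])

lemma cocycles_submodule:
  "submodule (cocycles R n G H) R (hom_module R (term (projective_resolution R G) n) H)"
proof (rule submoduleI'[OF hom_module_is_module[OF resolution(2) H]])
  note [simp] = cocycles_iff[OF G H] nt_closed[OF resolution(5)] hom_zero_nt[OF resolution(2) H]
     hom_add_nt[OF resolution(2) H] hom_smult_nt[OF resolution(2) H]
     abelian_monoid.l_zero abelian_monoid.zero_closed Module.module.smult_r_null[OF fun_module[OF H]]
  have [simp]: "abelian_monoid (obj H V)" if "V \<in> fd" for V
    using fun_module[OF H that] by (auto simp: Module.module_def abelian_group_def)
  show "cocycles R n G H \<subseteq> carrier (hom_module R (term (projective_resolution R G) n) H)" by auto
  show "\<zero>\<^bsub>hom_module R (term (projective_resolution R G) n) H\<^esub> \<in> cocycles R n G H" by simp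
  show "c \<oplus>\<^bsub>hom_module R (term (projective_resolution R G) n) H\<^esub> c' \<in> cocycles R n G H"
    if "c \<in> cocycles R n G H" "c' \<in> cocycles R n G H" for c c' using that by simp
  show "a \<odot>\<^bsub>hom_module R (term (projective_resolution R G) n) H\<^esub> c \<in> cocycles R n G H"
    if "a \<in> carrier R" "c \<in> cocycles R n G H" for a c using that by simp
qed

lemma cocycle_module_is_module: "Module.module R (cocycle_module R n G H)"
  unfolding cocycle_module_def
  by (rule submodule.submodule_is_module[OF cocycles_submodule hom_module_is_module[OF resolution(2) H]])

lemma cocycle_module_simps [simp]:
  "carrier (cocycle_module R n G H) = cocycles R n G H"
  "\<zero>\<^bsub>cocycle_module R n G H\<^esub> = \<zero>\<^bsub>hom_module R (term (projective_resolution R G) n) H\<^esub>"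
  "c \<oplus>\<^bsub>cocycle_module R n G H\<^esub> c' = c \<oplus>\<^bsub>hom_module R (term (projective_resolution R G) n) H\<^esub> c'"
  "a \<odot>\<^bsub>cocycle_module R n G H\<^esub> c = a \<odot>\<^bsub>hom_module R (term (projective_resolution R G) n) H\<^esub> c"
  by (simp_all add: cocycle_module_def)

text \<open>
  Coboundaries in degree \<open>0\<close> and in positive degrees are defined by different
  formulas.
\<close>

lemma coboundary_cases:
  assumes "b \<in> coboundaries R n G H"
  obtains (zero) "n = 0" "b = \<zero>\<^bsub>hom_module R (term (projective_resolution R G) 0) H\<^esub>"
  | (diff) m e where "n = Suc m" "e \<in> nat_trans R (term (projective_resolution R G) m) H"
      "b \<in> nat_trans R (term (projective_resolution R G) n) H"
      "\<And>V x. V \<in> fd \<Longrightarrow> x \<in> carrier (obj (term (projective_resolution R G) (Suc m)) V) \<Longrightarrow>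
         b V x = e V (diff (projective_resolution R G) m V x)"
proof (cases n)
  case 0
  then show ?thesis using assms zero by (simp add: coboundaries_def)
next
  case (Suc m)
  then obtain e where "e \<in> nat_trans R (term (projective_resolution R G) m) H"
      "b = trans_comp R (term (projective_resolution R G) (Suc m)) e (diff (projective_resolution R G) m)"
    using assms by (auto simp: coboundaries_def Let_def)
  then show ?thesis using diff Suc trans_comp_nt[OF resolution(5) _ resolution(2)] by simp
qed

lemma coboundary_zeroI: "\<zero>\<^bsub>hom_module R (term (projective_resolution R G) 0) H\<^esub> \<in> coboundaries R 0 G H"
  by (simp add: coboundaries_def)

lemma coboundary_diffI:
  assumes e: "e \<in> nat_trans R (term (projective_resolution R G) m) H"
    and b: "b \<in> nat_trans R (term (projective_resolution R G) (Suc m)) H"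
    and eq: "\<And>V x. V \<in> fd \<Longrightarrow> x \<in> carrier (obj (term (projective_resolution R G) (Suc m)) V) \<Longrightarrow>
         b V x = e V (diff (projective_resolution R G) m V x)"
  shows "b \<in> coboundaries R (Suc m) G H"
proof -
  have "b = trans_comp R (term (projective_resolution R G) (Suc m)) e (diff (projective_resolution R G) m)"
    by (rule nt_eqI[OF b trans_comp_nt[OF resolution(5) e resolution(2)]]) (simp add: eq)
  then show ?thesis using e by (auto simp: coboundaries_def Let_def)
qed

lemma coboundaries_cocycles: "b \<in> coboundaries R n G H \<Longrightarrow> b \<in> cocycles R n G H"
proof (erule coboundary_cases)
  assume *: "n = 0" "b = \<zero>\<^bsub>hom_module R (term (projective_resolution R G) 0) H\<^esub>"
  show ?thesis unfolding * cocycles_iff[OF G H]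
    using hom_zero_nt[OF resolution(2) H] nt_closed[OF resolution(5)] by auto
next
  fix m e
  assume *: "n = Suc m" "e \<in> nat_trans R (term (projective_resolution R G) m) H"
      "b \<in> nat_trans R (term (projective_resolution R G) n) H"
      "\<And>V x. V \<in> fd \<Longrightarrow> x \<in> carrier (obj (term (projective_resolution R G) (Suc m)) V) \<Longrightarrow>
         b V x = e V (diff (projective_resolution R G) m V x)"
  have "b V (diff (projective_resolution R G) n V x) = \<zero>\<^bsub>obj H V\<^esub>"
    if V: "V \<in> fd" "x \<in> carrier (obj (term (projective_resolution R G) (Suc n)) V)" for V x
    using is_exact_zero[OF resolution(8) V] nt_closed[OF resolution(5) V] V
    by (simp add: *(1,4) lin_zero[OF nt_lin[OF *(2)]] fun_module H resolution)
  then show ?thesis using * by (simp add: cocycles_iff[OF G H])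
qed

lemma coboundaries_submodule: "submodule (coboundaries R n G H) R (cocycle_module R n G H)"
proof (rule submoduleI'[OF cocycle_module_is_module])
  show "coboundaries R n G H \<subseteq> carrier (cocycle_module R n G H)" using coboundaries_cocycles by auto
  let ?P = "projective_resolution R G"
  let ?M = "\<lambda>n. hom_module R (term ?P n) H"
  note z = hom_zero_nt[OF resolution(2) H] and nt = hom_add_nt[OF resolution(2) H] hom_smult_nt[OF resolution(2) H]
  interpret M: Module.module R "?M 0" by (rule hom_module_is_module[OF resolution(2) H])
  have [simp]: "\<zero>\<^bsub>?M 0\<^esub> \<oplus>\<^bsub>?M 0\<^esub> \<zero>\<^bsub>?M 0\<^esub> = \<zero>\<^bsub>?M 0\<^esub>" using M.M.l_zero[OF M.M.zero_closed] .
  have zero: "\<zero>\<^bsub>?M n\<^esub> \<in> coboundaries R n G H"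
  proof (cases n)
    case (Suc m)
    show ?thesis unfolding Suc
      by (rule coboundary_diffI[OF z z]) (simp add: nt_closed[OF resolution(5)])
  qed (simp add: coboundary_zeroI)
  then show "\<zero>\<^bsub>cocycle_module R n G H\<^esub> \<in> coboundaries R n G H" by simp
  show "b \<oplus>\<^bsub>cocycle_module R n G H\<^esub> b' \<in> coboundaries R n G H"
    if b: "b \<in> coboundaries R n G H" and b': "b' \<in> coboundaries R n G H" for b b'
  proof (cases n)
    case 0
    then show ?thesis using b b' by (simp add: coboundaries_def)
  next
    case (Suc m)
    from b obtain e where e: "e \<in> nat_trans R (term ?P m) H" "b \<in> nat_trans R (term ?P (Suc m)) H"
      "\<And>V x. V \<in> fd \<Longrightarrow> x \<in> carrier (obj (term ?P (Suc m)) V) \<Longrightarrow> b V x = e V (diff ?P m V x)"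
      using Suc by (auto elim!: coboundary_cases)
    from b' obtain e' where e': "e' \<in> nat_trans R (term ?P m) H" "b' \<in> nat_trans R (term ?P (Suc m)) H"
      "\<And>V x. V \<in> fd \<Longrightarrow> x \<in> carrier (obj (term ?P (Suc m)) V) \<Longrightarrow> b' V x = e' V (diff ?P m V x)"
      using Suc by (auto elim!: coboundary_cases)
    show ?thesis unfolding Suc cocycle_module_simps
      by (rule coboundary_diffI[OF nt(1)[OF e(1) e'(1)] nt(1)[OF e(2) e'(2)]])
        (simp add: e(3) e'(3) nt_closed[OF resolution(5)])
  qed
  show "a \<odot>\<^bsub>cocycle_module R n G H\<^esub> b \<in> coboundaries R n G H"
    if a: "a \<in> carrier R" and b: "b \<in> coboundaries R n G H" for a b
  proof (cases n)
    case 0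
    then show ?thesis using b a M.smult_r_null by (simp add: coboundaries_def)
  next
    case (Suc m)
    from b obtain e where e: "e \<in> nat_trans R (term ?P m) H" "b \<in> nat_trans R (term ?P (Suc m)) H"
      "\<And>V x. V \<in> fd \<Longrightarrow> x \<in> carrier (obj (term ?P (Suc m)) V) \<Longrightarrow> b V x = e V (diff ?P m V x)"
      using Suc by (auto elim!: coboundary_cases)
    show ?thesis unfolding Suc cocycle_module_simps
      by (rule coboundary_diffI[OF nt(2)[OF a e(1)] nt(2)[OF a e(2)]])
        (simp add: e(3) nt_closed[OF resolution(5)])
  qed
qed

lemma ext_carrier: "carrier (ext R n G H) = ext_class R n G H ` cocycles R n G H"
  unfolding ext_def ext_class_def quot_carrier[OF cocycle_module_is_module coboundaries_submodule] by simp

lemma ext_carrier_cocycle: "x \<in> carrier (ext R n G H) \<Longrightarrow> x \<in> cocycles R n G H"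
  unfolding ext_def using quot_carrier_subset[OF cocycle_module_is_module coboundaries_submodule] by simp

lemma ext_class_carrier: "x \<in> carrier (ext R n G H) \<Longrightarrow> ext_class R n G H x = x"
  unfolding ext_def ext_class_def by (rule quot_rep_carrier[OF cocycle_module_is_module coboundaries_submodule])

lemma ext_add: "c \<in> cocycles R n G H \<Longrightarrow> c' \<in> cocycles R n G H \<Longrightarrow>
    ext_class R n G H c \<oplus>\<^bsub>ext R n G H\<^esub> ext_class R n G H c' =
    ext_class R n G H (c \<oplus>\<^bsub>hom_module R (term (projective_resolution R G) n) H\<^esub> c')"
  using quot_add[OF cocycle_module_is_module coboundaries_submodule, of c n c'] by (simp add: ext_def ext_class_def)

lemma ext_smult: "a \<in> carrier R \<Longrightarrow> c \<in> cocycles R n G H \<Longrightarrow>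
    a \<odot>\<^bsub>ext R n G H\<^esub> ext_class R n G H c =
    ext_class R n G H (a \<odot>\<^bsub>hom_module R (term (projective_resolution R G) n) H\<^esub> c)"
  using quot_smult[OF cocycle_module_is_module coboundaries_submodule, of a c n] by (simp add: ext_def ext_class_def)

lemma ext_class_ex:
  assumes "c \<in> cocycles R n G H"
  obtains b where "b \<in> coboundaries R n G H"
    "ext_class R n G H c = b \<oplus>\<^bsub>hom_module R (term (projective_resolution R G) n) H\<^esub> c"
  using quot_rep_ex[OF cocycle_module_is_module coboundaries_submodule, of c n] assms
  by (auto simp: ext_class_def)

lemma ext_class_eqI:
  assumes c: "c \<in> cocycles R n G H" "c' \<in> cocycles R n G H" and b: "b \<in> coboundaries R n G H"
    and eq: "c = b \<oplus>\<^bsub>hom_module R (term (projective_resolution R G) n) H\<^esub> c'"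
  shows "ext_class R n G H c = ext_class R n G H c'"
proof -
  have "c \<ominus>\<^bsub>cocycle_module R n G H\<^esub> c' = b"
    by (rule minus_eqI[OF cocycle_module_is_module]) (use c b eq coboundaries_cocycles in auto)
  then show ?thesis
    unfolding ext_class_def
    using quot_rep_eq_iff[OF cocycle_module_is_module coboundaries_submodule, of c n c'] b c by simp
qed

end

subsection \<open>Operations\<close>

definition op_cochain ::
  "('f, 'u) vfunctor \<Rightarrow> ('f, 'u) vfunctor \<Rightarrow> ('f, 'u) transf \<Rightarrow> ('f, 'u) transf \<Rightarrow> ('f, 'u) transf
     \<Rightarrow> ('f, 'u) transf" where
  "op_cochain A T u \<phi> c = trans_comp R A u (trans_comp R A (precomp_trans R T c) \<phi>)"

lemma op_cochain_apply [simp]: "V \<in> fd \<Longrightarrow> x \<in> carrier (obj A V) \<Longrightarrow>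
    op_cochain A T u \<phi> c V x = u V (c (obj T V) (\<phi> V x))"
  by (simp add: op_cochain_def)

text \<open>
  The data that determine an operation \<open>Ext(G, H) \<rightarrow> Ext(G', H')\<close>.
\<close>

definition op_data ::
  "('f, 'u) vfunctor \<Rightarrow> ('f, 'u) vfunctor \<Rightarrow> ('f, 'u) vfunctor \<Rightarrow> ('f, 'u) vfunctor \<Rightarrow> ('f, 'u) vfunctor
     \<Rightarrow> ('f, 'u) transf \<Rightarrow> ('f, 'u) transf \<Rightarrow> bool" where
  "op_data T G H G' H' g u \<longleftrightarrow> fd_functor T \<and> is_functor R G \<and> is_functor R H \<and> is_functor R G' \<and>
     is_functor R H' \<and> g \<in> nat_trans R G' (G \<circ>\<^sub>F T) \<and> u \<in> nat_trans R (H \<circ>\<^sub>F T) H'"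

lemma op_data_simps:
  assumes "op_data T G H G' H' g u"
  shows "fd_functor T" "is_functor R G" "is_functor R H" "is_functor R G'" "is_functor R H'"
    "g \<in> nat_trans R G' (G \<circ>\<^sub>F T)" "u \<in> nat_trans R (H \<circ>\<^sub>F T) H'"
  using assms by (auto simp: op_data_def)

text \<open>
  The operation sends the class of a cocycle \<open>c : P n \<rightarrow> H\<close> to the class
  of \<open>P' n \<rightarrow> P n \<circ> T \<rightarrow> H \<circ> T \<rightarrow> H'\<close>,
  where the first map is a lift of \<open>g\<close>. Pullbacks, pushforwards, precomposition, the
  map of the theorem and its retraction are all of this form.
\<close>

definition operation ::
  "('f, 'u) vfunctor \<Rightarrow> nat \<Rightarrow> ('f, 'u) vfunctor \<Rightarrow> ('f, 'u) vfunctor \<Rightarrow> ('f, 'u) vfunctor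
     \<Rightarrow> ('f, 'u) vfunctor \<Rightarrow> ('f, 'u) transf \<Rightarrow> ('f, 'u) transf \<Rightarrow> ('f, 'u) transf \<Rightarrow> ('f, 'u) transf" where
  "operation T n G H G' H' g u = (\<lambda>c\<in>carrier (ext R n G H). ext_class R n G' H'
     (op_cochain (term (projective_resolution R G') n) T u
       (chain_lift R (projective_resolution R G') (precomp_complex R T (projective_resolution R G)) g n) c))"

context
  fixes T G H G' H' :: "('f, 'u :: infinite) vfunctor" and g u
  assumes data: "op_data T G H G' H' g u"
begin

private lemma T: "fd_functor T" and G: "is_functor R G" and H: "is_functor R H" and G': "is_functor R G'"
  and H': "is_functor R H'" and g: "g \<in> nat_trans R G' (G \<circ>\<^sub>F T)" and u: "u \<in> nat_trans R (H \<circ>\<^sub>F T) H'"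
  using data by (auto simp: op_data_def)

private abbreviation "P \<equiv> projective_resolution R G"
private abbreviation "P' \<equiv> projective_resolution R G'"
private abbreviation "PT \<equiv> precomp_complex R T P"

private lemma exact_P: "exact_complex G P" by (rule resolution_exact[OF G projective_resolution_resolves[OF G]])
private lemma exact_P': "exact_complex G' P'" by (rule resolution_exact[OF G' projective_resolution_resolves[OF G']])
private lemma exact_PT: "exact_complex (G \<circ>\<^sub>F T) PT" by (rule precomp_exact[OF exact_P T])

private lemmas E = exact_complex_simps[OF exact_P] and E' = exact_complex_simps[OF exact_P']

lemma lift_chain_map: "is_chain_map R P' PT g (chain_lift R P' PT g)"
  by (rule chain_map_exists[OF projective_resolution_resolves[OF G'] G' exact_PT g])

lemma chain_map_simps:
  assumes "is_chain_map R P' PT g \<phi>"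
  shows "\<phi> n \<in> nat_trans R (term P' n) (term P n \<circ>\<^sub>F T)"
    "V \<in> fd \<Longrightarrow> x \<in> carrier (obj (term P' (Suc n)) V) \<Longrightarrow>
       diff P n (obj T V) (\<phi> (Suc n) V x) = \<phi> n V (diff P' n V x)"
  using assms[unfolded chain_map_iff[OF exact_P' exact_PT g]] by auto

lemma op_cochain_nt:
  assumes "is_chain_map R P' PT g \<phi>" and c: "c \<in> nat_trans R (term P n) H"
  shows "op_cochain (term P' n) T u (\<phi> n) c \<in> nat_trans R (term P' n) H'"
  unfolding op_cochain_def
  by (intro trans_comp_nt[OF _ u] trans_comp_nt[OF chain_map_simps(1)[OF assms(1)]] precomp_trans_nt T c E')

lemma op_cochain_add:
  assumes \<phi>: "is_chain_map R P' PT g \<phi>"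
    and c: "c \<in> nat_trans R (term P n) H" and e: "e \<in> nat_trans R (term P n) H"
  shows "op_cochain (term P' n) T u (\<phi> n) (c \<oplus>\<^bsub>hom_module R (term P n) H\<^esub> e) =
    op_cochain (term P' n) T u (\<phi> n) c \<oplus>\<^bsub>hom_module R (term P' n) H'\<^esub> op_cochain (term P' n) T u (\<phi> n) e"
  by (rule nt_eqI[OF op_cochain_nt[OF \<phi> hom_add_nt[OF E(2) H c e]]
        hom_add_nt[OF E'(2) H' op_cochain_nt[OF \<phi> c] op_cochain_nt[OF \<phi> e]]])
    (use nt_closed[OF chain_map_simps(1)[OF \<phi>]] lin_add[OF nt_lin[OF u]] nt_closed[OF c] nt_closed[OF e] in
      \<open>simp add: fd_functor_obj[OF T]\<close>)

lemma op_cochain_smult: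
  assumes \<phi>: "is_chain_map R P' PT g \<phi>"
    and c: "c \<in> nat_trans R (term P n) H" and a: "a \<in> carrier R"
  shows "op_cochain (term P' n) T u (\<phi> n) (a \<odot>\<^bsub>hom_module R (term P n) H\<^esub> c) =
    a \<odot>\<^bsub>hom_module R (term P' n) H'\<^esub> op_cochain (term P' n) T u (\<phi> n) c"
  by (rule nt_eqI[OF op_cochain_nt[OF \<phi> hom_smult_nt[OF E(2) H a c]]
        hom_smult_nt[OF E'(2) H' a op_cochain_nt[OF \<phi> c]]])
    (use nt_closed[OF chain_map_simps(1)[OF \<phi>]] lin_smult[OF nt_lin[OF u]] nt_closed[OF c] a in
      \<open>simp add: fd_functor_obj[OF T]\<close>)

lemma op_cochain_cocycle:
  assumes \<phi>: "is_chain_map R P' PT g \<phi>" and c: "c \<in> cocycles R n G H"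
  shows "op_cochain (term P' n) T u (\<phi> n) c \<in> cocycles R n G' H'"
proof -
  have "u V (c (obj T V) (\<phi> n V (diff P' n V x))) = \<zero>\<^bsub>obj H' V\<^esub>"
    if V: "V \<in> fd" "x \<in> carrier (obj (term P' (Suc n)) V)" for V x
  proof -
    have "c (obj T V) (diff P n (obj T V) (\<phi> (Suc n) V x)) = \<zero>\<^bsub>obj H (obj T V)\<^esub>"
      using c V nt_closed[OF chain_map_simps(1)[OF \<phi>] V] unfolding cocycles_iff[OF G H]
      by (simp add: fd_functor_obj[OF T])
    then show ?thesis
      using V lin_zero[OF nt_lin[OF u V(1)]] fun_module[OF H] fun_module[OF H'] fd_functor_obj[OF T V(1)]
      by (simp add: chain_map_simps(2)[OF \<phi>])
  qed
  then show ?thesis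
    using op_cochain_nt[OF \<phi> cocycle_nt[OF G H c]] by (simp add: cocycles_iff[OF G' H'] nt_closed[OF E'(5)])
qed

lemma op_cochain_coboundary:
  assumes \<phi>: "is_chain_map R P' PT g \<phi>" and b: "b \<in> coboundaries R n G H"
  shows "op_cochain (term P' n) T u (\<phi> n) b \<in> coboundaries R n G' H'"
  using b
proof (cases rule: coboundary_cases[OF G H, consumes 1, case_names zero diff])
  case zero
  have "op_cochain (term P' 0) T u (\<phi> 0) \<zero>\<^bsub>hom_module R (term P 0) H\<^esub> = \<zero>\<^bsub>hom_module R (term P' 0) H'\<^esub>"
    by (rule nt_eqI[OF op_cochain_nt[OF \<phi> hom_zero_nt[OF E(2) H]] hom_zero_nt[OF E'(2) H']])
      (use nt_closed[OF chain_map_simps(1)[OF \<phi>]] lin_zero[OF nt_lin[OF u]] fun_module[OF H] fun_module[OF H'] in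
       \<open>simp add: fd_functor_obj[OF T]\<close>)
  then show ?thesis using zero by (simp add: coboundary_zeroI[OF G' H'])
next
  case (diff m e)
  show ?thesis unfolding diff(1)
    by (rule coboundary_diffI[OF G' H' op_cochain_nt[OF \<phi> diff(2)] op_cochain_nt[OF \<phi> diff(3)[unfolded diff(1)]]])
      (use nt_closed[OF chain_map_simps(1)[OF \<phi>]] in
       \<open>simp add: diff(4) chain_map_simps(2)[OF \<phi>] fd_functor_obj[OF T] nt_closed[OF E'(5)]\<close>)
qed

text \<open>
  If \<open>h\<close> is a homotopy between the lifts, then \<open>c\<close> kills \<open>d
  \<circ> h\<close> because it is a cocycle, and \<open>c \<circ> h \<circ> d\<close> is a
  coboundary.
\<close>

lemma op_cochain_homotopic:
  assumes \<phi>: "is_chain_map R P' PT g \<phi>" and \<psi>: "is_chain_map R P' PT g \<psi>" and c: "c \<in> cocycles R n G H"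
  shows "ext_class R n G' H' (op_cochain (term P' n) T u (\<phi> n) c) =
    ext_class R n G' H' (op_cochain (term P' n) T u (\<psi> n) c)"
proof -
  obtain h where h': "\<And>n. h n \<in> nat_trans R (term P' n) (term PT (Suc n))"
    and h0': "\<And>V x. V \<in> fd \<Longrightarrow> x \<in> carrier (obj (term P' 0) V) \<Longrightarrow>
       \<phi> 0 V x \<ominus>\<^bsub>obj (term PT 0) V\<^esub> \<psi> 0 V x = diff PT 0 V (h 0 V x)"
    and hS': "\<And>n V x. V \<in> fd \<Longrightarrow> x \<in> carrier (obj (term P' (Suc n)) V) \<Longrightarrow>
       \<phi> (Suc n) V x \<ominus>\<^bsub>obj (term PT (Suc n)) V\<^esub> \<psi> (Suc n) V x =
       diff PT (Suc n) V (h (Suc n) V x) \<oplus>\<^bsub>obj (term PT (Suc n)) V\<^esub> h n V (diff P' n V x)"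
    by (rule chain_map_homotopy[OF projective_resolution_resolves[OF G'] G' exact_PT g \<phi> \<psi>]) (rule that)
  have h: "h n \<in> nat_trans R (term P' n) (term P (Suc n) \<circ>\<^sub>F T)" for n using h'[of n] by simp
  have h0: "\<phi> 0 V x \<ominus>\<^bsub>obj (term P 0) (obj T V)\<^esub> \<psi> 0 V x = diff P 0 (obj T V) (h 0 V x)"
    if "V \<in> fd" "x \<in> carrier (obj (term P' 0) V)" for V x using h0'[OF that] that by simp
  have hS: "\<phi> (Suc n) V x \<ominus>\<^bsub>obj (term P (Suc n)) (obj T V)\<^esub> \<psi> (Suc n) V x =
       diff P (Suc n) (obj T V) (h (Suc n) V x) \<oplus>\<^bsub>obj (term P (Suc n)) (obj T V)\<^esub> h n V (diff P' n V x)"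
    if "V \<in> fd" "x \<in> carrier (obj (term P' (Suc n)) V)" for n V x using hS'[OF that] that by simp
  have c_nt: "c \<in> nat_trans R (term P n) H" by (rule cocycle_nt[OF G H c])
  have cd: "c V (diff P n V x) = \<zero>\<^bsub>obj H V\<^esub>" if "V \<in> fd" "x \<in> carrier (obj (term P (Suc n)) V)" for V x
    using c that by (simp add: cocycles_iff[OF G H])
  note uc = lin_comp[OF nt_lin[OF c_nt] nt_lin[OF u, unfolded obj_precomp]]
  have ucd: "u V (c (obj T V) (\<phi> n V x)) =
      u V (c (obj T V) (\<phi> n V x \<ominus>\<^bsub>obj (term P n) (obj T V)\<^esub> \<psi> n V x)) \<oplus>\<^bsub>obj H' V\<^esub> u V (c (obj T V) (\<psi> n V x))"
    if V: "V \<in> fd" "x \<in> carrier (obj (term P' n) V)" for V x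
  proof -
    have TV: "obj T V \<in> fd" by (rule fd_functor_obj[OF T V(1)])
    note cl = nt_closed[OF chain_map_simps(1)[OF \<phi>] V, unfolded obj_precomp]
      nt_closed[OF chain_map_simps(1)[OF \<psi>] V, unfolded obj_precomp]
    note M = fun_module[OF E(2) TV, of n]
    interpret Module.module R "obj (term P n) (obj T V)" by (rule M)
    have cl': "\<phi> n V x \<ominus>\<^bsub>obj (term P n) (obj T V)\<^esub> \<psi> n V x \<in> carrier (obj (term P n) (obj T V))"
      using cl by (rule M.minus_closed)
    have "\<phi> n V x = (\<phi> n V x \<ominus>\<^bsub>obj (term P n) (obj T V)\<^esub> \<psi> n V x) \<oplus>\<^bsub>obj (term P n) (obj T V)\<^esub> \<psi> n V x"
      by (rule minus_add_cancel[OF M cl, symmetric])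
    then have "u V (c (obj T V) (\<phi> n V x)) =
      u V (c (obj T V) ((\<phi> n V x \<ominus>\<^bsub>obj (term P n) (obj T V)\<^esub> \<psi> n V x) \<oplus>\<^bsub>obj (term P n) (obj T V)\<^esub> \<psi> n V x))"
      by simp
    also have "\<dots> = u V (c (obj T V) (\<phi> n V x \<ominus>\<^bsub>obj (term P n) (obj T V)\<^esub> \<psi> n V x)) \<oplus>\<^bsub>obj H' V\<^esub> u V (c (obj T V) (\<psi> n V x))"
      using lin_add[OF nt_lin[OF c_nt TV] cl' cl(2)] lin_add[OF nt_lin[OF u V(1), unfolded obj_precomp]]
        nt_closed[OF c_nt TV cl'] nt_closed[OF c_nt TV cl(2)] by simp
    finally show ?thesis .
  qed
  note o\<phi> = op_cochain_cocycle[OF \<phi> c] and o\<psi> = op_cochain_cocycle[OF \<psi> c]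
  show ?thesis
  proof (cases n)
    case 0
    have "op_cochain (term P' n) T u (\<phi> n) c = op_cochain (term P' n) T u (\<psi> n) c"
    proof (rule nt_eqI[OF op_cochain_nt[OF \<phi> c_nt] op_cochain_nt[OF \<psi> c_nt]])
      fix V x assume V: "V \<in> fd" "x \<in> carrier (obj (term P' n) V)"
      have TV: "obj T V \<in> fd" by (rule fd_functor_obj[OF T V(1)])
      interpret Module.module R "obj H' V" by (rule fun_module[OF H' V(1)])
      have "u V (c (obj T V) (\<phi> n V x \<ominus>\<^bsub>obj (term P n) (obj T V)\<^esub> \<psi> n V x)) = \<zero>\<^bsub>obj H' V\<^esub>"
        using h0 V cd[of "obj T V" "h 0 V x"] nt_closed[OF h V(1), of x 0] TV 0
          lin_zero[OF nt_lin[OF u V(1)]] fun_module[OF H TV] fun_module[OF H' V(1)] by simp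
      then show "op_cochain (term P' n) T u (\<phi> n) c V x = op_cochain (term P' n) T u (\<psi> n) c V x"
        using V ucd[OF V] nt_closed[OF op_cochain_nt[OF \<psi> c_nt] V] by simp
    qed
    then show ?thesis by simp
  next
    case (Suc m)
    let ?b = "op_cochain (term P' (Suc m)) T u (trans_comp R (term P' (Suc m)) (h m) (diff P' m)) c"
    let ?e = "op_cochain (term P' m) T u (h m) c"
    have hm: "h m \<in> nat_trans R (term P' m) (term P n \<circ>\<^sub>F T)" using h[of m] Suc by simp
    have e: "?e \<in> nat_trans R (term P' m) H'"
      unfolding op_cochain_def
      by (intro trans_comp_nt[OF _ u] trans_comp_nt[OF hm] precomp_trans_nt T c_nt E')
    have b: "?b \<in> nat_trans R (term P' (Suc m)) H'"
      unfolding op_cochain_def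
      by (intro trans_comp_nt[OF _ u] trans_comp_nt[OF trans_comp_nt[OF _ hm]] precomp_trans_nt T c_nt E')
    have bc: "?b \<in> coboundaries R n G' H'"
      unfolding Suc by (rule coboundary_diffI[OF G' H' e b]) (simp add: nt_closed[OF E'(5)])
    show ?thesis
    proof (rule ext_class_eqI[OF G' H' o\<phi> o\<psi> bc])
      show "op_cochain (term P' n) T u (\<phi> n) c =
        ?b \<oplus>\<^bsub>hom_module R (term P' n) H'\<^esub> op_cochain (term P' n) T u (\<psi> n) c"
      proof (rule nt_eqI[OF op_cochain_nt[OF \<phi> c_nt] hom_add_nt[OF E'(2) H' _ op_cochain_nt[OF \<psi> c_nt]]])
        show "?b \<in> nat_trans R (term P' n) H'" using b Suc by simp
        fix V x assume V: "V \<in> fd" "x \<in> carrier (obj (term P' n) V)"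
        have TV: "obj T V \<in> fd" by (rule fd_functor_obj[OF T V(1)])
        interpret H: Module.module R "obj H (obj T V)" by (rule fun_module[OF H TV])
        have x: "x \<in> carrier (obj (term P' (Suc m)) V)" using V Suc by simp
        have 1: "h (Suc m) V x \<in> carrier (obj (term P (Suc n)) (obj T V))"
          using nt_closed[OF h V(1) x] Suc by simp
        have 2: "h m V (diff P' m V x) \<in> carrier (obj (term P n) (obj T V))"
          using nt_closed[OF hm V(1) nt_closed[OF E'(5) V(1) x]] by simp
        have "c (obj T V) (\<phi> n V x \<ominus>\<^bsub>obj (term P n) (obj T V)\<^esub> \<psi> n V x) = c (obj T V) (h m V (diff P' m V x))"
          using hS[OF V(1) x] Suc lin_add[OF nt_lin[OF c_nt TV] nt_closed[OF E(5) TV 1] 2] cd[OF TV 1]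
            nt_closed[OF c_nt TV 2] by simp
        then show "op_cochain (term P' n) T u (\<phi> n) c V x =
            (?b \<oplus>\<^bsub>hom_module R (term P' n) H'\<^esub> op_cochain (term P' n) T u (\<psi> n) c) V x"
          using V x ucd[OF V] by simp
      qed
    qed
  qed
qed

text \<open>
  An operation may be computed with any representative of a class and with any lift of
  \<open>g\<close>. All identities between operations rest on this freedom.
\<close>

lemma operation_class:
  assumes c: "c \<in> cocycles R n G H" and \<phi>: "is_chain_map R P' PT g \<phi>"
  shows "operation T n G H G' H' g u (ext_class R n G H c) =
    ext_class R n G' H' (op_cochain (term P' n) T u (\<phi> n) c)"
proof -
  let ?l = "chain_lift R P' PT g"
  obtain b where b: "b \<in> coboundaries R n G H" "ext_class R n G H c = b \<oplus>\<^bsub>hom_module R (term P n) H\<^esub> c"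
    using ext_class_ex[OF G H c] by metis
  have eq: "op_cochain (term P' n) T u (?l n) (ext_class R n G H c) =
      op_cochain (term P' n) T u (?l n) b \<oplus>\<^bsub>hom_module R (term P' n) H'\<^esub> op_cochain (term P' n) T u (?l n) c"
    unfolding b(2)
    by (rule op_cochain_add[OF lift_chain_map cocycle_nt[OF G H coboundaries_cocycles[OF G H b(1)]] cocycle_nt[OF G H c]])
  have ec: "ext_class R n G H c \<in> carrier (ext R n G H)" using c by (simp add: ext_carrier[OF G H])
  have "operation T n G H G' H' g u (ext_class R n G H c) =
      ext_class R n G' H' (op_cochain (term P' n) T u (?l n) (ext_class R n G H c))"
    using ec by (simp add: operation_def)
  also have "\<dots> = ext_class R n G' H' (op_cochain (term P' n) T u (?l n) c)"
    by (rule ext_class_eqI[OF G' H' _ _ op_cochain_coboundary[OF lift_chain_map b(1)] eq])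
      (use ext_carrier_cocycle[OF G H ec] c in \<open>auto intro: op_cochain_cocycle[OF lift_chain_map]\<close>)
  also have "\<dots> = ext_class R n G' H' (op_cochain (term P' n) T u (\<phi> n) c)"
    by (rule op_cochain_homotopic[OF lift_chain_map \<phi> c])
  finally show ?thesis .
qed

lemma operation_linear: "operation T n G H G' H' g u \<in> linear_maps R (ext R n G H) (ext R n G' H')"
proof -
  let ?l = "chain_lift R P' PT g" and ?op = "operation T n G H G' H' g u"
  note cl = operation_class[OF _ lift_chain_map] and oc = op_cochain_cocycle[OF lift_chain_map]
  note ca = submodule_simps(3)[OF hom_module_is_module[OF E(2) H] cocycles_submodule[OF G H]]
    submodule_simps(4)[OF hom_module_is_module[OF E(2) H] cocycles_submodule[OF G H]]
  show ?thesis
  proof (rule linear_mapsI)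
    fix x assume "x \<in> carrier (ext R n G H)"
    then show "?op x \<in> carrier (ext R n G' H')"
      by (auto simp: ext_carrier[OF G H] ext_carrier[OF G' H'] cl oc)
  next
    fix x y assume "x \<in> carrier (ext R n G H)" "y \<in> carrier (ext R n G H)"
    then obtain c e where c: "c \<in> cocycles R n G H" and e: "e \<in> cocycles R n G H"
        and "x = ext_class R n G H c" "y = ext_class R n G H e"
      by (auto simp: ext_carrier[OF G H])
    then show "?op (x \<oplus>\<^bsub>ext R n G H\<^esub> y) = ?op x \<oplus>\<^bsub>ext R n G' H'\<^esub> ?op y"
      by (simp add: ext_add[OF G H] cl[OF c] cl[OF e] cl[OF ca(1)[OF c e]] ext_add[OF G' H'] oc op_cochain_add[OF lift_chain_map] cocycle_nt[OF G H])
  next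
    fix a x assume a: "a \<in> carrier R" and "x \<in> carrier (ext R n G H)"
    then obtain c where c: "c \<in> cocycles R n G H" and "x = ext_class R n G H c"
      by (auto simp: ext_carrier[OF G H])
    then show "?op (a \<odot>\<^bsub>ext R n G H\<^esub> x) = a \<odot>\<^bsub>ext R n G' H'\<^esub> ?op x"
      using a by (simp add: ext_smult[OF G H] cl[OF c] cl[OF ca(2)[OF a c]] ext_smult[OF G' H'] oc op_cochain_smult[OF lift_chain_map] cocycle_nt[OF G H])
  qed (simp add: operation_def)
qed

end

text \<open>
  If \<open>\<phi>\<close> lifts \<open>g1\<close> and \<open>\<psi>\<close> lifts
  \<open>g2\<close>, then \<open>\<phi> T2 \<circ> \<psi>\<close> lifts \<open>g1 T2 \<circ>
  g2\<close>.
\<close>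

lemma operation_comp:
  fixes G :: "('f, 'u :: infinite) vfunctor"
  assumes d1: "op_data T1 G H G' H' g1 u1" and d2: "op_data T2 G' H' G'' H'' g2 u2"
    and x: "x \<in> carrier (ext R n G H)"
  shows "operation T2 n G' H' G'' H'' g2 u2 (operation T1 n G H G' H' g1 u1 x) =
    operation (T1 \<circ>\<^sub>F T2) n G H G'' H'' (trans_comp R G'' (precomp_trans R T2 g1) g2)
      (trans_comp R (H \<circ>\<^sub>F T1 \<circ>\<^sub>F T2) u2 (precomp_trans R T2 u1)) x"
proof -
  note T1 = op_data_simps[OF d1] and T2 = op_data_simps[OF d2]
  let ?P = "projective_resolution R G" and ?P' = "projective_resolution R G'" and ?P'' = "projective_resolution R G''"
  let ?g = "trans_comp R G'' (precomp_trans R T2 g1) g2"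
  let ?u = "trans_comp R (H \<circ>\<^sub>F T1 \<circ>\<^sub>F T2) u2 (precomp_trans R T2 u1)"
  have d: "op_data (T1 \<circ>\<^sub>F T2) G H G'' H'' ?g ?u"
    unfolding op_data_def precomp_assoc
    by (intro conjI trans_comp_nt[OF T2(6)] trans_comp_nt[OF _ T2(7)] precomp_trans_nt
        precomp_functor fd_functor_precomp T1 T2)
  note T = op_data_simps[OF d]
  let ?\<phi> = "chain_lift R ?P' (precomp_complex R T1 ?P) g1"
  let ?\<psi> = "chain_lift R ?P'' (precomp_complex R T2 ?P') g2"
  note EP = resolution_exact[OF T1(2) projective_resolution_resolves[OF T1(2)]]
    and EP' = resolution_exact[OF T2(2) projective_resolution_resolves[OF T2(2)]]
    and EP'' = resolution_exact[OF T2(4) projective_resolution_resolves[OF T2(4)]]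
  note E'' = exact_complex_simps[OF EP'']
  have \<phi>: "is_chain_map R ?P' (precomp_complex R T1 ?P) g1 ?\<phi>" by (rule lift_chain_map[OF d1])
  have \<psi>: "is_chain_map R ?P'' (precomp_complex R T2 ?P') g2 ?\<psi>" by (rule lift_chain_map[OF d2])
  note \<phi>' = \<phi>[unfolded chain_map_iff[OF EP' precomp_exact[OF EP T1(1)] T1(6)]]
  note \<psi>' = \<psi>[unfolded chain_map_iff[OF EP'' precomp_exact[OF EP' T2(1)] T2(6)]]
  define \<chi> where "\<chi> k = trans_comp R (term ?P'' k) (precomp_trans R T2 (?\<phi> k)) (?\<psi> k)" for k
  have \<phi>n: "?\<phi> k \<in> nat_trans R (term ?P' k) (term ?P k \<circ>\<^sub>F T1)" for k using \<phi>' by simp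
  have \<psi>n: "?\<psi> k \<in> nat_trans R (term ?P'' k) (term ?P' k \<circ>\<^sub>F T2)" for k using \<psi>' by simp
  have \<chi>: "is_chain_map R ?P'' (precomp_complex R (T1 \<circ>\<^sub>F T2) ?P) ?g \<chi>"
    unfolding chain_map_iff[OF EP'' precomp_exact[OF EP T(1)] T(6)]
  proof (intro conjI allI ballI)
    fix k
    show "\<chi> k \<in> nat_trans R (term ?P'' k) (term (precomp_complex R (T1 \<circ>\<^sub>F T2) ?P) k)"
      unfolding \<chi>_def precomp_complex_simps precomp_assoc
      by (rule trans_comp_nt[OF \<psi>n precomp_trans_nt[OF T2(1) \<phi>n] E''(2)])
  next
    fix V :: "('f, 'u) module" and x assume V: "V \<in> fd" and x: "x \<in> carrier (obj (term ?P'' 0) V)"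
    have TV: "obj T2 V \<in> fd" by (rule fd_functor_obj[OF T2(1) V])
    show "aug (precomp_complex R (T1 \<circ>\<^sub>F T2) ?P) V (\<chi> 0 V x) = ?g V (aug ?P'' V x)"
      using \<phi>' \<psi>' V x TV nt_closed[OF \<psi>n V x] nt_closed[OF E''(6) V x]
      by (simp add: \<chi>_def)
  next
    fix k and V :: "('f, 'u) module" and x assume V: "V \<in> fd" and x: "x \<in> carrier (obj (term ?P'' (Suc k)) V)"
    have TV: "obj T2 V \<in> fd" by (rule fd_functor_obj[OF T2(1) V])
    show "diff (precomp_complex R (T1 \<circ>\<^sub>F T2) ?P) k V (\<chi> (Suc k) V x) = \<chi> k V (diff ?P'' k V x)"
      using \<phi>' \<psi>' V x TV nt_closed[OF \<psi>n V x] nt_closed[OF E''(5) V x]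
      by (simp add: \<chi>_def)
  qed
  have xc: "x \<in> cocycles R n G H" by (rule ext_carrier_cocycle[OF T1(2,3) x])
  have xx: "ext_class R n G H x = x" by (rule ext_class_carrier[OF T1(2,3) x])
  let ?c1 = "op_cochain (term ?P' n) T1 u1 (?\<phi> n) x"
  have "operation T2 n G' H' G'' H'' g2 u2 (operation T1 n G H G' H' g1 u1 x) =
      ext_class R n G'' H'' (op_cochain (term ?P'' n) T2 u2 (?\<psi> n) ?c1)"
    using operation_class[OF d1 xc \<phi>] operation_class[OF d2 op_cochain_cocycle[OF d1 \<phi> xc] \<psi>] by (simp add: xx)
  also have "op_cochain (term ?P'' n) T2 u2 (?\<psi> n) ?c1 = op_cochain (term ?P'' n) (T1 \<circ>\<^sub>F T2) ?u (\<chi> n) x"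
    by (rule nt_eqI[OF op_cochain_nt[OF d2 \<psi> op_cochain_nt[OF d1 \<phi> cocycle_nt[OF T1(2,3) xc]]]
          op_cochain_nt[OF d \<chi> cocycle_nt[OF T1(2,3) xc]]])
      (use nt_closed[OF \<psi>n] nt_closed[OF \<phi>n] nt_closed[OF cocycle_nt[OF T1(2,3) xc]] in
        \<open>simp add: \<chi>_def fd_functor_obj T1(1) T2(1)\<close>)
  also have "ext_class R n G'' H'' \<dots> = operation (T1 \<circ>\<^sub>F T2) n G H G'' H'' ?g ?u x"
    using operation_class[OF d xc \<chi>] by (simp add: xx)
  finally show ?thesis .
qed

text \<open>
  The lift of \<open>G(\<alpha>)\<close> to be used is \<open>P(\<alpha>)\<close>. A cocycle
  \<open>c\<close> is natural, so \<open>c T \<circ> P(\<alpha>) = H(\<alpha>) \<circ> c\<close>,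
  which \<open>u\<close> takes back to \<open>c\<close>.
\<close>

lemma operation_identity:
  fixes G :: "('f, 'u :: infinite) vfunctor"
  assumes G: "is_functor R G" and H: "is_functor R H" and T: "fd_functor T"
    and \<alpha>: "\<alpha> \<in> nat_trans R id_functor T" and u: "u \<in> nat_trans R (H \<circ>\<^sub>F T) H"
    and uH: "\<And>V x. V \<in> fd \<Longrightarrow> x \<in> carrier (obj H V) \<Longrightarrow> u V (mor H V (obj T V) (\<alpha> V) x) = x"
    and x: "x \<in> carrier (ext R n G H)"
  shows "operation T n G H G H (postcomp_trans R G id_functor T \<alpha>) u x = x"
proof -
  let ?P = "projective_resolution R G" and ?g = "postcomp_trans R G id_functor T \<alpha>"
  have P: "exact_complex G ?P" by (rule resolution_exact[OF G projective_resolution_resolves[OF G]])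
  note E = exact_complex_simps[OF P]
  have post: "postcomp_trans R F id_functor T \<alpha> \<in> nat_trans R F (F \<circ>\<^sub>F T)" if "is_functor R F" for F
    using postcomp_trans_nt[OF that fd_functor_id T \<alpha>] by simp
  have d: "op_data T G H G H ?g u"
    using G H T u post[OF G] by (simp add: op_data_def)
  define \<phi> where "\<phi> n = postcomp_trans R (term ?P n) id_functor T \<alpha>" for n
  have \<phi>: "is_chain_map R ?P (precomp_complex R T ?P) ?g \<phi>"
    unfolding chain_map_iff[OF P precomp_exact[OF P T] post[OF G]]
    using nt_nat[OF E(6)] nt_nat[OF E(5)] nt_lin[OF \<alpha>]
    by (auto simp: \<phi>_def post[OF E(2)] fd_functor_obj[OF T])
  have xc: "x \<in> cocycles R n G H" by (rule ext_carrier_cocycle[OF G H x])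
  have xx: "ext_class R n G H x = x" by (rule ext_class_carrier[OF G H x])
  note xn = cocycle_nt[OF G H xc]
  have "op_cochain (term ?P n) T u (\<phi> n) x = x"
    by (rule nt_eqI[OF op_cochain_nt[OF d \<phi> xn] xn])
      (use nt_nat[OF xn] nt_lin[OF \<alpha>] nt_closed[OF xn] in \<open>simp add: \<phi>_def fd_functor_obj[OF T] uH\<close>)
  then show ?thesis using operation_class[OF d xc \<phi>] by (simp add: xx)
qed

lemma op_data_push:
  "is_functor R G \<Longrightarrow> is_functor R H \<Longrightarrow> is_functor R H' \<Longrightarrow> h \<in> nat_trans R H H' \<Longrightarrow>
    op_data id_functor G H G H' (id_trans R G) h"
  by (simp add: op_data_def fd_functor_id id_trans_nt)

lemma op_data_pull:
  "is_functor R G \<Longrightarrow> is_functor R H \<Longrightarrow> is_functor R G' \<Longrightarrow> g \<in> nat_trans R G' G \<Longrightarrow>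
    op_data id_functor G H G' H g (id_trans R H)"
  by (simp add: op_data_def fd_functor_id id_trans_nt)

lemma op_data_precomp:
  "is_functor R G \<Longrightarrow> is_functor R H \<Longrightarrow> fd_functor F \<Longrightarrow>
    op_data F G H (G \<circ>\<^sub>F F) (H \<circ>\<^sub>F F) (id_trans R (G \<circ>\<^sub>F F)) (id_trans R (H \<circ>\<^sub>F F))"
  by (simp add: op_data_def precomp_functor id_trans_nt)

lemma precomp_complex_id:
  assumes "exact_complex G X"
  shows "precomp_complex R id_functor X = X"
proof (rule aug_complex.equality)
  show "term (precomp_complex R id_functor X) = term X" by (rule ext) simp
  show "diff (precomp_complex R id_functor X) = diff X"
    by (rule ext) (simp add: precomp_trans_id_functor[OF exact_complex_simps(5)[OF assms]])
  show "aug (precomp_complex R id_functor X) = aug X"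
    by (simp add: precomp_trans_id_functor[OF exact_complex_simps(6)[OF assms]])
qed simp

text \<open>
  The identity of the resolution of \<open>G\<close> lifts the identity of \<open>G\<close>.
\<close>

lemma ext_push_operation:
  fixes G :: "('f, 'u :: infinite) vfunctor"
  assumes G: "is_functor R G" and H: "is_functor R H" and H': "is_functor R H'" and h: "h \<in> nat_trans R H H'"
    and x: "x \<in> carrier (ext R n G H)"
  shows "ext_push R n G H H' h x = operation id_functor n G H G H' (id_trans R G) h x"
proof -
  let ?P = "projective_resolution R G"
  note d = op_data_push[OF G H H' h]
  have P: "exact_complex G ?P" by (rule resolution_exact[OF G projective_resolution_resolves[OF G]])
  note E = exact_complex_simps[OF P]
  have \<phi>: "is_chain_map R ?P (precomp_complex R id_functor ?P) (id_trans R G) (\<lambda>n. id_trans R (term ?P n))"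
    unfolding precomp_complex_id[OF P] chain_map_iff[OF P P id_trans_nt[OF G]]
    by (simp add: id_trans_nt E(2) nt_closed[OF E(6)] nt_closed[OF E(5)])
  have xc: "x \<in> cocycles R n G H" by (rule ext_carrier_cocycle[OF G H x])
  have "op_cochain (term ?P n) id_functor h (id_trans R (term ?P n)) x = trans_comp R (term ?P n) h x"
    using cocycle_nt[OF G H xc] by (simp add: op_cochain_def precomp_trans_id_functor trans_comp_id_right)
  then show ?thesis
    using operation_class[OF d xc \<phi>] x by (simp add: ext_class_carrier[OF G H x] ext_push_def)
qed

lemma ext_pull_operation:
  fixes G :: "('f, 'u :: infinite) vfunctor"
  assumes G: "is_functor R G" and H: "is_functor R H" and G': "is_functor R G'" and g: "g \<in> nat_trans R G' G"
    and x: "x \<in> carrier (ext R n G H)"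
  shows "ext_pull R n G' G H g x = operation id_functor n G H G' H g (id_trans R H) x"
proof -
  let ?P = "projective_resolution R G" and ?P' = "projective_resolution R G'"
  note d = op_data_pull[OF G H G' g]
  have P: "exact_complex G ?P" by (rule resolution_exact[OF G projective_resolution_resolves[OF G]])
  have P': "exact_complex G' ?P'" by (rule resolution_exact[OF G' projective_resolution_resolves[OF G']])
  have xc: "x \<in> cocycles R n G H" by (rule ext_carrier_cocycle[OF G H x])
  have "chain_lift R ?P' ?P g n \<in> nat_trans R (term ?P' n) (term ?P n)"
    using chain_map_simps(1)[OF d lift_chain_map[OF d]] by (simp add: precomp_complex_id[OF P])
  then have "op_cochain (term ?P' n) id_functor (id_trans R H) (chain_lift R ?P' ?P g n) x =
      trans_comp R (term ?P' n) x (chain_lift R ?P' ?P g n)"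
    using cocycle_nt[OF G H xc] trans_comp_nt[OF _ cocycle_nt[OF G H xc]] exact_complex_simps(2)[OF P']
    by (simp add: op_cochain_def precomp_trans_id_functor trans_comp_id_left)
  then show ?thesis
    using x by (simp add: operation_def precomp_complex_id[OF P] ext_pull_def Let_def)
qed

lemma ext_precomp_operation:
  fixes G :: "('f, 'u :: infinite) vfunctor"
  assumes G: "is_functor R G" and H: "is_functor R H" and F: "fd_functor F"
    and x: "x \<in> carrier (ext R n G H)"
  shows "ext_precomp R n F G H x =
    operation F n G H (G \<circ>\<^sub>F F) (H \<circ>\<^sub>F F) (id_trans R (G \<circ>\<^sub>F F)) (id_trans R (H \<circ>\<^sub>F F)) x"
proof -
  let ?P = "projective_resolution R G" and ?Q = "projective_resolution R (G \<circ>\<^sub>F F)"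
  note d = op_data_precomp[OF G H F]
  have Q: "exact_complex (G \<circ>\<^sub>F F) ?Q"
    by (rule resolution_exact[OF precomp_functor[OF G F] projective_resolution_resolves[OF precomp_functor[OF G F]]])
  have xc: "x \<in> cocycles R n G H" by (rule ext_carrier_cocycle[OF G H x])
  have "trans_comp R (term ?Q n) (precomp_trans R F x)
      (chain_lift R ?Q (precomp_complex R F ?P) (id_trans R (G \<circ>\<^sub>F F)) n) \<in> nat_trans R (term ?Q n) (H \<circ>\<^sub>F F)"
    using chain_map_simps(1)[OF d lift_chain_map[OF d]]
    by (rule trans_comp_nt) (rule precomp_trans_nt[OF F cocycle_nt[OF G H xc]], rule exact_complex_simps(2)[OF Q])
  then show ?thesis
    using x by (simp add: operation_def ext_precomp_def Let_def op_cochain_def trans_comp_id_left)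
qed

lemma ext_induced_operation:
  fixes G :: "('f, 'u :: infinite) vfunctor"
  assumes G: "is_functor R G" and H: "is_functor R H" and F1: "fd_functor F1" and F2: "fd_functor F2"
    and f: "f \<in> nat_trans R F1 F2" and x: "x \<in> carrier (ext R n G H)"
  shows "ext_induced R F1 F2 f n G H x =
    operation F1 n G H (G \<circ>\<^sub>F F1) (H \<circ>\<^sub>F F2) (id_trans R (G \<circ>\<^sub>F F1)) (postcomp_trans R H F1 F2 f) x"
proof -
  note fnc = precomp_functor[OF G F1] precomp_functor[OF H F1] precomp_functor[OF H F2]
  note post = postcomp_trans_nt[OF H F1 F2 f]
  note d1 = op_data_precomp[OF G H F1] and d2 = op_data_push[OF fnc post]
  have "operation F1 n G H (G \<circ>\<^sub>F F1) (H \<circ>\<^sub>F F1) (id_trans R (G \<circ>\<^sub>F F1)) (id_trans R (H \<circ>\<^sub>F F1)) x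
      \<in> carrier (ext R n (G \<circ>\<^sub>F F1) (H \<circ>\<^sub>F F1))"
    by (rule lin_closed[OF operation_linear[OF d1] x])
  then have "ext_induced R F1 F2 f n G H x = operation id_functor n (G \<circ>\<^sub>F F1) (H \<circ>\<^sub>F F1) (G \<circ>\<^sub>F F1) (H \<circ>\<^sub>F F2)
      (id_trans R (G \<circ>\<^sub>F F1)) (postcomp_trans R H F1 F2 f)
      (operation F1 n G H (G \<circ>\<^sub>F F1) (H \<circ>\<^sub>F F1) (id_trans R (G \<circ>\<^sub>F F1)) (id_trans R (H \<circ>\<^sub>F F1)) x)"
    using x by (simp add: ext_induced_def compose_eq ext_precomp_operation[OF G H F1]
        ext_push_operation[OF fnc post])
  also have "\<dots> = operation F1 n G H (G \<circ>\<^sub>F F1) (H \<circ>\<^sub>F F2) (id_trans R (G \<circ>\<^sub>F F1)) (postcomp_trans R H F1 F2 f) x"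
    unfolding operation_comp[OF d1 d2 x]
    by (simp add: precomp_trans_id_functor[OF id_trans_nt] fnc trans_comp_id_right[OF id_trans_nt] trans_comp_id_right[OF post])
  finally show ?thesis .
qed

section \<open>The retraction\<close>

text \<open>
  The retraction is the operation given by \<open>T\<close>, \<open>G(\<alpha>)\<close> and
  \<open>H(\<beta>)\<close>. By \<open>operation_comp\<close>, the two sides of each naturality
  statement are operations with the same functor; that they have the same transformations is a
  naturality square for \<open>g\<close> or \<open>h\<close>.
\<close>

lemma ext_induced_split:
  fixes F1 F2 T :: "('f, 'u :: infinite) vfunctor"
  assumes F1: "fd_functor F1" and F2: "fd_functor F2" and f: "f \<in> nat_trans R F1 F2" and T: "fd_functor T"
    and \<alpha>: "\<alpha> \<in> nat_trans R id_functor (F1 \<circ>\<^sub>F T)" and \<beta>: "\<beta> \<in> nat_trans R (F2 \<circ>\<^sub>F T) id_functor"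
    and id: "\<And>V x. V \<in> fd \<Longrightarrow> x \<in> carrier V \<Longrightarrow> \<beta> V (f (obj T V) (\<alpha> V x)) = x"
  shows "(\<forall>n G H. is_functor R G \<longrightarrow> is_functor R H \<longrightarrow>
            ext_induced R F1 F2 f n G H \<in> linear_maps R (ext R n G H) (ext R n (G \<circ>\<^sub>F F1) (H \<circ>\<^sub>F F2)) \<and>
            inj_on (ext_induced R F1 F2 f n G H) (carrier (ext R n G H))) \<and>
         (\<exists>\<rho>.
           (\<forall>n G H. is_functor R G \<longrightarrow> is_functor R H \<longrightarrow>
              \<rho> n G H \<in> linear_maps R (ext R n (G \<circ>\<^sub>F F1) (H \<circ>\<^sub>F F2)) (ext R n G H) \<and>
              (\<forall>x\<in>carrier (ext R n G H). \<rho> n G H (ext_induced R F1 F2 f n G H x) = x)) \<and>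
           (\<forall>n G G' H g. is_functor R G \<longrightarrow> is_functor R G' \<longrightarrow> is_functor R H \<longrightarrow>
              g \<in> nat_trans R G' G \<longrightarrow>
              (\<forall>x\<in>carrier (ext R n G H).
                 ext_induced R F1 F2 f n G' H (ext_pull R n G' G H g x) =
                 ext_pull R n (G' \<circ>\<^sub>F F1) (G \<circ>\<^sub>F F1) (H \<circ>\<^sub>F F2) (precomp_trans R F1 g) (ext_induced R F1 F2 f n G H x)) \<and>
              (\<forall>y\<in>carrier (ext R n (G \<circ>\<^sub>F F1) (H \<circ>\<^sub>F F2)).
                 \<rho> n G' H (ext_pull R n (G' \<circ>\<^sub>F F1) (G \<circ>\<^sub>F F1) (H \<circ>\<^sub>F F2) (precomp_trans R F1 g) y) =
                 ext_pull R n G' G H g (\<rho> n G H y))) \<and>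
           (\<forall>n G H H' h. is_functor R G \<longrightarrow> is_functor R H \<longrightarrow> is_functor R H' \<longrightarrow>
              h \<in> nat_trans R H H' \<longrightarrow>
              (\<forall>x\<in>carrier (ext R n G H).
                 ext_induced R F1 F2 f n G H' (ext_push R n G H H' h x) =
                 ext_push R n (G \<circ>\<^sub>F F1) (H \<circ>\<^sub>F F2) (H' \<circ>\<^sub>F F2) (precomp_trans R F2 h) (ext_induced R F1 F2 f n G H x)) \<and>
              (\<forall>y\<in>carrier (ext R n (G \<circ>\<^sub>F F1) (H \<circ>\<^sub>F F2)).
                 \<rho> n G H' (ext_push R n (G \<circ>\<^sub>F F1) (H \<circ>\<^sub>F F2) (H' \<circ>\<^sub>F F2) (precomp_trans R F2 h) y) =
                 ext_push R n G H H' h (\<rho> n G H y))))"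
    (is "(\<forall>n G H. _ \<longrightarrow> _ \<longrightarrow> ?I n G H) \<and> _")
proof -
  let ?S = "F1 \<circ>\<^sub>F T" and ?S2 = "F2 \<circ>\<^sub>F T"
  let ?g = "\<lambda>G. postcomp_trans R G id_functor ?S \<alpha>" and ?u = "\<lambda>H. postcomp_trans R H ?S2 id_functor \<beta>"
  let ?f = "\<lambda>H. postcomp_trans R H F1 F2 f"
  define \<rho> where "\<rho> n G H = operation T n (G \<circ>\<^sub>F F1) (H \<circ>\<^sub>F F2) G H (?g G) (?u H)" for n G H
  have S: "fd_functor ?S" and S2: "fd_functor ?S2" using F1 F2 T by (simp_all add: fd_functor_precomp)
  have g: "?g G \<in> nat_trans R G (G \<circ>\<^sub>F F1 \<circ>\<^sub>F T)" if "is_functor R G" for G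
    using postcomp_trans_nt[OF that fd_functor_id S \<alpha>] by (simp add: precomp_assoc)
  have u: "?u H \<in> nat_trans R (H \<circ>\<^sub>F F2 \<circ>\<^sub>F T) H" if "is_functor R H" for H
    using postcomp_trans_nt[OF that S2 fd_functor_id \<beta>] by (simp add: precomp_assoc)
  have fH: "?f H \<in> nat_trans R (H \<circ>\<^sub>F F1) (H \<circ>\<^sub>F F2)" if "is_functor R H" for H
    by (rule postcomp_trans_nt[OF that F1 F2 f])
  have d\<rho>: "op_data T (G \<circ>\<^sub>F F1) (H \<circ>\<^sub>F F2) G H (?g G) (?u H)" if "is_functor R G" "is_functor R H" for G H
    using that g u by (simp add: op_data_def T precomp_functor F1 F2)
  have di: "op_data F1 G H (G \<circ>\<^sub>F F1) (H \<circ>\<^sub>F F2) (id_trans R (G \<circ>\<^sub>F F1)) (?f H)"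
    if "is_functor R G" "is_functor R H" for G H
    using that fH by (simp add: op_data_def F1 F2 precomp_functor id_trans_nt)
  note fnc = precomp_functor[OF _ F1] precomp_functor[OF _ F2]
  note ind = ext_induced_operation[OF _ _ F1 F2 f]
  have ind_lin: "ext_induced R F1 F2 f n G H \<in> linear_maps R (ext R n G H) (ext R n (G \<circ>\<^sub>F F1) (H \<circ>\<^sub>F F2))"
    if GH: "is_functor R G" "is_functor R H" for n G H
  proof -
    have "ext_induced R F1 F2 f n G H = operation F1 n G H (G \<circ>\<^sub>F F1) (H \<circ>\<^sub>F F2) (id_trans R (G \<circ>\<^sub>F F1)) (?f H)"
      by (rule extensionalityI[of _ "carrier (ext R n G H)"])
        (use ind[OF GH] in \<open>auto simp: ext_induced_def operation_def\<close>)
    then show ?thesis using operation_linear[OF di[OF GH]] by simp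
  qed
  have \<rho>_lin: "\<rho> n G H \<in> linear_maps R (ext R n (G \<circ>\<^sub>F F1) (H \<circ>\<^sub>F F2)) (ext R n G H)"
    if "is_functor R G" "is_functor R H" for n G H
    unfolding \<rho>_def by (rule operation_linear[OF d\<rho>[OF that]])
  have retr: "\<rho> n G H (ext_induced R F1 F2 f n G H x) = x"
    if GH: "is_functor R G" "is_functor R H" and x: "x \<in> carrier (ext R n G H)" for n G H x
  proof -
    let ?U = "trans_comp R (H \<circ>\<^sub>F F1 \<circ>\<^sub>F T) (?u H) (precomp_trans R T (?f H))"
    have U: "?U \<in> nat_trans R (H \<circ>\<^sub>F ?S) H"
      unfolding precomp_assoc
      by (rule trans_comp_nt[OF precomp_trans_nt[OF T fH] u]) (use GH F1 T in \<open>auto intro!: precomp_functor\<close>)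
    have UH: "?U V (mor H V (obj ?S V) (\<alpha> V) y) = y" if V: "V \<in> fd" "y \<in> carrier (obj H V)" for V y
    proof -
      have TV: "obj T V \<in> fd" by (rule fd_functor_obj[OF T V(1)])
      have F: "obj F1 (obj T V) \<in> fd" "obj F2 (obj T V) \<in> fd"
        using fd_functor_obj F1 F2 TV by blast+
      note l = nt_lin[OF \<alpha> V(1), simplified] nt_lin[OF f TV] nt_lin[OF \<beta> V(1), simplified]
      have cl: "mor H V (obj F1 (obj T V)) (\<alpha> V) y \<in> carrier (obj H (obj F1 (obj T V)))"
        by (rule fun_closed[OF GH(2) V(1) F(1) l(1) V(2)])
      have "?U V (mor H V (obj ?S V) (\<alpha> V) y) = mor H (obj F2 (obj T V)) V (\<beta> V)
          (mor H (obj F1 (obj T V)) (obj F2 (obj T V)) (f (obj T V)) (mor H V (obj F1 (obj T V)) (\<alpha> V) y))"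
        using V TV cl by simp
      also have "\<dots> = mor H V V (compose (carrier V) (\<beta> V) (compose (carrier V) (f (obj T V)) (\<alpha> V))) y"
        unfolding fun_comp[OF GH(2) V(1) F l(1,2) V(2)]
        by (rule fun_comp[OF GH(2) V(1) F(2) V(1) lin_comp[OF l(1,2) fd_module[OF V(1)]] l(3) V(2)])
      also have "compose (carrier V) (\<beta> V) (compose (carrier V) (f (obj T V)) (\<alpha> V)) = (\<lambda>x\<in>carrier V. x)"
        using id[OF V(1)] by (auto simp: compose_def)
      finally show ?thesis unfolding fun_id[OF GH(2) V] .
    qed
    have "trans_comp R G (precomp_trans R T (id_trans R (G \<circ>\<^sub>F F1))) (?g G) = ?g G"
      using trans_comp_id_left[OF g[OF GH(1)]] by (simp add: precomp_trans_id_trans[OF T])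
    then have "\<rho> n G H (ext_induced R F1 F2 f n G H x) = operation ?S n G H G H (?g G) ?U x"
      unfolding \<rho>_def ind[OF GH x] operation_comp[OF di[OF GH] d\<rho>[OF GH] x] by simp
    then show ?thesis
      using operation_identity[OF GH S \<alpha> U UH x] by simp
  qed
  have pull_ind: "ext_induced R F1 F2 f n G' H (ext_pull R n G' G H g x) =
       ext_pull R n (G' \<circ>\<^sub>F F1) (G \<circ>\<^sub>F F1) (H \<circ>\<^sub>F F2) (precomp_trans R F1 g) (ext_induced R F1 F2 f n G H x)"
    if GH: "is_functor R G" "is_functor R H" and G': "is_functor R G'" and g: "g \<in> nat_trans R G' G"
      and x: "x \<in> carrier (ext R n G H)" for n G G' H g x
  proof -
    note gF = precomp_trans_nt[OF F1 g]
    note dg = op_data_pull[OF GH G' g] and dgF = op_data_pull[OF fnc(1)[OF GH(1)] fnc(2)[OF GH(2)] fnc(1)[OF G'] gF]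
    have "ext_pull R n G' G H g x \<in> carrier (ext R n G' H)"
      using lin_closed[OF operation_linear[OF dg] x] by (simp add: ext_pull_operation[OF GH G' g x])
    then have "ext_induced R F1 F2 f n G' H (ext_pull R n G' G H g x) =
        operation F1 n G H (G' \<circ>\<^sub>F F1) (H \<circ>\<^sub>F F2) (precomp_trans R F1 g) (?f H) x"
      using operation_comp[OF dg di[OF G' GH(2)] x] trans_comp_id_right[OF gF] trans_comp_id_right[OF fH[OF GH(2)]]
      by (simp add: ind[OF G' GH(2)] ext_pull_operation[OF GH G' g x] precomp_trans_id_trans[OF F1])
    moreover have "ext_pull R n (G' \<circ>\<^sub>F F1) (G \<circ>\<^sub>F F1) (H \<circ>\<^sub>F F2) (precomp_trans R F1 g) (ext_induced R F1 F2 f n G H x) =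
        operation F1 n G H (G' \<circ>\<^sub>F F1) (H \<circ>\<^sub>F F2) (precomp_trans R F1 g) (?f H) x"
      using operation_comp[OF di[OF GH] dgF x] trans_comp_id_left[OF gF] trans_comp_id_left[OF fH[OF GH(2)]]
        ext_pull_operation[OF fnc(1)[OF GH(1)] fnc(2)[OF GH(2)] fnc(1)[OF G'] gF lin_closed[OF ind_lin[OF GH] x]]
      by (simp add: ind[OF GH x] precomp_trans_id_functor[OF id_trans_nt] fnc GH precomp_trans_id_functor[OF fH[OF GH(2)]])
    ultimately show ?thesis by simp
  qed
  have pull_\<rho>: "\<rho> n G' H (ext_pull R n (G' \<circ>\<^sub>F F1) (G \<circ>\<^sub>F F1) (H \<circ>\<^sub>F F2) (precomp_trans R F1 g') y) =
        ext_pull R n G' G H g' (\<rho> n G H y)"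
    if GH: "is_functor R G" "is_functor R H" and G': "is_functor R G'" and g': "g' \<in> nat_trans R G' G"
      and y: "y \<in> carrier (ext R n (G \<circ>\<^sub>F F1) (H \<circ>\<^sub>F F2))" for n G G' H g' y
  proof -
    note gF = precomp_trans_nt[OF F1 g']
    note dg = op_data_pull[OF GH G' g'] and dgF = op_data_pull[OF fnc(1)[OF GH(1)] fnc(2)[OF GH(2)] fnc(1)[OF G'] gF]
    let ?k = "trans_comp R G' (?g G) g'"
    have k: "trans_comp R G' (precomp_trans R T (precomp_trans R F1 g')) (?g G') = ?k"
    proof (rule nt_eqI[OF trans_comp_nt[OF g[OF G'] precomp_trans_nt[OF T gF] G'] trans_comp_nt[OF g' g[OF GH(1)] G']])
      fix V x assume V: "V \<in> fd" "x \<in> carrier (obj G' V)"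
      then show "trans_comp R G' (precomp_trans R T (precomp_trans R F1 g')) (?g G') V x = ?k V x"
        using nt_nat[OF g' V(1) _ nt_lin[OF \<alpha> V(1), simplified] V(2)] fd_functor_obj[OF S V(1)]
          fd_functor_obj[OF T V(1)] by simp
    qed
    have "\<rho> n G' H (ext_pull R n (G' \<circ>\<^sub>F F1) (G \<circ>\<^sub>F F1) (H \<circ>\<^sub>F F2) (precomp_trans R F1 g') y) =
        operation T n (G \<circ>\<^sub>F F1) (H \<circ>\<^sub>F F2) G' H ?k (?u H) y"
      using operation_comp[OF dgF d\<rho>[OF G' GH(2)] y] trans_comp_id_right[OF u[OF GH(2)]]
      by (simp add: \<rho>_def ext_pull_operation[OF fnc(1)[OF GH(1)] fnc(2)[OF GH(2)] fnc(1)[OF G'] gF y] k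
          precomp_trans_id_trans[OF T])
    moreover have "ext_pull R n G' G H g' (\<rho> n G H y) = operation T n (G \<circ>\<^sub>F F1) (H \<circ>\<^sub>F F2) G' H ?k (?u H) y"
      using operation_comp[OF d\<rho>[OF GH] dg y] trans_comp_id_left[OF u[OF GH(2)]]
        ext_pull_operation[OF GH G' g' lin_closed[OF \<rho>_lin[OF GH] y]]
      by (simp add: \<rho>_def precomp_trans_id_functor[OF g[OF GH(1)]] precomp_trans_id_functor[OF u[OF GH(2)]])
    ultimately show ?thesis by simp
  qed
  have push_ind: "ext_induced R F1 F2 f n G H' (ext_push R n G H H' h x) =
       ext_push R n (G \<circ>\<^sub>F F1) (H \<circ>\<^sub>F F2) (H' \<circ>\<^sub>F F2) (precomp_trans R F2 h) (ext_induced R F1 F2 f n G H x)"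
    if GH: "is_functor R G" "is_functor R H" and H': "is_functor R H'" and h: "h \<in> nat_trans R H H'"
      and x: "x \<in> carrier (ext R n G H)" for n G H H' h x
  proof -
    note hF = precomp_trans_nt[OF F2 h]
    note dh = op_data_push[OF GH H' h] and dhF = op_data_push[OF fnc(1)[OF GH(1)] fnc(2)[OF GH(2)] fnc(2)[OF H'] hF]
    let ?k = "trans_comp R (H \<circ>\<^sub>F F1) (precomp_trans R F2 h) (?f H)"
    have k: "trans_comp R (H \<circ>\<^sub>F F1) (?f H') (precomp_trans R F1 h) = ?k"
    proof (rule nt_eqI[OF trans_comp_nt[OF precomp_trans_nt[OF F1 h] fH[OF H'] fnc(1)[OF GH(2)]]
            trans_comp_nt[OF fH[OF GH(2)] hF fnc(1)[OF GH(2)]]])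
      fix V x assume V: "V \<in> fd" "x \<in> carrier (obj (H \<circ>\<^sub>F F1) V)"
      then show "trans_comp R (H \<circ>\<^sub>F F1) (?f H') (precomp_trans R F1 h) V x = ?k V x"
        using nt_nat[OF h fd_functor_obj[OF F1 V(1)] fd_functor_obj[OF F2 V(1)] nt_lin[OF f V(1)]] by simp
    qed
    have "ext_push R n G H H' h x \<in> carrier (ext R n G H')"
      using lin_closed[OF operation_linear[OF dh] x] by (simp add: ext_push_operation[OF GH H' h x])
    then have "ext_induced R F1 F2 f n G H' (ext_push R n G H H' h x) =
        operation F1 n G H (G \<circ>\<^sub>F F1) (H' \<circ>\<^sub>F F2) (id_trans R (G \<circ>\<^sub>F F1)) ?k x"
      using operation_comp[OF dh di[OF GH(1) H'] x] trans_comp_id_right[OF id_trans_nt[OF fnc(1)[OF GH(1)]]]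
      by (simp add: ind[OF GH(1) H'] ext_push_operation[OF GH H' h x] precomp_trans_id_trans[OF F1] k)
    moreover have "ext_push R n (G \<circ>\<^sub>F F1) (H \<circ>\<^sub>F F2) (H' \<circ>\<^sub>F F2) (precomp_trans R F2 h) (ext_induced R F1 F2 f n G H x) =
        operation F1 n G H (G \<circ>\<^sub>F F1) (H' \<circ>\<^sub>F F2) (id_trans R (G \<circ>\<^sub>F F1)) ?k x"
      using operation_comp[OF di[OF GH] dhF x] trans_comp_id_left[OF id_trans_nt[OF fnc(1)[OF GH(1)]]]
        ext_push_operation[OF fnc(1)[OF GH(1)] fnc(2)[OF GH(2)] fnc(2)[OF H'] hF lin_closed[OF ind_lin[OF GH] x]]
      by (simp add: ind[OF GH x] precomp_trans_id_functor[OF id_trans_nt] fnc GH precomp_trans_id_functor[OF fH[OF GH(2)]])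
    ultimately show ?thesis by simp
  qed
  have push_\<rho>: "\<rho> n G H' (ext_push R n (G \<circ>\<^sub>F F1) (H \<circ>\<^sub>F F2) (H' \<circ>\<^sub>F F2) (precomp_trans R F2 h) y) =
        ext_push R n G H H' h (\<rho> n G H y)"
    if GH: "is_functor R G" "is_functor R H" and H': "is_functor R H'" and h: "h \<in> nat_trans R H H'"
      and y: "y \<in> carrier (ext R n (G \<circ>\<^sub>F F1) (H \<circ>\<^sub>F F2))" for n G H H' h y
  proof -
    note hF = precomp_trans_nt[OF F2 h]
    note dh = op_data_push[OF GH H' h] and dhF = op_data_push[OF fnc(1)[OF GH(1)] fnc(2)[OF GH(2)] fnc(2)[OF H'] hF]
    let ?k = "trans_comp R (H \<circ>\<^sub>F F2 \<circ>\<^sub>F T) h (?u H)"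
    have HFT: "is_functor R (H \<circ>\<^sub>F F2 \<circ>\<^sub>F T)" by (intro precomp_functor GH F2 T)
    have k: "trans_comp R (H \<circ>\<^sub>F F2 \<circ>\<^sub>F T) (?u H') (precomp_trans R T (precomp_trans R F2 h)) = ?k"
    proof (rule nt_eqI[OF trans_comp_nt[OF precomp_trans_nt[OF T hF] u[OF H'] HFT] trans_comp_nt[OF u[OF GH(2)] h HFT]])
      fix V x assume V: "V \<in> fd" "x \<in> carrier (obj (H \<circ>\<^sub>F F2 \<circ>\<^sub>F T) V)"
      then show "trans_comp R (H \<circ>\<^sub>F F2 \<circ>\<^sub>F T) (?u H') (precomp_trans R T (precomp_trans R F2 h)) V x = ?k V x"
        using nt_nat[OF h _ V(1) nt_lin[OF \<beta> V(1), simplified]] fd_functor_obj[OF S2 V(1)]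
          fd_functor_obj[OF T V(1)] by simp
    qed
    have "\<rho> n G H' (ext_push R n (G \<circ>\<^sub>F F1) (H \<circ>\<^sub>F F2) (H' \<circ>\<^sub>F F2) (precomp_trans R F2 h) y) =
        operation T n (G \<circ>\<^sub>F F1) (H \<circ>\<^sub>F F2) G H' (?g G) ?k y"
      using operation_comp[OF dhF d\<rho>[OF GH(1) H'] y] trans_comp_id_left[OF g[OF GH(1)]]
      by (simp add: \<rho>_def ext_push_operation[OF fnc(1)[OF GH(1)] fnc(2)[OF GH(2)] fnc(2)[OF H'] hF y] k
          precomp_trans_id_trans[OF T])
    moreover have "ext_push R n G H H' h (\<rho> n G H y) = operation T n (G \<circ>\<^sub>F F1) (H \<circ>\<^sub>F F2) G H' (?g G) ?k y"
      using operation_comp[OF d\<rho>[OF GH] dh y] trans_comp_id_right[OF g[OF GH(1)]]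
        ext_push_operation[OF GH H' h lin_closed[OF \<rho>_lin[OF GH] y]]
      by (simp add: \<rho>_def precomp_trans_id_functor[OF g[OF GH(1)]] precomp_trans_id_functor[OF u[OF GH(2)]])
    ultimately show ?thesis by simp
  qed
  have inj: "inj_on (ext_induced R F1 F2 f n G H) (carrier (ext R n G H))"
    if "is_functor R G" "is_functor R H" for n G H
    by (rule inj_on_inverseI) (rule retr[OF that])
  show ?thesis
    by (intro conjI exI[of _ \<rho>] allI impI ballI)
      ((rule ind_lin inj \<rho>_lin retr pull_ind pull_\<rho> push_ind push_\<rho>; assumption)+)
qed

section \<open>The difference functor\<close>

definition line_proj :: "('f, 'u) module \<Rightarrow> 'u \<Rightarrow> 'u" where
  "line_proj V = (\<lambda>z\<in>carrier (plus_line_space R V). fst (pair_decode R z))"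

text \<open>
  The idempotent endomorphism \<open>(x, r) \<mapsto> (x, 0)\<close> of \<open>V \<oplus>
  R\<close>.
\<close>

definition line_kill :: "('f, 'u) module \<Rightarrow> 'u \<Rightarrow> 'u" where
  "line_kill V = compose (carrier (plus_line_space R V)) (plus_line_incl R V) (line_proj V)"

lemma obj_plus_line [simp]: "obj (plus_line R) V = plus_line_space R V"
  by (simp add: plus_line_def)

lemma mor_plus_line [simp]:
  fixes V :: "('f, 'u :: infinite) module"
  shows "x \<in> carrier V \<Longrightarrow> r \<in> carrier R \<Longrightarrow> mor (plus_line R) V W f (pair_code R (x, r)) = pair_code R (f x, r)"
  by (simp add: plus_line_def)

lemma line_proj_apply [simp]:
  fixes V :: "('f, 'u :: infinite) module"
  shows "x \<in> carrier V \<Longrightarrow> r \<in> carrier R \<Longrightarrow> line_proj V (pair_code R (x, r)) = x"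
  by (simp add: line_proj_def)

lemma line_kill_apply [simp]:
  fixes V :: "('f, 'u :: infinite) module"
  shows "x \<in> carrier V \<Longrightarrow> r \<in> carrier R \<Longrightarrow> line_kill V (pair_code R (x, r)) = pair_code R (x, \<zero>)"
  by (simp add: line_kill_def compose_eq plus_line_incl_def)

lemma plus_line_eqI:
  fixes V :: "('f, 'u :: infinite) module"
  assumes "f \<in> linear_maps R (plus_line_space R V) M" "g \<in> linear_maps R (plus_line_space R V) N"
    and "\<And>x r. x \<in> carrier V \<Longrightarrow> r \<in> carrier R \<Longrightarrow> f (pair_code R (x, r)) = g (pair_code R (x, r))"
  shows "f = g"
  by (rule lin_eqI[OF assms(1,2)]) (auto elim!: plus_line_cases simp: assms(3))

lemma plus_line_mor_linear:
  fixes V W :: "('f, 'u :: infinite) module"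
  assumes V: "V \<in> fd" and f: "f \<in> linear_maps R V W"
  shows "mor (plus_line R) V W f \<in> linear_maps R (plus_line_space R V) (plus_line_space R W)"
  unfolding plus_line_def vfunctor.simps
  by (rule line_linearI[OF V, of "\<lambda>x r. pair_code R (f x, r)"])
    (auto simp: lin_closed[OF f] lin_add[OF f] lin_smult[OF f])

lemma fd_functor_plus_line: "fd_functor (plus_line R :: ('f, 'u :: infinite) vfunctor)"
  unfolding fd_functor_def
proof (intro conjI is_functorI ballI)
  fix V :: "('f, 'u) module" assume V: "V \<in> fd"
  show "obj (plus_line R) V \<in> fd" by (simp add: plus_line_fd[OF V])
  show "Module.module R (obj (plus_line R) V)" by (simp add: fd_module plus_line_fd[OF V])
  show "mor (plus_line R) V V (\<lambda>x\<in>carrier V. x) x = x" if "x \<in> carrier (obj (plus_line R) V)" for x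
    using that by (auto elim!: plus_line_cases)
next
  fix V W :: "('f, 'u) module" and f assume "V \<in> fd" "f \<in> linear_maps R V W"
  then show "mor (plus_line R) V W f \<in> linear_maps R (obj (plus_line R) V) (obj (plus_line R) W)"
    using plus_line_mor_linear by simp
next
  fix U V W :: "('f, 'u) module" and f g x
  assume "f \<in> linear_maps R U V" "g \<in> linear_maps R V W" "x \<in> carrier (obj (plus_line R) U)"
  then show "mor (plus_line R) U W (compose (carrier U) g f) x =
     mor (plus_line R) V W g (mor (plus_line R) U V f x)"
    by (auto elim!: plus_line_cases simp: compose_eq lin_closed)
qed

lemma plus_line_incl_linear:
  fixes V :: "('f, 'u :: infinite) module"
  assumes V: "V \<in> fd"
  shows "plus_line_incl R V \<in> linear_maps R V (plus_line_space R V)"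
proof -
  interpret Module.module R V by (rule fd_module[OF V])
  show ?thesis unfolding plus_line_incl_def by (rule linear_mapsI) auto
qed

lemma line_proj_linear:
  fixes V :: "('f, 'u :: infinite) module"
  assumes V: "V \<in> fd"
  shows "line_proj V \<in> linear_maps R (plus_line_space R V) V"
  unfolding line_proj_def by (rule line_linearI[OF V, of "\<lambda>x r. x"]) auto

lemma line_kill_linear:
  fixes V :: "('f, 'u :: infinite) module"
  assumes V: "V \<in> fd"
  shows "line_kill V \<in> linear_maps R (plus_line_space R V) (plus_line_space R V)"
  unfolding line_kill_def
  by (rule lin_comp[OF line_proj_linear[OF V] plus_line_incl_linear[OF V] fd_module[OF plus_line_fd[OF V]]])

lemma incl_natural: "(\<lambda>V\<in>fd. plus_line_incl R V) \<in> nat_trans R id_functor (plus_line R :: ('f, 'u :: infinite) vfunctor)"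
  by (rule ntI) (auto simp: plus_line_incl_linear lin_closed, auto simp: plus_line_incl_def lin_closed)

lemma kill_natural:
  "(\<lambda>V\<in>fd. line_kill V) \<in> nat_trans R (plus_line R) (plus_line R :: ('f, 'u :: infinite) vfunctor)"
  by (rule ntI) (auto simp: line_kill_linear elim!: plus_line_cases, simp add: lin_closed)

abbreviation difference_sub :: "('f, 'u) vfunctor \<Rightarrow> ('f, 'u) module \<Rightarrow> 'u set" where
  "difference_sub F V \<equiv> mor F V (plus_line_space R V) (plus_line_incl R V) ` carrier (obj F V)"

lemma difference_subfunctor:
  fixes F :: "('f, 'u :: infinite) vfunctor"
  assumes F: "is_functor R F"
  shows "is_subfunctor R (F \<circ>\<^sub>F plus_line R) (difference_sub F)"
proof -
  let ?t = "postcomp_trans R F id_functor (plus_line R) (\<lambda>V\<in>fd. plus_line_incl R V)"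
  have "?t \<in> nat_trans R F (F \<circ>\<^sub>F plus_line R)"
    using postcomp_trans_nt[OF F fd_functor_id fd_functor_plus_line incl_natural] by simp
  from image_subfunctor[OF F precomp_functor[OF F fd_functor_plus_line] this]
  show ?thesis unfolding is_subfunctor_def by simp
qed

lemma difference_functor:
  fixes F :: "('f, 'u :: infinite) vfunctor"
  assumes F: "is_functor R F"
  shows "is_functor R (difference R F)"
  unfolding difference_def
  by (rule quot_functor_functor[OF precomp_functor[OF F fd_functor_plus_line] difference_subfunctor[OF F]])

text \<open>
  The idempotent \<open>1 - F(line_kill)\<close> of \<open>F(V \<oplus> R)\<close> vanishes on the
  image of \<open>F(V)\<close>. So it factors through the difference functor, and the
  factorisation is a section \<open>s\<close> of the projection \<open>q\<close>.
\<close>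

lemma difference_split:
  fixes F :: "('f, 'u :: infinite) vfunctor"
  assumes F: "is_functor R F"
  obtains q s where "q \<in> nat_trans R (F \<circ>\<^sub>F plus_line R) (difference R F)"
    "s \<in> nat_trans R (difference R F) (F \<circ>\<^sub>F plus_line R)"
    "\<And>V x. V \<in> fd \<Longrightarrow> x \<in> carrier (obj F (plus_line_space R V)) \<Longrightarrow>
      s V (q V x) = x \<ominus>\<^bsub>obj F (plus_line_space R V)\<^esub> mor F (plus_line_space R V) (plus_line_space R V) (line_kill V) x"
    "\<And>V y. V \<in> fd \<Longrightarrow> y \<in> carrier (obj (difference R F) V) \<Longrightarrow> q V (s V y) = y"
    "\<And>V y. V \<in> fd \<Longrightarrow> y \<in> carrier (obj (difference R F) V) \<Longrightarrow>
      mor F (plus_line_space R V) (plus_line_space R V) (line_kill V) (s V y) = \<zero>\<^bsub>obj F (plus_line_space R V)\<^esub>"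
proof -
  let ?FL = "F \<circ>\<^sub>F plus_line R" and ?D = "difference_sub F"
  let ?q = "quot_trans ?FL ?D"
  let ?e = "postcomp_trans R F (plus_line R) (plus_line R) (\<lambda>V\<in>fd. line_kill V)"
  have FL: "is_functor R ?FL" by (rule precomp_functor[OF F fd_functor_plus_line])
  note D = difference_subfunctor[OF F]
  have e: "?e \<in> nat_trans R ?FL ?FL"
    by (rule postcomp_trans_nt[OF F fd_functor_plus_line fd_functor_plus_line kill_natural])
  let ?k = "id_trans R ?FL \<ominus>\<^bsub>hom_module R ?FL ?FL\<^esub> ?e"
  have k_nt: "?k \<in> nat_trans R ?FL ?FL" by (rule hom_minus_nt[OF FL FL id_trans_nt[OF FL] e])
  have k: "?k V x = x \<ominus>\<^bsub>obj F (plus_line_space R V)\<^esub> mor F (plus_line_space R V) (plus_line_space R V) (line_kill V) x"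
    if "V \<in> fd" "x \<in> carrier (obj F (plus_line_space R V))" for V x
    using hom_minus_apply[OF FL FL id_trans_nt[OF FL] e that(1)] that by simp
  have 0: "\<forall>x\<in>?D V. ?k V x = \<zero>\<^bsub>obj ?FL V\<^esub>" if V: "V \<in> fd" for V
  proof
    fix x assume "x \<in> ?D V"
    then obtain y where y: "y \<in> carrier (obj F V)" "x = mor F V (plus_line_space R V) (plus_line_incl R V) y" by blast
    note LV = plus_line_fd[OF V] and i = plus_line_incl_linear[OF V]
    have x: "x \<in> carrier (obj F (plus_line_space R V))" unfolding y(2) by (rule fun_closed[OF F V LV i y(1)])
    have "compose (carrier V) (line_kill V) (plus_line_incl R V) = plus_line_incl R V"
      by (auto simp: compose_def plus_line_incl_def restrict_def fun_eq_iff)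
    then have "mor F (plus_line_space R V) (plus_line_space R V) (line_kill V) x = x"
      unfolding y(2) by (simp only: fun_comp[OF F V LV LV i line_kill_linear[OF V] y(1)])
    then show "?k V x = \<zero>\<^bsub>obj ?FL V\<^esub>"
      using k[OF V x] minus_eq_zero_iff[OF fun_module[OF F LV] x x] by simp
  qed
  obtain s where s: "s \<in> nat_trans R (difference R F) ?FL"
    "\<And>V x. V \<in> fd \<Longrightarrow> x \<in> carrier (obj ?FL V) \<Longrightarrow> s V (?q V x) = ?k V x"
    by (rule quot_lift_nt[OF FL D FL k_nt, folded difference_def]) (rule 0, assumption, rule that)
  have q: "?q \<in> nat_trans R ?FL (difference R F)"
    unfolding difference_def by (rule quot_trans_nt[OF FL D])
  have sq: "s V (?q V x) = x \<ominus>\<^bsub>obj F (plus_line_space R V)\<^esub>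
      mor F (plus_line_space R V) (plus_line_space R V) (line_kill V) x"
    if "V \<in> fd" "x \<in> carrier (obj F (plus_line_space R V))" for V x
    using s(2)[OF that(1)] that k[OF that] by simp
  have qs: "?q V (s V y) = y" and ks: "mor F (plus_line_space R V) (plus_line_space R V) (line_kill V) (s V y) =
        \<zero>\<^bsub>obj F (plus_line_space R V)\<^esub>"
    if V: "V \<in> fd" and y: "y \<in> carrier (obj (difference R F) V)" for V y
  proof -
    let ?L = "plus_line_space R V"
    let ?E = "mor F ?L ?L (line_kill V)"
    note LV = plus_line_fd[OF V] and i = plus_line_incl_linear[OF V] and p = line_proj_linear[OF V]
    note M = fun_module[OF F LV] and Mq = fun_module[OF difference_functor[OF F] V]
    obtain x where x': "x \<in> carrier (obj ?FL V)" and yx: "y = ?q V x"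
      by (rule quot_functor_elem[OF FL D V y[unfolded difference_def]])
    have x: "x \<in> carrier (obj F ?L)" using x' by simp
    have E: "?E \<in> linear_maps R (obj F ?L) (obj F ?L)" by (rule fun_lin[OF F LV LV line_kill_linear[OF V]])
    have Ex: "?E x \<in> carrier (obj F ?L)" by (rule lin_closed[OF E x])
    have "?E x = mor F V ?L (plus_line_incl R V) (mor F ?L V (line_proj V) x)"
      unfolding fun_comp[OF F LV V LV p i x] line_kill_def by (rule refl)
    then have "?E x \<in> ?D V" using fun_closed[OF F LV V p x] by blast
    then have 0: "?q V (?E x) = \<zero>\<^bsub>obj (difference R F) V\<^esub>"
      using quot_trans_zero_iff[OF FL D V] Ex unfolding difference_def by simp
    note ql = nt_lin[OF q V, unfolded obj_precomp obj_plus_line]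
    interpret Q: Module.module R "obj (difference R F) V" by (rule Mq)
    have "?q V (s V y) = ?q V x \<ominus>\<^bsub>obj (difference R F) V\<^esub> ?q V (?E x)"
      unfolding yx sq[OF V x] by (rule lin_minus[OF ql M Mq x Ex])
    also have "\<dots> = y"
      unfolding 0 using y yx by (intro minus_eqI[OF Mq]) auto
    finally show qs: "?q V (s V y) = y" .
    have sy: "s V y \<in> carrier (obj F ?L)" using nt_closed[OF s(1) V y] by simp
    have EE: "?E (?E x) = ?E x"
    proof -
      have "compose (carrier ?L) (line_kill V) (line_kill V) = line_kill V"
        by (rule plus_line_eqI[OF lin_comp[OF line_kill_linear[OF V] line_kill_linear[OF V] fd_module[OF LV]]
              line_kill_linear[OF V]]) (simp add: compose_eq)
      then show ?thesis by (simp only: fun_comp[OF F LV LV LV line_kill_linear[OF V] line_kill_linear[OF V] x])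
    qed
    have "?E (s V y) = ?E x \<ominus>\<^bsub>obj F ?L\<^esub> ?E (?E x)"
      unfolding yx sq[OF V x] by (rule lin_minus[OF E M M x Ex])
    then show "?E (s V y) = \<zero>\<^bsub>obj F ?L\<^esub>"
      unfolding EE using minus_eq_zero_iff[OF M Ex Ex] by simp
  qed
  show ?thesis by (rule that[OF q s(1) sq qs ks])
qed

definition identity_retract :: "('f, 'u) vfunctor \<Rightarrow> ('f, 'u) vfunctor \<Rightarrow> ('f, 'u) transf \<Rightarrow> bool" where
  "identity_retract F1 F2 f \<longleftrightarrow> (\<exists>T \<alpha> \<beta>. fd_functor T \<and> \<alpha> \<in> nat_trans R id_functor (F1 \<circ>\<^sub>F T) \<and>
     \<beta> \<in> nat_trans R (F2 \<circ>\<^sub>F T) id_functor \<and>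
     (\<forall>V\<in>fd. \<forall>x\<in>carrier V. \<beta> V (f (obj T V) (\<alpha> V x)) = x))"

definition is_mono :: "('f, 'u) vfunctor \<Rightarrow> ('f, 'u) transf \<Rightarrow> bool" where
  "is_mono A t \<longleftrightarrow> (\<forall>V\<in>fd. inj_on (t V) (carrier (obj A V)))"

lemma linear_inj_onI:
  assumes f: "f \<in> linear_maps R M N" and M: "Module.module R M" and N: "Module.module R N"
    and 0: "\<And>x. x \<in> carrier M \<Longrightarrow> f x = \<zero>\<^bsub>N\<^esub> \<Longrightarrow> x = \<zero>\<^bsub>M\<^esub>"
  shows "inj_on f (carrier M)"
proof (rule inj_onI)
  interpret M: Module.module R M by fact
  fix x y assume xy: "x \<in> carrier M" "y \<in> carrier M" "f x = f y"
  then have "f (x \<ominus>\<^bsub>M\<^esub> y) = \<zero>\<^bsub>N\<^esub>"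
    using lin_minus[OF f M N xy(1,2)] minus_eq_zero_iff[OF N lin_closed[OF f xy(1)] lin_closed[OF f xy(2)]] by simp
  then show "x = y" using 0 minus_eq_zero_iff[OF M xy(1,2)] xy by simp
qed

text \<open>
  The maps \<open>e'\<close> and \<open>m'\<close> are the differences of \<open>e\<close> and
  \<open>m\<close>, formed as \<open>q \<circ> e \<circ> s\<close> and \<open>q \<circ> m \<circ>
  s\<close>. They stay epi and mono because \<open>e\<close> and \<open>m\<close> commute with the
  idempotents \<open>s \<circ> q\<close>. For the last claim, \<open>\<alpha>\<close> is composed
  with \<open>s\<close>, \<open>\<beta>\<close> with \<open>q\<close>, and \<open>T\<close> is
  replaced by \<open>T \<oplus> R\<close>.
\<close>

lemma identity_retract_difference:
  fixes F1 F2 I :: "('f, 'u :: infinite) vfunctor"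
  assumes F1: "is_functor R F1" and F2: "is_functor R F2" and I: "is_functor R I"
    and e: "e \<in> nat_trans R F1 I" and m: "m \<in> nat_trans R I F2"
    and epi: "is_epi R F1 I e" and mono: "is_mono I m"
  obtains e' m' where "e' \<in> nat_trans R (difference R F1) (difference R I)"
    "m' \<in> nat_trans R (difference R I) (difference R F2)"
    "is_epi R (difference R F1) (difference R I) e'" "is_mono (difference R I) m'"
    "identity_retract (difference R F1) (difference R F2) (trans_comp R (difference R F1) m' e') \<Longrightarrow>
     identity_retract F1 F2 (trans_comp R F1 m e)"
proof -
  let ?L = "plus_line_space R"
  let ?K = "\<lambda>F V. mor F (?L V) (?L V) (line_kill V)"
  obtain q1 s1 where q1: "q1 \<in> nat_trans R (F1 \<circ>\<^sub>F plus_line R) (difference R F1)"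
    and s1: "s1 \<in> nat_trans R (difference R F1) (F1 \<circ>\<^sub>F plus_line R)"
    and sq1: "\<And>V x. V \<in> fd \<Longrightarrow> x \<in> carrier (obj F1 (?L V)) \<Longrightarrow> s1 V (q1 V x) = x \<ominus>\<^bsub>obj F1 (?L V)\<^esub> ?K F1 V x"
    and qs1: "\<And>V y. V \<in> fd \<Longrightarrow> y \<in> carrier (obj (difference R F1) V) \<Longrightarrow> q1 V (s1 V y) = y"
    and ks1: "\<And>V y. V \<in> fd \<Longrightarrow> y \<in> carrier (obj (difference R F1) V) \<Longrightarrow> ?K F1 V (s1 V y) = \<zero>\<^bsub>obj F1 (?L V)\<^esub>"
    by (rule difference_split[OF F1]) (rule that)
  obtain q2 s2 where q2: "q2 \<in> nat_trans R (F2 \<circ>\<^sub>F plus_line R) (difference R F2)"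
    and s2: "s2 \<in> nat_trans R (difference R F2) (F2 \<circ>\<^sub>F plus_line R)"
    and sq2: "\<And>V x. V \<in> fd \<Longrightarrow> x \<in> carrier (obj F2 (?L V)) \<Longrightarrow> s2 V (q2 V x) = x \<ominus>\<^bsub>obj F2 (?L V)\<^esub> ?K F2 V x"
    by (rule difference_split[OF F2]) (rule that)
  obtain qI sI where qI: "qI \<in> nat_trans R (I \<circ>\<^sub>F plus_line R) (difference R I)"
    and sI: "sI \<in> nat_trans R (difference R I) (I \<circ>\<^sub>F plus_line R)"
    and sqI: "\<And>V x. V \<in> fd \<Longrightarrow> x \<in> carrier (obj I (?L V)) \<Longrightarrow> sI V (qI V x) = x \<ominus>\<^bsub>obj I (?L V)\<^esub> ?K I V x"
    and qsI: "\<And>V y. V \<in> fd \<Longrightarrow> y \<in> carrier (obj (difference R I) V) \<Longrightarrow> qI V (sI V y) = y"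
    and ksI: "\<And>V y. V \<in> fd \<Longrightarrow> y \<in> carrier (obj (difference R I) V) \<Longrightarrow> ?K I V (sI V y) = \<zero>\<^bsub>obj I (?L V)\<^esub>"
    by (rule difference_split[OF I]) (rule that)
  note L = fd_functor_plus_line
  have cl: "V \<in> fd \<Longrightarrow> y \<in> carrier (obj (difference R F1) V) \<Longrightarrow> s1 V y \<in> carrier (obj F1 (?L V))"
    "V \<in> fd \<Longrightarrow> y \<in> carrier (obj (difference R I) V) \<Longrightarrow> sI V y \<in> carrier (obj I (?L V))"
    "V \<in> fd \<Longrightarrow> x \<in> carrier (obj F1 (?L V)) \<Longrightarrow> q1 V x \<in> carrier (obj (difference R F1) V)"
    "V \<in> fd \<Longrightarrow> x \<in> carrier (obj I (?L V)) \<Longrightarrow> qI V x \<in> carrier (obj (difference R I) V)"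
    "V \<in> fd \<Longrightarrow> x \<in> carrier (obj F2 (?L V)) \<Longrightarrow> q2 V x \<in> carrier (obj (difference R F2) V)"
    for V y x
    using nt_closed[OF s1, of V y] nt_closed[OF sI, of V y] nt_closed[OF q1, of V x] nt_closed[OF qI, of V x]
      nt_closed[OF q2, of V x] by simp_all
  let ?e = "trans_comp R (difference R F1) qI (trans_comp R (difference R F1) (precomp_trans R (plus_line R) e) s1)"
  let ?m = "trans_comp R (difference R I) q2 (trans_comp R (difference R I) (precomp_trans R (plus_line R) m) sI)"
  note d1 = difference_functor[OF F1] and dI = difference_functor[OF I] and d2 = difference_functor[OF F2]
  have e': "?e \<in> nat_trans R (difference R F1) (difference R I)"
    by (rule trans_comp_nt[OF trans_comp_nt[OF s1 precomp_trans_nt[OF L e] d1] qI d1])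
  have m': "?m \<in> nat_trans R (difference R I) (difference R F2)"
    by (rule trans_comp_nt[OF trans_comp_nt[OF sI precomp_trans_nt[OF L m] dI] q2 dI])
  have Ke: "sI V (qI V (e (?L V) x)) = e (?L V) (s1 V (q1 V x))"
    if V: "V \<in> fd" and x: "x \<in> carrier (obj F1 (?L V))" for V x
  proof -
    note LV = plus_line_fd[OF V] and k = line_kill_linear[OF V]
    show ?thesis
      unfolding sq1[OF V x] sqI[OF V nt_closed[OF e LV x]]
        lin_minus[OF nt_lin[OF e LV] fun_module[OF F1 LV] fun_module[OF I LV] x fun_closed[OF F1 LV LV k x]]
        nt_nat[OF e LV LV k x] by (rule refl)
  qed
  have Km: "s2 V (q2 V (m (?L V) x)) = m (?L V) (sI V (qI V x))"
    if V: "V \<in> fd" and x: "x \<in> carrier (obj I (?L V))" for V x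
  proof -
    note LV = plus_line_fd[OF V] and k = line_kill_linear[OF V]
    show ?thesis
      unfolding sqI[OF V x] sq2[OF V nt_closed[OF m LV x]]
        lin_minus[OF nt_lin[OF m LV] fun_module[OF I LV] fun_module[OF F2 LV] x fun_closed[OF I LV LV k x]]
        nt_nat[OF m LV LV k x] by (rule refl)
  qed
  show ?thesis
  proof (rule that[OF e' m'])
    show "is_epi R (difference R F1) (difference R I) ?e"
      unfolding is_epi_def
    proof (intro ballI equalityI subsetI)
      fix V y assume "V \<in> (fd :: ('f, 'u) module set)" "y \<in> ?e V ` carrier (obj (difference R F1) V)"
      then show "y \<in> carrier (obj (difference R I) V)" using nt_closed[OF e'] by auto
    next
      fix V :: "('f, 'u) module" and y assume V: "V \<in> fd" and y: "y \<in> carrier (obj (difference R I) V)"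
      note LV = plus_line_fd[OF V]
      have "sI V y \<in> e (?L V) ` carrier (obj F1 (?L V))"
        using epi[unfolded is_epi_def] LV cl(2)[OF V y] by simp
      then obtain x where x: "x \<in> carrier (obj F1 (?L V))" "sI V y = e (?L V) x" by auto
      have "?e V (q1 V x) = qI V (sI V (qI V (e (?L V) x)))"
        using V by (simp add: cl x Ke)
      also have "\<dots> = y" unfolding x(2)[symmetric] by (simp add: qsI[OF V] y cl V)
      finally show "y \<in> ?e V ` carrier (obj (difference R F1) V)"
        using cl(3)[OF V x(1)] by (metis imageI)
    qed
    show "is_mono (difference R I) ?m"
      unfolding is_mono_def
    proof
      fix V :: "('f, 'u) module" assume V: "V \<in> fd"
      note LV = plus_line_fd[OF V]
      show "inj_on (?m V) (carrier (obj (difference R I) V))"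
      proof (rule linear_inj_onI[OF nt_lin[OF m' V] fun_module[OF dI V] fun_module[OF d2 V]])
        fix y assume y: "y \<in> carrier (obj (difference R I) V)" and 0: "?m V y = \<zero>\<^bsub>obj (difference R F2) V\<^esub>"
        have "m (?L V) (sI V y) = s2 V (?m V y)"
          using V y by (simp add: Km cl qsI)
        also have "\<dots> = \<zero>\<^bsub>obj F2 (?L V)\<^esub>"
          unfolding 0 using lin_zero[OF nt_lin[OF s2 V] fun_module[OF d2 V]] fun_module[OF F2 LV] by simp
        also have "\<dots> = m (?L V) \<zero>\<^bsub>obj I (?L V)\<^esub>"
          by (rule lin_zero[OF nt_lin[OF m LV] fun_module[OF I LV] fun_module[OF F2 LV], symmetric])
        finally have "m (?L V) (sI V y) = m (?L V) \<zero>\<^bsub>obj I (?L V)\<^esub>" .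
        moreover interpret Module.module R "obj I (?L V)" by (rule fun_module[OF I LV])
        have "inj_on (m (?L V)) (carrier (obj I (?L V)))" using mono LV by (simp add: is_mono_def)
        ultimately have "sI V y = \<zero>\<^bsub>obj I (?L V)\<^esub>" using cl(2)[OF V y] by (auto dest: inj_onD)
        then have "qI V (sI V y) = \<zero>\<^bsub>obj (difference R I) V\<^esub>"
          using lin_zero[OF nt_lin[OF qI V] _ fun_module[OF dI V]] fun_module[OF I LV] by simp
        then show "y = \<zero>\<^bsub>obj (difference R I) V\<^esub>" using qsI[OF V y] by simp
      qed
    qed
    assume "identity_retract (difference R F1) (difference R F2) (trans_comp R (difference R F1) ?m ?e)"
    then obtain T \<alpha> \<beta> where T: "fd_functor T" and \<alpha>: "\<alpha> \<in> nat_trans R id_functor (difference R F1 \<circ>\<^sub>F T)"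
      and \<beta>: "\<beta> \<in> nat_trans R (difference R F2 \<circ>\<^sub>F T) id_functor"
      and id: "\<And>V x. V \<in> fd \<Longrightarrow> x \<in> carrier V \<Longrightarrow>
        \<beta> V (trans_comp R (difference R F1) ?m ?e (obj T V) (\<alpha> V x)) = x"
      unfolding identity_retract_def by blast
    let ?T = "plus_line R \<circ>\<^sub>F T"
    let ?\<alpha> = "trans_comp R id_functor (precomp_trans R T s1) \<alpha>"
    let ?\<beta> = "trans_comp R (F2 \<circ>\<^sub>F ?T) \<beta> (precomp_trans R T q2)"
    show "identity_retract F1 F2 (trans_comp R F1 m e)"
      unfolding identity_retract_def
    proof (intro exI conjI ballI)
      show T': "fd_functor ?T" by (rule fd_functor_precomp[OF L T])
      show "?\<alpha> \<in> nat_trans R id_functor (F1 \<circ>\<^sub>F ?T)"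
        unfolding precomp_assoc
        by (rule trans_comp_nt[OF \<alpha> precomp_trans_nt[OF T s1] fd_functor_functor[OF fd_functor_id]])
      show "?\<beta> \<in> nat_trans R (F2 \<circ>\<^sub>F ?T) id_functor"
        using precomp_trans_nt[OF T q2] unfolding precomp_assoc
        by (rule trans_comp_nt[OF _ \<beta>]) (intro precomp_functor F2 L T)
      fix V :: "('f, 'u) module" and x assume V: "V \<in> fd" and x: "x \<in> carrier V"
      note TV = fd_functor_obj[OF T V]
      let ?y = "\<alpha> V x"
      have y: "?y \<in> carrier (obj (difference R F1) (obj T V))" using nt_closed[OF \<alpha> V] x by simp
      note LTV = plus_line_fd[OF TV]
      have sy: "s1 (obj T V) ?y \<in> carrier (obj F1 (?L (obj T V)))" by (rule cl(1)[OF TV y])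
      note ey = nt_closed[OF e LTV sy]
      have "sI (obj T V) (qI (obj T V) (e (?L (obj T V)) (s1 (obj T V) ?y))) = e (?L (obj T V)) (s1 (obj T V) ?y)"
        by (simp add: Ke[OF TV sy] qs1[OF TV y])
      then have "trans_comp R (difference R F1) ?m ?e (obj T V) ?y =
          q2 (obj T V) (m (?L (obj T V)) (e (?L (obj T V)) (s1 (obj T V) ?y)))"
        using TV y by (simp add: cl ey)
      then show "?\<beta> V (trans_comp R F1 m e (obj ?T V) (?\<alpha> V x)) = x"
        using id[OF V x] V x LTV sy nt_closed[OF m LTV ey] by simp
    qed
  qed
qed

section \<open>Eigenvectors of scalar actions\<close>

abbreviation units :: "'f set" where "units \<equiv> carrier R - {\<zero>}"

lemma unit_closed: "a \<in> units \<Longrightarrow> a \<in> carrier R" "a \<in> units \<Longrightarrow> inv a \<in> units"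
    "a \<in> units \<Longrightarrow> inv a \<otimes> a = \<one>" "a \<in> units \<Longrightarrow> a \<otimes> inv a = \<one>"
    "a \<in> units \<Longrightarrow> b \<in> units \<Longrightarrow> a \<otimes> b \<in> units" "\<one> \<in> units"
  using field_Units by (auto simp: integral_iff)

lemma finite_units: "finite units"
  using finite_scalars by simp

lemma mult_units_image:
  assumes "b \<in> units"
  shows "inj_on (\<lambda>a. b \<otimes> a) units" "(\<lambda>a. b \<otimes> a) ` units = units"
proof -
  show inj: "inj_on (\<lambda>a. b \<otimes> a) units"
    using assms by (intro inj_onI) (simp add: m_lcancel)
  have "(\<lambda>a. b \<otimes> a) ` units \<subseteq> units" by (rule image_subsetI) (rule unit_closed(5)[OF assms])
  then show "(\<lambda>a. b \<otimes> a) ` units = units"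
    using endo_inj_surj[OF finite_units _ inj] by blast
qed

lemma unit_pow_card: "a \<in> units \<Longrightarrow> a [^] card units = \<one>"
  using units_power_order_eq_one[of a] finite_units by (simp add: field_Units)

text \<open>
  This scalar is \<open>-1\<close>: the sum of \<open>1\<close> over all elements of the field
  vanishes, as one sees by shifting the summands of \<open>\<Sum> x\<close> by \<open>1\<close>.
\<close>

definition unit_count :: 'f where
  "unit_count = (\<Oplus>a\<in>units. \<one>)"

lemma unit_count_closed: "unit_count \<in> units"
proof -
  let ?S = "\<Oplus>x\<in>carrier R. x"
  have bij: "inj_on (\<lambda>x. x \<oplus> \<one>) (carrier R)" by (rule inj_onI) simp
  have "(\<lambda>x. x \<oplus> \<one>) ` carrier R \<subseteq> carrier R" by auto
  then have im: "(\<lambda>x. x \<oplus> \<one>) ` carrier R = carrier R"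
    using endo_inj_surj[OF finite_scalars _ bij] by blast
  have "?S = (\<Oplus>x\<in>(\<lambda>x. x \<oplus> \<one>) ` carrier R. x)" unfolding im by (rule refl)
  also have "\<dots> = (\<Oplus>x\<in>carrier R. x \<oplus> \<one>)"
    by (rule finsum_reindex[OF _ bij]) auto
  also have "\<dots> = ?S \<oplus> (\<Oplus>x\<in>carrier R. \<one>)"
    by (rule finsum_addf) auto
  finally have "(\<Oplus>x\<in>carrier R. \<one>) = \<zero>"
    by (metis (no_types, lifting) finsum_closed Pi_I a_comm add.r_cancel_one' one_closed)
  moreover have "carrier R = insert \<zero> units" by auto
  then have "(\<Oplus>x\<in>carrier R. \<one>) = (\<Oplus>x\<in>insert \<zero> units. \<one>)" by simp
  moreover have "(\<Oplus>x\<in>insert \<zero> units. \<one>) = \<one> \<oplus> unit_count"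
    unfolding unit_count_def using finite_units by (subst finsum_insert) auto
  ultimately have "\<one> \<oplus> unit_count = \<zero>" by simp
  moreover have "unit_count \<in> carrier R" unfolding unit_count_def by (rule finsum_closed) auto
  ultimately show ?thesis by (auto intro: ccontr)
qed

text \<open>
  The geometric sum vanishes for \<open>a \<noteq> 1\<close> because \<open>a\<close> to the
  number of units is \<open>1\<close>.
\<close>

lemma sum_powers:
  assumes a: "a \<in> units"
  shows "(\<Oplus>k\<in>{..<card units}. a [^] (k::nat)) = (if a = \<one> then unit_count else \<zero>)"
proof (cases "a = \<one>")
  case True
  obtain h where h: "bij_betw h {..<card units} units"
    using ex_bij_betw_nat_finite[OF finite_units] by (auto simp: atLeast0LessThan)
  have "unit_count = (\<Oplus>a\<in>h ` {..<card units}. \<one>)" unfolding unit_count_def bij_betw_imp_surj_on[OF h] by (rule refl)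
  also have "\<dots> = (\<Oplus>k\<in>{..<card units}. \<one>)"
    by (rule finsum_reindex) (use h in \<open>auto simp: bij_betw_def\<close>)
  finally show ?thesis using True by simp
next
  case False
  let ?S = "\<lambda>n. \<Oplus>k\<in>{..<n}. a [^] (k::nat)"
  have ac: "a \<in> carrier R" using a by simp
  have S: "?S n \<in> carrier R" for n by (rule finsum_closed) (use ac in auto)
  have "(a \<ominus> \<one>) \<otimes> ?S n = a [^] n \<ominus> \<one>" for n
  proof (induction n)
    case 0
    then show ?case using ac by (simp add: a_minus_def r_neg)
  next
    case (Suc n)
    have "?S (Suc n) = a [^] n \<oplus> ?S n"
      unfolding lessThan_Suc by (rule finsum_insert) (use ac in auto)
    then have "(a \<ominus> \<one>) \<otimes> ?S (Suc n) = (a \<ominus> \<one>) \<otimes> a [^] n \<oplus> (a [^] n \<ominus> \<one>)"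
      using ac S Suc by (simp add: r_distr)
    also have "\<dots> = a [^] Suc n \<ominus> \<one>"
    proof -
      have p: "a [^] n \<in> carrier R" using ac by simp
      have "(a \<ominus> \<one>) \<otimes> a [^] n = a [^] n \<otimes> a \<oplus> \<ominus> (a [^] n)"
        using ac p by (simp add: a_minus_def l_distr l_minus m_comm[of a "a [^] n"])
      then show ?thesis using ac p by (simp add: a_minus_def a_assoc r_neg1)
    qed
    finally show ?case .
  qed
  then have "(a \<ominus> \<one>) \<otimes> ?S (card units) = \<zero>"
    using unit_pow_card[OF a] by (simp add: a_minus_def r_neg)
  moreover have "a \<ominus> \<one> \<noteq> \<zero>"
  proof
    assume 0: "a \<ominus> \<one> = \<zero>"
    have "a = (a \<ominus> \<one>) \<oplus> \<one>" using ac by (simp add: a_minus_def a_assoc l_neg)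
    then show False using 0 False by simp
  qed
  ultimately show ?thesis using False integral_iff[of "a \<ominus> \<one>"] S ac by simp
qed

text \<open>
  Linear actions of the multiplicative monoid of the field; the zero scalar acts as an idempotent.
\<close>

definition scalar_action :: "('f, 'a) module \<Rightarrow> ('f \<Rightarrow> 'a \<Rightarrow> 'a) \<Rightarrow> bool" where
  "scalar_action M E \<longleftrightarrow> Module.module R M \<and> (\<forall>a\<in>carrier R. E a \<in> linear_maps R M M) \<and>
     (\<forall>x\<in>carrier M. E \<one> x = x) \<and> (\<forall>a\<in>carrier R. \<forall>b\<in>carrier R. \<forall>x\<in>carrier M. E a (E b x) = E (a \<otimes> b) x)"

text \<open>
  The sum \<open>P k\<close> of \<open>a\<^sup>k E(a) v\<close> over the units \<open>a\<close> is
  an eigenvector with character \<open>a \<mapsto> a\<^sup>-\<^sup>k\<close>, unless it vanishes.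
  The vectors \<open>P k\<close> add up to a nonzero multiple of \<open>v\<close>, by
  orthogonality of characters (\<open>sum_powers\<close>). So \<open>t\<close> does not kill all
  of them.
\<close>

lemma eigenvector_exists:
  assumes E: "scalar_action M E" and v: "v \<in> carrier M" "E \<zero> v = \<zero>\<^bsub>M\<^esub>"
    and t: "t \<in> linear_maps R M N" and N: "Module.module R N" and tv: "t v \<noteq> \<zero>\<^bsub>N\<^esub>"
  obtains w \<chi> where "w \<in> carrier M" "E \<zero> w = \<zero>\<^bsub>M\<^esub>" "t w \<noteq> \<zero>\<^bsub>N\<^esub>"
    "\<And>a. a \<in> units \<Longrightarrow> \<chi> a \<in> units \<and> E a w = \<chi> a \<odot>\<^bsub>M\<^esub> w"
proof -
  have M: "Module.module R M" and El: "\<And>a. a \<in> carrier R \<Longrightarrow> E a \<in> linear_maps R M M"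
    and E1: "\<And>x. x \<in> carrier M \<Longrightarrow> E \<one> x = x"
    and EE: "\<And>a b x. a \<in> carrier R \<Longrightarrow> b \<in> carrier R \<Longrightarrow> x \<in> carrier M \<Longrightarrow> E a (E b x) = E (a \<otimes> b) x"
    using E by (auto simp: scalar_action_def)
  interpret M: Module.module R M by (rule M)
  interpret N: Module.module R N by (rule N)
  have Ec: "E a x \<in> carrier M" if "a \<in> carrier R" "x \<in> carrier M" for a x using lin_closed[OF El] that by blast
  (* S n collects P 0, ..., P (n - 1), with the order of summation exchanged. *)
  define P where "P k = (\<Oplus>\<^bsub>M\<^esub>a\<in>units. a [^] (k::nat) \<odot>\<^bsub>M\<^esub> E a v)" for k
  define S where "S n = (\<Oplus>\<^bsub>M\<^esub>a\<in>units. (\<Oplus>k\<in>{..<n}. a [^] (k::nat)) \<odot>\<^bsub>M\<^esub> E a v)" for n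
  have c1: "(\<lambda>a. a [^] k \<odot>\<^bsub>M\<^esub> E a v) \<in> units \<rightarrow> carrier M" for k :: nat using v Ec by auto
  have Pc: "P k \<in> carrier M" for k unfolding P_def using c1 by (rule M.M.finsum_closed)
  have c2: "(\<Oplus>k\<in>{..<n}. a [^] (k::nat)) \<in> carrier R" if "a \<in> carrier R" for a n
    by (rule finsum_closed) (use that in auto)
  have Sc: "S n \<in> carrier M" for n unfolding S_def by (rule M.M.finsum_closed) (use v Ec c2 in auto)
  have SSuc: "S (Suc n) = P n \<oplus>\<^bsub>M\<^esub> S n" for n
  proof -
    have "S (Suc n) = (\<Oplus>\<^bsub>M\<^esub>a\<in>units. a [^] n \<odot>\<^bsub>M\<^esub> E a v \<oplus>\<^bsub>M\<^esub> (\<Oplus>k\<in>{..<n}. a [^] (k::nat)) \<odot>\<^bsub>M\<^esub> E a v)"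
      unfolding S_def
    proof (rule M.M.finsum_cong')
      fix a assume a: "a \<in> units"
      have "(\<Oplus>k\<in>{..<Suc n}. a [^] (k::nat)) = a [^] n \<oplus> (\<Oplus>k\<in>{..<n}. a [^] (k::nat))"
        unfolding lessThan_Suc by (rule finsum_insert) (use a in auto)
      then show "(\<Oplus>k\<in>{..<Suc n}. a [^] (k::nat)) \<odot>\<^bsub>M\<^esub> E a v =
          a [^] n \<odot>\<^bsub>M\<^esub> E a v \<oplus>\<^bsub>M\<^esub> (\<Oplus>k\<in>{..<n}. a [^] (k::nat)) \<odot>\<^bsub>M\<^esub> E a v"
        using a v Ec c2 by (simp add: M.smult_l_distr)
    qed (use v Ec c2 in auto)
    also have "\<dots> = P n \<oplus>\<^bsub>M\<^esub> S n"
      unfolding P_def S_def by (rule M.M.finsum_addf[OF c1]) (use v Ec c2 in auto)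
    finally show ?thesis .
  qed
  (* Only a = 1 contributes to the sum over all exponents. *)
  have "S (card units) = (\<Oplus>\<^bsub>M\<^esub>a\<in>units. if \<one> = a then unit_count \<odot>\<^bsub>M\<^esub> v else \<zero>\<^bsub>M\<^esub>)"
    unfolding S_def
  proof (rule M.M.finsum_cong')
    fix a assume a: "a \<in> units"
    show "(\<Oplus>k\<in>{..<card units}. a [^] (k::nat)) \<odot>\<^bsub>M\<^esub> E a v = (if \<one> = a then unit_count \<odot>\<^bsub>M\<^esub> v else \<zero>\<^bsub>M\<^esub>)"
      unfolding sum_powers[OF a] using v Ec E1 a by auto
  qed (use v unit_count_closed in auto)
  also have "\<dots> = unit_count \<odot>\<^bsub>M\<^esub> v"
    by (rule M.M.finsum_singleton[OF _ finite_units]) (use v unit_count_closed unit_closed(6) in auto)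
  finally have Scard: "S (card units) = unit_count \<odot>\<^bsub>M\<^esub> v" .
  have tS: "t (S (card units)) \<noteq> \<zero>\<^bsub>N\<^esub>"
  proof
    assume "t (S (card units)) = \<zero>\<^bsub>N\<^esub>"
    then have "unit_count \<odot>\<^bsub>N\<^esub> t v = \<zero>\<^bsub>N\<^esub>"
      unfolding Scard using unit_count_closed v by (simp add: lin_smult[OF t])
    then have "inv unit_count \<odot>\<^bsub>N\<^esub> (unit_count \<odot>\<^bsub>N\<^esub> t v) = \<zero>\<^bsub>N\<^esub>"
      using unit_closed(2)[OF unit_count_closed] by simp
    then show False
      using tv unit_count_closed unit_closed(1-3)[OF unit_count_closed] unit_closed(1)[OF unit_closed(2)[OF unit_count_closed]] lin_closed[OF t v(1)]
      by (simp add: N.smult_assoc1[symmetric])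
  qed
  have "\<exists>k. t (P k) \<noteq> \<zero>\<^bsub>N\<^esub>"
  proof (rule ccontr)
    assume "\<not> (\<exists>k. t (P k) \<noteq> \<zero>\<^bsub>N\<^esub>)"
    then have tP: "t (P k) = \<zero>\<^bsub>N\<^esub>" for k by blast
    have "t (S n) = \<zero>\<^bsub>N\<^esub>" for n
    proof (induction n)
      case 0
      have "S 0 = \<zero>\<^bsub>M\<^esub>" unfolding S_def by (rule M.add.finprod_one_eqI) (use v Ec in auto)
      then show ?case using lin_zero[OF t M N] by simp
    next
      case (Suc n)
      then show ?case using tP by (simp add: SSuc lin_add[OF t] Pc Sc)
    qed
    then show False using tS by blast
  qed
  then obtain k where k: "t (P k) \<noteq> \<zero>\<^bsub>N\<^esub>" by blast
  have EP: "b [^] k \<odot>\<^bsub>M\<^esub> E b (P k) = P k" if b: "b \<in> units" for b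
  proof -
    have bc: "b \<in> carrier R" using b by simp
    have "P k = (\<Oplus>\<^bsub>M\<^esub>a\<in>(\<lambda>a. b \<otimes> a) ` units. a [^] k \<odot>\<^bsub>M\<^esub> E a v)"
      unfolding mult_units_image(2)[OF b] P_def by (rule refl)
    also have "\<dots> = (\<Oplus>\<^bsub>M\<^esub>a\<in>units. (b \<otimes> a) [^] k \<odot>\<^bsub>M\<^esub> E (b \<otimes> a) v)"
      by (rule M.M.finsum_reindex[OF _ mult_units_image(1)[OF b]]) (use v Ec bc in auto)
    also have "\<dots> = (\<Oplus>\<^bsub>M\<^esub>a\<in>units. b [^] k \<odot>\<^bsub>M\<^esub> E b (a [^] k \<odot>\<^bsub>M\<^esub> E a v))"
      by (rule M.M.finsum_cong')
        (use v Ec bc in \<open>auto simp: lin_smult[OF El] EE nat_pow_distrib M.smult_assoc1\<close>)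
    also have "\<dots> = b [^] k \<odot>\<^bsub>M\<^esub> (\<Oplus>\<^bsub>M\<^esub>a\<in>units. E b (a [^] k \<odot>\<^bsub>M\<^esub> E a v))"
      by (rule M.finsum_smult_ldistr[OF finite_units, symmetric]) (use v Ec bc in auto)
    also have "(\<Oplus>\<^bsub>M\<^esub>a\<in>units. E b (a [^] k \<odot>\<^bsub>M\<^esub> E a v)) = E b (P k)"
      unfolding P_def by (rule lin_finsum[OF El[OF bc] M M finite_units c1, symmetric])
    finally show ?thesis by simp
  qed
  show ?thesis
  proof (rule that[OF Pc _ k])
    have "E \<zero> (P k) = (\<Oplus>\<^bsub>M\<^esub>a\<in>units. E \<zero> (a [^] k \<odot>\<^bsub>M\<^esub> E a v))"
      unfolding P_def by (rule lin_finsum[OF El[OF zero_closed] M M finite_units c1])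
    also have "\<dots> = \<zero>\<^bsub>M\<^esub>"
      by (rule M.add.finprod_one_eqI) (use v Ec in \<open>auto simp: lin_smult[OF El] EE\<close>)
    finally show "E \<zero> (P k) = \<zero>\<^bsub>M\<^esub>" .
    fix b assume b: "b \<in> units"
    have bk: "b [^] k \<in> units"
    proof (induction k)
      case (Suc k)
      then show ?case using unit_closed(5)[OF Suc b] by simp
    qed (use unit_closed in simp)
    have "inv (b [^] k) \<odot>\<^bsub>M\<^esub> P k = inv (b [^] k) \<odot>\<^bsub>M\<^esub> (b [^] k \<odot>\<^bsub>M\<^esub> E b (P k))" by (simp add: EP[OF b])
    also have "\<dots> = E b (P k)"
      using unit_closed(1-3)[OF bk] b Pc Ec by (simp add: M.smult_assoc1[symmetric])
    finally show "inv (b [^] k) \<in> units \<and> E b (P k) = inv (b [^] k) \<odot>\<^bsub>M\<^esub> P k"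
      using unit_closed(2)[OF bk] by simp
  qed
qed

text \<open>
  A functional with value \<open>1\<close> at \<open>u\<close> is averaged over the units against
  the inverse of \<open>\<chi>\<close>. To make the result vanish on the image of \<open>E
  0\<close> also for trivial \<open>\<chi>\<close>, arguments are first projected to the kernel of
  \<open>E 0\<close>.
\<close>

lemma eigenfunctional_exists:
  assumes E: "scalar_action M E" and u: "u \<in> carrier M" "u \<noteq> \<zero>\<^bsub>M\<^esub>" "E \<zero> u = \<zero>\<^bsub>M\<^esub>"
    and \<chi>: "\<And>a. a \<in> units \<Longrightarrow> \<chi> a \<in> units" "\<And>a b. a \<in> units \<Longrightarrow> b \<in> units \<Longrightarrow> \<chi> (a \<otimes> b) = \<chi> a \<otimes> \<chi> b"
    and Eu: "\<And>a. a \<in> units \<Longrightarrow> E a u = \<chi> a \<odot>\<^bsub>M\<^esub> u"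
  obtains \<xi> where "\<xi> \<in> linear_maps R M scalars" "\<xi> u = \<one>"
    "\<And>x. x \<in> carrier M \<Longrightarrow> \<xi> (E \<zero> x) = \<zero>"
    "\<And>a x. a \<in> units \<Longrightarrow> x \<in> carrier M \<Longrightarrow> \<xi> (E a x) = \<chi> a \<otimes> \<xi> x"
proof -
  have M: "Module.module R M" and El: "\<And>a. a \<in> carrier R \<Longrightarrow> E a \<in> linear_maps R M M"
    and E1: "\<And>x. x \<in> carrier M \<Longrightarrow> E \<one> x = x"
    and EE: "\<And>a b x. a \<in> carrier R \<Longrightarrow> b \<in> carrier R \<Longrightarrow> x \<in> carrier M \<Longrightarrow> E a (E b x) = E (a \<otimes> b) x"
    using E by (auto simp: scalar_action_def)
  interpret M: Module.module R M by (rule M)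
  have Ec: "E a x \<in> carrier M" if "a \<in> carrier R" "x \<in> carrier M" for a x using lin_closed[OF El] that by blast
  obtain \<eta> where \<eta>: "\<eta> \<in> linear_maps R M scalars" "\<eta> u = \<one>" using functional_exists[OF M u(1,2)] .
  note \<eta>c [simp] = lin_closed[OF \<eta>(1), simplified]
  (* The projection to the kernel of E 0, written so that linearity of differences applies. *)
  define r where "r = (\<lambda>x\<in>carrier M. (\<lambda>x\<in>carrier M. x) x \<ominus>\<^bsub>M\<^esub> E \<zero> x)"
  have r: "r \<in> linear_maps R M M"
    unfolding r_def by (rule lin_restrict_minus[OF lin_id[OF M] El M M]) simp
  have r_eq: "r x = x \<ominus>\<^bsub>M\<^esub> E \<zero> x" if "x \<in> carrier M" for x using that by (simp add: r_def)
  have rc [simp]: "r x \<in> carrier M" if "x \<in> carrier M" for x using lin_closed[OF r that] .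
  have r0: "r (E \<zero> x) = \<zero>\<^bsub>M\<^esub>" if x: "x \<in> carrier M" for x
    using x Ec minus_eq_zero_iff[OF M] by (simp add: r_eq EE)
  have rE: "r (E a x) = E a (r x)" if a: "a \<in> carrier R" and x: "x \<in> carrier M" for a x
    using lin_minus[OF El[OF a] M M x Ec[OF zero_closed x]] a x Ec by (simp add: r_eq EE)
  have ru: "r u = u" unfolding r_eq[OF u(1)] u(3) by (rule minus_eqI[OF M]) (use u in auto)
  define \<xi> where "\<xi> = (\<lambda>x\<in>carrier M. inv unit_count \<otimes> (\<Oplus>a\<in>units. inv (\<chi> a) \<otimes> \<eta> (E a (r x))))"
  have \<chi>': "\<chi> a \<in> carrier R" "inv (\<chi> a) \<in> carrier R" "inv (\<chi> a) \<otimes> \<chi> a = \<one>" "\<chi> a \<otimes> inv (\<chi> a) = \<one>"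
    if "a \<in> units" for a
    using unit_closed(1-4)[OF \<chi>(1)[OF that]] unit_closed(1)[OF unit_closed(2)[OF \<chi>(1)[OF that]]] by auto
  have cc: "inv unit_count \<in> carrier R" "inv unit_count \<otimes> unit_count = \<one>"
    using unit_closed(2,3)[OF unit_count_closed] by auto
  have cl: "(\<lambda>a. inv (\<chi> a) \<otimes> \<eta> (E a (r x))) \<in> units \<rightarrow> carrier R" if "x \<in> carrier M" for x
    using that \<chi>' Ec by auto
  have sc: "(\<Oplus>a\<in>units. inv (\<chi> a) \<otimes> \<eta> (E a (r x))) \<in> carrier R" if "x \<in> carrier M" for x
    by (rule finsum_closed[OF cl[OF that]])
  show ?thesis
  proof (rule that[of \<xi>])
    show "\<xi> \<in> linear_maps R M scalars"
    proof (rule linear_mapsI)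
      fix x assume "x \<in> carrier M"
      then show "\<xi> x \<in> carrier scalars" using cc sc by (simp add: \<xi>_def)
    next
      fix x y assume xy: "x \<in> carrier M" "y \<in> carrier M"
      have "(\<Oplus>a\<in>units. inv (\<chi> a) \<otimes> \<eta> (E a (r (x \<oplus>\<^bsub>M\<^esub> y)))) =
          (\<Oplus>a\<in>units. inv (\<chi> a) \<otimes> \<eta> (E a (r x)) \<oplus> inv (\<chi> a) \<otimes> \<eta> (E a (r y)))"
        by (rule finsum_cong')
          (use xy \<chi>' Ec in \<open>auto simp: lin_add[OF r] lin_add[OF El] lin_add[OF \<eta>(1)] r_distr\<close>)
      also have "\<dots> = (\<Oplus>a\<in>units. inv (\<chi> a) \<otimes> \<eta> (E a (r x))) \<oplus> (\<Oplus>a\<in>units. inv (\<chi> a) \<otimes> \<eta> (E a (r y)))"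
        by (rule finsum_addf[OF cl[OF xy(1)] cl[OF xy(2)]])
      finally show "\<xi> (x \<oplus>\<^bsub>M\<^esub> y) = \<xi> x \<oplus>\<^bsub>scalars\<^esub> \<xi> y"
        using xy cc sc by (simp add: \<xi>_def r_distr)
    next
      fix b x assume b: "b \<in> carrier R" and x: "x \<in> carrier M"
      have "(\<Oplus>a\<in>units. inv (\<chi> a) \<otimes> \<eta> (E a (r (b \<odot>\<^bsub>M\<^esub> x)))) = (\<Oplus>a\<in>units. b \<otimes> (inv (\<chi> a) \<otimes> \<eta> (E a (r x))))"
        by (rule finsum_cong')
          (use b x \<chi>' Ec in \<open>auto simp: lin_smult[OF r] lin_smult[OF El] lin_smult[OF \<eta>(1)] m_lcomm\<close>)
      also have "\<dots> = b \<otimes> (\<Oplus>a\<in>units. inv (\<chi> a) \<otimes> \<eta> (E a (r x)))"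
        by (rule finsum_rdistr[OF finite_units b cl[OF x], symmetric])
      finally show "\<xi> (b \<odot>\<^bsub>M\<^esub> x) = b \<odot>\<^bsub>scalars\<^esub> \<xi> x"
        using b x cc sc by (simp add: \<xi>_def m_lcomm)
    qed (simp add: \<xi>_def)
    have "(\<Oplus>a\<in>units. inv (\<chi> a) \<otimes> \<eta> (E a (r u))) = unit_count"
      unfolding unit_count_def
      by (rule finsum_cong') (use u \<chi>' \<eta> Eu in \<open>auto simp: ru lin_smult[OF \<eta>(1)]\<close>)
    then show "\<xi> u = \<one>" using u cc by (simp add: \<xi>_def)
  next
    fix x assume x: "x \<in> carrier M"
    have "\<eta> (E a \<zero>\<^bsub>M\<^esub>) = \<zero>" if "a \<in> units" for a
      using that lin_zero[OF El M M] lin_zero[OF \<eta>(1) M scalars_module] by simp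
    then have "(\<Oplus>a\<in>units. inv (\<chi> a) \<otimes> \<eta> (E a (r (E \<zero> x)))) = \<zero>"
      by (intro add.finprod_one_eqI) (use x \<chi>' in \<open>auto simp: r0\<close>)
    then show "\<xi> (E \<zero> x) = \<zero>" using x Ec cc by (simp add: \<xi>_def)
  next
    fix b x assume b: "b \<in> units" and x: "x \<in> carrier M"
    have bc: "b \<in> carrier R" using b by simp
    have "(\<Oplus>a\<in>units. inv (\<chi> a) \<otimes> \<eta> (E a (r x))) = (\<Oplus>a\<in>(\<lambda>a. b \<otimes> a) ` units. inv (\<chi> a) \<otimes> \<eta> (E a (r x)))"
      unfolding mult_units_image(2)[OF b] by (rule refl)
    also have "\<dots> = (\<Oplus>a\<in>units. inv (\<chi> (b \<otimes> a)) \<otimes> \<eta> (E (b \<otimes> a) (r x)))"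
      by (rule finsum_reindex[OF _ mult_units_image(1)[OF b]]) (unfold mult_units_image(2)[OF b], rule cl[OF x])
    finally have *: "(\<Oplus>a\<in>units. inv (\<chi> a) \<otimes> \<eta> (E a (r x))) =
        (\<Oplus>a\<in>units. inv (\<chi> (b \<otimes> a)) \<otimes> \<eta> (E (b \<otimes> a) (r x)))" .
    have inv: "inv (\<chi> a) = \<chi> b \<otimes> inv (\<chi> (b \<otimes> a))" if a: "a \<in> units" for a
    proof -
      have "inv (\<chi> (b \<otimes> a)) = inv (\<chi> b) \<otimes> inv (\<chi> a)"
        unfolding \<chi>(2)[OF b a] by (rule comm_inv_char) 
          (use \<chi>'[OF a] \<chi>'[OF b] in \<open>auto simp: m_ac intro!: trans[OF _ \<chi>'(4)[OF a]]\<close>)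
      then show ?thesis using \<chi>'[OF a] \<chi>'[OF b] by (simp add: m_assoc[symmetric])
    qed
    have "(\<Oplus>a\<in>units. inv (\<chi> a) \<otimes> \<eta> (E a (r (E b x)))) =
        (\<Oplus>a\<in>units. \<chi> b \<otimes> (inv (\<chi> (b \<otimes> a)) \<otimes> \<eta> (E (b \<otimes> a) (r x))))"
    proof (rule finsum_cong')
      fix a assume a: "a \<in> units"
      have "\<eta> (E a (r (E b x))) = \<eta> (E (b \<otimes> a) (r x))" using a bc x by (simp add: rE EE m_comm)
      then show "inv (\<chi> a) \<otimes> \<eta> (E a (r (E b x))) = \<chi> b \<otimes> (inv (\<chi> (b \<otimes> a)) \<otimes> \<eta> (E (b \<otimes> a) (r x)))"
        unfolding inv[OF a] using \<chi>'[OF b] \<chi>'[OF unit_closed(5)[OF b a]] a bc x Ec by (simp add: m_assoc)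
    qed (use \<chi>' b x Ec bc unit_closed(5)[OF b] in auto)
    also have "\<dots> = \<chi> b \<otimes> (\<Oplus>a\<in>units. inv (\<chi> (b \<otimes> a)) \<otimes> \<eta> (E (b \<otimes> a) (r x)))"
      by (rule finsum_rdistr[OF finite_units, symmetric]) (use \<chi>' b x Ec bc unit_closed(5)[OF b] in auto)
    finally show "\<xi> (E b x) = \<chi> b \<otimes> \<xi> x"
      using x bc Ec cc sc \<chi>'[OF b] by (simp add: \<xi>_def *[symmetric] m_lcomm)
  qed
qed

section \<open>Functors of degree one\<close>

subsection \<open>Additivity\<close>

text \<open>
  The linear map on \<open>V \<oplus> R\<close> with components \<open>j\<close> and \<open>r
  \<mapsto> r b\<close>.
\<close>

definition line_map :: "('f, 'u) module \<Rightarrow> ('f, 'a) module \<Rightarrow> ('u \<Rightarrow> 'a) \<Rightarrow> 'a \<Rightarrow> 'u \<Rightarrow> 'a" where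
  "line_map V M j b =
     (\<lambda>z\<in>carrier (plus_line_space R V). j (fst (pair_decode R z)) \<oplus>\<^bsub>M\<^esub> snd (pair_decode R z) \<odot>\<^bsub>M\<^esub> b)"

text \<open>
  The map into \<open>V \<oplus> R\<close> with components \<open>g\<close> and
  \<open>\<eta>\<close>.
\<close>

definition into_line :: "('f, 'a) module \<Rightarrow> ('a \<Rightarrow> 'u) \<Rightarrow> ('a \<Rightarrow> 'f) \<Rightarrow> 'a \<Rightarrow> 'u" where
  "into_line M g \<eta> = (\<lambda>x\<in>carrier M. pair_code R (g x, \<eta> x))"

lemma line_map_apply [simp]:
  fixes V :: "('f, 'u :: infinite) module"
  shows "x \<in> carrier V \<Longrightarrow> r \<in> carrier R \<Longrightarrow> line_map V M j b (pair_code R (x, r)) = j x \<oplus>\<^bsub>M\<^esub> r \<odot>\<^bsub>M\<^esub> b"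
  by (simp add: line_map_def)

lemma into_line_apply [simp]: "x \<in> carrier M \<Longrightarrow> into_line M g \<eta> x = pair_code R (g x, \<eta> x)"
  by (simp add: into_line_def)

lemma line_map_lin:
  fixes V :: "('f, 'u :: infinite) module"
  shows "V \<in> fd \<Longrightarrow> Module.module R M \<Longrightarrow> g \<in> linear_maps R V M \<Longrightarrow> b \<in> carrier M \<Longrightarrow>
    line_map V M g b \<in> linear_maps R (plus_line_space R V) M"
  unfolding line_map_def by (rule line_map_linear)

lemma into_line_lin:
  fixes V :: "('f, 'u :: infinite) module"
  shows "Module.module R M \<Longrightarrow> g \<in> linear_maps R M V \<Longrightarrow> \<eta> \<in> linear_maps R M scalars \<Longrightarrow>
    into_line M g \<eta> \<in> linear_maps R M (plus_line_space R V)"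
  unfolding into_line_def by (rule into_line_linear)

lemma line_coord_linear:
  fixes V :: "('f, 'u :: infinite) module"
  assumes V: "V \<in> fd"
  shows "(\<lambda>z\<in>carrier (plus_line_space R V). snd (pair_decode R z)) \<in> linear_maps R (plus_line_space R V) scalars"
  by (rule line_linearI[OF V, of "\<lambda>x r. r"]) auto

lemma fun_comp_eq:
  assumes F: "is_functor R F" and X: "X \<in> fd" "Y \<in> fd" "Z \<in> fd" and g: "g \<in> linear_maps R X Y"
    and h: "h \<in> linear_maps R Y Z" and k: "k \<in> linear_maps R X Z" and eq: "\<And>z. z \<in> carrier X \<Longrightarrow> h (g z) = k z"
    and x: "x \<in> carrier (obj F X)"
  shows "mor F Y Z h (mor F X Y g x) = mor F X Z k x"
proof -
  have "compose (carrier X) h g = k"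
    by (rule lin_eqI[OF lin_comp[OF g h fd_module[OF X(1)]] k]) (simp add: compose_eq eq)
  then show ?thesis by (simp only: fun_comp[OF F X g h x])
qed

text \<open>
  The two lines in \<open>W \<oplus> R \<oplus> R\<close> give commuting idempotents
  \<open>K0\<close> and \<open>K1\<close> on \<open>F(W \<oplus> R \<oplus> R)\<close>, and the
  second difference of \<open>F\<close> at \<open>W\<close> is the image of \<open>(1 - K0)(1 -
  K1)\<close>. Its vanishing is expanded here into an identity without signs.
\<close>

lemma second_difference_zero:
  fixes F :: "('f, 'u :: infinite) vfunctor"
  assumes F: "is_functor R F" and 0: "is_zero_functor R (difference R (difference R F))" and W: "W \<in> fd"
  defines "LW \<equiv> plus_line_space R W" and "LLW \<equiv> plus_line_space R (plus_line_space R W)"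
  defines "K0 \<equiv> mor F LLW LLW (line_kill LW)" and "K1 \<equiv> mor F LLW LLW (mor (plus_line R) LW LW (line_kill W))"
  assumes x: "x \<in> carrier (obj F LLW)"
  shows "x \<oplus>\<^bsub>obj F LLW\<^esub> K0 (K1 x) = K0 x \<oplus>\<^bsub>obj F LLW\<^esub> K1 x"
proof -
  note dF = difference_functor[OF F]
  have LW: "LW \<in> fd" unfolding LW_def by (rule plus_line_fd[OF W])
  have LLW: "LLW \<in> fd" unfolding LLW_def by (intro plus_line_fd W)
  have LL: "plus_line_space R LW = LLW" by (simp add: LW_def LLW_def)
  note M = fun_module[OF F LLW]
  interpret M: Module.module R "obj F LLW" by (rule M)
  have k1: "mor (plus_line R) LW LW (line_kill W) \<in> linear_maps R LLW LLW"
    unfolding LL[symmetric] by (rule plus_line_mor_linear[OF LW line_kill_linear[OF W, folded LW_def]])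
  have k0: "line_kill LW \<in> linear_maps R LLW LLW" using line_kill_linear[OF LW] by (simp add: LL)
  have c1: "K1 y \<in> carrier (obj F LLW)" and c0: "K0 y \<in> carrier (obj F LLW)" if "y \<in> carrier (obj F LLW)" for y
    unfolding K1_def K0_def using fun_closed[OF F LLW LLW] k1 k0 that by blast+
  obtain q s where q: "q \<in> nat_trans R (F \<circ>\<^sub>F plus_line R) (difference R F)"
    and sq: "\<And>V x. V \<in> fd \<Longrightarrow> x \<in> carrier (obj F (plus_line_space R V)) \<Longrightarrow>
      s V (q V x) = x \<ominus>\<^bsub>obj F (plus_line_space R V)\<^esub> mor F (plus_line_space R V) (plus_line_space R V) (line_kill V) x"
    by (rule difference_split[OF F]) (rule that)
  obtain q' s' where q': "q' \<in> nat_trans R (difference R F \<circ>\<^sub>F plus_line R) (difference R (difference R F))"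
    and s': "s' \<in> nat_trans R (difference R (difference R F)) (difference R F \<circ>\<^sub>F plus_line R)"
    and sq': "\<And>V x. V \<in> fd \<Longrightarrow> x \<in> carrier (obj (difference R F) (plus_line_space R V)) \<Longrightarrow>
      s' V (q' V x) = x \<ominus>\<^bsub>obj (difference R F) (plus_line_space R V)\<^esub>
        mor (difference R F) (plus_line_space R V) (plus_line_space R V) (line_kill V) x"
    by (rule difference_split[OF dF]) (rule that)
  let ?u = "q LW x"
  have u: "?u \<in> carrier (obj (difference R F) LW)" using nt_closed[OF q LW] x LL by simp
  have "q' W ?u \<in> carrier (obj (difference R (difference R F)) W)"
    using nt_closed[OF q' W] u by (simp add: LW_def)
  then have "q' W ?u = \<zero>\<^bsub>obj (difference R (difference R F)) W\<^esub>"
    using 0 W by (simp add: is_zero_functor_def)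
  then have "s' W (q' W ?u) = \<zero>\<^bsub>obj (difference R F) LW\<^esub>"
    using lin_zero[OF nt_lin[OF s' W] fun_module[OF difference_functor[OF dF] W]] fun_module[OF dF LW]
    by (simp add: LW_def)
  then have "?u \<ominus>\<^bsub>obj (difference R F) LW\<^esub> mor (difference R F) LW LW (line_kill W) ?u = \<zero>\<^bsub>obj (difference R F) LW\<^esub>"
    using sq'[OF W, folded LW_def, OF u] by simp
  then have "?u = mor (difference R F) LW LW (line_kill W) ?u"
    using minus_eq_zero_iff[OF fun_module[OF dF LW] u
        fun_closed[OF dF LW LW line_kill_linear[OF W, folded LW_def] u]] by simp
  also have "\<dots> = q LW (K1 x)"
    using nt_nat[OF q LW LW line_kill_linear[OF W, folded LW_def]] x LL by (simp add: K1_def)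
  finally have "s LW (q LW x) = s LW (q LW (K1 x))" by simp
  then have *: "x \<ominus>\<^bsub>obj F LLW\<^esub> K0 x = K1 x \<ominus>\<^bsub>obj F LLW\<^esub> K0 (K1 x)"
    using sq[OF LW] LL x c1[OF x] by (simp add: K0_def)
  have "x = (K1 x \<ominus>\<^bsub>obj F LLW\<^esub> K0 (K1 x)) \<oplus>\<^bsub>obj F LLW\<^esub> K0 x"
    using minus_add_cancel[OF M x c0[OF x]] unfolding * by simp
  then have "x \<oplus>\<^bsub>obj F LLW\<^esub> K0 (K1 x) =
      (K1 x \<ominus>\<^bsub>obj F LLW\<^esub> K0 (K1 x)) \<oplus>\<^bsub>obj F LLW\<^esub> K0 x \<oplus>\<^bsub>obj F LLW\<^esub> K0 (K1 x)"
    by simp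
  also have "\<dots> = K0 x \<oplus>\<^bsub>obj F LLW\<^esub> ((K1 x \<ominus>\<^bsub>obj F LLW\<^esub> K0 (K1 x)) \<oplus>\<^bsub>obj F LLW\<^esub> K0 (K1 x))"
    using x c1 c0 by (simp add: M.M.a_ac)
  also have "\<dots> = K0 x \<oplus>\<^bsub>obj F LLW\<^esub> K1 x"
    using minus_add_cancel[OF M c1[OF x] c0[OF c1[OF x]]] by simp
  finally show ?thesis .
qed

text \<open>
  The expansion of \<open>second_difference_zero\<close>, read along \<open>X \<rightarrow> W
  \<oplus> R \<oplus> R \<rightarrow> Y\<close>: the maps \<open>h0\<close>, \<open>h1\<close> and
  \<open>h01\<close> arise from the composite \<open>h\<close> by killing the outer line, the
  inner line and both.
\<close>

lemma cross_effect:
  fixes F :: "('f, 'u :: infinite) vfunctor" and W :: "('f, 'u) module"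
  assumes F: "is_functor R F" and 0: "is_zero_functor R (difference R (difference R F))" and W: "W \<in> fd"
    and X: "X \<in> fd" and Y: "Y \<in> fd"
    and u: "u \<in> linear_maps R X (plus_line_space R (plus_line_space R W))"
    and g: "g \<in> linear_maps R (plus_line_space R (plus_line_space R W)) Y"
    and h: "h \<in> linear_maps R X Y" "h0 \<in> linear_maps R X Y" "h1 \<in> linear_maps R X Y" "h01 \<in> linear_maps R X Y"
    and eq: "\<And>z. z \<in> carrier X \<Longrightarrow> h z = g (u z)"
      "\<And>z. z \<in> carrier X \<Longrightarrow> h0 z = g (line_kill (plus_line_space R W) (u z))"
      "\<And>z. z \<in> carrier X \<Longrightarrow> h1 z = g (mor (plus_line R) (plus_line_space R W) (plus_line_space R W) (line_kill W) (u z))"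
      "\<And>z. z \<in> carrier X \<Longrightarrow> h01 z = g (line_kill (plus_line_space R W)
         (mor (plus_line R) (plus_line_space R W) (plus_line_space R W) (line_kill W) (u z)))"
    and x: "x \<in> carrier (obj F X)"
  shows "mor F X Y h x \<oplus>\<^bsub>obj F Y\<^esub> mor F X Y h01 x = mor F X Y h0 x \<oplus>\<^bsub>obj F Y\<^esub> mor F X Y h1 x"
proof -
  let ?LW = "plus_line_space R W" and ?LLW = "plus_line_space R (plus_line_space R W)"
  let ?k0 = "line_kill ?LW" and ?k1 = "mor (plus_line R) ?LW ?LW (line_kill W)"
  have LW: "?LW \<in> fd" by (rule plus_line_fd[OF W])
  have LLW: "?LLW \<in> fd" by (rule plus_line_fd[OF LW])
  have k0: "?k0 \<in> linear_maps R ?LLW ?LLW" by (rule line_kill_linear[OF LW])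
  have k1: "?k1 \<in> linear_maps R ?LLW ?LLW" by (rule plus_line_mor_linear[OF LW line_kill_linear[OF W]])
  let ?y = "mor F X ?LLW u x"
  note Xm = fd_module[OF X] and Lm = fd_module[OF LLW]
  have y: "?y \<in> carrier (obj F ?LLW)" by (rule fun_closed[OF F X LLW u x])
  have c1: "mor F ?LLW ?LLW ?k1 ?y \<in> carrier (obj F ?LLW)" by (rule fun_closed[OF F LLW LLW k1 y])
  have c0: "mor F ?LLW ?LLW ?k0 ?y \<in> carrier (obj F ?LLW)" by (rule fun_closed[OF F LLW LLW k0 y])
  have c01: "mor F ?LLW ?LLW ?k0 (mor F ?LLW ?LLW ?k1 ?y) \<in> carrier (obj F ?LLW)" by (rule fun_closed[OF F LLW LLW k0 c1])
  note gk0 = lin_comp[OF k0 g Lm] and gk1 = lin_comp[OF k1 g Lm]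
  note uc = lin_closed[OF u]
  have G: "mor F ?LLW Y g ?y = mor F X Y h x"
    by (rule fun_comp_eq[OF F X LLW Y u g h(1) _ x]) (simp add: eq)
  have G0: "mor F ?LLW Y g (mor F ?LLW ?LLW ?k0 ?y) = mor F X Y h0 x"
    unfolding fun_comp[OF F LLW LLW Y k0 g y]
    by (rule fun_comp_eq[OF F X LLW Y u gk0 h(2) _ x]) (simp add: eq compose_eq uc)
  have G1: "mor F ?LLW Y g (mor F ?LLW ?LLW ?k1 ?y) = mor F X Y h1 x"
    unfolding fun_comp[OF F LLW LLW Y k1 g y]
    by (rule fun_comp_eq[OF F X LLW Y u gk1 h(3) _ x]) (simp add: eq compose_eq uc)
  have G01: "mor F ?LLW Y g (mor F ?LLW ?LLW ?k0 (mor F ?LLW ?LLW ?k1 ?y)) = mor F X Y h01 x"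
    unfolding fun_comp[OF F LLW LLW Y k0 g c1] fun_comp[OF F LLW LLW Y k1 gk0 y]
    by (rule fun_comp_eq[OF F X LLW Y u lin_comp[OF k1 gk0 Lm] h(4) _ x]) (simp add: eq compose_eq uc lin_closed[OF k1])
  note gl = fun_lin[OF F LLW Y g]
  have "mor F ?LLW Y g (?y \<oplus>\<^bsub>obj F ?LLW\<^esub> mor F ?LLW ?LLW ?k0 (mor F ?LLW ?LLW ?k1 ?y)) =
      mor F ?LLW Y g (mor F ?LLW ?LLW ?k0 ?y \<oplus>\<^bsub>obj F ?LLW\<^esub> mor F ?LLW ?LLW ?k1 ?y)"
    by (simp only: second_difference_zero[OF F 0 W y])
  then show ?thesis
    unfolding lin_add[OF gl y c01] lin_add[OF gl c0 c1] G G0 G1 G01 .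
qed

text \<open>
  Apply \<open>cross_effect\<close> to the diagonal \<open>W \<oplus> R \<rightarrow> W \<oplus> R
  \<oplus> R\<close>, followed by the map that takes the two lines to \<open>b\<close> and
  \<open>c\<close>. When both lines are killed, the map factors through \<open>line_kill\<close>,
  which kills \<open>v\<close>.
\<close>

lemma line_map_additive:
  fixes F :: "('f, 'u :: infinite) vfunctor" and W :: "('f, 'u) module"
  assumes F: "is_functor R F" and 0: "is_zero_functor R (difference R (difference R F))" and W: "W \<in> fd"
    and Y: "Y \<in> fd" and j: "j \<in> linear_maps R W Y" and b: "b \<in> carrier Y" and c: "c \<in> carrier Y"
    and v: "v \<in> carrier (obj F (plus_line_space R W))"
      "mor F (plus_line_space R W) (plus_line_space R W) (line_kill W) v = \<zero>\<^bsub>obj F (plus_line_space R W)\<^esub>"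
  shows "mor F (plus_line_space R W) Y (line_map W Y j (b \<oplus>\<^bsub>Y\<^esub> c)) v =
    mor F (plus_line_space R W) Y (line_map W Y j b) v \<oplus>\<^bsub>obj F Y\<^esub> mor F (plus_line_space R W) Y (line_map W Y j c) v"
proof -
  let ?L = "plus_line_space R W"
  note L = plus_line_fd[OF W] and YM = fd_module[OF Y]
  interpret Y: Module.module R Y by (rule YM)
  interpret W: Module.module R W by (rule fd_module[OF W])
  interpret FY: Module.module R "obj F Y" by (rule fun_module[OF F Y])
  note lm = line_map_lin[OF W YM j]
  note [simp] = lin_closed[OF j] b c
  let ?u = "into_line ?L (\<lambda>z\<in>carrier ?L. z) (\<lambda>z\<in>carrier ?L. snd (pair_decode R z))"
  let ?g = "line_map ?L Y (line_map W Y j b) c"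
  have u: "?u \<in> linear_maps R ?L (plus_line_space R ?L)"
    by (rule into_line_lin[OF fd_module[OF L] lin_id[OF fd_module[OF L]] line_coord_linear[OF W]])
  have g: "?g \<in> linear_maps R (plus_line_space R ?L) Y" by (rule line_map_lin[OF L YM lm[OF b] c])
  have "mor F ?L Y (line_map W Y j (b \<oplus>\<^bsub>Y\<^esub> c)) v \<oplus>\<^bsub>obj F Y\<^esub> mor F ?L Y (line_map W Y j \<zero>\<^bsub>Y\<^esub>) v =
    mor F ?L Y (line_map W Y j b) v \<oplus>\<^bsub>obj F Y\<^esub> mor F ?L Y (line_map W Y j c) v"
    by (rule cross_effect[OF F 0 W L Y u g lm lm lm lm _ _ _ _ v(1)])
      (auto elim!: plus_line_cases simp: Y.smult_r_distr Y.M.a_assoc)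
  moreover have "mor F ?L Y (line_map W Y j \<zero>\<^bsub>Y\<^esub>) v = \<zero>\<^bsub>obj F Y\<^esub>"
  proof -
    have "mor F ?L Y (line_map W Y j \<zero>\<^bsub>Y\<^esub>) (mor F ?L ?L (line_kill W) v) = mor F ?L Y (line_map W Y j \<zero>\<^bsub>Y\<^esub>) v"
      by (rule fun_comp_eq[OF F L L Y line_kill_linear[OF W] lm lm _ v(1)]) (auto elim!: plus_line_cases)
    then show ?thesis
      unfolding v(2) using lin_zero[OF fun_lin[OF F L Y lm[of "\<zero>\<^bsub>Y\<^esub>"]] fun_module[OF F L] fun_module[OF F Y]] by simp
  qed
  moreover have "mor F ?L Y (line_map W Y j (b \<oplus>\<^bsub>Y\<^esub> c)) v \<in> carrier (obj F Y)"
    by (rule fun_closed[OF F L Y lm v(1)]) simp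
  ultimately show ?thesis by simp
qed

text \<open>
  Dually, apply \<open>cross_effect\<close> to the map \<open>X \<rightarrow> W \<oplus> R
  \<oplus> R\<close> with components \<open>p\<close>, \<open>\<eta>\<close> and
  \<open>\<theta>\<close>, followed by addition of the last two coordinates.
\<close>

lemma into_line_additive:
  fixes F :: "('f, 'u :: infinite) vfunctor" and W :: "('f, 'u) module"
  assumes F: "is_functor R F" and 0: "is_zero_functor R (difference R (difference R F))" and W: "W \<in> fd"
    and X: "X \<in> fd" and p: "p \<in> linear_maps R X W"
    and \<eta>: "\<eta> \<in> linear_maps R X scalars" and \<theta>: "\<theta> \<in> linear_maps R X scalars"
    and \<xi>: "\<xi> \<in> linear_maps R (obj F (plus_line_space R W)) scalars"
      "\<And>y. y \<in> carrier (obj F (plus_line_space R W)) \<Longrightarrow>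
        \<xi> (mor F (plus_line_space R W) (plus_line_space R W) (line_kill W) y) = \<zero>"
    and x: "x \<in> carrier (obj F X)"
  shows "\<xi> (mor F X (plus_line_space R W) (into_line X p (\<lambda>z\<in>carrier X. \<eta> z \<oplus> \<theta> z)) x) =
    \<xi> (mor F X (plus_line_space R W) (into_line X p \<eta>) x) \<oplus> \<xi> (mor F X (plus_line_space R W) (into_line X p \<theta>) x)"
proof -
  let ?L = "plus_line_space R W"
  note L = plus_line_fd[OF W] and XM = fd_module[OF X] and LM = fd_module[OF L]
  interpret W: Module.module R W by (rule fd_module[OF W])
  interpret X: Module.module R X by (rule XM)
  note il = into_line_lin[OF XM p]
  note [simp] = lin_closed[OF p] lin_closed[OF \<eta>, simplified] lin_closed[OF \<theta>, simplified]
  let ?u = "into_line X (into_line X p \<eta>) \<theta>"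
  let ?g = "line_map ?L ?L (\<lambda>z\<in>carrier ?L. z) (pair_code R (\<zero>\<^bsub>W\<^esub>, \<one>))"
  let ?zf = "\<lambda>z\<in>carrier X. \<zero>"
  have sum: "(\<lambda>z\<in>carrier X. \<eta> z \<oplus> \<theta> z) \<in> linear_maps R X scalars"
    using lin_sum[OF \<eta> \<theta> XM scalars_module] by simp
  have zero: "?zf \<in> linear_maps R X scalars" by (rule linear_mapsI) auto
  have u: "?u \<in> linear_maps R X (plus_line_space R ?L)" by (rule into_line_lin[OF XM il[OF \<eta>] \<theta>])
  have g: "?g \<in> linear_maps R (plus_line_space R ?L) ?L"
    by (rule line_map_lin[OF L LM lin_id[OF LM]]) simp
  have eq: "mor F X ?L (into_line X p (\<lambda>z\<in>carrier X. \<eta> z \<oplus> \<theta> z)) x \<oplus>\<^bsub>obj F ?L\<^esub> mor F X ?L (into_line X p ?zf) x =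
    mor F X ?L (into_line X p \<eta>) x \<oplus>\<^bsub>obj F ?L\<^esub> mor F X ?L (into_line X p \<theta>) x"
    by (rule cross_effect[OF F 0 W X L u g il[OF sum] il[OF \<eta>] il[OF \<theta>] il[OF zero] _ _ _ _ x]) auto
  have kill: "mor F ?L ?L (line_kill W) (mor F X ?L (into_line X p \<eta>) x) = mor F X ?L (into_line X p ?zf) x"
    by (rule fun_comp_eq[OF F X L L il[OF \<eta>] line_kill_linear[OF W] il[OF zero] _ x]) simp
  note cl = fun_closed[OF F X L il x]
  have "\<xi> (mor F X ?L (into_line X p ?zf) x) = \<zero>"
    unfolding kill[symmetric] by (rule \<xi>(2)[OF cl[OF \<eta>]])
  then have "\<xi> (mor F X ?L (into_line X p (\<lambda>z\<in>carrier X. \<eta> z \<oplus> \<theta> z)) x) =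
      \<xi> (mor F X ?L (into_line X p (\<lambda>z\<in>carrier X. \<eta> z \<oplus> \<theta> z)) x) \<oplus> \<xi> (mor F X ?L (into_line X p ?zf) x)"
    using lin_closed[OF \<xi>(1) cl[OF sum]] by (simp only: scalars_simps r_zero)
  also have "\<dots> = \<xi> (mor F X ?L (into_line X p \<eta>) x) \<oplus> \<xi> (mor F X ?L (into_line X p \<theta>) x)"
    using arg_cong[OF eq, of \<xi>]
    unfolding lin_add[OF \<xi>(1) cl[OF sum] cl[OF zero]] lin_add[OF \<xi>(1) cl[OF \<eta>] cl[OF \<theta>]] scalars_simps .
  finally show ?thesis .
qed

subsection \<open>Finite-dimensional duality\<close>

lemma functionals_separate:
  assumes V: "Module.module R V" and xy: "x \<in> carrier V" "y \<in> carrier V"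
    and eq: "\<And>\<eta>. \<eta> \<in> linear_maps R V scalars \<Longrightarrow> \<eta> x = \<eta> y"
  shows "x = y"
proof (rule ccontr)
  interpret V: Module.module R V by (rule V)
  assume "x \<noteq> y"
  then have "x \<ominus>\<^bsub>V\<^esub> y \<noteq> \<zero>\<^bsub>V\<^esub>" using minus_eq_zero_iff[OF V xy] by simp
  then obtain \<eta> where \<eta>: "\<eta> \<in> linear_maps R V scalars" "\<eta> (x \<ominus>\<^bsub>V\<^esub> y) = \<one>"
    using functional_exists[OF V] V.M.minus_closed[OF xy] by metis
  have "\<eta> (x \<ominus>\<^bsub>V\<^esub> y) = \<eta> x \<ominus>\<^bsub>scalars\<^esub> \<eta> y" by (rule lin_minus[OF \<eta>(1) V scalars_module xy])
  also have "\<dots> = \<zero>"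
    using minus_eq_zero_iff[OF scalars_module, of "\<eta> x" "\<eta> y"] eq[OF \<eta>(1)] lin_closed[OF \<eta>(1)] xy by simp
  finally show False using \<eta>(2) by simp
qed

text \<open>
  A finite-dimensional space is its own double dual; this is how a vector is found from the values
  that functionals are to take on it.
\<close>

lemma dual_representable:
  fixes V :: "('f, 'u) module"
  assumes V: "V \<in> fd"
    and closed: "\<And>\<eta>. \<eta> \<in> linear_maps R V scalars \<Longrightarrow> \<psi> \<eta> \<in> carrier R"
    and add: "\<And>\<eta> \<theta>. \<eta> \<in> linear_maps R V scalars \<Longrightarrow> \<theta> \<in> linear_maps R V scalars \<Longrightarrow>
      \<psi> (\<lambda>x\<in>carrier V. \<eta> x \<oplus> \<theta> x) = \<psi> \<eta> \<oplus> \<psi> \<theta>"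
    and smult: "\<And>a \<eta>. a \<in> carrier R \<Longrightarrow> \<eta> \<in> linear_maps R V scalars \<Longrightarrow> \<psi> (\<lambda>x\<in>carrier V. \<eta> x \<otimes> a) = \<psi> \<eta> \<otimes> a"
  shows "\<exists>!y. y \<in> carrier V \<and> (\<forall>\<eta>\<in>linear_maps R V scalars. \<eta> y = \<psi> \<eta>)"
proof -
  note VM = fd_module[OF V]
  interpret V: Module.module R V by (rule VM)
  obtain n :: nat and b \<eta> where b: "\<And>j. j < n \<Longrightarrow> b j \<in> carrier V" and \<eta>: "\<And>j. j < n \<Longrightarrow> \<eta> j \<in> linear_maps R V scalars"
    and coords: "\<And>x. x \<in> carrier V \<Longrightarrow> x = (\<Oplus>\<^bsub>V\<^esub>j\<in>{..<n}. \<eta> j x \<odot>\<^bsub>V\<^esub> b j)"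
    by (rule coordinates_exist[OF V]) (rule that)
  define y where "y = (\<Oplus>\<^bsub>V\<^esub>j\<in>{..<n}. \<psi> (\<eta> j) \<odot>\<^bsub>V\<^esub> b j)"
  have yc: "(\<lambda>j. \<psi> (\<eta> j) \<odot>\<^bsub>V\<^esub> b j) \<in> {..<n} \<rightarrow> carrier V" using b closed[OF \<eta>] by auto
  then have y: "y \<in> carrier V" unfolding y_def by (rule V.M.finsum_closed)
  have fin: "finsum scalars = finsum R" "\<And>A. A \<rightarrow> carrier scalars = A \<rightarrow> carrier R"
    by (simp_all add: scalars_def finsum_def finprod_def fun_eq_iff)
  have "\<theta> y = \<psi> \<theta>" if \<theta>: "\<theta> \<in> linear_maps R V scalars" for \<theta>
  proof -
    note \<theta>c = lin_closed[OF \<theta>, simplified]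
    have \<eta>c: "\<eta> j x \<in> carrier R" if "j < n" "x \<in> carrier V" for j x using lin_closed[OF \<eta>] that by simp
    define \<theta>' where "\<theta>' m = (\<lambda>x\<in>carrier V. \<Oplus>j\<in>{..<m}. \<eta> j x \<otimes> \<theta> (b j))" for m
    have ind: "\<theta>' m \<in> linear_maps R V scalars \<and> \<psi> (\<theta>' m) = (\<Oplus>j\<in>{..<m}. \<psi> (\<eta> j) \<otimes> \<theta> (b j))" if "m \<le> n" for m
      using that
    proof (induction m)
      case 0
      have eq: "\<theta>' 0 = (\<lambda>x\<in>carrier V. \<theta> x \<otimes> \<zero>)" unfolding \<theta>'_def by (rule restrict_ext) (simp add: \<theta>c)
      have "\<theta>' 0 \<in> linear_maps R V scalars" unfolding \<theta>'_def by (rule linear_mapsI) auto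
      moreover have "\<psi> (\<theta>' 0) = \<zero>" unfolding eq smult[OF zero_closed \<theta>] using closed[OF \<theta>] by simp
      ultimately show ?case by simp
    next
      case (Suc m)
      then have m: "m < n" and IH: "\<theta>' m \<in> linear_maps R V scalars" "\<psi> (\<theta>' m) = (\<Oplus>j\<in>{..<m}. \<psi> (\<eta> j) \<otimes> \<theta> (b j))"
        by auto
      have bc: "\<theta> (b j) \<in> carrier R" if "j < n" for j using \<theta>c b that by simp
      let ?t = "\<lambda>x\<in>carrier V. \<eta> m x \<otimes> \<theta> (b m)"
      have t: "?t \<in> linear_maps R V scalars"
        using smult_linear[OF scalars_module _ \<eta>[OF m] VM, of "\<theta> (b m)"] bc[OF m] by simp
      have eq: "\<theta>' (Suc m) = (\<lambda>x\<in>carrier V. ?t x \<oplus> \<theta>' m x)"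
        unfolding \<theta>'_def
      proof (rule restrict_ext)
        fix x assume x: "x \<in> carrier V"
        have "(\<Oplus>j\<in>{..<Suc m}. \<eta> j x \<otimes> \<theta> (b j)) = \<eta> m x \<otimes> \<theta> (b m) \<oplus> (\<Oplus>j\<in>{..<m}. \<eta> j x \<otimes> \<theta> (b j))"
          unfolding lessThan_Suc by (rule finsum_insert) (use m x \<eta>c bc in auto)
        then show "(\<Oplus>j\<in>{..<Suc m}. \<eta> j x \<otimes> \<theta> (b j)) = ?t x \<oplus> (\<lambda>x\<in>carrier V. \<Oplus>j\<in>{..<m}. \<eta> j x \<otimes> \<theta> (b j)) x"
          using x by simp
      qed
      have "\<psi> (\<theta>' (Suc m)) = \<psi> (\<eta> m) \<otimes> \<theta> (b m) \<oplus> (\<Oplus>j\<in>{..<m}. \<psi> (\<eta> j) \<otimes> \<theta> (b j))"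
        unfolding eq add[OF t IH(1)] smult[OF bc[OF m] \<eta>[OF m]] IH(2) by (rule refl)
      also have "\<dots> = (\<Oplus>j\<in>{..<Suc m}. \<psi> (\<eta> j) \<otimes> \<theta> (b j))"
        unfolding lessThan_Suc by (rule finsum_insert[symmetric]) (use m closed[OF \<eta>] bc in auto)
      finally have "\<psi> (\<theta>' (Suc m)) = (\<Oplus>j\<in>{..<Suc m}. \<psi> (\<eta> j) \<otimes> \<theta> (b j))" .
      moreover have "\<theta>' (Suc m) \<in> linear_maps R V scalars"
        unfolding eq using lin_sum[OF t IH(1) VM scalars_module] by (simp only: scalars_simps)
      ultimately show ?case by (rule conjI[rotated])
    qed
    have "\<theta>' n = \<theta>"
    proof (rule lin_eqI[OF conjunct1[OF ind[OF order_refl]] \<theta>])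
      fix x assume x: "x \<in> carrier V"
      have "\<theta> x = \<theta> (\<Oplus>\<^bsub>V\<^esub>j\<in>{..<n}. \<eta> j x \<odot>\<^bsub>V\<^esub> b j)" using coords[OF x] by simp
      also have "\<dots> = (\<Oplus>\<^bsub>scalars\<^esub>j\<in>{..<n}. \<theta> (\<eta> j x \<odot>\<^bsub>V\<^esub> b j))"
        by (rule lin_finsum[OF \<theta> VM scalars_module]) (use b \<eta>c x in auto)
      also have "\<dots> = (\<Oplus>j\<in>{..<n}. \<eta> j x \<otimes> \<theta> (b j))"
        unfolding fin by (rule finsum_cong') (use b \<eta>c x \<theta>c in \<open>auto simp: lin_smult[OF \<theta>]\<close>)
      finally show "\<theta>' n x = \<theta> x" using x by (simp add: \<theta>'_def)
    qed
    then have "\<psi> \<theta> = (\<Oplus>j\<in>{..<n}. \<psi> (\<eta> j) \<otimes> \<theta> (b j))" using ind[OF order_refl] by simp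
    also have "\<dots> = (\<Oplus>\<^bsub>scalars\<^esub>j\<in>{..<n}. \<theta> (\<psi> (\<eta> j) \<odot>\<^bsub>V\<^esub> b j))"
      unfolding fin by (rule finsum_cong') (use b closed[OF \<eta>] \<theta>c in \<open>auto simp: lin_smult[OF \<theta>]\<close>)
    also have "\<dots> = \<theta> y"
      unfolding y_def by (rule lin_finsum[OF \<theta> VM scalars_module _ yc, symmetric]) simp
    finally show ?thesis by simp
  qed
  then show ?thesis using y functionals_separate[OF VM] by (intro ex1I[of _ y]) auto
qed

subsection \<open>Eigenvectors in the linear part\<close>

definition field_automorphism :: "('f \<Rightarrow> 'f) \<Rightarrow> bool" where
  "field_automorphism \<sigma> \<longleftrightarrow> bij_betw \<sigma> (carrier R) (carrier R) \<and> \<sigma> \<one> = \<one> \<and>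
     (\<forall>a\<in>carrier R. \<forall>b\<in>carrier R. \<sigma> (a \<oplus> b) = \<sigma> a \<oplus> \<sigma> b \<and> \<sigma> (a \<otimes> b) = \<sigma> a \<otimes> \<sigma> b)"

text \<open>
  The endomorphism \<open>(x, r) \<mapsto> (x, r a)\<close> of \<open>W \<oplus> R\<close>.
\<close>

definition line_scale :: "('f, 'u) module \<Rightarrow> 'f \<Rightarrow> 'u \<Rightarrow> 'u" where
  "line_scale W a = line_map W (plus_line_space R W) (plus_line_incl R W) (pair_code R (\<zero>\<^bsub>W\<^esub>, a))"

lemma plus_line_incl_apply [simp]: "x \<in> carrier V \<Longrightarrow> plus_line_incl R V x = pair_code R (x, \<zero>)"
  by (simp add: plus_line_incl_def)

lemma line_scale_linear:
  fixes W :: "('f, 'u :: infinite) module"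
  assumes W: "W \<in> fd" and a: "a \<in> carrier R"
  shows "line_scale W a \<in> linear_maps R (plus_line_space R W) (plus_line_space R W)"
proof -
  interpret W: Module.module R W by (rule fd_module[OF W])
  show ?thesis unfolding line_scale_def
    by (rule line_map_lin[OF W fd_module[OF plus_line_fd[OF W]] plus_line_incl_linear[OF W]]) (use a in simp)
qed

lemma line_scale_apply [simp]:
  fixes W :: "('f, 'u :: infinite) module"
  assumes W: "W \<in> fd" and a: "a \<in> carrier R" and x: "x \<in> carrier W" "r \<in> carrier R"
  shows "line_scale W a (pair_code R (x, r)) = pair_code R (x, r \<otimes> a)"
proof -
  interpret W: Module.module R W by (rule fd_module[OF W])
  show ?thesis using a x by (simp add: line_scale_def)
qed

lemma line_scale_action:
  fixes F :: "('f, 'u :: infinite) vfunctor"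
  assumes F: "is_functor R F" and W: "W \<in> fd"
  shows "scalar_action (obj F (plus_line_space R W)) (\<lambda>a. mor F (plus_line_space R W) (plus_line_space R W) (line_scale W a))"
proof -
  note L = plus_line_fd[OF W]
  note sl = line_scale_linear[OF W]
  show ?thesis
    unfolding scalar_action_def
  proof (intro conjI ballI)
    show "Module.module R (obj F (plus_line_space R W))" by (rule fun_module[OF F L])
    fix a assume a: "a \<in> carrier R"
    show "mor F (plus_line_space R W) (plus_line_space R W) (line_scale W a) \<in>
        linear_maps R (obj F (plus_line_space R W)) (obj F (plus_line_space R W))"
      by (rule fun_lin[OF F L L sl[OF a]])
    fix b x assume b: "b \<in> carrier R" and x: "x \<in> carrier (obj F (plus_line_space R W))"
    show "mor F (plus_line_space R W) (plus_line_space R W) (line_scale W a)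
          (mor F (plus_line_space R W) (plus_line_space R W) (line_scale W b) x) =
        mor F (plus_line_space R W) (plus_line_space R W) (line_scale W (a \<otimes> b)) x"
      by (rule fun_comp_eq[OF F L L L sl[OF b] sl[OF a] sl[OF m_closed[OF a b]] _ x])
        (auto elim!: plus_line_cases simp: W a b m_ac)
  next
    fix x assume x: "x \<in> carrier (obj F (plus_line_space R W))"
    have "line_scale W \<one> = (\<lambda>z\<in>carrier (plus_line_space R W). z)"
      by (rule plus_line_eqI[OF sl[OF one_closed] lin_id[OF fd_module[OF L]]]) (simp add: W)
    then show "mor F (plus_line_space R W) (plus_line_space R W) (line_scale W \<one>) x = x"
      by (simp only: fun_id[OF F L x])
  qed
qed

lemma line_scale_zero:
  fixes W :: "('f, 'u :: infinite) module"
  shows "W \<in> fd \<Longrightarrow> line_scale W \<zero> = line_kill W"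
  by (rule plus_line_eqI[OF line_scale_linear line_kill_linear]) simp_all

lemma smult_cancel:
  fixes M :: "('f, 'a) module"
  assumes M: "Module.module R M" and v: "v \<in> carrier M" "v \<noteq> \<zero>\<^bsub>M\<^esub>"
    and ab: "a \<in> carrier R" "b \<in> carrier R" and eq: "a \<odot>\<^bsub>M\<^esub> v = b \<odot>\<^bsub>M\<^esub> v"
  shows "a = b"
proof -
  interpret M: Module.module R M by (rule M)
  obtain \<xi> where \<xi>: "\<xi> \<in> linear_maps R M scalars" "\<xi> v = \<one>" using functional_exists[OF M v] .
  have "\<xi> (a \<odot>\<^bsub>M\<^esub> v) = \<xi> (b \<odot>\<^bsub>M\<^esub> v)" using eq by simp
  then show ?thesis using ab v \<xi>(2) by (simp add: lin_smult[OF \<xi>(1)])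
qed

text \<open>
  By \<open>line_map_additive\<close>, \<open>a + b\<close> acts on the eigenvector as the sum of
  the actions of \<open>a\<close> and \<open>b\<close>. So its character is additive, and, being
  also multiplicative and nonzero on units, it extends to an automorphism of the finite field. The
  image of the eigenvector in \<open>F2\<close> has the same character, which gives the
  functional.
\<close>

lemma linear_part_eigenvector:
  fixes F1 F2 :: "('f, 'u :: infinite) vfunctor" and W :: "('f, 'u) module"
  defines "L \<equiv> plus_line_space R W"
  assumes F1: "is_functor R F1" and F2: "is_functor R F2" and f: "f \<in> nat_trans R F1 F2"
    and 01: "is_zero_functor R (difference R (difference R F1))" and W: "W \<in> fd"
    and x: "x \<in> carrier (obj F1 L)" "mor F1 L L (line_kill W) x = \<zero>\<^bsub>obj F1 L\<^esub>" "f L x \<noteq> \<zero>\<^bsub>obj F2 L\<^esub>"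
  obtains v \<sigma> \<xi> where "field_automorphism \<sigma>" "v \<in> carrier (obj F1 L)"
    "mor F1 L L (line_kill W) v = \<zero>\<^bsub>obj F1 L\<^esub>"
    "\<And>a. a \<in> carrier R \<Longrightarrow> mor F1 L L (line_scale W a) v = \<sigma> a \<odot>\<^bsub>obj F1 L\<^esub> v"
    "\<xi> \<in> linear_maps R (obj F2 L) scalars" "\<xi> (f L v) = \<one>"
    "\<And>y. y \<in> carrier (obj F2 L) \<Longrightarrow> \<xi> (mor F2 L L (line_kill W) y) = \<zero>"
    "\<And>a y. a \<in> carrier R \<Longrightarrow> y \<in> carrier (obj F2 L) \<Longrightarrow> \<xi> (mor F2 L L (line_scale W a) y) = \<sigma> a \<otimes> \<xi> y"
proof -
  have L: "L \<in> fd" unfolding L_def by (rule plus_line_fd[OF W])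
  note M1 = fun_module[OF F1 L] and M2 = fun_module[OF F2 L]
  interpret M1: Module.module R "obj F1 L" by (rule M1)
  interpret M2: Module.module R "obj F2 L" by (rule M2)
  interpret W: Module.module R W by (rule fd_module[OF W])
  let ?E1 = "\<lambda>a. mor F1 L L (line_scale W a)" and ?E2 = "\<lambda>a. mor F2 L L (line_scale W a)"
  have A1: "scalar_action (obj F1 L) ?E1" and A2: "scalar_action (obj F2 L) ?E2"
    unfolding L_def by (rule line_scale_action[OF _ W], fact)+
  have z: "line_scale W \<zero> = line_kill W" by (rule line_scale_zero[OF W])
  have sl: "line_scale W a \<in> linear_maps R L L" if "a \<in> carrier R" for a
    unfolding L_def by (rule line_scale_linear[OF W that])
  obtain v \<chi> where v: "v \<in> carrier (obj F1 L)" "?E1 \<zero> v = \<zero>\<^bsub>obj F1 L\<^esub>" "f L v \<noteq> \<zero>\<^bsub>obj F2 L\<^esub>"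
    and \<chi>: "\<And>a. a \<in> units \<Longrightarrow> \<chi> a \<in> units \<and> ?E1 a v = \<chi> a \<odot>\<^bsub>obj F1 L\<^esub> v"
    by (rule eigenvector_exists[OF A1 x(1) x(2)[folded z] nt_lin[OF f L] M2 x(3)]) (rule that)
  have v0: "v \<noteq> \<zero>\<^bsub>obj F1 L\<^esub>" using v(3) lin_zero[OF nt_lin[OF f L] M1 M2] by auto
  note cancel = smult_cancel[OF M1 v(1) v0]
  define \<sigma> where "\<sigma> a = (if a = \<zero> then \<zero> else \<chi> a)" for a
  have \<sigma>c: "\<sigma> a \<in> carrier R" and \<sigma>E: "?E1 a v = \<sigma> a \<odot>\<^bsub>obj F1 L\<^esub> v" if "a \<in> carrier R" for a
    using \<chi>[of a] that v by (auto simp: \<sigma>_def)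
  have \<sigma>u: "\<sigma> a \<in> units" if "a \<in> units" for a using \<chi>[OF that] that by (simp add: \<sigma>_def)
  have EE: "?E1 a (?E1 b y) = ?E1 (a \<otimes> b) y" if "a \<in> carrier R" "b \<in> carrier R" "y \<in> carrier (obj F1 L)" for a b y
    using A1 that by (simp add: scalar_action_def)
  have mult: "\<sigma> (a \<otimes> b) = \<sigma> a \<otimes> \<sigma> b" if ab: "a \<in> carrier R" "b \<in> carrier R" for a b
  proof (rule cancel)
    have "\<sigma> (a \<otimes> b) \<odot>\<^bsub>obj F1 L\<^esub> v = ?E1 a (?E1 b v)" using ab v by (simp add: EE \<sigma>E[symmetric])
    also have "\<dots> = \<sigma> b \<odot>\<^bsub>obj F1 L\<^esub> ?E1 a v"
      unfolding \<sigma>E[OF ab(2)] by (rule lin_smult[OF fun_lin[OF F1 L L sl[OF ab(1)]] \<sigma>c[OF ab(2)] v(1)])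
    also have "\<dots> = (\<sigma> a \<otimes> \<sigma> b) \<odot>\<^bsub>obj F1 L\<^esub> v"
      using ab v \<sigma>c by (simp add: \<sigma>E M1.smult_assoc1[symmetric] m_comm)
    finally show "\<sigma> (a \<otimes> b) \<odot>\<^bsub>obj F1 L\<^esub> v = (\<sigma> a \<otimes> \<sigma> b) \<odot>\<^bsub>obj F1 L\<^esub> v" .
  qed (use \<sigma>c ab in auto)
  have add: "\<sigma> (a \<oplus> b) = \<sigma> a \<oplus> \<sigma> b" if ab: "a \<in> carrier R" "b \<in> carrier R" for a b
  proof (rule cancel)
    have c: "pair_code R (\<zero>\<^bsub>W\<^esub>, a) \<in> carrier L" "pair_code R (\<zero>\<^bsub>W\<^esub>, b) \<in> carrier L"
      using ab by (simp_all add: L_def)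
    have s: "pair_code R (\<zero>\<^bsub>W\<^esub>, a) \<oplus>\<^bsub>L\<^esub> pair_code R (\<zero>\<^bsub>W\<^esub>, b) = pair_code R (\<zero>\<^bsub>W\<^esub>, a \<oplus> b)"
      using ab by (simp add: L_def)
    have "?E1 (a \<oplus> b) v = ?E1 a v \<oplus>\<^bsub>obj F1 L\<^esub> ?E1 b v"
      using line_map_additive[OF F1 01 W L[unfolded L_def] plus_line_incl_linear[OF W] c[unfolded L_def]
          v(1)[unfolded L_def] v(2)[unfolded z, unfolded L_def], folded L_def, unfolded s]
      unfolding line_scale_def[symmetric, where W=W, folded L_def] .
    then show "\<sigma> (a \<oplus> b) \<odot>\<^bsub>obj F1 L\<^esub> v = (\<sigma> a \<oplus> \<sigma> b) \<odot>\<^bsub>obj F1 L\<^esub> v"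
      using ab v \<sigma>c by (simp add: \<sigma>E M1.smult_l_distr)
  qed (use \<sigma>c ab in auto)
  have one: "\<sigma> \<one> = \<one>"
  proof (rule cancel)
    show "\<sigma> \<one> \<odot>\<^bsub>obj F1 L\<^esub> v = \<one> \<odot>\<^bsub>obj F1 L\<^esub> v"
      using A1 v by (simp add: \<sigma>E[symmetric] scalar_action_def)
  qed (use \<sigma>c in auto)
  have inj: "inj_on \<sigma> (carrier R)"
  proof (rule inj_onI, rule ccontr)
    fix a b assume ab: "a \<in> carrier R" "b \<in> carrier R" "\<sigma> a = \<sigma> b" "a \<noteq> b"
    have a: "a = (a \<ominus> b) \<oplus> b" using ab by (simp add: a_minus_def a_assoc l_neg)
    then have "a \<ominus> b \<noteq> \<zero>" using ab by auto
    then have "\<sigma> (a \<ominus> b) \<in> units" using ab by (intro \<sigma>u) auto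
    moreover have "\<sigma> (a \<ominus> b) \<oplus> \<sigma> b = \<sigma> b"
      using add[of "a \<ominus> b" b, folded a] ab by simp
    then have "\<sigma> (a \<ominus> b) = \<zero>" using ab \<sigma>c[of "a \<ominus> b"] \<sigma>c[of b] by simp
    ultimately show False by simp
  qed
  have "\<sigma> ` carrier R = carrier R" by (rule endo_inj_surj[OF finite_scalars _ inj]) (use \<sigma>c in auto)
  then have aut: "field_automorphism \<sigma>"
    using inj one add mult by (simp add: field_automorphism_def bij_betw_def)
  have fv: "f L v \<in> carrier (obj F2 L)" by (rule nt_closed[OF f L v(1)])
  have fE: "f L (?E1 a v) = ?E2 a (f L v)" if "a \<in> carrier R" for a by (rule nt_nat[OF f L L sl[OF that] v(1)])
  have E20: "?E2 \<zero> (f L v) = \<zero>\<^bsub>obj F2 L\<^esub>"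
    using fE[OF zero_closed] lin_zero[OF nt_lin[OF f L] M1 M2] by (simp add: v(2))
  have E2u: "?E2 a (f L v) = \<sigma> a \<odot>\<^bsub>obj F2 L\<^esub> f L v" if "a \<in> units" for a
    using that fE[of a] \<sigma>E[of a] lin_smult[OF nt_lin[OF f L] \<sigma>c v(1)] by simp
  obtain \<xi> where \<xi>: "\<xi> \<in> linear_maps R (obj F2 L) scalars" "\<xi> (f L v) = \<one>"
    "\<And>y. y \<in> carrier (obj F2 L) \<Longrightarrow> \<xi> (?E2 \<zero> y) = \<zero>"
    "\<And>a y. a \<in> units \<Longrightarrow> y \<in> carrier (obj F2 L) \<Longrightarrow> \<xi> (?E2 a y) = \<sigma> a \<otimes> \<xi> y"
    by (rule eigenfunctional_exists[OF A2 fv v(3) E20, of \<sigma>]) (use \<sigma>u mult E2u that in auto)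
  have \<xi>E: "\<xi> (?E2 a y) = \<sigma> a \<otimes> \<xi> y" if "a \<in> carrier R" "y \<in> carrier (obj F2 L)" for a y
    using \<xi>(3)[of y] \<xi>(4)[of a y] lin_closed[OF \<xi>(1) that(2)] that by (cases "a = \<zero>") (auto simp: \<sigma>_def)
  show ?thesis
    using that[OF aut v(1) v(2)[unfolded z] \<sigma>E \<xi>(1,2) \<xi>(3)[unfolded z] \<xi>E] .
qed

subsection \<open>Twisted sums\<close>

definition sum_code :: "'u \<times> 'u \<Rightarrow> 'u" where
  "sum_code = (SOME e. inj e)"

definition sum_decode :: "'u \<Rightarrow> 'u \<times> 'u" where
  "sum_decode = inv_into UNIV sum_code"

lemma sum_code_inj: "inj (sum_code :: 'u :: infinite \<times> 'u \<Rightarrow> 'u)"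
proof -
  have "codable TYPE('u) ((UNIV :: 'u set) \<times> (UNIV :: 'u set))" by (intro codable_Times codable_UNIV)
  then have "\<exists>e :: 'u \<times> 'u \<Rightarrow> 'u. inj e" by (simp add: codable_def)
  then show ?thesis unfolding sum_code_def by (rule someI_ex)
qed

lemma sum_decode_code [simp]: "sum_decode (sum_code (p :: 'u :: infinite \<times> 'u)) = p"
  unfolding sum_decode_def by (rule inv_into_f_f[OF sum_code_inj]) simp

text \<open>
  The space \<open>W \<oplus> V\<close> with scalars acting on \<open>V\<close> through
  \<open>\<sigma>\<close>. The twist cancels the automorphism by which scalars act on the
  eigenvector, so that the maps from and to the identity functor become linear.
\<close>

definition twisted_sum :: "('f \<Rightarrow> 'f) \<Rightarrow> ('f, 'u) module \<Rightarrow> ('f, 'u) module \<Rightarrow> ('f, 'u) module" where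
  "twisted_sum \<sigma> W V = \<lparr>carrier = sum_code ` (carrier W \<times> carrier V), mult = undefined, one = undefined,
     zero = sum_code (\<zero>\<^bsub>W\<^esub>, \<zero>\<^bsub>V\<^esub>),
     add = (\<lambda>z z'. sum_code (fst (sum_decode z) \<oplus>\<^bsub>W\<^esub> fst (sum_decode z'), snd (sum_decode z) \<oplus>\<^bsub>V\<^esub> snd (sum_decode z'))),
     smult = (\<lambda>a z. sum_code (a \<odot>\<^bsub>W\<^esub> fst (sum_decode z), \<sigma> a \<odot>\<^bsub>V\<^esub> snd (sum_decode z)))\<rparr>"

lemma twisted_sum_simps [simp]:
  fixes V :: "('f, 'u :: infinite) module"
  shows "\<zero>\<^bsub>twisted_sum \<sigma> W V\<^esub> = sum_code (\<zero>\<^bsub>W\<^esub>, \<zero>\<^bsub>V\<^esub>)"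
    "sum_code (w, x) \<oplus>\<^bsub>twisted_sum \<sigma> W V\<^esub> sum_code (w', x') = sum_code (w \<oplus>\<^bsub>W\<^esub> w', x \<oplus>\<^bsub>V\<^esub> x')"
    "a \<odot>\<^bsub>twisted_sum \<sigma> W V\<^esub> sum_code (w, x) = sum_code (a \<odot>\<^bsub>W\<^esub> w, \<sigma> a \<odot>\<^bsub>V\<^esub> x)"
  by (simp_all add: twisted_sum_def)

lemma twisted_sum_elem [simp]:
  fixes V :: "('f, 'u :: infinite) module"
  shows "sum_code (w, x) \<in> carrier (twisted_sum \<sigma> W V) \<longleftrightarrow> w \<in> carrier W \<and> x \<in> carrier V"
  using sum_code_inj by (auto simp: twisted_sum_def inj_on_def)

lemma twisted_sum_cases:
  fixes V :: "('f, 'u :: infinite) module"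
  assumes "z \<in> carrier (twisted_sum \<sigma> W V)"
  obtains w x where "w \<in> carrier W" "x \<in> carrier V" "z = sum_code (w, x)"
  using assms by (auto simp: twisted_sum_def)

context
  fixes \<sigma>
  assumes \<sigma>: "field_automorphism \<sigma>"
begin

lemma automorphism_simps:
  "a \<in> carrier R \<Longrightarrow> \<sigma> a \<in> carrier R" "\<sigma> \<one> = \<one>"
  "a \<in> carrier R \<Longrightarrow> b \<in> carrier R \<Longrightarrow> \<sigma> (a \<oplus> b) = \<sigma> a \<oplus> \<sigma> b"
  "a \<in> carrier R \<Longrightarrow> b \<in> carrier R \<Longrightarrow> \<sigma> (a \<otimes> b) = \<sigma> a \<otimes> \<sigma> b"
  using \<sigma> by (auto simp: field_automorphism_def bij_betw_def)

lemma automorphism_inv: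
  "a \<in> carrier R \<Longrightarrow> inv_into (carrier R) \<sigma> a \<in> carrier R"
  "a \<in> carrier R \<Longrightarrow> \<sigma> (inv_into (carrier R) \<sigma> a) = a"
  "a \<in> carrier R \<Longrightarrow> inv_into (carrier R) \<sigma> (\<sigma> a) = a"
  using \<sigma> by (auto simp: field_automorphism_def bij_betw_def intro: inv_into_into f_inv_into_f inv_into_f_f)

lemma automorphism_inv_ops:
  assumes "a \<in> carrier R" "b \<in> carrier R"
  shows "inv_into (carrier R) \<sigma> (a \<oplus> b) = inv_into (carrier R) \<sigma> a \<oplus> inv_into (carrier R) \<sigma> b"
    "inv_into (carrier R) \<sigma> (a \<otimes> b) = inv_into (carrier R) \<sigma> a \<otimes> inv_into (carrier R) \<sigma> b"
proof -
  have inj: "inj_on \<sigma> (carrier R)" using \<sigma> by (simp add: field_automorphism_def bij_betw_def)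
  show "inv_into (carrier R) \<sigma> (a \<oplus> b) = inv_into (carrier R) \<sigma> a \<oplus> inv_into (carrier R) \<sigma> b"
    by (rule inj_onD[OF inj]) (use assms in \<open>auto simp: automorphism_simps automorphism_inv\<close>)
  show "inv_into (carrier R) \<sigma> (a \<otimes> b) = inv_into (carrier R) \<sigma> a \<otimes> inv_into (carrier R) \<sigma> b"
    by (rule inj_onD[OF inj]) (use assms in \<open>auto simp: automorphism_simps automorphism_inv\<close>)
qed

lemma twisted_sum_fd:
  fixes V :: "('f, 'u :: infinite) module"
  assumes W: "W \<in> fd" and V: "V \<in> fd"
  shows "twisted_sum \<sigma> W V \<in> fd"
proof -
  interpret V: Module.module R V by (rule fd_module[OF V])
  let ?V = "V\<lparr>smult := \<lambda>a x. \<sigma> a \<odot>\<^bsub>V\<^esub> x\<rparr>"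
  have V': "Module.module R ?V"
  proof (rule moduleI)
    show "abelian_group ?V"
      by (rule abelian_groupI) (auto simp: V.M.a_ac intro: bexI[of _ "\<ominus>\<^bsub>V\<^esub> x" for x] V.M.l_neg)
  qed (auto simp: is_cring automorphism_simps V.smult_l_distr V.smult_r_distr V.smult_assoc1)
  have "Module.module R (twisted_sum \<sigma> W V)"
    by (rule transport_module[OF prod_module_is_module[OF fd_module[OF W] V'], where k=sum_code])
      (auto simp: twisted_sum_def)
  then show ?thesis using W V by (simp add: fd_iff_finite) (simp add: twisted_sum_def)
qed

lemma twisted_sum_linearI:
  fixes V :: "('f, 'u :: infinite) module"
  assumes W: "W \<in> fd" and V: "V \<in> fd"
    and closed: "\<And>w x. w \<in> carrier W \<Longrightarrow> x \<in> carrier V \<Longrightarrow> F w x \<in> carrier M"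
    and add: "\<And>w x w' x'. w \<in> carrier W \<Longrightarrow> x \<in> carrier V \<Longrightarrow> w' \<in> carrier W \<Longrightarrow> x' \<in> carrier V \<Longrightarrow>
      F (w \<oplus>\<^bsub>W\<^esub> w') (x \<oplus>\<^bsub>V\<^esub> x') = F w x \<oplus>\<^bsub>M\<^esub> F w' x'"
    and smult: "\<And>a w x. a \<in> carrier R \<Longrightarrow> w \<in> carrier W \<Longrightarrow> x \<in> carrier V \<Longrightarrow>
      F (a \<odot>\<^bsub>W\<^esub> w) (\<sigma> a \<odot>\<^bsub>V\<^esub> x) = a \<odot>\<^bsub>M\<^esub> F w x"
  shows "(\<lambda>z\<in>carrier (twisted_sum \<sigma> W V). F (fst (sum_decode z)) (snd (sum_decode z)))
     \<in> linear_maps R (twisted_sum \<sigma> W V) M" (is "?f \<in> _")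
proof -
  interpret V: Module.module R V by (rule fd_module[OF V])
  interpret W: Module.module R W by (rule fd_module[OF W])
  show ?thesis
  proof (rule linear_mapsI)
    fix z assume "z \<in> carrier (twisted_sum \<sigma> W V)"
    then obtain w x where "w \<in> carrier W" "x \<in> carrier V" "z = sum_code (w, x)" by (rule twisted_sum_cases)
    then show "?f z \<in> carrier M" by (simp add: closed)
  next
    fix z z' assume "z \<in> carrier (twisted_sum \<sigma> W V)" "z' \<in> carrier (twisted_sum \<sigma> W V)"
    then obtain w x w' x' where "w \<in> carrier W" "x \<in> carrier V" "z = sum_code (w, x)"
      "w' \<in> carrier W" "x' \<in> carrier V" "z' = sum_code (w', x')" by (metis twisted_sum_cases)
    then show "?f (z \<oplus>\<^bsub>twisted_sum \<sigma> W V\<^esub> z') = ?f z \<oplus>\<^bsub>M\<^esub> ?f z'" by (simp add: add)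
  next
    fix a z assume "a \<in> carrier R" "z \<in> carrier (twisted_sum \<sigma> W V)"
    then obtain w x where "a \<in> carrier R" "w \<in> carrier W" "x \<in> carrier V" "z = sum_code (w, x)"
      by (metis twisted_sum_cases)
    then show "?f (a \<odot>\<^bsub>twisted_sum \<sigma> W V\<^esub> z) = a \<odot>\<^bsub>M\<^esub> ?f z"
      by (simp add: smult automorphism_simps)
  qed simp
qed

definition twisted_sum_functor :: "('f, 'u) module \<Rightarrow> ('f, 'u) vfunctor" where
  "twisted_sum_functor W = \<lparr>obj = twisted_sum \<sigma> W, mor = (\<lambda>V V' h. \<lambda>z\<in>carrier (twisted_sum \<sigma> W V).
     sum_code (fst (sum_decode z), h (snd (sum_decode z))))\<rparr>"

lemma twisted_sum_functor_simps [simp]: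
  fixes V :: "('f, 'u :: infinite) module"
  shows "obj (twisted_sum_functor W) V = twisted_sum \<sigma> W V"
    "w \<in> carrier W \<Longrightarrow> x \<in> carrier V \<Longrightarrow> mor (twisted_sum_functor W) V V' h (sum_code (w, x)) = sum_code (w, h x)"
  by (simp_all add: twisted_sum_functor_def)

lemma twisted_sum_mor_linear:
  fixes V :: "('f, 'u :: infinite) module"
  assumes W: "W \<in> fd" and V: "V \<in> fd" and h: "h \<in> linear_maps R V V'"
  shows "mor (twisted_sum_functor W) V V' h \<in> linear_maps R (twisted_sum \<sigma> W V) (twisted_sum \<sigma> W V')"
  unfolding twisted_sum_functor_def vfunctor.simps
  by (rule twisted_sum_linearI[OF W V, of "\<lambda>w x. sum_code (w, h x)"])
    (auto simp: lin_closed[OF h] lin_add[OF h] lin_smult[OF h] automorphism_simps)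

lemma fd_functor_twisted_sum:
  fixes W :: "('f, 'u :: infinite) module"
  assumes W: "W \<in> fd"
  shows "fd_functor (twisted_sum_functor W)"
  unfolding fd_functor_def
proof (intro conjI is_functorI ballI)
  fix V :: "('f, 'u) module" assume V: "V \<in> fd"
  show "obj (twisted_sum_functor W) V \<in> fd" using twisted_sum_fd[OF W V] by simp
  show "Module.module R (obj (twisted_sum_functor W) V)" using fd_module[OF twisted_sum_fd[OF W V]] by simp
  show "mor (twisted_sum_functor W) V V (\<lambda>x\<in>carrier V. x) x = x" if "x \<in> carrier (obj (twisted_sum_functor W) V)" for x
    using that by (auto elim!: twisted_sum_cases)
next
  fix V V' :: "('f, 'u) module" and f assume "V \<in> fd" "f \<in> linear_maps R V V'"
  then show "mor (twisted_sum_functor W) V V' f \<in> linear_maps R (obj (twisted_sum_functor W) V) (obj (twisted_sum_functor W) V')"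
    using twisted_sum_mor_linear[OF W] by simp
next
  fix U V V' :: "('f, 'u) module" and f g x
  assume "f \<in> linear_maps R U V" "g \<in> linear_maps R V V'" "x \<in> carrier (obj (twisted_sum_functor W) U)"
  then show "mor (twisted_sum_functor W) U V' (compose (carrier U) g f) x =
     mor (twisted_sum_functor W) V V' g (mor (twisted_sum_functor W) U V f x)"
    by (auto elim!: twisted_sum_cases simp: compose_eq lin_closed)
qed

end

subsection \<open>The identity as a retract\<close>

text \<open>
  For \<open>y\<close> in \<open>V\<close> let \<open>A y\<close> be the map \<open>W \<oplus> R
  \<rightarrow> T V\<close>, \<open>(w, r) \<mapsto> (w, \<sigma>(r) y)\<close>, and for a
  functional \<open>\<eta>\<close> on \<open>V\<close> let \<open>B \<eta>\<close> be the map
  \<open>T V \<rightarrow> W \<oplus> R\<close>, \<open>(w, y) \<mapsto> (w,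
  \<sigma>\<^sup>-\<^sup>1(\<eta> y))\<close>. Then \<open>\<alpha> y = F1(A y) v\<close>, and
  \<open>\<beta> z\<close> is the vector on which every \<open>\<eta>\<close> takes the value
  \<open>\<xi>(F2(B \<eta>) z)\<close>. The composite of \<open>A y\<close> and \<open>B
  \<eta>\<close> scales the line by \<open>\<sigma>\<^sup>-\<^sup>1(\<eta> y)\<close>. So it
  multiplies \<open>v\<close> by \<open>\<eta> y\<close>, and this is the value of
  \<open>\<eta>\<close> on \<open>\<beta>(f(\<alpha> y))\<close>.
\<close>

lemma identity_retract_linear_part:
  fixes F1 F2 :: "('f, 'u :: infinite) vfunctor" and W :: "('f, 'u) module"
  assumes F1: "is_functor R F1" and F2: "is_functor R F2" and f: "f \<in> nat_trans R F1 F2"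
    and 01: "is_zero_functor R (difference R (difference R F1))"
    and 02: "is_zero_functor R (difference R (difference R F2))" and W: "W \<in> fd"
    and x: "x \<in> carrier (obj F1 (plus_line_space R W))"
      "mor F1 (plus_line_space R W) (plus_line_space R W) (line_kill W) x = \<zero>\<^bsub>obj F1 (plus_line_space R W)\<^esub>"
      "f (plus_line_space R W) x \<noteq> \<zero>\<^bsub>obj F2 (plus_line_space R W)\<^esub>"
  shows "identity_retract F1 F2 f"
proof -
  define L where "L = plus_line_space R W"
  have L: "L \<in> fd" unfolding L_def by (rule plus_line_fd[OF W])
  note WM = fd_module[OF W] and LM = fd_module[OF L]
  interpret W: Module.module R W by (rule WM)
  obtain v \<sigma> \<xi> where \<sigma>: "field_automorphism \<sigma>" and v: "v \<in> carrier (obj F1 L)"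
    "mor F1 L L (line_kill W) v = \<zero>\<^bsub>obj F1 L\<^esub>"
    and v\<sigma>: "\<And>a. a \<in> carrier R \<Longrightarrow> mor F1 L L (line_scale W a) v = \<sigma> a \<odot>\<^bsub>obj F1 L\<^esub> v"
    and \<xi>: "\<xi> \<in> linear_maps R (obj F2 L) scalars" and \<xi>v: "\<xi> (f L v) = \<one>"
    and \<xi>0: "\<And>y. y \<in> carrier (obj F2 L) \<Longrightarrow> \<xi> (mor F2 L L (line_kill W) y) = \<zero>"
    and \<xi>\<sigma>: "\<And>a y. a \<in> carrier R \<Longrightarrow> y \<in> carrier (obj F2 L) \<Longrightarrow> \<xi> (mor F2 L L (line_scale W a) y) = \<sigma> a \<otimes> \<xi> y"
    by (rule linear_part_eigenvector[OF F1 F2 f 01 W x, folded L_def]) (rule that)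
  note \<sigma>s = automorphism_simps[OF \<sigma>]
  define \<tau> where "\<tau> = inv_into (carrier R) \<sigma>"
  note \<tau>s = automorphism_inv[OF \<sigma>, folded \<tau>_def] automorphism_inv_ops[OF \<sigma>, folded \<tau>_def]
  note [simp] = \<sigma>s \<tau>s
  define T where "T = twisted_sum_functor \<sigma> W"
  have T: "fd_functor T" unfolding T_def by (rule fd_functor_twisted_sum[OF \<sigma> W])
  let ?S = "twisted_sum \<sigma> W"
  have T_obj [simp]: "obj T V = ?S V" for V by (simp add: T_def twisted_sum_functor_simps[OF \<sigma>])
  have T_mor [simp]: "mor T V V' h (sum_code (w, y)) = sum_code (w, h y)"
    if "w \<in> carrier W" "y \<in> carrier V" for V V' h w y
    using that by (simp add: T_def twisted_sum_functor_simps[OF \<sigma>])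
  have T_lin: "mor T V V' h \<in> linear_maps R (?S V) (?S V')" if "V \<in> fd" "V' \<in> fd" "h \<in> linear_maps R V V'" for V V' h
    using fd_functor_mor[OF T that] by simp
  have S: "?S V \<in> fd" if "V \<in> fd" for V by (rule twisted_sum_fd[OF \<sigma> W that])
  define A where "A V y = line_map W (?S V) (\<lambda>w\<in>carrier W. sum_code (w, \<zero>\<^bsub>V\<^esub>)) (sum_code (\<zero>\<^bsub>W\<^esub>, y))" for V y
  define B where "B V \<eta> = into_line (?S V) (\<lambda>z\<in>carrier (?S V). fst (sum_decode z))
      (\<lambda>z\<in>carrier (?S V). \<tau> (\<eta> (snd (sum_decode z))))" for V and \<eta> :: "'u \<Rightarrow> 'f"
  have j: "(\<lambda>w\<in>carrier W. sum_code (w, \<zero>\<^bsub>V\<^esub>)) \<in> linear_maps R W (?S V)" if V: "V \<in> fd" for V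
  proof -
    interpret V: Module.module R V by (rule fd_module[OF V])
    show ?thesis by (rule linear_mapsI) auto
  qed
  have A_lin: "A V y \<in> linear_maps R L (?S V)" if V: "V \<in> fd" and y: "y \<in> carrier V" for V y
    unfolding A_def L_def by (rule line_map_lin[OF W fd_module[OF S[OF V]] j[OF V]]) (use y in simp)
  have A_apply [simp]: "A V y (pair_code R (w, r)) = sum_code (w, \<sigma> r \<odot>\<^bsub>V\<^esub> y)"
    if V: "V \<in> fd" and y: "y \<in> carrier V" "w \<in> carrier W" "r \<in> carrier R" for V y w r
  proof -
    interpret V: Module.module R V by (rule fd_module[OF V])
    show ?thesis using y by (simp add: A_def)
  qed
  have p: "(\<lambda>z\<in>carrier (?S V). fst (sum_decode z)) \<in> linear_maps R (?S V) W" if V: "V \<in> fd" for V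
    by (rule twisted_sum_linearI[OF \<sigma> W V, of "\<lambda>w x. w"]) auto
  have hat: "(\<lambda>z\<in>carrier (?S V). \<tau> (\<eta> (snd (sum_decode z)))) \<in> linear_maps R (?S V) scalars"
    if V: "V \<in> fd" and \<eta>: "\<eta> \<in> linear_maps R V scalars" for V \<eta>
    by (rule twisted_sum_linearI[OF \<sigma> W V, of "\<lambda>w x. \<tau> (\<eta> x)"])
      (use lin_closed[OF \<eta>] in \<open>auto simp: lin_add[OF \<eta>] lin_smult[OF \<eta>]\<close>)
  have B_lin: "B V \<eta> \<in> linear_maps R (?S V) L" if "V \<in> fd" "\<eta> \<in> linear_maps R V scalars" for V \<eta>
    unfolding B_def L_def by (rule into_line_lin[OF fd_module[OF S[OF that(1)]] p[OF that(1)] hat[OF that]])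
  have B_apply [simp]: "B V \<eta> (sum_code (w, y)) = pair_code R (w, \<tau> (\<eta> y))"
    if "w \<in> carrier W" "y \<in> carrier V" for V \<eta> w y
    using that by (simp add: B_def)
  define \<alpha> where "\<alpha> = (\<lambda>V\<in>fd. \<lambda>y\<in>carrier V. mor F1 L (?S V) (A V y) v)"
  have Ac: "mor F1 L (?S V) (A V y) v \<in> carrier (obj F1 (?S V))" if "V \<in> fd" "y \<in> carrier V" for V y
    by (rule fun_closed[OF F1 L S[OF that(1)] A_lin[OF that] v(1)])
  have \<alpha>: "\<alpha> \<in> nat_trans R id_functor (F1 \<circ>\<^sub>F T)"
  proof (rule ntI)
    fix V :: "('f, 'u) module" assume V: "V \<in> fd"
    interpret V: Module.module R V by (rule fd_module[OF V])
    have "(\<lambda>y\<in>carrier V. mor F1 L (?S V) (A V y) v) \<in> linear_maps R V (obj F1 (?S V))"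
    proof (rule linear_mapsI)
      fix y z assume yz: "y \<in> carrier V" "z \<in> carrier V"
      have "sum_code (\<zero>\<^bsub>W\<^esub>, y \<oplus>\<^bsub>V\<^esub> z) = sum_code (\<zero>\<^bsub>W\<^esub>, y) \<oplus>\<^bsub>?S V\<^esub> sum_code (\<zero>\<^bsub>W\<^esub>, z)" by simp
      then have "mor F1 L (?S V) (A V (y \<oplus>\<^bsub>V\<^esub> z)) v =
          mor F1 L (?S V) (A V y) v \<oplus>\<^bsub>obj F1 (?S V)\<^esub> mor F1 L (?S V) (A V z) v"
        unfolding A_def L_def
        by (simp only:) (rule line_map_additive[OF F1 01 W S[OF V] j[OF V] _ _ v[unfolded L_def]], use yz in simp_all)
      then show "(\<lambda>y\<in>carrier V. mor F1 L (?S V) (A V y) v) (y \<oplus>\<^bsub>V\<^esub> z) =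
          (\<lambda>y\<in>carrier V. mor F1 L (?S V) (A V y) v) y \<oplus>\<^bsub>obj F1 (?S V)\<^esub> (\<lambda>y\<in>carrier V. mor F1 L (?S V) (A V y) v) z"
        using yz by simp
    next
      fix a y assume a: "a \<in> carrier R" and y: "y \<in> carrier V"
      have "mor F1 L (?S V) (A V (a \<odot>\<^bsub>V\<^esub> y)) v = mor F1 L (?S V) (A V y) (mor F1 L L (line_scale W (\<tau> a)) v)"
        by (rule fun_comp_eq[OF F1 L L S[OF V] line_scale_linear[OF W, folded L_def] A_lin[OF V y] A_lin[OF V] _ v(1), symmetric])
          (use a y V in \<open>auto elim!: plus_line_cases simp: L_def W V.smult_assoc1\<close>)
      also have "\<dots> = a \<odot>\<^bsub>obj F1 (?S V)\<^esub> mor F1 L (?S V) (A V y) v"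
        using a v(1) by (simp add: v\<sigma> lin_smult[OF fun_lin[OF F1 L S[OF V] A_lin[OF V y]]])
      finally show "(\<lambda>y\<in>carrier V. mor F1 L (?S V) (A V y) v) (a \<odot>\<^bsub>V\<^esub> y) =
          a \<odot>\<^bsub>obj F1 (?S V)\<^esub> (\<lambda>y\<in>carrier V. mor F1 L (?S V) (A V y) v) y"
        using a y by simp
    qed (use V Ac in auto)
    then show "\<alpha> V \<in> linear_maps R (obj id_functor V) (obj (F1 \<circ>\<^sub>F T) V)" using V by (simp add: \<alpha>_def)
  next
    fix V V' :: "('f, 'u) module" and h y
    assume V: "V \<in> fd" "V' \<in> fd" and h: "h \<in> linear_maps R V V'" and "y \<in> carrier (obj id_functor V)"
    then have y: "y \<in> carrier V" by simp
    have "mor F1 (?S V) (?S V') (mor T V V' h) (mor F1 L (?S V) (A V y) v) = mor F1 L (?S V') (A V' (h y)) v"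
      by (rule fun_comp_eq[OF F1 L S[OF V(1)] S[OF V(2)] A_lin[OF V(1) y] T_lin[OF V h] A_lin[OF V(2) lin_closed[OF h y]] _ v(1)])
        (use y V Module.module.smult_closed[OF fd_module[OF V(1)]] in
          \<open>auto elim!: plus_line_cases simp: L_def lin_smult[OF h] lin_closed[OF h]\<close>)
    then show "\<alpha> V' (mor id_functor V V' h y) = mor (F1 \<circ>\<^sub>F T) V V' h (\<alpha> V y)"
      using V y lin_closed[OF h y] by (simp add: \<alpha>_def)
  qed (simp add: \<alpha>_def)
  define \<psi> where "\<psi> V w \<eta> = \<xi> (mor F2 (?S V) L (B V \<eta>) w)" for V w and \<eta> :: "'u \<Rightarrow> 'f"
  have Bc: "mor F2 (?S V) L (B V \<eta>) w \<in> carrier (obj F2 L)"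
    if "V \<in> fd" "\<eta> \<in> linear_maps R V scalars" "w \<in> carrier (obj F2 (?S V))" for V w \<eta>
    by (rule fun_closed[OF F2 S[OF that(1)] L B_lin[OF that(1,2)] that(3)])
  have ex1: "\<exists>!y. y \<in> carrier V \<and> (\<forall>\<eta>\<in>linear_maps R V scalars. \<eta> y = \<psi> V w \<eta>)"
    if V: "V \<in> fd" and w: "w \<in> carrier (obj F2 (?S V))" for V w
  proof (rule dual_representable[OF V])
    fix \<eta> assume \<eta>: "\<eta> \<in> linear_maps R V scalars"
    show "\<psi> V w \<eta> \<in> carrier R" unfolding \<psi>_def using lin_closed[OF \<xi> Bc[OF V \<eta> w]] by simp
    note \<eta>c = lin_closed[OF \<eta>, simplified]
    fix \<theta> assume \<theta>: "\<theta> \<in> linear_maps R V scalars"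
    note \<theta>c = lin_closed[OF \<theta>, simplified]
    let ?h = "\<lambda>\<eta> :: 'u \<Rightarrow> 'f. \<lambda>z\<in>carrier (?S V). \<tau> (\<eta> (snd (sum_decode z)))"
    have "?h (\<lambda>x\<in>carrier V. \<eta> x \<oplus> \<theta> x) = (\<lambda>z\<in>carrier (?S V). ?h \<eta> z \<oplus> ?h \<theta> z)"
      by (rule restrict_ext) (auto elim!: twisted_sum_cases simp: \<eta>c \<theta>c)
    then show "\<psi> V w (\<lambda>x\<in>carrier V. \<eta> x \<oplus> \<theta> x) = \<psi> V w \<eta> \<oplus> \<psi> V w \<theta>"
      unfolding \<psi>_def B_def L_def
      by (simp only:) (rule into_line_additive[OF F2 02 W S[OF V] p[OF V] hat[OF V \<eta>] hat[OF V \<theta>]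
            \<xi>[unfolded L_def] \<xi>0[unfolded L_def] w])
  next
    fix a \<eta> assume a: "a \<in> carrier R" and \<eta>: "\<eta> \<in> linear_maps R V scalars"
    note \<eta>c = lin_closed[OF \<eta>, simplified]
    have \<eta>a: "(\<lambda>x\<in>carrier V. \<eta> x \<otimes> a) \<in> linear_maps R V scalars"
      using smult_linear[OF scalars_module _ \<eta> fd_module[OF V], of a] a by simp
    have "mor F2 (?S V) L (B V (\<lambda>x\<in>carrier V. \<eta> x \<otimes> a)) w =
        mor F2 L L (line_scale W (\<tau> a)) (mor F2 (?S V) L (B V \<eta>) w)"
      by (rule fun_comp_eq[OF F2 S[OF V] L L B_lin[OF V \<eta>] line_scale_linear[OF W, folded L_def] B_lin[OF V \<eta>a] _ w, symmetric])
        (use a in \<open>auto elim!: twisted_sum_cases simp: W \<eta>c\<close>)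
    then show "\<psi> V w (\<lambda>x\<in>carrier V. \<eta> x \<otimes> a) = \<psi> V w \<eta> \<otimes> a"
      using a lin_closed[OF \<xi> Bc[OF V \<eta> w]] by (simp add: \<psi>_def \<xi>\<sigma> Bc[OF V \<eta> w] m_comm)
  qed
  define \<beta> where "\<beta> = (\<lambda>V\<in>fd. \<lambda>w\<in>carrier (obj F2 (?S V)).
      THE y. y \<in> carrier V \<and> (\<forall>\<eta>\<in>linear_maps R V scalars. \<eta> y = \<psi> V w \<eta>))"
  have \<beta>c: "\<beta> V w \<in> carrier V" and \<beta>\<eta>: "\<And>\<eta>. \<eta> \<in> linear_maps R V scalars \<Longrightarrow> \<eta> (\<beta> V w) = \<psi> V w \<eta>"
    if V: "V \<in> fd" and w: "w \<in> carrier (obj F2 (?S V))" for V w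
    using theI'[OF ex1[OF V w]] V w by (auto simp: \<beta>_def)
  have \<beta>: "\<beta> \<in> nat_trans R (F2 \<circ>\<^sub>F T) id_functor"
  proof (rule ntI)
    fix V :: "('f, 'u) module" assume V: "V \<in> fd"
    note VM = fd_module[OF V]
    interpret V: Module.module R V by (rule VM)
    interpret F: Module.module R "obj F2 (?S V)" by (rule fun_module[OF F2 S[OF V]])
    have "\<beta> V \<in> linear_maps R (obj F2 (?S V)) V"
    proof (rule linear_mapsI)
      fix w w' assume w: "w \<in> carrier (obj F2 (?S V))" "w' \<in> carrier (obj F2 (?S V))"
      show "\<beta> V (w \<oplus>\<^bsub>obj F2 (?S V)\<^esub> w') = \<beta> V w \<oplus>\<^bsub>V\<^esub> \<beta> V w'"
      proof (rule functionals_separate[OF VM])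
        fix \<eta> assume \<eta>: "\<eta> \<in> linear_maps R V scalars"
        show "\<eta> (\<beta> V (w \<oplus>\<^bsub>obj F2 (?S V)\<^esub> w')) = \<eta> (\<beta> V w \<oplus>\<^bsub>V\<^esub> \<beta> V w')"
          using w by (simp add: lin_add[OF \<eta>] \<beta>c[OF V] \<beta>\<eta>[OF V _ \<eta>] \<psi>_def
              lin_add[OF fun_lin[OF F2 S[OF V] L B_lin[OF V \<eta>]]] lin_add[OF \<xi>] Bc[OF V \<eta>])
      qed (use w \<beta>c[OF V] in auto)
    next
      fix a w assume a: "a \<in> carrier R" and w: "w \<in> carrier (obj F2 (?S V))"
      show "\<beta> V (a \<odot>\<^bsub>obj F2 (?S V)\<^esub> w) = a \<odot>\<^bsub>V\<^esub> \<beta> V w"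
      proof (rule functionals_separate[OF VM])
        fix \<eta> assume \<eta>: "\<eta> \<in> linear_maps R V scalars"
        show "\<eta> (\<beta> V (a \<odot>\<^bsub>obj F2 (?S V)\<^esub> w)) = \<eta> (a \<odot>\<^bsub>V\<^esub> \<beta> V w)"
          using w a by (simp add: lin_smult[OF \<eta>] \<beta>c[OF V] \<beta>\<eta>[OF V _ \<eta>] \<psi>_def
              lin_smult[OF fun_lin[OF F2 S[OF V] L B_lin[OF V \<eta>]]] lin_smult[OF \<xi>] Bc[OF V \<eta>])
      qed (use w a \<beta>c[OF V] in auto)
    qed (use V \<beta>c in \<open>auto simp: \<beta>_def\<close>)
    then show "\<beta> V \<in> linear_maps R (obj (F2 \<circ>\<^sub>F T) V) (obj id_functor V)" by simp
  next
    fix V V' :: "('f, 'u) module" and h w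
    assume V: "V \<in> fd" "V' \<in> fd" and h: "h \<in> linear_maps R V V'" and "w \<in> carrier (obj (F2 \<circ>\<^sub>F T) V)"
    then have w: "w \<in> carrier (obj F2 (?S V))" by simp
    have w': "mor F2 (?S V) (?S V') (mor T V V' h) w \<in> carrier (obj F2 (?S V'))"
      by (rule fun_closed[OF F2 S[OF V(1)] S[OF V(2)] T_lin[OF V h] w])
    have "\<beta> V' (mor F2 (?S V) (?S V') (mor T V V' h) w) = h (\<beta> V w)"
    proof (rule functionals_separate[OF fd_module[OF V(2)]])
      fix \<eta> assume \<eta>: "\<eta> \<in> linear_maps R V' scalars"
      note \<eta>h = lin_comp[OF h \<eta> fd_module[OF V(1)]]
      have "\<eta> (h (\<beta> V w)) = \<psi> V w (compose (carrier V) \<eta> h)"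
        using \<beta>\<eta>[OF V(1) w \<eta>h] \<beta>c[OF V(1) w] by (simp add: compose_eq)
      also have "\<dots> = \<psi> V' (mor F2 (?S V) (?S V') (mor T V V' h) w) \<eta>"
        unfolding \<psi>_def
        by (subst fun_comp_eq[OF F2 S[OF V(1)] S[OF V(2)] L T_lin[OF V h] B_lin[OF V(2) \<eta>] B_lin[OF V(1) \<eta>h] _ w])
          (auto elim!: twisted_sum_cases simp: compose_eq lin_closed[OF h])
      finally show "\<eta> (\<beta> V' (mor F2 (?S V) (?S V') (mor T V V' h) w)) = \<eta> (h (\<beta> V w))"
        using \<beta>\<eta>[OF V(2) w' \<eta>] by simp
    qed (use \<beta>c[OF V(2) w'] lin_closed[OF h \<beta>c[OF V(1) w]] in auto)
    then show "\<beta> V' (mor (F2 \<circ>\<^sub>F T) V V' h w) = mor id_functor V V' h (\<beta> V w)" by simp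
  qed (simp add: \<beta>_def)
  have "\<beta> V (f (obj T V) (\<alpha> V y)) = y" if V: "V \<in> fd" and y: "y \<in> carrier V" for V y
  proof -
    note VM = fd_module[OF V]
    have c: "f (?S V) (mor F1 L (?S V) (A V y) v) \<in> carrier (obj F2 (?S V))"
      by (rule nt_closed[OF f S[OF V] Ac[OF V y]])
    have "\<beta> V (f (?S V) (mor F1 L (?S V) (A V y) v)) = y"
    proof (rule functionals_separate[OF VM \<beta>c[OF V c] y])
      fix \<eta> assume \<eta>: "\<eta> \<in> linear_maps R V scalars"
      note \<eta>c = lin_closed[OF \<eta>, simplified]
      have fv: "f L v \<in> carrier (obj F2 L)" by (rule nt_closed[OF f L v(1)])
      have "mor F2 (?S V) L (B V \<eta>) (f (?S V) (mor F1 L (?S V) (A V y) v)) =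
          f L (mor F1 (?S V) L (B V \<eta>) (mor F1 L (?S V) (A V y) v))"
        by (rule nt_nat[OF f S[OF V] L B_lin[OF V \<eta>] Ac[OF V y], symmetric])
      also have "mor F1 (?S V) L (B V \<eta>) (mor F1 L (?S V) (A V y) v) = mor F1 L L (line_scale W (\<tau> (\<eta> y))) v"
        by (rule fun_comp_eq[OF F1 L S[OF V] L A_lin[OF V y] B_lin[OF V \<eta>] line_scale_linear[OF W, folded L_def] _ v(1)])
          (use V y Module.module.smult_closed[OF VM] in \<open>auto elim!: plus_line_cases simp: L_def W \<eta>c lin_smult[OF \<eta>]\<close>)
      also have "f L \<dots> = \<eta> y \<odot>\<^bsub>obj F2 L\<^esub> f L v"
        using \<eta>c[OF y] v(1) by (simp add: v\<sigma> lin_smult[OF nt_lin[OF f L]])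
      finally have "\<psi> V (f (?S V) (mor F1 L (?S V) (A V y) v)) \<eta> = \<eta> y"
        using \<eta>c[OF y] fv by (simp add: \<psi>_def lin_smult[OF \<xi>] \<xi>v)
      then show "\<eta> (\<beta> V (f (?S V) (mor F1 L (?S V) (A V y) v))) = \<eta> y" using \<beta>\<eta>[OF V c \<eta>] by simp
    qed
    then show ?thesis using V y by (simp add: \<alpha>_def)
  qed
  then show ?thesis unfolding identity_retract_def using T \<alpha> \<beta> by blast
qed

text \<open>
  A nonzero element of \<open>(\<Delta>I)(W)\<close> gives an element of \<open>I(W \<oplus>
  R)\<close> that is killed by \<open>I(line_kill)\<close>. It has a preimage in \<open>F1(W
  \<oplus> R)\<close>, which the idempotent \<open>1 - F1(line_kill)\<close> corrects to one that
  is killed as well.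
\<close>

lemma identity_retract_degree_one:
  fixes F1 F2 I :: "('f, 'u :: infinite) vfunctor"
  assumes F1: "is_functor R F1" and F2: "is_functor R F2" and I: "is_functor R I"
    and e: "e \<in> nat_trans R F1 I" and m: "m \<in> nat_trans R I F2"
    and epi: "is_epi R F1 I e" and mono: "is_mono I m"
    and 01: "is_zero_functor R (difference R (difference R F1))"
    and 02: "is_zero_functor R (difference R (difference R F2))"
    and nz: "\<not> is_zero_functor R (difference R I)"
  shows "identity_retract F1 F2 (trans_comp R F1 m e)"
proof -
  obtain W :: "('f, 'u) module" where W: "W \<in> fd" and nz: "carrier (obj (difference R I) W) \<noteq> {\<zero>\<^bsub>obj (difference R I) W\<^esub>}"
    using nz by (auto simp: is_zero_functor_def)
  interpret dI: Module.module R "obj (difference R I) W" by (rule fun_module[OF difference_functor[OF I] W])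
  obtain y where y: "y \<in> carrier (obj (difference R I) W)" "y \<noteq> \<zero>\<^bsub>obj (difference R I) W\<^esub>"
    using nz dI.M.zero_closed by blast
  let ?L = "plus_line_space R W"
  note L = plus_line_fd[OF W]
  obtain q s where q: "q \<in> nat_trans R (I \<circ>\<^sub>F plus_line R) (difference R I)"
    and s: "s \<in> nat_trans R (difference R I) (I \<circ>\<^sub>F plus_line R)"
    and qs: "\<And>V y. V \<in> fd \<Longrightarrow> y \<in> carrier (obj (difference R I) V) \<Longrightarrow> q V (s V y) = y"
    and ks: "\<And>V y. V \<in> fd \<Longrightarrow> y \<in> carrier (obj (difference R I) V) \<Longrightarrow>
      mor I (plus_line_space R V) (plus_line_space R V) (line_kill V) (s V y) = \<zero>\<^bsub>obj I (plus_line_space R V)\<^esub>"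
    by (rule difference_split[OF I]) (rule that)
  obtain q1 s1 where q1: "q1 \<in> nat_trans R (F1 \<circ>\<^sub>F plus_line R) (difference R F1)"
    and s1: "s1 \<in> nat_trans R (difference R F1) (F1 \<circ>\<^sub>F plus_line R)"
    and sq1: "\<And>V x. V \<in> fd \<Longrightarrow> x \<in> carrier (obj F1 (plus_line_space R V)) \<Longrightarrow>
      s1 V (q1 V x) = x \<ominus>\<^bsub>obj F1 (plus_line_space R V)\<^esub> mor F1 (plus_line_space R V) (plus_line_space R V) (line_kill V) x"
    and ks1: "\<And>V y. V \<in> fd \<Longrightarrow> y \<in> carrier (obj (difference R F1) V) \<Longrightarrow>
      mor F1 (plus_line_space R V) (plus_line_space R V) (line_kill V) (s1 V y) = \<zero>\<^bsub>obj F1 (plus_line_space R V)\<^esub>"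
    by (rule difference_split[OF F1]) (rule that)
  interpret IL: Module.module R "obj I ?L" by (rule fun_module[OF I L])
  have sy: "s W y \<in> carrier (obj I ?L)" using nt_closed[OF s W y(1)] by simp
  have sy0: "s W y \<noteq> \<zero>\<^bsub>obj I ?L\<^esub>"
  proof
    assume "s W y = \<zero>\<^bsub>obj I ?L\<^esub>"
    then have "q W (s W y) = \<zero>\<^bsub>obj (difference R I) W\<^esub>"
      using lin_zero[OF nt_lin[OF q W] _ fun_module[OF difference_functor[OF I] W]] fun_module[OF I L] by simp
    then show False using qs[OF W y(1)] y(2) by simp
  qed
  have "s W y \<in> e ?L ` carrier (obj F1 ?L)" using epi[unfolded is_epi_def] L sy by simp
  then obtain x where x: "x \<in> carrier (obj F1 ?L)" "e ?L x = s W y" by auto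
  let ?x = "s1 W (q1 W x)"
  have qx: "q1 W x \<in> carrier (obj (difference R F1) W)" using nt_closed[OF q1 W] x by simp
  have xc: "?x \<in> carrier (obj F1 ?L)" using nt_closed[OF s1 W qx] by simp
  note k = line_kill_linear[OF W]
  have "e ?L ?x = e ?L x \<ominus>\<^bsub>obj I ?L\<^esub> mor I ?L ?L (line_kill W) (e ?L x)"
    unfolding sq1[OF W x(1)] nt_nat[OF e L L k x(1), symmetric]
    by (rule lin_minus[OF nt_lin[OF e L] fun_module[OF F1 L] fun_module[OF I L] x(1) fun_closed[OF F1 L L k x(1)]])
  also have "\<dots> = s W y"
    unfolding x(2) ks[OF W y(1)] by (rule minus_eqI[OF fun_module[OF I L]]) (use sy in auto)
  finally have ex: "e ?L ?x = s W y" .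
  have "m ?L (s W y) \<noteq> m ?L \<zero>\<^bsub>obj I ?L\<^esub>"
    using mono L sy sy0 by (auto simp: is_mono_def dest: inj_onD)
  then have "trans_comp R F1 m e ?L ?x \<noteq> \<zero>\<^bsub>obj F2 ?L\<^esub>"
    using L xc ex lin_zero[OF nt_lin[OF m L] fun_module[OF I L] fun_module[OF F2 L]] by simp
  then show ?thesis
    by (rule identity_retract_linear_part[OF F1 F2 trans_comp_nt[OF e m F1] 01 02 W xc ks1[OF W qx]])
qed

lemma identity_retract_polynomial:
  fixes F1 F2 I :: "('f, 'u :: infinite) vfunctor"
  assumes "is_functor R F1" "is_functor R F2" "is_functor R I"
    and "e \<in> nat_trans R F1 I" "m \<in> nat_trans R I F2" "is_epi R F1 I e" "is_mono I m"
    and "is_zero_functor R ((difference R ^^ (n + 2)) F1)" "is_zero_functor R ((difference R ^^ (n + 2)) F2)"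
    and "\<not> is_zero_functor R ((difference R ^^ (n + 1)) I)"
  shows "identity_retract F1 F2 (trans_comp R F1 m e)"
  using assms
proof (induction n arbitrary: F1 F2 I e m)
  case 0
  then show ?case by (intro identity_retract_degree_one[of F1 F2 I e m]) (simp_all add: numeral_2_eq_2)
next
  case (Suc n)
  note S = Suc.prems
  have funpow: "(difference R ^^ (Suc k)) F = (difference R ^^ k) (difference R F)" for k and F :: "('f, 'u) vfunctor"
    by (simp add: funpow_swap1)
  show ?case
  proof (rule identity_retract_difference[OF S(1-7)])
    fix e' m' assume e': "e' \<in> nat_trans R (difference R F1) (difference R I)"
      and m': "m' \<in> nat_trans R (difference R I) (difference R F2)"
      and epi: "is_epi R (difference R F1) (difference R I) e'" and mono: "is_mono (difference R I) m'"
      and imp: "identity_retract (difference R F1) (difference R F2) (trans_comp R (difference R F1) m' e') \<Longrightarrow>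
        identity_retract F1 F2 (trans_comp R F1 m e)"
    have "identity_retract (difference R F1) (difference R F2) (trans_comp R (difference R F1) m' e')"
    proof (rule Suc.IH[OF difference_functor[OF S(1)] difference_functor[OF S(2)] difference_functor[OF S(3)] e' m' epi mono])
      show "is_zero_functor R ((difference R ^^ (n + 2)) (difference R F1))"
        "is_zero_functor R ((difference R ^^ (n + 2)) (difference R F2))"
        using S(8,9) unfolding add_Suc funpow by auto
      show "\<not> is_zero_functor R ((difference R ^^ (n + 1)) (difference R I))"
        using S(10) unfolding add_Suc funpow by auto
    qed
    then show ?thesis by (rule imp)
  qed
qed

section \<open>Finite functors\<close>

lemma finite_free_module:
  assumes "finite I"
  shows "finite (carrier (free_module I))"
proof (rule finite_imageD)
  show "finite ((\<lambda>c. restrict c I) ` carrier (free_module I))"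
    by (rule finite_subset[OF _ finite_PiE[of I "\<lambda>_. carrier R"]]) (use assms finite_scalars in auto)
  show "inj_on (\<lambda>c. restrict c I) (carrier (free_module I))"
  proof (rule inj_onI, rule ext)
    fix c d :: "'a \<Rightarrow> 'f" and i
    assume "c \<in> carrier (free_module I)" "d \<in> carrier (free_module I)" and eq: "restrict c I = restrict d I"
    then have "c i = \<zero>" "d i = \<zero>" if "i \<notin> I" using that by auto
    then show "c i = d i" using fun_cong[OF eq, of i] by (cases "i \<in> I") auto
  qed
qed

text \<open>
  A nonzero element \<open>x\<close> of \<open>S(V)\<close> generates a nonzero subfunctor, hence
  all of \<open>S\<close>. So \<open>S(W)\<close> is the image of the free module on the finite
  set \<open>Hom(V, W)\<close>.
\<close>

lemma simple_functor_finite: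
  fixes S :: "('f, 'u :: infinite) vfunctor"
  assumes S: "is_simple_functor R S" and W: "W \<in> fd"
  shows "finite (carrier (obj S W))"
proof -
  have F: "is_functor R S" using S by (simp add: is_simple_functor_def)
  obtain V :: "('f, 'u) module" where V: "V \<in> fd" and nz: "carrier (obj S V) \<noteq> {\<zero>\<^bsub>obj S V\<^esub>}"
    using S by (auto simp: is_simple_functor_def is_zero_functor_def)
  interpret SV: Module.module R "obj S V" by (rule fun_module[OF F V])
  obtain x where x: "x \<in> carrier (obj S V)" "x \<noteq> \<zero>\<^bsub>obj S V\<^esub>" using nz SV.M.zero_closed by blast
  let ?F = "\<lambda>W :: ('f, 'u) module. free_module (linear_maps R V W)"
  have "\<exists>g. g \<in> linear_maps R (?F W) (obj S W) \<and> (\<forall>h\<in>linear_maps R V W. g (free_gen h) = mor S V W h x)"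
    if W: "W \<in> fd" for W
    by (rule free_linear_exists[OF fun_module[OF F W], of "linear_maps R V W" "\<lambda>h. mor S V W h x"])
      (use fun_closed[OF F V W _ x(1)] in auto)
  then obtain g where g: "\<And>W. W \<in> fd \<Longrightarrow> g W \<in> linear_maps R (?F W) (obj S W)"
    and gh: "\<And>W h. W \<in> fd \<Longrightarrow> h \<in> linear_maps R V W \<Longrightarrow> g W (free_gen h) = mor S V W h x"
    by metis
  define D where "D W = g W ` carrier (?F W)" for W
  have "is_subfunctor R S D"
    unfolding is_subfunctor_def
  proof (intro conjI ballI)
    fix W :: "('f, 'u) module" assume W: "W \<in> fd"
    show "submodule (D W) R (obj S W)"
      unfolding D_def by (rule submodule_image[OF g[OF W] free_module_is_module fun_module[OF F W]])
  next
    fix W W' :: "('f, 'u) module" and k assume W: "W \<in> fd" "W' \<in> fd" and k: "k \<in> linear_maps R W W'"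
    note hk = lin_comp[OF _ k fd_module[OF V]]
    obtain p where p: "p \<in> linear_maps R (?F W) (?F W')"
      "\<And>h. h \<in> linear_maps R V W \<Longrightarrow> p (free_gen h) = free_gen (compose (carrier V) k h)"
      by (rule free_linear_exists[OF free_module_is_module, of "linear_maps R V W"
            "\<lambda>h. free_gen (compose (carrier V) k h)" "linear_maps R V W'"])
        (use hk in \<open>auto intro: free_gen_closed simp del: free_module_simps\<close>)
    have "compose (carrier (?F W)) (mor S W W' k) (g W) = compose (carrier (?F W)) (g W') p"
    proof (rule free_linear_eqI[OF lin_comp[OF g[OF W(1)] fun_lin[OF F W k] free_module_is_module]
          lin_comp[OF p(1) g[OF W(2)] free_module_is_module] fun_module[OF F W(2)]])
      fix h assume h: "h \<in> linear_maps R V W"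
      show "compose (carrier (?F W)) (mor S W W' k) (g W) (free_gen h) = compose (carrier (?F W)) (g W') p (free_gen h)"
        using h hk[OF h] free_gen_closed[OF h]
        by (simp add: compose_eq gh W p(2) fun_comp[OF F V W h k x(1)] del: free_module_simps)
    qed
    note eq = fun_cong[OF this]
    show "mor S W W' k ` D W \<subseteq> D W'"
    proof
      fix z assume "z \<in> mor S W W' k ` D W"
      then obtain c where c: "c \<in> carrier (?F W)" "z = mor S W W' k (g W c)" unfolding D_def by blast
      then have "z = g W' (p c)" using eq[of c] by (simp add: compose_eq del: free_module_simps)
      then show "z \<in> D W'" unfolding D_def using lin_closed[OF p(1) c(1)] by blast
    qed
  qed
  moreover have "x \<in> D V"
  proof -
    note id = lin_id[OF fd_module[OF V]]
    have "x = g V (free_gen (\<lambda>y\<in>carrier V. y))" unfolding gh[OF V id] by (rule fun_id[OF F V x(1), symmetric])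
    then show ?thesis unfolding D_def using free_gen_closed[OF id] by blast
  qed
  then have "\<not> (\<forall>V\<in>fd. D V = {\<zero>\<^bsub>obj S V\<^esub>})" using V x(2) by blast
  ultimately have "D W = carrier (obj S W)" using S W unfolding is_simple_functor_def by blast
  moreover have "finite (linear_maps R V W)" using V W by (simp add: finite_linear_maps fd_iff_finite)
  then have "finite (D W)" unfolding D_def by (intro finite_imageI finite_free_module)
  ultimately show ?thesis by simp
qed

lemma finite_extension:
  fixes M :: "('f, 'u) module"
  assumes M: "Module.module R M" and N: "submodule N R M" and fin: "finite N" "finite (carrier (quot_module M N))"
  shows "finite (carrier M)"
proof (rule finite_subset)
  interpret M: Module.module R M by (rule M)
  show "carrier M \<subseteq> (\<lambda>(n, q). \<ominus>\<^bsub>M\<^esub> n \<oplus>\<^bsub>M\<^esub> q) ` (N \<times> carrier (quot_module M N))"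
  proof
    fix x assume x: "x \<in> carrier M"
    obtain n where n: "n \<in> N" "n \<in> carrier M" "quot_rep M N x = n \<oplus>\<^bsub>M\<^esub> x" using quot_rep_ex[OF M N x] .
    then have "x = \<ominus>\<^bsub>M\<^esub> n \<oplus>\<^bsub>M\<^esub> quot_rep M N x" using x by (simp add: M.M.a_assoc[symmetric] M.M.l_neg)
    then show "x \<in> (\<lambda>(n, q). \<ominus>\<^bsub>M\<^esub> n \<oplus>\<^bsub>M\<^esub> q) ` (N \<times> carrier (quot_module M N))"
      using n(1) x unfolding quot_carrier[OF M N] by force
  qed
qed (use fin in auto)

lemma finite_functor_fd:
  fixes F :: "('f, 'u :: infinite) vfunctor"
  assumes "is_finite_functor R F"
  shows "fd_functor F"
proof -
  have F: "is_functor R F" using assms by (simp add: is_finite_functor_def)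
  from assms[unfolded is_finite_functor_def, THEN conjunct2]
  obtain n :: nat and D where series: "(\<forall>i\<le>n. is_subfunctor R F (D i)) \<and>
      (\<forall>V\<in>fd. D 0 V = {\<zero>\<^bsub>obj F V\<^esub>} \<and> D n V = carrier (obj F V)) \<and>
      (\<forall>i<n. (\<forall>V\<in>fd. D i V \<subseteq> D (Suc i) V) \<and>
        is_simple_functor R (quot_functor (sub_functor F (D (Suc i))) (D i)))"
    by (elim exE)
  then have D: "\<And>i. i \<le> n \<Longrightarrow> is_subfunctor R F (D i)"
    and D0: "\<And>V. V \<in> fd \<Longrightarrow> D 0 V = {\<zero>\<^bsub>obj F V\<^esub>} \<and> D n V = carrier (obj F V)"
    and DS: "\<And>i V. i < n \<Longrightarrow> V \<in> fd \<Longrightarrow> D i V \<subseteq> D (Suc i) V"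
    and simple: "\<And>i. i < n \<Longrightarrow> is_simple_functor R (quot_functor (sub_functor F (D (Suc i))) (D i))"
    by simp_all
  have "finite (D i V)" if V: "V \<in> fd" and "i \<le> n" for V i
    using that(2)
  proof (induction i)
    case 0
    then show ?case using D0[OF V] by simp
  next
    case (Suc i)
    let ?M = "obj (sub_functor F (D (Suc i))) V"
    have M: "Module.module R ?M" by (rule fun_module[OF sub_functor_functor[OF F D[OF Suc.prems]] V])
    have "submodule (D i V) R (obj F V)" using D[of i] Suc.prems V by (simp add: is_subfunctor_def)
    note N' = submodule_simps[OF fun_module[OF F V] this]
    have N: "submodule (D i V) R ?M"
      by (rule submoduleI'[OF M]) (use N' DS[of i V] Suc.prems V in auto)
    have "finite (carrier (quot_module ?M (D i V)))"
      using simple_functor_finite[OF simple[of i] V] Suc.prems by (simp add: quot_functor_def)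
    then have "finite (carrier ?M)" using finite_extension[OF M N] Suc by simp
    then show ?case by simp
  qed
  then have "finite (carrier (obj F V))" if "V \<in> fd" for V using D0[OF that] that by (metis order_refl)
  then show ?thesis using F by (simp add: fd_functor_def fd_iff_finite fun_module)
qed

lemma identity_retract_of_image:
  fixes F1 F2 :: "('f, 'u :: infinite) vfunctor"
  assumes d: "d > 0" and F1: "is_functor R F1" "is_polynomial R d F1"
    and F2: "is_functor R F2" "is_polynomial R d F2"
    and f: "f \<in> nat_trans R F1 F2" and I: "has_polynomial_degree R d (image_functor F1 F2 f)"
  shows "identity_retract F1 F2 f"
proof -
  let ?I = "image_functor F1 F2 f" and ?D = "\<lambda>V. f V ` carrier (obj F1 V)"
  have D: "is_subfunctor R F2 ?D" by (rule image_subfunctor[OF F1(1) F2(1) f])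
  have If: "is_functor R ?I" unfolding image_functor_def by (rule sub_functor_functor[OF F2(1) D])
  have e: "f \<in> nat_trans R F1 ?I" unfolding image_functor_def by (rule nt_into_sub[OF f]) auto
  have m: "id_trans R ?I \<in> nat_trans R ?I F2"
    using nt_from_sub[OF _ F2(1) D] id_trans_nt[OF If] by (simp add: image_functor_def)
  have epi: "is_epi R F1 ?I f" by (simp add: is_epi_def image_functor_def)
  have mono: "is_mono ?I (id_trans R ?I)" by (simp add: is_mono_def inj_on_def)
  obtain n where n: "d = n + 1" using d by (cases d) auto
  have "identity_retract F1 F2 (trans_comp R F1 (id_trans R ?I) f)"
    by (rule identity_retract_polynomial[OF F1(1) F2(1) If e m epi mono, of n])
      (use F1(2) F2(2) I in \<open>simp_all add: n is_polynomial_def has_polynomial_degree_def\<close>)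
  then show ?thesis unfolding trans_comp_id_left[OF e] .
qed

end


theorem theorem8p3:
  fixes R :: "('f, 'm) ring_scheme"
    and F1 F2 :: "('f, 'u :: infinite) vfunctor"
    and f :: "('f, 'u) transf"
    and d :: nat
  assumes "field R" and "finite (carrier R)"
    and "d > 0"
    and "is_finite_functor R F1" and "has_polynomial_degree R d F1"
    and "is_finite_functor R F2" and "has_polynomial_degree R d F2"
    and "f \<in> nat_trans R F1 F2"
    and "has_polynomial_degree R d (image_functor F1 F2 f)"
  shows "(\<forall>n G H. is_functor R G \<longrightarrow> is_functor R H \<longrightarrow>
            ext_induced R F1 F2 f n G H \<in> linear_maps R (ext R n G H) (ext R n (G \<circ>\<^sub>F F1) (H \<circ>\<^sub>F F2)) \<and>
            inj_on (ext_induced R F1 F2 f n G H) (carrier (ext R n G H))) \<and>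
         (\<exists>\<rho>.
           (\<forall>n G H. is_functor R G \<longrightarrow> is_functor R H \<longrightarrow>
              \<rho> n G H \<in> linear_maps R (ext R n (G \<circ>\<^sub>F F1) (H \<circ>\<^sub>F F2)) (ext R n G H) \<and>
              (\<forall>x\<in>carrier (ext R n G H). \<rho> n G H (ext_induced R F1 F2 f n G H x) = x)) \<and>
           (\<forall>n G G' H g. is_functor R G \<longrightarrow> is_functor R G' \<longrightarrow> is_functor R H \<longrightarrow>
              g \<in> nat_trans R G' G \<longrightarrow>
              (\<forall>x\<in>carrier (ext R n G H).
                 ext_induced R F1 F2 f n G' H (ext_pull R n G' G H g x) =
                 ext_pull R n (G' \<circ>\<^sub>F F1) (G \<circ>\<^sub>F F1) (H \<circ>\<^sub>F F2) (precomp_trans R F1 g) (ext_induced R F1 F2 f n G H x)) \<and>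
              (\<forall>y\<in>carrier (ext R n (G \<circ>\<^sub>F F1) (H \<circ>\<^sub>F F2)).
                 \<rho> n G' H (ext_pull R n (G' \<circ>\<^sub>F F1) (G \<circ>\<^sub>F F1) (H \<circ>\<^sub>F F2) (precomp_trans R F1 g) y) =
                 ext_pull R n G' G H g (\<rho> n G H y))) \<and>
           (\<forall>n G H H' h. is_functor R G \<longrightarrow> is_functor R H \<longrightarrow> is_functor R H' \<longrightarrow>
              h \<in> nat_trans R H H' \<longrightarrow>
              (\<forall>x\<in>carrier (ext R n G H).
                 ext_induced R F1 F2 f n G H' (ext_push R n G H H' h x) =
                 ext_push R n (G \<circ>\<^sub>F F1) (H \<circ>\<^sub>F F2) (H' \<circ>\<^sub>F F2) (precomp_trans R F2 h) (ext_induced R F1 F2 f n G H x)) \<and>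
              (\<forall>y\<in>carrier (ext R n (G \<circ>\<^sub>F F1) (H \<circ>\<^sub>F F2)).
                 \<rho> n G H' (ext_push R n (G \<circ>\<^sub>F F1) (H \<circ>\<^sub>F F2) (H' \<circ>\<^sub>F F2) (precomp_trans R F2 h) y) =
                 ext_push R n G H H' h (\<rho> n G H y))))"
proof -
  interpret finite_field R
    using assms(1,2) by (simp add: finite_field_def finite_field_axioms_def)
  have F1: "fd_functor F1" and F2: "fd_functor F2" using assms(4,6) by (simp_all add: finite_functor_fd)
  have "identity_retract F1 F2 f"
    using assms(3,5,7,8,9) fd_functor_functor[OF F1] fd_functor_functor[OF F2]
    by (intro identity_retract_of_image[of d]) (simp_all add: has_polynomial_degree_def)
  then obtain T \<alpha> \<beta> where "fd_functor T" "\<alpha> \<in> nat_trans R id_functor (F1 \<circ>\<^sub>F T)"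
    "\<beta> \<in> nat_trans R (F2 \<circ>\<^sub>F T) id_functor"
    "\<And>V x. V \<in> fd \<Longrightarrow> x \<in> carrier V \<Longrightarrow> \<beta> V (f (obj T V) (\<alpha> V x)) = x"
    unfolding identity_retract_def by blast
  then show ?thesis by (rule ext_induced_split[OF F1 F2 assms(8)])
qed

end
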